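(* Fix $\beta>0$. For each $n\ge 1$ let $H_{n,\beta}$ be the random $n\times n$ Jacobi matrix of the Gaussian $\beta$-ensemble, with eigenvalues $\lambda_1,\dots,\lambda_n$, and let $\mu_n=\sum_{i=1}^n q_i^2\delta_{\lambda_i}$ be its spectral measure. Let $sc$ be the semicircle distribution. (i) The measures $\mu_n$ converge weakly, almost surely, to $sc$ as $n\to\infty$, that is, for any bounded continuous function $f:\mathbb{R}\to\mathbb{R}$, $$\langle \mu_n,f\rangle=\sum_{i=1}^n q_i^2 f(\lambda_i)\to\langle sc,f\rangle\quad\text{almost surely as } n\to\infty.$$ (ii) For any differentiable function $f:\mathbb{R}\to\mathbb{R}$ whose derivative is continuous and of polynomial growth, $$\frac{\sqrt{n\beta}}{\sqrt2}\big(\langle\mu_n,f\rangle-\mathbb{E}[\langle\mu_n,f\rangle]\big)\to \mathcal{N}(0,\sigma^2(f))\quad\text{in distribution as } n\to\infty,$$ where $\sigma^2(f)=\langle sc,f^2\rangle-\langle sc,f\rangle^2=\mathrm{Var}_{sc}[f]$.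
   Context: Notation: $\langle\mu,f\rangle=\int f\,d\mu$; $\mathcal{N}(\mu,\sigma^2)$ is the normal distribution with mean $\mu$ and variance $\sigma^2$; $\chi_k$ is the chi distribution with $k>0$ (real) degrees of freedom. A function $g$ is of polynomial growth if there is a polynomial $p$ with $|g(x)|\le p(x)$ for all $x\in\mathbb{R}$. $H_{n,\beta}$ is the random symmetric tridiagonal $n\times n$ matrix with diagonal entries $a_1,\dots,a_n$ and off-diagonal entries $b_1,\dots,b_{n-1}$ (with $b_i$ in positions $(i,i+1)$ and $(i+1,i)$), where $a_1,\dots,a_n,b_1,\dots,b_{n-1}$ are independent, $\sqrt{n\beta}\,a_i\sim\mathcal{N}(0,2)$ and $\sqrt{n\beta}\,b_i\sim\chi_{(n-i)\beta}$. The matrices for different $n$ are defined on a common probability space. The spectral measure of a finite Jacobi matrix $J$ (real symmetric tridiagonal with positive off-diagonal entries) of size $n$ is the unique probability measure $\mu$ on $\mathbb{R}$ with $\langle\mu,x^k\rangle=J^k(1,1)$ for $k=0,1,\dots$; equivalently $\mu=\sum_{i=1}^n q_i^2\delta_{\lambda_i}$, where $\lambda_1,\dots,\lambda_n$ are the (distinct) eigenvalues of $J$, $v_1,\dots,v_n$ are corresponding orthonormal eigenvectors, and $q_i=|v_i(1)|$. The semicircle distribution $sc$ is the probability measure on $[-2,2]$ with density $\frac{1}{2\pi}\sqrt{4-x^2}$. *)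

theory Defs
  imports
    "HOL-Probability.Probability"
    "Jordan_Normal_Form.Char_Poly"
begin

unbundle no vec_syntax
no_notation inner (infix "\<bullet>" 70)

text \<open>Indices \<open>1, ..., n\<close> are used for the entries, eigenvalues and eigenvectors;
  the rows and columns of a \<open>mat\<close> and the coordinates of a \<open>vec\<close> count from \<open>0\<close>.\<close>

definition jacobi_mat :: "nat \<Rightarrow> (nat \<Rightarrow> real) \<Rightarrow> (nat \<Rightarrow> real) \<Rightarrow> real mat" where
  "jacobi_mat n a b = mat n n (\<lambda>(r, c).
     if r = c then a (r + 1)
     else if c = r + 1 then b (r + 1)
     else if r = c + 1 then b (c + 1)
     else 0)"

definition orthonormal_eigensystem :: "nat \<Rightarrow> real mat \<Rightarrow> (nat \<Rightarrow> real) \<Rightarrow> (nat \<Rightarrow> real vec) \<Rightarrow> bool" where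
  "orthonormal_eigensystem n J lam v \<longleftrightarrow>
     (\<forall>i\<in>{1..n}. eigenvector J (v i) (lam i)) \<and>
     (\<forall>i\<in>{1..n}. \<forall>j\<in>{1..n}. v i \<bullet> v j = (if i = j then 1 else 0))"

text \<open>The measure \<open>\<Sum>i=1..n. q\<^sub>i\<^sup>2 \<delta>(lam i)\<close> with \<open>q\<^sub>i = \<bar>v\<^sub>i(1)\<bar>\<close>, as the image under \<open>lam\<close> of the
  measure on \<open>{1..n}\<close> with weights \<open>q\<^sub>i\<^sup>2\<close>.  For an orthonormal eigensystem of \<open>J\<close> it does not
  depend on the choice of eigenvectors, even if eigenvalues coincide; its moments are the
  entries \<open>J\<^sup>k(1,1)\<close>.\<close>

definition spectral_measure :: "nat \<Rightarrow> (nat \<Rightarrow> real) \<Rightarrow> (nat \<Rightarrow> real vec) \<Rightarrow> real measure" where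
  "spectral_measure n lam v =
     distr (point_measure {1..n} (\<lambda>i. ennreal (\<bar>v i $ 0\<bar>\<^sup>2))) borel lam"

lemma integral_spectral_measure:
  assumes [measurable]: "f \<in> borel_measurable borel"
  shows "(\<integral>x. f x \<partial>spectral_measure n lam v) = (\<Sum>i=1..n. \<bar>v i $ 0\<bar>\<^sup>2 * (f (lam i) :: real))"
  unfolding spectral_measure_def
  by (subst integral_distr)
     (auto simp: lebesgue_integral_point_measure_finite measurable_point_measure_eq1)

lemma spectral_measure_moments:
  assumes n: "n \<ge> 1" and J: "J \<in> carrier_mat n n" and eig: "orthonormal_eigensystem n J lam v"
  shows "(\<integral>x. x ^ k \<partial>spectral_measure n lam v) = (J ^\<^sub>m k) $$ (0, 0)"
proof -
  define V where "V = mat n n (\<lambda>(r, c). v (c + 1) $ r)"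
  have evec: "eigenvector J (v i) (lam i)" if "i \<in> {1..n}" for i
    using eig that by (auto simp: orthonormal_eigensystem_def)
  have v: "v i \<in> carrier_vec n" if "i \<in> {1..n}" for i
    using evec[OF that] J by (auto simp: eigenvector_def)
  have V: "V \<in> carrier_mat n n" by (simp add: V_def)
  have col: "col V c = v (c + 1)" if "c < n" for c
    using v[of "c + 1"] that by (auto simp: V_def intro!: eq_vecI)
  have "transpose_mat V * V = 1\<^sub>m n"
    using V eig by (auto intro!: eq_matI simp: col orthonormal_eigensystem_def)
  then have VV: "V * transpose_mat V = 1\<^sub>m n"
    using mat_mult_left_right_inverse[of "transpose_mat V" n V] V by auto
  define P where "P = J ^\<^sub>m k"
  have P: "P \<in> carrier_mat n n" using J by (simp add: P_def)
  have entry: "(P * V) $$ (0, c) = lam (c + 1) ^ k * v (c + 1) $ 0" if "c < n" for c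
  proof -
    have "(P * V) $$ (0, c) = (P *\<^sub>v col V c) $ 0"
      using that P V n by simp
    also have "\<dots> = (lam (c + 1) ^ k \<cdot>\<^sub>v v (c + 1)) $ 0"
      using eigenvector_pow[OF J evec[of "c + 1"], of k] that by (simp add: col P_def)
    finally show ?thesis using v[of "c + 1"] that n by simp
  qed
  have "P = (P * V) * transpose_mat V"
    using P V VV by (metis assoc_mult_mat right_mult_one_mat transpose_carrier_mat)
  then have "(P) $$ (0, 0) = ((P * V) * transpose_mat V) $$ (0, 0)"
    by simp
  also have "\<dots> = (\<Sum>c<n. (P * V) $$ (0, c) * V $$ (0, c))"
  proof -
    have "W \<in> carrier_mat n n \<Longrightarrow>
      (W * transpose_mat V) $$ (0, 0) = (\<Sum>c<n. W $$ (0, c) * V $$ (0, c))" for W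
      using V n by (simp add: scalar_prod_def atLeast0LessThan)
    then show ?thesis using P V by (metis mult_carrier_mat)
  qed
  also have "\<dots> = (\<Sum>c<n. \<bar>v (Suc c) $ 0\<bar>\<^sup>2 * lam (Suc c) ^ k)"
  proof (rule sum.cong[OF refl])
    fix c assume "c \<in> {..<n}"
    moreover from this n have "V $$ (0, c) = v (Suc c) $ 0" by (simp add: V_def)
    ultimately show "(P * V) $$ (0, c) * V $$ (0, c) = \<bar>v (Suc c) $ 0\<bar>\<^sup>2 * lam (Suc c) ^ k"
      using entry[of c] by (simp add: power2_eq_square del: index_mult_mat(1))
  qed
  also have "\<dots> = (\<Sum>i=1..n. \<bar>v i $ 0\<bar>\<^sup>2 * lam i ^ k)"
    by (rule sum.reindex_bij_witness[of _ "\<lambda>i. i - 1" Suc]) auto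
  finally show ?thesis by (simp add: integral_spectral_measure P_def)
qed

definition chi_density :: "real \<Rightarrow> real \<Rightarrow> real" where
  "chi_density k x =
     (if x > 0 then x powr (k - 1) * exp (- x\<^sup>2 / 2) / (2 powr (k / 2 - 1) * Gamma (k / 2)) else 0)"

text \<open>The random variables \<open>a i\<close> (\<open>1 \<le> i \<le> n\<close>) and \<open>b i\<close> (\<open>1 \<le> i < n\<close>) are the entries
  \<open>a\<^sub>i\<close> and \<open>b\<^sub>i\<close> of \<open>H\<^bsub>n,\<beta>\<^esub>\<close>; the sum type indexes the whole family for joint independence.
  The second parameter of \<open>normal_density\<close> is the standard deviation.\<close>

definition gaussian_beta_entries ::
    "'w measure \<Rightarrow> real \<Rightarrow> nat \<Rightarrow> (nat \<Rightarrow> 'w \<Rightarrow> real) \<Rightarrow> (nat \<Rightarrow> 'w \<Rightarrow> real) \<Rightarrow> bool" where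
  "gaussian_beta_entries M \<beta> n a b \<longleftrightarrow>
     prob_space.indep_vars M (\<lambda>_. borel) (case_sum a b) ({1..n} <+> {1..<n}) \<and>
     (\<forall>i\<in>{1..n}. distributed M lborel (\<lambda>\<omega>. sqrt (real n * \<beta>) * a i \<omega>)
        (\<lambda>x. ennreal (normal_density 0 (sqrt 2) x))) \<and>
     (\<forall>i\<in>{1..<n}. distributed M lborel (\<lambda>\<omega>. sqrt (real n * \<beta>) * b i \<omega>)
        (\<lambda>x. ennreal (chi_density (real (n - i) * \<beta>) x)))"

definition semicircle :: "real measure" where
  "semicircle = density lborel (\<lambda>x. ennreal (indicator {-2..2} x * sqrt (4 - x\<^sup>2) / (2 * pi)))"

text \<open>The second parameter is the variance; variance \<open>0\<close> gives a point mass.\<close>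

definition normal_distribution :: "real \<Rightarrow> real \<Rightarrow> real measure" where
  "normal_distribution m s2 =
     (if s2 = 0 then return borel m
      else density lborel (\<lambda>x. ennreal (normal_density m (sqrt s2) x)))"

definition polynomial_growth :: "(real \<Rightarrow> real) \<Rightarrow> bool" where
  "polynomial_growth g \<longleftrightarrow> (\<exists>p :: real poly. \<forall>x. \<bar>g x\<bar> \<le> poly p x)"

end

theory Submission
  imports Defs "HOL-Real_Asymp.Real_Asymp"
begin

text \<open>
Both parts use the orthonormal polynomials \<open>U\<^sub>m\<close> of the semicircle distribution, the Chebyshev
polynomials of the second kind rescaled to \<open>[-2, 2]\<close> (\<open>chebU\<close>).

Far from its lower right corner the matrix \<open>H\<close> is close to the free Jacobi matrix \<open>J\<^sub>0\<close>, with zeros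
on the diagonal and ones next to it: \<open>a\<^sub>i\<close> and \<open>b\<^sub>i - 1\<close> are of order \<open>1 / sqrt n\<close> for fixed \<open>i\<close>.
Since \<open>\<langle>\<mu>\<^sub>n, f\<rangle> = f(H)(1,1)\<close> and \<open>U\<^sub>m(H)(1,1)\<close> involves only the entries with index at most
\<open>m\<close>, perturbation of the three-term recurrence gives
\<open>\<langle>\<mu>\<^sub>n, U\<^sub>m\<rangle> = [m = 0] + lin\<^sub>m + O(1 / n)\<close>.  Here \<open>lin\<^sub>m\<close> is \<open>a\<^sub>i\<close> for \<open>m = 2 i - 1\<close> and, up to the
order of the remainder, \<open>2 (b\<^sub>i - 1)\<close> for \<open>m = 2 i\<close>; it is taken to be the centred square of the chi
variable divided by \<open>n \<beta>\<close>, which differs from that by terms of order \<open>1 / n\<close>.  The key point is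
that each \<open>U\<^sub>m\<close> sees one single entry in its linear part, so that the linear parts are independent,
and after multiplication by \<open>sqrt (n \<beta>) / sqrt 2\<close> each tends to a standard normal variable
(\<open>spec_chebU_linearization\<close>, \<open>lin_sum_char_tendsto\<close>).  For a polynomial
\<open>p = \<Sum>m\<le>d. \<alpha>\<^sub>m U\<^sub>m\<close> the limit is thus normal with variance \<open>\<Sum>m=1..d. \<alpha>\<^sub>m\<^sup>2\<close>, and this is the
variance of \<open>p\<close> under the semicircle distribution by orthonormality.

For part (i) the remainders have fourth moments of order \<open>n\<^sup>-\<^sup>2\<close>, hence almost surely
\<open>\<langle>\<mu>\<^sub>n, U\<^sub>m\<rangle> \<longlonglongrightarrow> [m = 0] = \<langle>sc, U\<^sub>m\<rangle>\<close> for all \<open>m\<close> together.  This carries over from polynomials to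
continuous functions of polynomial growth: what happens outside \<open>[-3, 3]\<close> is dominated by
\<open>K x\<^sup>2\<^sup>D (x / 3)\<^sup>2\<^sup>r\<close>, a polynomial whose semicircle integral is as small as one likes
(\<open>spec_limit_of_chebU\<close>).

For part (ii) a differentiable \<open>f\<close> is approximated in \<open>C\<^sup>1\<close> on \<open>[-3, 3]\<close> by a polynomial \<open>p\<close>, and
the fluctuations of \<open>\<langle>\<mu>\<^sub>n, f - p\<rangle>\<close> have to be small uniformly in \<open>n\<close>.  They are, by a Poincare
inequality.  The Efron-Stein inequality reduces the variance of a function of the independent entries
to one coordinate at a time; in one dimension the normal distribution and every chi distribution
satisfy a Poincare inequality with a constant that is independent of the degrees of freedom
(\<open>gauss_poincare\<close>, \<open>chi_poincare\<close>); and the gradient of \<open>\<langle>\<mu>\<^sub>n, g\<rangle>\<close> with respect to the entries is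
given by the divided differences of \<open>g\<close>, so that the sum of its squares is
controlled by the spectral measure (\<open>spec_kern_sum_squares\<close>).  Therefore
\<open>n \<beta> Var \<langle>\<mu>\<^sub>n, g\<rangle>\<close> is at most \<open>12 e\<^sup>2\<close> plus a small polynomial tail if \<open>g'\<close> is bounded by \<open>e\<close> on
\<open>[-3, 3]\<close> (\<open>variance_spec_tail\<close>).  Convergence of characteristic functions and the continuity
theorem of Levy finish the proof.
\<close>

section \<open>Eigensystems of symmetric matrices\<close>
text \<open>Rows of \<open>w\<close> are the eigenvectors.  Functions on \<open>nat\<close> restricted to
  indices below \<open>n\<close> are used instead of a matrix type, because \<open>n\<close> grows in the limit
  theorems.\<close>

definition eigensystem :: "nat \<Rightarrow> (nat \<Rightarrow> nat \<Rightarrow> real) \<Rightarrow> (nat \<Rightarrow> real) \<Rightarrow> (nat \<Rightarrow> nat \<Rightarrow> real) \<Rightarrow> bool" where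
  "eigensystem n A lam w \<longleftrightarrow>
     (\<forall>i<n. \<forall>r<n. (\<Sum>k<n. A r k * w i k) = lam i * w i r) \<and>
     (\<forall>i<n. \<forall>j<n. (\<Sum>k<n. w i k * w j k) = (if i = j then 1 else 0)) \<and>
     (\<forall>r<n. \<forall>c<n. (\<Sum>i<n. w i r * w i c) = (if r = c then 1 else 0))"

text \<open>The projections of the \<open>n\<close> unit vectors onto the orthogonal complement cannot all
  vanish: their squared norms sum to \<open>n - k\<close>.\<close>

lemma exists_unit_vector_orthogonal:
  fixes w :: "nat \<Rightarrow> nat \<Rightarrow> real"
  assumes kn: "k < n"
    and on: "\<And>i j. i < k \<Longrightarrow> j < k \<Longrightarrow> (\<Sum>r<n. w i r * w j r) = (if i = j then 1 else 0)"
  shows "\<exists>x. (\<forall>r\<ge>n. x r = 0) \<and> (\<Sum>r<n. (x r)\<^sup>2) = 1 \<and> (\<forall>i<k. (\<Sum>r<n. x r * w i r) = 0)"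
proof -
  define y where "y s r = (if r < n then (if r = s then 1 else 0) - (\<Sum>i<k. w i s * w i r) else 0)" for s r
  have orth: "(\<Sum>r<n. y s r * w j r) = 0" if "s < n" "j < k" for s j
  proof -
    have "(\<Sum>r<n. y s r * w j r) = (\<Sum>r<n. (if r = s then w j r else 0)) - (\<Sum>r<n. \<Sum>i<k. w i s * (w i r * w j r))"
      unfolding sum_subtractf[symmetric]
      by (rule sum.cong) (auto simp: y_def algebra_simps sum_distrib_left)
    also have "(\<Sum>r<n. \<Sum>i<k. w i s * (w i r * w j r)) = (\<Sum>i<k. w i s * (\<Sum>r<n. w i r * w j r))"
      by (subst sum.swap) (simp add: sum_distrib_left)
    also have "\<dots> = (\<Sum>i<k. if i = j then w i s else 0)"
      by (rule sum.cong) (auto simp: on that)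
    finally show ?thesis using that by simp
  qed
  have nz: "\<exists>s<n. (\<Sum>r<n. (y s r)\<^sup>2) \<noteq> 0"
  proof (rule ccontr)
    assume "\<not> ?thesis"
    then have z: "(\<Sum>r<n. (y s r)\<^sup>2) = 0" if "s < n" for s using that by blast
    have "y s s = 0" if "s < n" for s
      using z[OF that] that by (subst (asm) sum_nonneg_eq_0_iff) auto
    then have "(\<Sum>i<k. w i s * w i s) = 1" if "s < n" for s
      using that by (auto simp: y_def dest!: meta_spec)
    then have "(\<Sum>s<n. \<Sum>i<k. w i s * w i s) = n" by simp
    moreover have "(\<Sum>s<n. \<Sum>i<k. w i s * w i s) = k"
      by (subst sum.swap) (simp add: on)
    ultimately show False using kn by simp
  qed
  then obtain s where s: "s < n" "(\<Sum>r<n. (y s r)\<^sup>2) \<noteq> 0" by blast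
  define N where "N = (\<Sum>r<n. (y s r)\<^sup>2)"
  have N: "N > 0" using s(2) unfolding N_def by (simp add: sum_nonneg order_less_le)
  show ?thesis
  proof (intro exI conjI allI impI)
    let ?x = "\<lambda>r. y s r / sqrt N"
    show "r \<ge> n \<Longrightarrow> ?x r = 0" for r by (simp add: y_def)
    show "(\<Sum>r<n. (?x r)\<^sup>2) = 1"
      using N by (simp add: power_divide sum_divide_distrib[symmetric] N_def[symmetric])
    show "i < k \<Longrightarrow> (\<Sum>r<n. ?x r * w i r) = 0" for i
      using orth[OF s(1), of i] by (simp add: sum_divide_distrib[symmetric])
  qed
qed

text \<open>Maximising the quadratic form over the unit sphere of the orthogonal complement of the
  eigenvectors found so far gives one more eigenvector.  The complement sits inside the compact
  box of all \<open>nat \<Rightarrow> real\<close> with coordinates in \<open>[-1, 1]\<close>, so that the dimension need not be a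
  type.\<close>

lemma exists_orthogonal_eigenvector:
  fixes A w :: "nat \<Rightarrow> nat \<Rightarrow> real"
  assumes kn: "k < n"
    and sym: "\<And>r c. r < n \<Longrightarrow> c < n \<Longrightarrow> A r c = A c r"
    and ev: "\<And>i r. i < k \<Longrightarrow> r < n \<Longrightarrow> (\<Sum>c<n. A r c * w i c) = lam i * w i r"
    and on: "\<And>i j. i < k \<Longrightarrow> j < k \<Longrightarrow> (\<Sum>r<n. w i r * w j r) = (if i = j then 1 else 0)"
  shows "\<exists>x l. (\<forall>r<n. (\<Sum>c<n. A r c * x c) = l * x r) \<and> (\<Sum>r<n. x r * x r) = 1 \<and>
           (\<forall>i<k. (\<Sum>r<n. x r * w i r) = 0)"
proof -
  define q where "q x = (\<Sum>r<n. \<Sum>c<n. A r c * x r * x c)" for x :: "nat \<Rightarrow> real"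
  define S where "S = {x. (\<forall>r\<ge>n. x r = 0) \<and> (\<Sum>r<n. (x r)\<^sup>2) = 1 \<and> (\<forall>i<k. (\<Sum>r<n. x r * w i r) = 0)}"
  have ne: "S \<noteq> {}" unfolding S_def using exists_unit_vector_orthogonal[OF kn on] by blast
  have coord: "continuous_on UNIV (\<lambda>x :: nat \<Rightarrow> real. x r)" for r
    by (rule continuous_on_product_coordinates)
  have S_Int: "S = (\<Inter>r\<in>{n..}. {x. x r = 0}) \<inter> {x. (\<Sum>r<n. (x r)\<^sup>2) = 1} \<inter> (\<Inter>i\<in>{..<k}. {x. (\<Sum>r<n. x r * w i r) = 0})"
    by (auto simp: S_def)
  have "closed S" unfolding S_Int
    by (intro closed_Int closed_INT ballI closed_Collect_eq continuous_intros coord)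
  have box: "S \<subseteq> Pi\<^sub>E UNIV (\<lambda>_. {-1..1})"
  proof
    fix x assume x: "x \<in> S"
    have "\<bar>x r\<bar> \<le> 1" for r
    proof (cases "r < n")
      case True
      have "(x r)\<^sup>2 \<le> (\<Sum>r<n. (x r)\<^sup>2)" by (rule member_le_sum) (use True in auto)
      then have "(x r)\<^sup>2 \<le> 1" using x by (simp add: S_def)
      then show ?thesis by (simp add: abs_square_le_1)
    qed (use x in \<open>simp add: S_def\<close>)
    then show "x \<in> Pi\<^sub>E UNIV (\<lambda>_. {-1..1})" by (auto simp: abs_le_iff)
  qed
  have "compactin (product_topology (\<lambda>_::nat. euclidean) UNIV) (Pi\<^sub>E UNIV (\<lambda>_. {-1..1::real}))"
    by (simp add: compactin_PiE)
  then have "compact (Pi\<^sub>E UNIV (\<lambda>_::nat. {-1..1::real}))"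
    by (simp add: euclidean_product_topology)
  then have "compact S" using \<open>closed S\<close> box by (metis compact_Int_closed inf.absorb_iff2)
  moreover have "continuous_on S q" unfolding q_def
    by (intro continuous_intros continuous_on_subset[OF coord]) auto
  ultimately obtain x where xS: "x \<in> S" and mx: "\<And>y. y \<in> S \<Longrightarrow> q y \<le> q x"
    using continuous_attains_sup[of S q] ne by blast
  define l where "l = q x"
  have x0: "\<And>r. r \<ge> n \<Longrightarrow> x r = 0" and x1: "(\<Sum>r<n. (x r)\<^sup>2) = 1"
    and xo: "\<And>i. i < k \<Longrightarrow> (\<Sum>r<n. x r * w i r) = 0"
    using xS by (auto simp: S_def)
  have bound: "q y \<le> l * (\<Sum>r<n. (y r)\<^sup>2)"
    if y: "\<And>r. r \<ge> n \<Longrightarrow> y r = 0" "\<And>i. i < k \<Longrightarrow> (\<Sum>r<n. y r * w i r) = 0" for y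
  proof (cases "(\<Sum>r<n. (y r)\<^sup>2) = 0")
    case True
    then have "\<And>r. r < n \<Longrightarrow> y r = 0" by (subst (asm) sum_nonneg_eq_0_iff) auto
    then show ?thesis by (simp add: q_def)
  next
    case False
    define N where "N = (\<Sum>r<n. (y r)\<^sup>2)"
    have N: "N > 0" using False unfolding N_def by (simp add: sum_nonneg order_less_le)
    let ?z = "\<lambda>r. y r / sqrt N"
    have "?z \<in> S" using N y
      by (auto simp: S_def power_divide sum_divide_distrib[symmetric] N_def[symmetric])
    then have "q ?z \<le> l" using mx l_def by simp
    moreover have "q ?z = q y / N"
      using N by (simp add: q_def sum_divide_distrib)
    ultimately show ?thesis using N by (simp add: field_simps N_def)
  qed
  define z where "z r = (if r < n then (\<Sum>c<n. A r c * x c) - l * x r else 0)" for r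
  have Asym: "(\<Sum>r<n. (\<Sum>c<n. A r c * u c) * u' r) = (\<Sum>r<n. u r * (\<Sum>c<n. A r c * u' c))" for u u'
  proof -
    have "(\<Sum>r<n. (\<Sum>c<n. A r c * u c) * u' r) = (\<Sum>r<n. \<Sum>c<n. u c * (A c r * u' r))"
      by (auto simp: sum_distrib_right sum_distrib_left sym intro!: sum.cong)
    also have "\<dots> = (\<Sum>c<n. \<Sum>r<n. u c * (A c r * u' r))" by (rule sum.swap)
    finally show ?thesis by (simp add: sum_distrib_left)
  qed
  have zo: "(\<Sum>r<n. z r * w i r) = 0" if i: "i < k" for i
  proof -
    have "(\<Sum>r<n. z r * w i r) = (\<Sum>r<n. (\<Sum>c<n. A r c * x c) * w i r) - l * (\<Sum>r<n. x r * w i r)"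
      by (simp add: z_def sum_distrib_left sum_subtractf[symmetric] algebra_simps)
    also have "\<dots> = (\<Sum>r<n. x r * (\<Sum>c<n. A r c * w i c))" using xo[OF i] Asym by simp
    also have "\<dots> = (\<Sum>r<n. lam i * (x r * w i r))" by (rule sum.cong) (auto simp: ev[OF i])
    also have "\<dots> = 0" using xo[OF i] by (simp add: sum_distrib_left[symmetric])
    finally show ?thesis .
  qed
  have z0: "\<And>r. r \<ge> n \<Longrightarrow> z r = 0" by (simp add: z_def)
  define Z where "Z = (\<Sum>r<n. (z r)\<^sup>2)"
  have qz: "q (\<lambda>r. x r + t * z r) - l * (\<Sum>r<n. (x r + t * z r)\<^sup>2) = 2 * t * Z + t\<^sup>2 * (q z - l * Z)" for t
  proof -
    have cross: "(\<Sum>r<n. \<Sum>c<n. A r c * x r * z c) = (\<Sum>r<n. \<Sum>c<n. A r c * z r * x c)"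
      using Asym[of x z] by (simp add: sum_distrib_left sum_distrib_right ac_simps)
    have "q (\<lambda>r. x r + t * z r) = q x + t * (\<Sum>r<n. \<Sum>c<n. A r c * x r * z c)
        + t * (\<Sum>r<n. \<Sum>c<n. A r c * z r * x c) + t\<^sup>2 * q z"
      by (simp add: q_def sum_distrib_left sum.distrib[symmetric] algebra_simps power2_eq_square)
    also have "\<dots> = l + 2 * t * (\<Sum>r<n. \<Sum>c<n. A r c * z r * x c) + t\<^sup>2 * q z"
      using cross by (simp add: l_def)
    finally have 1: "q (\<lambda>r. x r + t * z r) = l + 2 * t * (\<Sum>r<n. \<Sum>c<n. A r c * z r * x c) + t\<^sup>2 * q z" .
    have "(\<Sum>r<n. (x r + t * z r)\<^sup>2) = (\<Sum>r<n. (x r)\<^sup>2) + 2 * t * (\<Sum>r<n. x r * z r) + t\<^sup>2 * Z"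
      by (simp add: Z_def sum_distrib_left sum.distrib[symmetric] algebra_simps power2_eq_square)
    then have 2: "(\<Sum>r<n. (x r + t * z r)\<^sup>2) = 1 + 2 * t * (\<Sum>r<n. x r * z r) + t\<^sup>2 * Z" by (simp add: x1)
    have "(\<Sum>r<n. \<Sum>c<n. A r c * z r * x c) - l * (\<Sum>r<n. x r * z r)
        = (\<Sum>r<n. z r * ((\<Sum>c<n. A r c * x c) - l * x r))"
      by (simp add: sum_distrib_left sum_subtractf[symmetric] algebra_simps)
    also have "\<dots> = Z" unfolding Z_def by (rule sum.cong) (auto simp: z_def power2_eq_square)
    finally have 3: "(\<Sum>r<n. \<Sum>c<n. A r c * z r * x c) = Z + l * (\<Sum>r<n. x r * z r)" by simp
    show ?thesis unfolding 1 2 3 by (simp add: algebra_simps)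
  qed
  have le: "2 * t * Z + t\<^sup>2 * (q z - l * Z) \<le> 0" for t
  proof -
    have "q (\<lambda>r. x r + t * z r) \<le> l * (\<Sum>r<n. (x r + t * z r)\<^sup>2)"
      by (rule bound) (auto simp: x0 z0 xo zo sum.distrib algebra_simps sum_distrib_left[symmetric])
    then show ?thesis using qz[of t] by simp
  qed
  have "Z = 0"
  proof (rule ccontr)
    assume "Z \<noteq> 0"
    then have Z: "Z > 0" unfolding Z_def by (simp add: sum_nonneg order_less_le)
    define B where "B = \<bar>q z - l * Z\<bar> + 1"
    have B: "B > 0" and "- (q z - l * Z) < B" by (auto simp: B_def)
    have "2 * (Z / B) * Z + (Z / B)\<^sup>2 * (q z - l * Z) \<ge> 2 * (Z / B) * Z - (Z / B)\<^sup>2 * B"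
      using \<open>- (q z - l * Z) < B\<close> mult_left_mono[of "- B" "q z - l * Z" "(Z / B)\<^sup>2"] by simp
    moreover have "2 * (Z / B) * Z - (Z / B)\<^sup>2 * B = Z * Z / B" using B by (simp add: power2_eq_square)
    moreover have "Z * Z / B > 0" using Z B by simp
    ultimately show False using le[of "Z / B"] by linarith
  qed
  then have "z r = 0" if "r < n" for r
    using that unfolding Z_def by (subst (asm) sum_nonneg_eq_0_iff) auto
  then have "\<forall>r<n. (\<Sum>c<n. A r c * x c) = l * x r" by (auto simp: z_def)
  moreover have "(\<Sum>r<n. x r * x r) = 1" using x1 by (simp add: power2_eq_square)
  ultimately show ?thesis using xo by blast
qed

text \<open>A left inverse of a square matrix is a right inverse.\<close>

lemma orthonormal_rows_imp_columns:
  fixes w :: "nat \<Rightarrow> nat \<Rightarrow> real"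
  assumes "\<And>i j. i < n \<Longrightarrow> j < n \<Longrightarrow> (\<Sum>k<n. w i k * w j k) = (if i = j then 1 else 0)"
    and "r < n" "c < n"
  shows "(\<Sum>i<n. w i r * w i c) = (if r = c then 1 else 0)"
proof -
  define V where "V = mat n n (\<lambda>(i, r). w i r)"
  have V: "V \<in> carrier_mat n n" by (simp add: V_def)
  have "V * transpose_mat V = 1\<^sub>m n"
    using assms(1) by (intro eq_matI) (auto simp: V_def scalar_prod_def atLeast0LessThan)
  then have "transpose_mat V * V = 1\<^sub>m n"
    using mat_mult_left_right_inverse[of V n "transpose_mat V"] V by auto
  then have "(transpose_mat V * V) $$ (r, c) = 1\<^sub>m n $$ (r, c)" by simp
  then show ?thesis
    using assms(2,3) by (simp add: V_def scalar_prod_def atLeast0LessThan)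
qed

theorem symmetric_eigensystem_exists:
  fixes A :: "nat \<Rightarrow> nat \<Rightarrow> real"
  assumes sym: "\<And>r c. r < n \<Longrightarrow> c < n \<Longrightarrow> A r c = A c r"
  shows "\<exists>lam w. eigensystem n A lam w"
proof -
  have "k \<le> n \<Longrightarrow> \<exists>lam w. (\<forall>i<k. \<forall>r<n. (\<Sum>c<n. A r c * w i c) = lam i * w i r) \<and>
     (\<forall>i<k. \<forall>j<k. (\<Sum>r<n. w i r * w j r) = (if i = j then 1 else 0))" for k
  proof (induction k)
    case (Suc k)
    then have "k \<le> n" by simp
    from Suc.IH[OF this] obtain lam w
      where ev: "\<forall>i<k. \<forall>r<n. (\<Sum>c<n. A r c * w i c) = lam i * w i r"
        and on: "\<forall>i<k. \<forall>j<k. (\<Sum>r<n. w i r * w j r) = (if i = j then 1 else 0)"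
      by (elim exE conjE)
    note w = ev[rule_format] on[rule_format]
    have "\<exists>x l. (\<forall>r<n. (\<Sum>c<n. A r c * x c) = l * x r) \<and> (\<Sum>r<n. x r * x r) = 1 \<and>
           (\<forall>i<k. (\<Sum>r<n. x r * w i r) = 0)"
    proof (rule exists_orthogonal_eigenvector)
      show "k < n" using Suc.prems by simp
      show "\<And>r c. r < n \<Longrightarrow> c < n \<Longrightarrow> A r c = A c r" by (rule sym)
      show "\<And>i r. i < k \<Longrightarrow> r < n \<Longrightarrow> (\<Sum>c<n. A r c * w i c) = lam i * w i r" by (rule w(1))
      show "\<And>i j. i < k \<Longrightarrow> j < k \<Longrightarrow> (\<Sum>r<n. w i r * w j r) = (if i = j then 1 else 0)" by (rule w(2))
    qed
    then obtain x l where x: "\<forall>r<n. (\<Sum>c<n. A r c * x c) = l * x r" "(\<Sum>r<n. x r * x r) = 1"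
      "\<forall>i<k. (\<Sum>r<n. x r * w i r) = 0" by (elim exE conjE)
    have x': "i < k \<Longrightarrow> (\<Sum>r<n. w i r * x r) = 0" for i using x(3) by (simp add: mult.commute)
    define lam' w' where "lam' = lam(k := l)" and "w' = w(k := x)"
    have old: "lam' i = lam i" "w' i = w i" if "i < k" for i using that by (auto simp: lam'_def w'_def)
    have new: "lam' k = l" "w' k = x" by (auto simp: lam'_def w'_def)
    have "(\<Sum>c<n. A r c * w' i c) = lam' i * w' i r" if "i < Suc k" "r < n" for i r
      using that w(1)[of i r] x(1) by (cases "i = k") (auto simp only: old new less_Suc_eq)
    moreover have "(\<Sum>r<n. w' i r * w' j r) = (if i = j then 1 else 0)" if ij: "i < Suc k" "j < Suc k" for i j
    proof -
      consider "i < k" "j < k" | "i = k" "j < k" | "i < k" "j = k" | "i = k" "j = k"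
        using ij unfolding less_Suc_eq by blast
      then show ?thesis
      proof cases
        case 1
        show ?thesis unfolding old[OF 1(1)] old[OF 1(2)] by (rule w(2)[OF 1])
      next
        case 2
        then show ?thesis unfolding old[OF 2(2)] 2(1) new using x(3) by simp
      next
        case 3
        then show ?thesis unfolding old[OF 3(1)] 3(2) new using x'[OF 3(1)] by simp
      next
        case 4
        then show ?thesis unfolding 4 new using x(2) by simp
      qed
    qed
    ultimately show ?case by (intro exI[of _ lam'] exI[of _ w'] conjI allI impI)
  qed simp
  from this[of n] obtain lam w where "\<forall>i<n. \<forall>r<n. (\<Sum>c<n. A r c * w i c) = lam i * w i r"
    "\<forall>i<n. \<forall>j<n. (\<Sum>r<n. w i r * w j r) = (if i = j then 1 else 0)" by auto
  note w = this
  have "\<forall>r<n. \<forall>c<n. (\<Sum>i<n. w i r * w i c) = (if r = c then 1 else 0)"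
  proof (intro allI impI)
    fix r c assume "r < n" "c < n"
    then show "(\<Sum>i<n. w i r * w i c) = (if r = c then 1 else 0)"
      using orthonormal_rows_imp_columns[of n w r c] w(2) by simp
  qed
  with w have "eigensystem n A lam w" unfolding eigensystem_def by (intro conjI)
  then show ?thesis by (intro exI)
qed

section \<open>The spectral functional on polynomials\<close>
lemma sum_pull_inner:
  fixes f :: "'a \<Rightarrow> 'b \<Rightarrow> 'c \<Rightarrow> 'd \<Rightarrow> real"
  shows "(\<Sum>a\<in>A. \<Sum>b\<in>B a. \<Sum>k\<in>C. \<Sum>l\<in>D. f a b k l) = (\<Sum>k\<in>C. \<Sum>l\<in>D. \<Sum>a\<in>A. \<Sum>b\<in>B a. f a b k l)"
proof -
  have "(\<Sum>a\<in>A. \<Sum>b\<in>B a. \<Sum>k\<in>C. \<Sum>l\<in>D. f a b k l) = (\<Sum>a\<in>A. \<Sum>k\<in>C. \<Sum>b\<in>B a. \<Sum>l\<in>D. f a b k l)"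
    by (rule sum.cong[OF refl], rule sum.swap)
  also have "\<dots> = (\<Sum>a\<in>A. \<Sum>k\<in>C. \<Sum>l\<in>D. \<Sum>b\<in>B a. f a b k l)"
    by (rule sum.cong[OF refl], rule sum.cong[OF refl], rule sum.swap)
  also have "\<dots> = (\<Sum>k\<in>C. \<Sum>a\<in>A. \<Sum>l\<in>D. \<Sum>b\<in>B a. f a b k l)" by (rule sum.swap)
  also have "\<dots> = (\<Sum>k\<in>C. \<Sum>l\<in>D. \<Sum>a\<in>A. \<Sum>b\<in>B a. f a b k l)"
    by (rule sum.cong[OF refl], rule sum.swap)
  finally show ?thesis .
qed

lemma sum_pull_one:
  fixes f :: "'a \<Rightarrow> 'c \<Rightarrow> 'd \<Rightarrow> real"
  shows "(\<Sum>a\<in>A. \<Sum>k\<in>C. \<Sum>l\<in>D. f a k l) = (\<Sum>k\<in>C. \<Sum>l\<in>D. \<Sum>a\<in>A. f a k l)"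
proof -
  have "(\<Sum>a\<in>A. \<Sum>k\<in>C. \<Sum>l\<in>D. f a k l) = (\<Sum>k\<in>C. \<Sum>a\<in>A. \<Sum>l\<in>D. f a k l)" by (rule sum.swap)
  also have "\<dots> = (\<Sum>k\<in>C. \<Sum>l\<in>D. \<Sum>a\<in>A. f a k l)"
    by (rule sum.cong[OF refl], rule sum.swap)
  finally show ?thesis .
qed

lemma eigensystem_eq: "eigensystem n A lam w \<Longrightarrow> i < n \<Longrightarrow> r < n \<Longrightarrow> (\<Sum>k<n. A r k * w i k) = lam i * w i r"
  and eigensystem_rows: "eigensystem n A lam w \<Longrightarrow> i < n \<Longrightarrow> j < n \<Longrightarrow> (\<Sum>k<n. w i k * w j k) = (if i = j then 1 else 0)"
  and eigensystem_cols: "eigensystem n A lam w \<Longrightarrow> r < n \<Longrightarrow> c < n \<Longrightarrow> (\<Sum>i<n. w i r * w i c) = (if r = c then 1 else 0)"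
  unfolding eigensystem_def by blast+

lemma eigensystem_abs_le_1:
  assumes e: "eigensystem n A lam w" and "i < n" "r < n"
  shows "\<bar>w i r\<bar> \<le> 1"
proof -
  have "w i r * w i r \<le> (\<Sum>k<n. w i k * w i k)" by (rule member_le_sum) (use assms in auto)
  then have "(w i r)\<^sup>2 \<le> 1" using eigensystem_rows[OF e, of i i] assms by (simp add: power2_eq_square)
  then show ?thesis by (simp add: abs_square_le_1)
qed

text \<open>A crude bound for the spectral radius; it is enough to confine the eigenvalues of a given matrix
  to a compact set.\<close>

definition entry_sum :: "nat \<Rightarrow> (nat \<Rightarrow> nat \<Rightarrow> real) \<Rightarrow> real" where
  "entry_sum n A = (\<Sum>r<n. \<Sum>c<n. \<bar>A r c\<bar>)"

lemma eigenvalue_bound: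
  assumes e: "eigensystem n A lam w" and i: "i < n"
  shows "\<bar>lam i\<bar> \<le> entry_sum n A"
proof -
  have "lam i = (\<Sum>r<n. lam i * (w i r * w i r))"
    using eigensystem_rows[OF e i i] by (simp add: sum_distrib_left[symmetric])
  also have "\<dots> = (\<Sum>r<n. w i r * (\<Sum>c<n. A r c * w i c))"
  proof (rule sum.cong[OF refl])
    fix r assume "r \<in> {..<n}"
    then show "lam i * (w i r * w i r) = w i r * (\<Sum>c<n. A r c * w i c)"
      using eigensystem_eq[OF e i, of r] by simp
  qed
  also have "\<dots> = (\<Sum>r<n. \<Sum>c<n. A r c * (w i r * w i c))" by (simp add: sum_distrib_left algebra_simps)
  finally have eq: "lam i = (\<Sum>r<n. \<Sum>c<n. A r c * (w i r * w i c))" .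
  have "\<bar>lam i\<bar> \<le> (\<Sum>r<n. \<bar>\<Sum>c<n. A r c * (w i r * w i c)\<bar>)" unfolding eq by (rule sum_abs)
  also have "\<dots> \<le> (\<Sum>r<n. \<Sum>c<n. \<bar>A r c * (w i r * w i c)\<bar>)" by (intro sum_mono sum_abs)
  also have "\<dots> \<le> (\<Sum>r<n. \<Sum>c<n. \<bar>A r c\<bar>)"
  proof (intro sum_mono)
    fix r c assume "r \<in> {..<n}" "c \<in> {..<n}"
    then have "\<bar>w i r\<bar> * \<bar>w i c\<bar> \<le> 1 * 1"
      by (intro mult_mono eigensystem_abs_le_1[OF e i]) auto
    then show "\<bar>A r c * (w i r * w i c)\<bar> \<le> \<bar>A r c\<bar>"
      by (simp add: abs_mult mult_left_le)
  qed
  finally show ?thesis by (simp add: entry_sum_def)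
qed

lemma eigensystem_weights: "eigensystem n A lam w \<Longrightarrow> r < n \<Longrightarrow> (\<Sum>i<n. (w i r)\<^sup>2) = 1"
  using eigensystem_cols[of n A lam w r r] by (simp add: power2_eq_square)

fun mpow :: "nat \<Rightarrow> (nat \<Rightarrow> nat \<Rightarrow> real) \<Rightarrow> nat \<Rightarrow> nat \<Rightarrow> nat \<Rightarrow> real" where
  "mpow n A 0 r c = (if r = c then 1 else 0)"
| "mpow n A (Suc m) r c = (\<Sum>k<n. mpow n A m r k * A k c)"

lemma mpow_spectral:
  assumes e: "eigensystem n A lam w" and sym: "\<And>r c. A r c = A c r"
  shows "r < n \<Longrightarrow> c < n \<Longrightarrow> mpow n A m r c = (\<Sum>i<n. lam i ^ m * (w i r * w i c))"
proof (induction m arbitrary: c)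
  case 0
  then show ?case using eigensystem_cols[OF e, of r c] by simp
next
  case (Suc m)
  have "mpow n A (Suc m) r c = (\<Sum>k<n. \<Sum>i<n. lam i ^ m * w i r * (A c k * w i k))"
    using Suc by (auto simp: sum_distrib_left sum_distrib_right sym[of _ c] algebra_simps intro!: sum.cong)
  also have "\<dots> = (\<Sum>i<n. lam i ^ m * w i r * (\<Sum>k<n. A c k * w i k))"
    by (subst sum.swap) (simp add: sum_distrib_left)
  also have "\<dots> = (\<Sum>i<n. lam i ^ Suc m * (w i r * w i c))"
    by (rule sum.cong) (use eigensystem_eq[OF e _ Suc.prems(2)] in auto)
  finally show ?case .
qed

definition eig_vals :: "nat \<Rightarrow> (nat \<Rightarrow> nat \<Rightarrow> real) \<Rightarrow> nat \<Rightarrow> real" where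
  "eig_vals n A = (SOME lam. \<exists>w. eigensystem n A lam w)"

definition eig_vecs :: "nat \<Rightarrow> (nat \<Rightarrow> nat \<Rightarrow> real) \<Rightarrow> nat \<Rightarrow> nat \<Rightarrow> real" where
  "eig_vecs n A = (SOME w. eigensystem n A (eig_vals n A) w)"

lemma eigensystem_eig:
  assumes sym: "\<And>r c. A r c = A c r"
  shows "eigensystem n A (eig_vals n A) (eig_vecs n A)"
proof -
  have "\<exists>lam w. eigensystem n A lam w" by (rule symmetric_eigensystem_exists) (rule sym)
  then have "\<exists>w. eigensystem n A (eig_vals n A) w" unfolding eig_vals_def by (rule someI_ex)
  then show ?thesis unfolding eig_vecs_def by (rule someI_ex)
qed

text \<open>The integral of \<open>f\<close> against the spectral measure of \<open>A\<close> at the first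
  coordinate, that is, \<open>f(A)(1,1)\<close>.  A choice of eigensystem is fixed;
  \<open>spec_eq_eigensystem\<close> shows that it does not matter.\<close>

definition spec :: "nat \<Rightarrow> (nat \<Rightarrow> nat \<Rightarrow> real) \<Rightarrow> (real \<Rightarrow> real) \<Rightarrow> real" where
  "spec n A f = (\<Sum>i<n. (eig_vecs n A i 0)\<^sup>2 * f (eig_vals n A i))"

definition ddiff :: "(real \<Rightarrow> real) \<Rightarrow> (real \<Rightarrow> real) \<Rightarrow> real \<Rightarrow> real \<Rightarrow> real" where
  "ddiff f f' x y = (if x = y then f' x else (f x - f y) / (x - y))"

text \<open>The derivative of \<open>f(A)(1,1)\<close> in the direction \<open>E\<^sub>k\<^sub>l\<close>, in
  the form of Daleckii and Krein: divided differences of \<open>f\<close> in the eigenbasis.\<close>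

definition spec_kern :: "nat \<Rightarrow> (nat \<Rightarrow> nat \<Rightarrow> real) \<Rightarrow> (real \<Rightarrow> real) \<Rightarrow> (real \<Rightarrow> real) \<Rightarrow> nat \<Rightarrow> nat \<Rightarrow> real" where
  "spec_kern n A f f' k l = (let lam = eig_vals n A; w = eig_vecs n A in
     \<Sum>i<n. \<Sum>j<n. ddiff f f' (lam i) (lam j) * (w i 0 * w i k) * (w j 0 * w j l))"

text \<open>Polynomials with explicit coefficients; \<open>psum'\<close> is the derivative.\<close>

definition psum :: "(nat \<Rightarrow> real) \<Rightarrow> nat \<Rightarrow> real \<Rightarrow> real" where
  "psum c d x = (\<Sum>m\<le>d. c m * x ^ m)"

definition psum' :: "(nat \<Rightarrow> real) \<Rightarrow> nat \<Rightarrow> real \<Rightarrow> real" where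
  "psum' c d x = (\<Sum>m\<le>d. c m * (real m * x ^ (m - 1)))"

lemma psum_deriv: "(psum c d has_real_derivative psum' c d x) (at x)"
  unfolding psum_def [abs_def] psum'_def by (auto intro!: derivative_eq_intros sum.cong)

lemma continuous_psum [continuous_intros]: "continuous_on S (psum c d)" "continuous_on S (psum' c d)"
  unfolding psum_def [abs_def] psum'_def[abs_def] by (intro continuous_intros)+

text \<open>The telescoping factorization of \<open>x\<^sup>m - y\<^sup>m\<close>.\<close>

lemma ddiff_psum: "ddiff (psum c d) (psum' c d) x y = (\<Sum>m\<le>d. c m * (\<Sum>j<m. x ^ j * y ^ (m - Suc j)))"
proof (cases "x = y")
  case True
  have "(\<Sum>j<m. y ^ j * y ^ (m - Suc j)) = real m * y ^ (m - 1)" for m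
    by (simp add: power_add[symmetric])
  then show ?thesis using True by (simp add: ddiff_def psum'_def)
next
  case False
  have "psum c d x - psum c d y = (x - y) * (\<Sum>m\<le>d. c m * (\<Sum>j<m. x ^ j * y ^ (m - Suc j)))"
    unfolding psum_def sum_subtractf[symmetric] right_diff_distrib[symmetric] power_diff_sumr2
    by (simp add: sum_distrib_left mult.commute mult.left_commute)
  then show ?thesis using False by (simp add: ddiff_def)
qed

lemma sum_mpow_spectral:
  assumes e: "eigensystem n A lam w" and sym: "\<And>r c. A r c = A c r" and n: "n > 0"
  shows "(\<Sum>m\<le>d. c m * mpow n A m 0 0) = (\<Sum>i<n. (w i 0)\<^sup>2 * psum c d (lam i))"
proof -
  have "(\<Sum>m\<le>d. c m * mpow n A m 0 0) = (\<Sum>m\<le>d. \<Sum>i<n. (w i 0)\<^sup>2 * (c m * lam i ^ m))"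
    by (simp add: mpow_spectral[OF e sym n n] sum_distrib_left power2_eq_square algebra_simps)
  also have "\<dots> = (\<Sum>i<n. (w i 0)\<^sup>2 * psum c d (lam i))"
    by (subst sum.swap) (simp add: psum_def sum_distrib_left)
  finally show ?thesis .
qed

lemma spec_psum:
  assumes sym: "\<And>r c. A r c = A c r" and n: "n > 0"
  shows "spec n A (psum c d) = (\<Sum>m\<le>d. c m * mpow n A m 0 0)"
  unfolding spec_def by (rule sum_mpow_spectral[symmetric, OF eigensystem_eig]) (use assms in auto)

lemma spec_kern_psum:
  assumes sym: "\<And>r c. A r c = A c r" and n: "k < n" "l < n"
  shows "spec_kern n A (psum c d) (psum' c d) k l
    = (\<Sum>m\<le>d. c m * (\<Sum>j<m. mpow n A j 0 k * mpow n A (m - Suc j) l 0))"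
proof -
  have n0: "0 < n" using n by simp
  note e = eigensystem_eig[of A n, OF sym]
  define lam w where "lam = eig_vals n A" and "w = eig_vecs n A"
  note e = e[folded lam_def w_def]
  have "(\<Sum>m\<le>d. c m * (\<Sum>j<m. mpow n A j 0 k * mpow n A (m - Suc j) l 0))
    = (\<Sum>m\<le>d. \<Sum>j<m. \<Sum>i<n. \<Sum>i'<n. c m * (lam i ^ j * lam i' ^ (m - Suc j)) * (w i 0 * w i k) * (w i' 0 * w i' l))"
    unfolding mpow_spectral[OF e sym n0 n(1)] mpow_spectral[OF e sym n(2) n0] sum_product
    by (simp add: sum_distrib_left ac_simps)
  also have "\<dots> = (\<Sum>i<n. \<Sum>i'<n. \<Sum>m\<le>d. \<Sum>j<m. c m * (lam i ^ j * lam i' ^ (m - Suc j)) * (w i 0 * w i k) * (w i' 0 * w i' l))"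
    by (rule sum_pull_inner)
  also have "\<dots> = spec_kern n A (psum c d) (psum' c d) k l"
    unfolding spec_kern_def Let_def ddiff_psum lam_def[symmetric] w_def[symmetric]
    by (simp add: sum_distrib_left sum_distrib_right)
  finally show ?thesis ..
qed

text \<open>The product rule for a matrix power, with the differentiated factor in each position.\<close>

lemma mpow_has_derivative:
  assumes A: "\<And>r c. r < n \<Longrightarrow> c < n \<Longrightarrow> ((\<lambda>t. A t r c) has_real_derivative H r c) (at t)"
  shows "r < n \<Longrightarrow> c < n \<Longrightarrow> ((\<lambda>t. mpow n (A t) m r c) has_real_derivative
     (\<Sum>j<m. \<Sum>k<n. \<Sum>l<n. mpow n (A t) j r k * H k l * mpow n (A t) (m - Suc j) l c)) (at t)"
proof (induction m arbitrary: c)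
  case (Suc m)
  let ?D = "\<lambda>m c. \<Sum>j<m. \<Sum>k<n. \<Sum>l<n. mpow n (A t) j r k * H k l * mpow n (A t) (m - Suc j) l c"
  have "((\<lambda>t. \<Sum>k<n. mpow n (A t) m r k * A t k c) has_real_derivative
     (\<Sum>k<n. ?D m k * A t k c + H k c * mpow n (A t) m r k)) (at t)"
    by (intro derivative_eq_intros) (use Suc A in \<open>auto simp: algebra_simps\<close>)
  moreover have "(\<Sum>k<n. ?D m k * A t k c + H k c * mpow n (A t) m r k) = ?D (Suc m) c"
  proof -
    have 1: "(\<Sum>k<n. ?D m k * A t k c) = (\<Sum>j<m. \<Sum>k<n. \<Sum>l<n. mpow n (A t) j r k * H k l * mpow n (A t) (Suc m - Suc j) l c)"
    proof -
      have "(\<Sum>k<n. ?D m k * A t k c) = (\<Sum>k'<n. \<Sum>j<m. \<Sum>k<n. \<Sum>l<n. mpow n (A t) j r k * H k l * (mpow n (A t) (m - Suc j) l k' * A t k' c))"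
        by (simp add: sum_distrib_right mult.assoc)
      also have "\<dots> = (\<Sum>j<m. \<Sum>k<n. \<Sum>l<n. \<Sum>k'<n. mpow n (A t) j r k * H k l * (mpow n (A t) (m - Suc j) l k' * A t k' c))"
        by (subst sum.swap, rule sum.cong[OF refl], rule sum_pull_one)
      also have "\<dots> = (\<Sum>j<m. \<Sum>k<n. \<Sum>l<n. mpow n (A t) j r k * H k l * mpow n (A t) (Suc (m - Suc j)) l c)"
        by (simp add: sum_distrib_left)
      also have "\<dots> = (\<Sum>j<m. \<Sum>k<n. \<Sum>l<n. mpow n (A t) j r k * H k l * mpow n (A t) (Suc m - Suc j) l c)"
        by (rule sum.cong[OF refl]) (simp only: lessThan_iff Suc_diff_Suc diff_Suc_Suc)
      finally show ?thesis .
    qed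
    have 2: "(\<Sum>k<n. H k c * mpow n (A t) m r k) = (\<Sum>k<n. \<Sum>l<n. mpow n (A t) m r k * H k l * mpow n (A t) 0 l c)"
    proof (rule sum.cong[OF refl])
      fix k
      have "(\<Sum>l<n. mpow n (A t) m r k * H k l * mpow n (A t) 0 l c)
          = (\<Sum>l<n. if l = c then mpow n (A t) m r k * H k l else 0)"
        by (rule sum.cong[OF refl]) simp
      then show "H k c * mpow n (A t) m r k = (\<Sum>l<n. mpow n (A t) m r k * H k l * mpow n (A t) 0 l c)"
        using Suc.prems by simp
    qed
    show ?thesis unfolding sum.distrib 1 2 by (simp del: mpow.simps)
  qed
  ultimately show ?case by simp
qed simp

lemma spec_psum_has_derivative:
  assumes A: "\<And>r c. r < n \<Longrightarrow> c < n \<Longrightarrow> ((\<lambda>t. A t r c) has_real_derivative H r c) (at t)"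
    and sym: "\<And>t r c. A t r c = A t c r" and n: "n > 0"
  shows "((\<lambda>t. spec n (A t) (psum c d)) has_real_derivative
     (\<Sum>k<n. \<Sum>l<n. H k l * spec_kern n (A t) (psum c d) (psum' c d) k l)) (at t)"
proof -
  have "((\<lambda>t. \<Sum>m\<le>d. c m * mpow n (A t) m 0 0) has_real_derivative
    (\<Sum>m\<le>d. c m * (\<Sum>j<m. \<Sum>k<n. \<Sum>l<n. mpow n (A t) j 0 k * H k l * mpow n (A t) (m - Suc j) l 0))) (at t)"
    by (intro derivative_eq_intros refl) (use mpow_has_derivative[of n A H t 0 0, OF A n n] in \<open>auto simp: algebra_simps\<close>)
  also have "(\<Sum>m\<le>d. c m * (\<Sum>j<m. \<Sum>k<n. \<Sum>l<n. mpow n (A t) j 0 k * H k l * mpow n (A t) (m - Suc j) l 0))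
    = (\<Sum>k<n. \<Sum>l<n. H k l * (\<Sum>m\<le>d. c m * (\<Sum>j<m. mpow n (A t) j 0 k * mpow n (A t) (m - Suc j) l 0)))"
    (is "?L = ?R")
  proof -
    have "?L = (\<Sum>m\<le>d. \<Sum>j<m. \<Sum>k<n. \<Sum>l<n. H k l * (c m * (mpow n (A t) j 0 k * mpow n (A t) (m - Suc j) l 0)))"
      by (simp add: sum_distrib_left ac_simps)
    also have "\<dots> = (\<Sum>k<n. \<Sum>l<n. \<Sum>m\<le>d. \<Sum>j<m. H k l * (c m * (mpow n (A t) j 0 k * mpow n (A t) (m - Suc j) l 0)))"
      by (rule sum_pull_inner)
    finally show ?thesis by (simp add: sum_distrib_left)
  qed
  also have "?R = (\<Sum>k<n. \<Sum>l<n. H k l * spec_kern n (A t) (psum c d) (psum' c d) k l)"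
    using spec_kern_psum[of "A t", OF sym] by (intro sum.cong refl) auto
  finally show ?thesis using spec_psum[of "A t" n for t, OF sym n] by simp
qed

section \<open>The spectral functional on functions with a continuous derivative\<close>
text \<open>The mean value theorem.\<close>

lemma ddiff_bound:
  assumes der: "\<And>x. (g has_real_derivative g' x) (at x)"
    and b: "\<And>x. \<bar>x\<bar> \<le> R \<Longrightarrow> \<bar>g' x\<bar> \<le> e" and x: "\<bar>x\<bar> \<le> R" "\<bar>y\<bar> \<le> R"
  shows "\<bar>ddiff g g' x y\<bar> \<le> e"
proof -
  have *: "\<exists>z. \<bar>z\<bar> \<le> R \<and> (g u - g v) / (u - v) = g' z" if uv: "v < u" "\<bar>u\<bar> \<le> R" "\<bar>v\<bar> \<le> R" for u v
  proof -
    obtain z where z: "v < z" "z < u" "g u - g v = (u - v) * g' z"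
      using MVT2[OF uv(1), of g g'] der by blast
    then have "(g u - g v) / (u - v) = g' z" "\<bar>z\<bar> \<le> R" using uv by auto
    then show ?thesis by blast
  qed
  consider "x = y" | "x < y" | "y < x" by linarith
  then show ?thesis
  proof cases
    case 1
    then show ?thesis using b x by (simp add: ddiff_def)
  next
    case 2
    have "(g x - g y) / (x - y) = (g y - g x) / (y - x)" using 2 by (simp add: field_simps)
    moreover obtain z where "\<bar>z\<bar> \<le> R" "(g y - g x) / (y - x) = g' z" using *[of x y] 2 x by blast
    ultimately have "ddiff g g' x y = g' z" using 2 by (simp add: ddiff_def)
    then show ?thesis using b[OF \<open>\<bar>z\<bar> \<le> R\<close>] by (simp only:)
  next
    case 3
    then obtain z where "\<bar>z\<bar> \<le> R" "(g x - g y) / (x - y) = g' z" using *[of y x] x by blast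
    then have "ddiff g g' x y = g' z" using 3 by (simp add: ddiff_def)
    then show ?thesis using b[OF \<open>\<bar>z\<bar> \<le> R\<close>] by (simp only:)
  qed
qed

lemma ddiff_diff: "ddiff (\<lambda>x. f x - g x) (\<lambda>x. f' x - g' x) x y = ddiff f f' x y - ddiff g g' x y"
  by (simp add: ddiff_def diff_divide_distrib)

lemma eigensystem_weight_prod:
  assumes e: "eigensystem n A lam w" and n: "k < n" "l < n"
  shows "(\<Sum>i<n. \<bar>w i k * w i l\<bar>) \<le> 1"
proof -
  have "(\<Sum>i<n. \<bar>w i k * w i l\<bar>) \<le> (\<Sum>i<n. ((w i k)\<^sup>2 + (w i l)\<^sup>2) / 2)"
  proof (rule sum_mono)
    fix i
    show "\<bar>w i k * w i l\<bar> \<le> ((w i k)\<^sup>2 + (w i l)\<^sup>2) / 2"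
      using sum_squares_bound[of "\<bar>w i k\<bar>" "\<bar>w i l\<bar>"] by (simp add: abs_mult)
  qed
  also have "\<dots> = 1"
    using eigensystem_weights[OF e] n by (simp add: sum_divide_distrib[symmetric] sum.distrib)
  finally show ?thesis .
qed

lemma spec_kern_diff:
  "spec_kern n A (\<lambda>x. f x - g x) (\<lambda>x. f' x - g' x) k l = spec_kern n A f f' k l - spec_kern n A g g' k l"
  unfolding spec_kern_def Let_def ddiff_diff by (simp add: left_diff_distrib sum_subtractf)

lemma spec_diff: "spec n A (\<lambda>x. f x - g x) = spec n A f - spec n A g"
  by (simp add: spec_def right_diff_distrib sum_subtractf)

lemma spec_bound:
  assumes sym: "\<And>r c. A r c = A c r" and n: "n > 0" and R: "entry_sum n A \<le> R"
    and b: "\<And>x. \<bar>x\<bar> \<le> R \<Longrightarrow> \<bar>f x\<bar> \<le> e"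
  shows "\<bar>spec n A f\<bar> \<le> e"
proof -
  note eg = eigensystem_eig[of A n, OF sym]
  have "\<bar>spec n A f\<bar> \<le> (\<Sum>i<n. \<bar>(eig_vecs n A i 0)\<^sup>2 * f (eig_vals n A i)\<bar>)"
    unfolding spec_def by (rule sum_abs)
  also have "\<dots> \<le> (\<Sum>i<n. (eig_vecs n A i 0)\<^sup>2 * e)"
  proof (rule sum_mono)
    fix i assume "i \<in> {..<n}"
    then have "\<bar>f (eig_vals n A i)\<bar> \<le> e"
      using eigenvalue_bound[OF eg, of i] R by (intro b) auto
    then show "\<bar>(eig_vecs n A i 0)\<^sup>2 * f (eig_vals n A i)\<bar> \<le> (eig_vecs n A i 0)\<^sup>2 * e"
      by (simp add: abs_mult mult_left_mono)
  qed
  also have "\<dots> = e" using eigensystem_weights[OF eg n] by (simp add: sum_distrib_right[symmetric])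
  finally show ?thesis .
qed

text \<open>The mean value theorem bounds the divided differences by \<open>e\<close>, and the weights
  \<open>w\<^sub>i(1) w\<^sub>i(k)\<close> sum in absolute value to at most one by the Cauchy-Schwarz
  inequality.\<close>

lemma spec_kern_bound:
  assumes sym: "\<And>r c. A r c = A c r" and n: "k < n" "l < n" and R: "entry_sum n A \<le> R"
    and der: "\<And>x. (g has_real_derivative g' x) (at x)"
    and b: "\<And>x. \<bar>x\<bar> \<le> R \<Longrightarrow> \<bar>g' x\<bar> \<le> e"
  shows "\<bar>spec_kern n A g g' k l\<bar> \<le> e"
proof -
  note eg = eigensystem_eig[of A n, OF sym]
  define lam w where "lam = eig_vals n A" and "w = eig_vecs n A"
  note eg = eg[folded lam_def w_def]
  have n0: "0 < n" using n by simp
  have lamR: "\<bar>lam i\<bar> \<le> R" if "i < n" for i using eigenvalue_bound[OF eg that] R by simp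
  have e: "e \<ge> 0" using b[OF lamR[OF n0]] by linarith
  have "\<bar>spec_kern n A g g' k l\<bar> \<le> (\<Sum>i<n. \<Sum>j<n. \<bar>ddiff g g' (lam i) (lam j) * (w i 0 * w i k) * (w j 0 * w j l)\<bar>)"
    unfolding spec_kern_def Let_def lam_def[symmetric] w_def[symmetric]
    by (rule order_trans[OF sum_abs sum_mono[OF sum_abs]])
  also have "\<dots> \<le> (\<Sum>i<n. \<Sum>j<n. e * (\<bar>w i 0 * w i k\<bar> * \<bar>w j 0 * w j l\<bar>))"
  proof (intro sum_mono)
    fix i j assume "i \<in> {..<n}" "j \<in> {..<n}"
    then have "\<bar>ddiff g g' (lam i) (lam j)\<bar> \<le> e"
      by (intro ddiff_bound[OF der b lamR lamR]) auto
    then have "\<bar>ddiff g g' (lam i) (lam j)\<bar> * (\<bar>w i 0 * w i k\<bar> * \<bar>w j 0 * w j l\<bar>) \<le> e * (\<bar>w i 0 * w i k\<bar> * \<bar>w j 0 * w j l\<bar>)"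
      by (rule mult_right_mono) simp
    then show "\<bar>ddiff g g' (lam i) (lam j) * (w i 0 * w i k) * (w j 0 * w j l)\<bar> \<le> e * (\<bar>w i 0 * w i k\<bar> * \<bar>w j 0 * w j l\<bar>)"
      by (simp only: abs_mult mult.assoc)
  qed
  also have "\<dots> = e * ((\<Sum>i<n. \<bar>w i 0 * w i k\<bar>) * (\<Sum>j<n. \<bar>w j 0 * w j l\<bar>))"
    unfolding sum_product by (simp only: sum_distrib_left)
  also have "\<dots> \<le> e * (1 * 1)"
    using eigensystem_weight_prod[OF eg n0 n(1)] eigensystem_weight_prod[OF eg n0 n(2)]
    by (intro mult_left_mono mult_mono e) (auto intro!: sum_nonneg)
  finally show ?thesis by simp
qed

lemma weierstrass_psum:
  fixes f :: "real \<Rightarrow> real"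
  assumes "continuous_on UNIV f" "e > 0"
  shows "\<exists>c d. \<forall>x. \<bar>x\<bar> \<le> R \<longrightarrow> \<bar>f x - psum c d x\<bar> < e"
proof -
  have "continuous_on {-R..R} f" using assms(1) continuous_on_subset by blast
  then obtain g where g: "real_polynomial_function g" "\<And>x. x \<in> {-R..R} \<Longrightarrow> \<bar>f x - g x\<bar> < e"
    using Stone_Weierstrass_real_polynomial_function[of "{-R..R}" f e] assms(2) by auto
  then obtain c d where "g = (\<lambda>x. \<Sum>i\<le>d. c i * x ^ i)" unfolding real_polynomial_function_iff_sum by blast
  then show ?thesis using g(2) by (intro exI[of _ c] exI[of _ d]) (auto simp: psum_def abs_le_iff)
qed

lemma weierstrass_C1_psum:
  fixes f :: "real \<Rightarrow> real"
  assumes der: "\<And>x. (f has_real_derivative f' x) (at x)" and cont: "continuous_on UNIV f'"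
    and e: "e > 0"
  shows "\<exists>c d. psum c d 0 = f 0 \<and> (\<forall>x. \<bar>x\<bar> \<le> R \<longrightarrow> \<bar>f' x - psum' c d x\<bar> < e \<and> \<bar>f x - psum c d x\<bar> \<le> e * \<bar>x\<bar>)"
proof -
  obtain q D where q: "\<And>x. \<bar>x\<bar> \<le> R \<Longrightarrow> \<bar>f' x - psum q D x\<bar> < e"
    using weierstrass_psum[OF cont e, of R] by blast
  define c where "c m = (if m = 0 then f 0 else q (m - 1) / real m)" for m
  have d: "psum' c (Suc D) x = psum q D x" for x
    unfolding psum'_def psum_def sum.atMost_Suc_shift by (simp add: c_def del: of_nat_Suc)
  have 0: "psum c (Suc D) 0 = f 0"
    unfolding psum_def sum.atMost_Suc_shift by (simp add: c_def)
  have der': "((\<lambda>x. f x - psum c (Suc D) x) has_real_derivative f' x - psum' c (Suc D) x) (at x)" for x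
    by (intro derivative_intros der psum_deriv)
  have "\<bar>f x - psum c (Suc D) x\<bar> \<le> e * \<bar>x\<bar>" if x: "\<bar>x\<bar> \<le> R" for x
  proof -
    have "\<bar>ddiff (\<lambda>x. f x - psum c (Suc D) x) (\<lambda>x. f' x - psum' c (Suc D) x) x 0\<bar> \<le> e"
      by (rule ddiff_bound[OF der', of R]) (use x q d in \<open>auto intro: less_imp_le\<close>)
    then show ?thesis
      by (cases "x = 0") (auto simp: ddiff_def 0 abs_divide field_simps)
  qed
  then show ?thesis using q 0 by (intro exI[of _ c] exI[of _ "Suc D"]) (simp add: d)
qed

text \<open>Both sides agree on polynomials, where they are entries of matrix powers, and polynomials are
  dense in the continuous functions on a compact interval.\<close>

lemma spec_eq_eigensystem:
  assumes e: "eigensystem n A lam w" and sym: "\<And>r c. A r c = A c r" and n: "n > 0"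
    and cont: "continuous_on UNIV f"
  shows "spec n A f = (\<Sum>i<n. (w i 0)\<^sup>2 * f (lam i))"
proof -
  let ?R = "entry_sum n A"
  have "\<bar>spec n A f - (\<Sum>i<n. (w i 0)\<^sup>2 * f (lam i))\<bar> \<le> 2 * d" if d: "d > 0" for d
  proof -
    obtain c k where p: "\<And>x. \<bar>x\<bar> \<le> ?R \<Longrightarrow> \<bar>f x - psum c k x\<bar> < d"
      using weierstrass_psum[OF cont d] by blast
    have "\<bar>spec n A (\<lambda>x. f x - psum c k x)\<bar> \<le> d"
      by (rule spec_bound[OF sym n order_refl]) (use p less_imp_le in blast)
    then have 1: "\<bar>spec n A f - spec n A (psum c k)\<bar> \<le> d" unfolding spec_diff .
    have "\<bar>(\<Sum>i<n. (w i 0)\<^sup>2 * (psum c k (lam i) - f (lam i)))\<bar> \<le> (\<Sum>i<n. (w i 0)\<^sup>2 * d)"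
    proof (rule order_trans[OF sum_abs], rule sum_mono)
      fix i assume "i \<in> {..<n}"
      then have "\<bar>psum c k (lam i) - f (lam i)\<bar> \<le> d"
        using p[of "lam i"] eigenvalue_bound[OF e, of i] by (simp add: abs_minus_commute less_imp_le)
      then show "\<bar>(w i 0)\<^sup>2 * (psum c k (lam i) - f (lam i))\<bar> \<le> (w i 0)\<^sup>2 * d"
        by (simp add: abs_mult mult_left_mono)
    qed
    also have "\<dots> = d" using eigensystem_weights[OF e n] by (simp add: sum_distrib_right[symmetric])
    finally have "\<bar>(\<Sum>i<n. (w i 0)\<^sup>2 * psum c k (lam i)) - (\<Sum>i<n. (w i 0)\<^sup>2 * f (lam i))\<bar> \<le> d"
      by (simp add: right_diff_distrib sum_subtractf)
    moreover have "spec n A (psum c k) = (\<Sum>i<n. (w i 0)\<^sup>2 * psum c k (lam i))"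
      using spec_psum[OF sym n] sum_mpow_spectral[OF e sym n] by simp
    ultimately show ?thesis using 1 by linarith
  qed
  from this[of "\<bar>spec n A f - (\<Sum>i<n. (w i 0)\<^sup>2 * f (lam i))\<bar> / 4"]
  show ?thesis by (cases "spec n A f = (\<Sum>i<n. (w i 0)\<^sup>2 * f (lam i))") auto
qed

text \<open>The Parseval identity in both indices of the kernel.\<close>

lemma eigensystem_parseval:
  assumes e: "eigensystem n A lam w"
  shows "(\<Sum>k<n. (\<Sum>i<n. x i * w i k)\<^sup>2) = (\<Sum>i<n. (x i)\<^sup>2)"
proof -
  have "(\<Sum>k<n. (\<Sum>i<n. x i * w i k)\<^sup>2) = (\<Sum>k<n. \<Sum>i<n. \<Sum>j<n. x i * x j * (w i k * w j k))"
    by (simp add: power2_eq_square sum_product ac_simps)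
  also have "\<dots> = (\<Sum>i<n. \<Sum>j<n. x i * x j * (\<Sum>k<n. w i k * w j k))"
    unfolding sum_distrib_left by (rule sum_pull_one)
  also have "\<dots> = (\<Sum>i<n. \<Sum>j<n. if j = i then x i * x j else 0)"
    by (intro sum.cong refl) (simp add: eigensystem_rows[OF e])
  also have "\<dots> = (\<Sum>i<n. (x i)\<^sup>2)" by (simp add: power2_eq_square)
  finally show ?thesis .
qed

text \<open>All directions together: the squared gradient of \<open>spec\<close> is a double integral of
  squared divided differences against the spectral measure, with no factor depending on
  \<open>n\<close>.\<close>

lemma spec_kern_sum_squares:
  assumes sym: "\<And>r c. A r c = A c r"
  shows "(\<Sum>k<n. \<Sum>l<n. (spec_kern n A f f' k l)\<^sup>2)
     = (\<Sum>i<n. \<Sum>j<n. (ddiff f f' (eig_vals n A i) (eig_vals n A j))\<^sup>2 * (eig_vecs n A i 0)\<^sup>2 * (eig_vecs n A j 0)\<^sup>2)"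
proof -
  note e = eigensystem_eig[of A n, OF sym]
  define lam w where "lam = eig_vals n A" and "w = eig_vecs n A"
  note e = e[folded lam_def w_def]
  define C where "C i j = ddiff f f' (lam i) (lam j) * w i 0 * w j 0" for i j
  have "spec_kern n A f f' k l = (\<Sum>i<n. (\<Sum>j<n. C i j * w j l) * w i k)" for k l
    unfolding spec_kern_def Let_def lam_def[symmetric] w_def[symmetric] C_def sum_distrib_right
    by (intro sum.cong refl) (simp only: mult.assoc mult.commute mult.left_commute)
  then have "(\<Sum>k<n. \<Sum>l<n. (spec_kern n A f f' k l)\<^sup>2) = (\<Sum>l<n. \<Sum>k<n. (\<Sum>i<n. (\<Sum>j<n. C i j * w j l) * w i k)\<^sup>2)"
    by (simp only:) (rule sum.swap)
  also have "\<dots> = (\<Sum>l<n. \<Sum>i<n. (\<Sum>j<n. C i j * w j l)\<^sup>2)"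
    by (simp only: eigensystem_parseval[OF e])
  also have "\<dots> = (\<Sum>i<n. \<Sum>l<n. (\<Sum>j<n. C i j * w j l)\<^sup>2)" by (rule sum.swap)
  also have "\<dots> = (\<Sum>i<n. \<Sum>j<n. (C i j)\<^sup>2)" by (simp only: eigensystem_parseval[OF e])
  finally show ?thesis by (simp add: C_def power_mult_distrib lam_def w_def)
qed

text \<open>One sequence of polynomials that works on every compact interval, so that \<open>spec\<close> and
  \<open>spec_kern\<close> are limits of polynomials in the entries, whatever the matrix is.\<close>

lemma C1_psum_sequence:
  fixes f :: "real \<Rightarrow> real"
  assumes der: "\<And>x. (f has_real_derivative f' x) (at x)" and cont: "continuous_on UNIV f'"
  shows "\<exists>c d. \<forall>R. \<forall>e>0. \<forall>\<^sub>F N in sequentially. \<forall>x. \<bar>x\<bar> \<le> R \<longrightarrow>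
     \<bar>f' x - psum' (c N) (d N) x\<bar> \<le> e \<and> \<bar>f x - psum (c N) (d N) x\<bar> \<le> (e::real)"
proof -
  have "\<exists>c d. \<forall>x. \<bar>x\<bar> \<le> real N \<longrightarrow> \<bar>f' x - psum' c d x\<bar> < 1 / real (Suc N) \<and> \<bar>f x - psum c d x\<bar> \<le> 1 / real (Suc N) * \<bar>x\<bar>" for N
    using weierstrass_C1_psum[OF der cont, of "1 / real (Suc N)" "real N"] by auto
  then obtain c d where cd: "\<And>N x. \<bar>x\<bar> \<le> real N \<Longrightarrow> \<bar>f' x - psum' (c N) (d N) x\<bar> < 1 / real (Suc N) \<and> \<bar>f x - psum (c N) (d N) x\<bar> \<le> 1 / real (Suc N) * \<bar>x\<bar>"
    by metis
  show ?thesis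
  proof (intro exI allI impI)
    fix R e :: real assume e: "e > 0"
    have lim: "(\<lambda>N. 1 / real (Suc N) * (\<bar>R\<bar> + 1)) \<longlonglongrightarrow> 0 * (\<bar>R\<bar> + 1)"
      by (intro tendsto_mult tendsto_const LIMSEQ_Suc lim_1_over_n)
    then have "\<forall>\<^sub>F N in sequentially. 1 / real (Suc N) * (\<bar>R\<bar> + 1) < e"
      using e by (auto dest: order_tendstoD(2))
    moreover have "\<forall>\<^sub>F N in sequentially. real N \<ge> R"
      using eventually_ge_at_top[of "nat \<lceil>R\<rceil>"] by eventually_elim linarith
    ultimately show "\<forall>\<^sub>F N in sequentially. \<forall>x. \<bar>x\<bar> \<le> R \<longrightarrow>
       \<bar>f' x - psum' (c N) (d N) x\<bar> \<le> e \<and> \<bar>f x - psum (c N) (d N) x\<bar> \<le> e"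
    proof eventually_elim
      case (elim N)
      show ?case
      proof (intro allI impI)
        fix x assume x: "\<bar>x\<bar> \<le> R"
        have "1 / real (Suc N) * \<bar>x\<bar> \<le> 1 / real (Suc N) * (\<bar>R\<bar> + 1)" "1 / real (Suc N) * 1 \<le> 1 / real (Suc N) * (\<bar>R\<bar> + 1)"
          using x by (intro mult_left_mono; simp)+
        then show "\<bar>f' x - psum' (c N) (d N) x\<bar> \<le> e \<and> \<bar>f x - psum (c N) (d N) x\<bar> \<le> e"
          using cd[of x N] elim x by auto
      qed
    qed
  qed
qed

lemma entry_sum_affine:
  assumes "\<bar>s\<bar> \<le> B"
  shows "entry_sum n (\<lambda>r c. A0 r c + s * H r c) \<le> entry_sum n A0 + B * entry_sum n H"
proof -
  have "entry_sum n (\<lambda>r c. A0 r c + s * H r c) \<le> (\<Sum>r<n. \<Sum>c<n. \<bar>A0 r c\<bar> + B * \<bar>H r c\<bar>)"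
    unfolding entry_sum_def
  proof (intro sum_mono)
    fix r c
    have "\<bar>s\<bar> * \<bar>H r c\<bar> \<le> B * \<bar>H r c\<bar>" using assms by (rule mult_right_mono) simp
    then show "\<bar>A0 r c + s * H r c\<bar> \<le> \<bar>A0 r c\<bar> + B * \<bar>H r c\<bar>"
      using abs_triangle_ineq[of "A0 r c" "s * H r c"] by (simp add: abs_mult)
  qed
  then show ?thesis by (simp add: entry_sum_def sum.distrib sum_distrib_left)
qed

text \<open>The formula holds for polynomials.  For \<open>f\<close> with continuous derivative it follows by
  locally uniform convergence of the derivatives, without differentiating eigenvalues or eigenvectors, which may
  fail to be smooth.\<close>

lemma spec_has_derivative:
  fixes A0 H :: "nat \<Rightarrow> nat \<Rightarrow> real"
  defines "A \<equiv> \<lambda>t r c. A0 r c + t * H r c"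
  assumes sym: "\<And>r c. A0 r c = A0 c r" "\<And>r c. H r c = H c r" and n: "n > 0"
    and der: "\<And>x. (f has_real_derivative f' x) (at x)" and cont: "continuous_on UNIV f'"
  shows "((\<lambda>t. spec n (A t) f) has_real_derivative
     (\<Sum>k<n. \<Sum>l<n. H k l * spec_kern n (A t) f f' k l)) (at t)" (is "(_ has_real_derivative ?D t) _")
    and "continuous_on UNIV (\<lambda>t. \<Sum>k<n. \<Sum>l<n. H k l * spec_kern n (A t) f f' k l)"
proof -
  obtain c d where "\<forall>R. \<forall>e>0. \<forall>\<^sub>F N in sequentially. \<forall>x. \<bar>x\<bar> \<le> R \<longrightarrow>
     \<bar>f' x - psum' (c N) (d N) x\<bar> \<le> e \<and> \<bar>f x - psum (c N) (d N) x\<bar> \<le> (e::real)"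
    using C1_psum_sequence[OF der cont] by (elim exE)
  note cd = this[rule_format]
  have Asym: "A t r c = A t c r" for t r c unfolding A_def by (subst sym(1), subst sym(2)) (rule refl)
  let ?DN = "\<lambda>N t. \<Sum>k<n. \<Sum>l<n. H k l * spec_kern n (A t) (psum (c N) (d N)) (psum' (c N) (d N)) k l"
  have derN: "((\<lambda>t. spec n (A t) (psum (c N) (d N))) has_real_derivative ?DN N t) (at t)" for N t
  proof (rule spec_psum_has_derivative)
    show "((\<lambda>t. A t r c) has_real_derivative H r c) (at t)" for r c
      unfolding A_def by (auto intro!: derivative_eq_intros)
  qed (fact Asym n)+
  define E where "E = entry_sum n H"
  have E: "E \<ge> 0" by (auto simp: E_def entry_sum_def intro!: sum_nonneg)
  have unif: "\<forall>\<^sub>F N in sequentially. \<forall>t\<in>{-B..B}. \<bar>?DN N t - ?D t\<bar> \<le> e \<and> \<bar>spec n (A t) (psum (c N) (d N)) - spec n (A t) f\<bar> \<le> e"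
    if e: "e > 0" for e B
  proof -
    define e' where "e' = e / (E + 1)"
    have e': "e' > 0" "E * e' \<le> e" "e' \<le> e" using e E by (auto simp: e'_def field_simps)
    show ?thesis using cd[OF e'(1), of "entry_sum n A0 + B * entry_sum n H"]
    proof eventually_elim
      case (elim N)
      let ?p = "psum (c N) (d N)" and ?p' = "psum' (c N) (d N)"
      have dd: "((\<lambda>x. f x - ?p x) has_real_derivative f' x - ?p' x) (at x)" for x
        by (intro derivative_intros der psum_deriv)
      show ?case
      proof (intro ballI conjI)
        fix t assume t: "t \<in> {-B..B}"
        have R: "entry_sum n (A t) \<le> entry_sum n A0 + B * entry_sum n H"
          unfolding A_def by (rule entry_sum_affine) (use t in auto)
        have "\<bar>spec n (A t) (\<lambda>x. f x - ?p x)\<bar> \<le> e'"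
          by (rule spec_bound[OF Asym n R]) (use elim in auto)
        then show "\<bar>spec n (A t) ?p - spec n (A t) f\<bar> \<le> e" using e'(3) unfolding spec_diff by linarith
        have k: "\<bar>spec_kern n (A t) ?p ?p' k l - spec_kern n (A t) f f' k l\<bar> \<le> e'" if "k < n" "l < n" for k l
          using spec_kern_bound[OF Asym that R dd, of e'] elim unfolding spec_kern_diff
          by (simp add: abs_minus_commute)
        have "\<bar>?DN N t - ?D t\<bar> = \<bar>\<Sum>k<n. \<Sum>l<n. H k l * (spec_kern n (A t) ?p ?p' k l - spec_kern n (A t) f f' k l)\<bar>"
          by (simp add: right_diff_distrib sum_subtractf)
        also have "\<dots> \<le> (\<Sum>k<n. \<Sum>l<n. \<bar>H k l * (spec_kern n (A t) ?p ?p' k l - spec_kern n (A t) f f' k l)\<bar>)"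
          by (rule order_trans[OF sum_abs sum_mono[OF sum_abs]])
        also have "\<dots> \<le> (\<Sum>k<n. \<Sum>l<n. \<bar>H k l\<bar> * e')"
          by (intro sum_mono) (simp add: abs_mult k mult_left_mono)
        also have "\<dots> = E * e'" by (simp add: E_def entry_sum_def sum_distrib_right)
        finally show "\<bar>?DN N t - ?D t\<bar> \<le> e" using e'(2) by linarith
      qed
    qed
  qed
  have lim: "(\<lambda>N. spec n (A t) (psum (c N) (d N))) \<longlonglongrightarrow> spec n (A t) f" for t
  proof (rule LIMSEQ_I)
    fix e :: real assume "e > 0"
    then have "e / 2 > 0" by simp
    have "\<forall>\<^sub>F N in sequentially. norm (spec n (A t) (psum (c N) (d N)) - spec n (A t) f) < e"
    proof (rule eventually_mono[OF unif[OF \<open>e / 2 > 0\<close>, of "\<bar>t\<bar>"]])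
      fix N assume "\<forall>s\<in>{- \<bar>t\<bar>..\<bar>t\<bar>}. \<bar>?DN N s - ?D s\<bar> \<le> e / 2 \<and> \<bar>spec n (A s) (psum (c N) (d N)) - spec n (A s) f\<bar> \<le> e / 2"
      then have "\<bar>spec n (A t) (psum (c N) (d N)) - spec n (A t) f\<bar> \<le> e / 2" by (rule ballE[of _ _ t]) auto
      then show "norm (spec n (A t) (psum (c N) (d N)) - spec n (A t) f) < e" using \<open>e > 0\<close> by simp
    qed
    then show "\<exists>no. \<forall>N\<ge>no. norm (spec n (A t) (psum (c N) (d N)) - spec n (A t) f) < e"
      unfolding eventually_sequentially .
  qed
  show "((\<lambda>t. spec n (A t) f) has_real_derivative ?D t) (at t)"
  proof -
    let ?S = "{-(\<bar>t\<bar>+1)<..<\<bar>t\<bar>+1}"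
    have "\<exists>g. \<forall>x\<in>?S. (\<lambda>N. spec n (A x) (psum (c N) (d N))) \<longlonglongrightarrow> g x \<and> (g has_derivative (\<lambda>h. h * ?D x)) (at x within ?S)"
    proof (rule has_derivative_sequence)
      show "convex ?S" by (rule convex_real_interval)
      show "((\<lambda>t. spec n (A t) (psum (c N) (d N))) has_derivative (\<lambda>h. h * ?DN N x)) (at x within ?S)" for N x
        using derN[of N x] unfolding has_field_derivative_def
        by (simp add: mult.commute[of _ "?DN N x"] has_derivative_at_withinI)
      show "\<forall>\<^sub>F N in sequentially. \<forall>x\<in>?S. \<forall>h. norm (h * ?DN N x - h * ?D x) \<le> e * norm h" if e: "e > 0" for e
        using unif[OF e, of "\<bar>t\<bar>+1"]
      proof eventually_elim
        case (elim N)
        show "\<forall>x\<in>?S. \<forall>h. norm (h * ?DN N x - h * ?D x) \<le> e * norm h"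
        proof (intro ballI allI)
          fix x h :: real assume "x \<in> ?S"
          then have "\<bar>?DN N x - ?D x\<bar> \<le> e" using elim by auto
          then have "\<bar>h\<bar> * \<bar>?DN N x - ?D x\<bar> \<le> \<bar>h\<bar> * e" by (rule mult_left_mono) simp
          then show "norm (h * ?DN N x - h * ?D x) \<le> e * norm h"
            by (simp add: right_diff_distrib[symmetric] abs_mult mult.commute)
        qed
      qed
      show "t \<in> ?S" by auto
      show "(\<lambda>N. spec n (A t) (psum (c N) (d N))) \<longlonglongrightarrow> spec n (A t) f" by (rule lim)
    qed
    then obtain g where g: "\<And>x. x \<in> ?S \<Longrightarrow> (\<lambda>N. spec n (A x) (psum (c N) (d N))) \<longlonglongrightarrow> g x"
      "\<And>x. x \<in> ?S \<Longrightarrow> (g has_derivative (\<lambda>h. h * ?D x)) (at x within ?S)" by blast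
    have tS: "t \<in> ?S" by auto
    have geq: "g x = spec n (A x) f" if "x \<in> ?S" for x using LIMSEQ_unique[OF g(1)[OF that] lim] .
    have "(g has_derivative (\<lambda>h. h * ?D t)) (at t)"
      using g(2)[OF tS] at_within_open[OF tS] by simp
    then have "((\<lambda>x. spec n (A x) f) has_derivative (\<lambda>h. h * ?D t)) (at t)"
      by (rule has_derivative_transform_within_open[OF _ _ tS]) (auto simp: geq)
    then show ?thesis unfolding has_field_derivative_def by (simp add: mult.commute[of _ "?D t"])
  qed
  have contN: "continuous_on UNIV (?DN N)" for N
  proof -
    have "continuous_on UNIV (\<lambda>t. mpow n (A t) m r c)" for m r c
      by (induction m arbitrary: c) (auto simp: A_def intro!: continuous_intros)
    note mc = this
    have "?DN N t = (\<Sum>k<n. \<Sum>l<n. H k l * (\<Sum>m\<le>d N. c N m * (\<Sum>j<m. mpow n (A t) j 0 k * mpow n (A t) (m - Suc j) l 0)))" for t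
      by (intro sum.cong refl) (simp add: spec_kern_psum[of "A t", OF Asym])
    then have "?DN N = (\<lambda>t. \<Sum>k<n. \<Sum>l<n. H k l * (\<Sum>m\<le>d N. c N m * (\<Sum>j<m. mpow n (A t) j 0 k * mpow n (A t) (m - Suc j) l 0)))"
      by (rule ext)
    then show ?thesis by (simp only:) (intro continuous_intros mc)
  qed
  show "continuous_on UNIV ?D"
  proof (rule continuous_at_imp_continuous_on, intro ballI)
    fix t :: real
    let ?S = "{-(\<bar>t\<bar>+1)<..<\<bar>t\<bar>+1}"
    have "continuous_on ?S ?D"
    proof (rule uniform_limit_theorem)
      show "\<forall>\<^sub>F N in sequentially. continuous_on ?S (?DN N)"
        using contN continuous_on_subset by (intro always_eventually allI) blast
      show "uniform_limit ?S ?DN ?D sequentially"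
      proof (rule uniform_limitI)
        fix e :: real assume "e > 0"
        then have "e / 2 > 0" by simp
        show "\<forall>\<^sub>F N in sequentially. \<forall>x\<in>?S. dist (?DN N x) (?D x) < e"
        proof (rule eventually_mono[OF unif[OF \<open>e / 2 > 0\<close>, of "\<bar>t\<bar>+1"]])
          fix N assume N: "\<forall>s\<in>{- (\<bar>t\<bar> + 1)..\<bar>t\<bar> + 1}. \<bar>?DN N s - ?D s\<bar> \<le> e / 2 \<and> \<bar>spec n (A s) (psum (c N) (d N)) - spec n (A s) f\<bar> \<le> e / 2"
          show "\<forall>x\<in>?S. dist (?DN N x) (?D x) < e"
          proof
            fix x assume "x \<in> ?S"
            then have "\<bar>?DN N x - ?D x\<bar> \<le> e / 2" using N by auto
            then show "dist (?DN N x) (?D x) < e" using \<open>e > 0\<close> by (simp add: dist_real_def)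
          qed
        qed
      qed
    qed simp
    moreover have "t \<in> ?S" by auto
    ultimately show "isCont ?D t" by (simp add: continuous_on_eq_continuous_at)
  qed
qed

lemma spec_limit_psum:
  assumes sym: "\<And>r c. A r c = A c r" and n: "n > 0"
    and cd: "\<And>R e. e > 0 \<Longrightarrow> \<forall>\<^sub>F N in sequentially. \<forall>x. \<bar>x\<bar> \<le> R \<longrightarrow>
     \<bar>f' x - psum' (c N) (d N) x\<bar> \<le> e \<and> \<bar>f x - psum (c N) (d N) x\<bar> \<le> (e::real)"
  shows "(\<lambda>N. spec n A (psum (c N) (d N))) \<longlonglongrightarrow> spec n A f"
proof (rule tendstoI)
  fix e :: real assume "e > 0"
  then have e: "e / 2 > 0" by simp
  show "\<forall>\<^sub>F N in sequentially. dist (spec n A (psum (c N) (d N))) (spec n A f) < e"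
    using cd[OF e, of "entry_sum n A"]
  proof eventually_elim
    case (elim N)
    have "\<bar>spec n A (\<lambda>x. f x - psum (c N) (d N) x)\<bar> \<le> e / 2"
      by (rule spec_bound[OF sym n order_refl]) (use elim in auto)
    then have "\<bar>spec n A (psum (c N) (d N)) - spec n A f\<bar> \<le> e / 2"
      unfolding spec_diff by (simp only: abs_minus_commute)
    then show ?case using e by (simp add: dist_real_def)
  qed
qed

section \<open>A weighted Poincare inequality on the line\<close>
lemma pred_mem_rays [measurable (raw)]:
  fixes f g :: "'a \<Rightarrow> real"
  assumes [measurable]: "f \<in> borel_measurable M" "g \<in> borel_measurable M"
  shows "Measurable.pred M (\<lambda>x. f x \<in> {g x<..})" "Measurable.pred M (\<lambda>x. f x \<in> {..<g x})"
  unfolding greaterThan_iff lessThan_iff by measurable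

text \<open>Cauchy-Schwarz for \<open>h' = (h' / sqrt g') sqrt g'\<close>.\<close>

lemma weighted_increment_bound:
  fixes g g' h h' :: "real \<Rightarrow> real"
  assumes yx: "y < x"
    and g: "\<And>t. t \<in> {y..x} \<Longrightarrow> (g has_real_derivative g' t) (at t)"
    and h: "\<And>t. t \<in> {y..x} \<Longrightarrow> (h has_real_derivative h' t) (at t)"
    and cg: "continuous_on {y..x} g'" and ch: "continuous_on {y..x} h'"
    and pos: "\<And>t. t \<in> {y..x} \<Longrightarrow> g' t > 0"
  shows "ennreal ((h x - h y)\<^sup>2) \<le> ennreal (g x - g y) * (\<integral>\<^sup>+t. indicator {y<..<x} t * ennreal ((h' t)\<^sup>2 / g' t) \<partial>lborel)"
proof -
  have gx: "g y < g x"
  proof -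
    obtain z where "y < z" "z < x" "g x - g y = (x - y) * g' z"
      using MVT2[OF yx, of g g'] g by (metis atLeastAtMost_iff)
    moreover have "(x - y) * g' z > 0" using yx pos[of z] calculation(1,2) by (intro mult_pos_pos) auto
    ultimately show ?thesis by linarith
  qed
  have ig: "(g' has_integral g x - g y) {y..x}"
    by (rule fundamental_theorem_of_calculus)
      (use yx g in \<open>auto simp: has_real_derivative_iff_has_vector_derivative[symmetric] intro: has_field_derivative_at_within\<close>)
  have ih: "(h' has_integral h x - h y) {y..x}"
    by (rule fundamental_theorem_of_calculus)
      (use yx h in \<open>auto simp: has_real_derivative_iff_has_vector_derivative[symmetric] intro: has_field_derivative_at_within\<close>)
  have "continuous_on {y..x} (\<lambda>t. (h' t)\<^sup>2 / g' t)"
    by (intro continuous_intros cg ch) (use pos in force)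
  then have "(\<lambda>t. (h' t)\<^sup>2 / g' t) integrable_on {y..x}" by (rule integrable_continuous_real)
  then obtain J where J: "((\<lambda>t. (h' t)\<^sup>2 / g' t) has_integral J) {y..x}" by blast
  \<comment> \<open>The minimizer of the quadratic polynomial whose nonnegativity gives the inequality.\<close>
  define d where "d = (h x - h y) / (g x - g y)"
  have "((\<lambda>t. (h' t)\<^sup>2 / g' t - 2 * d * h' t + d\<^sup>2 * g' t) has_integral (J - 2 * d * (h x - h y) + d\<^sup>2 * (g x - g y))) {y..x}"
    by (intro has_integral_add has_integral_diff J has_integral_mult_right ig ih)
  moreover have "(h' t)\<^sup>2 / g' t - 2 * d * h' t + d\<^sup>2 * g' t \<ge> 0" if "t \<in> {y..x}" for t
  proof -
    have "(h' t)\<^sup>2 / g' t - 2 * d * h' t + d\<^sup>2 * g' t = (h' t - d * g' t)\<^sup>2 / g' t"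
      using pos[OF that] by (simp add: field_simps power2_eq_square)
    then show ?thesis using pos[OF that] by simp
  qed
  ultimately have "J - 2 * d * (h x - h y) + d\<^sup>2 * (g x - g y) \<ge> 0"
    by (rule has_integral_nonneg)
  moreover have "2 * d * (h x - h y) - d\<^sup>2 * (g x - g y) = (h x - h y)\<^sup>2 / (g x - g y)"
  proof -
    have div: "2 * (a / b) * a - (a / b)\<^sup>2 * b = a\<^sup>2 / b" if "b > 0" for a b :: real
      using that by (simp add: power2_eq_square)
    show ?thesis unfolding d_def by (rule div) (use gx in simp)
  qed
  ultimately have "(h x - h y)\<^sup>2 / (g x - g y) \<le> J" by linarith
  then have *: "(h x - h y)\<^sup>2 \<le> (g x - g y) * J" using gx by (simp add: field_simps)
  have "(\<integral>\<^sup>+t. indicator {y<..<x} t * ennreal ((h' t)\<^sup>2 / g' t) \<partial>lborel)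
      = (\<integral>\<^sup>+t. ennreal ((h' t)\<^sup>2 / g' t) * indicator {y..x} t \<partial>lborel)"
  proof (rule nn_integral_cong_AE)
    have "AE t in lborel. t \<noteq> y \<and> t \<noteq> x" using AE_lborel_singleton[of y] AE_lborel_singleton[of x] by eventually_elim auto
    then show "AE t in lborel. indicator {y<..<x} t * ennreal ((h' t)\<^sup>2 / g' t) = ennreal ((h' t)\<^sup>2 / g' t) * indicator {y..x} t"
      by eventually_elim (auto simp: indicator_def)
  qed
  also have "\<dots> = ennreal J"
    by (rule nn_integral_has_integral_lebesgue'[OF _ J]) (use pos in \<open>auto intro: divide_nonneg_pos\<close>)
  finally show ?thesis using * gx by (simp add: ennreal_mult'[symmetric] ennreal_leI)
qed

text \<open>For \<open>y < x\<close> the squared increment is at most \<open>(g x - g y)\<close> times the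
  integral of \<open>h'\<^sup>2 / g'\<close> over \<open>(y, x)\<close>.  Integrating over \<open>x\<close> and
  \<open>y\<close> and exchanging the order leaves, at each point \<open>t\<close> between them, the weight
  \<open>\<integral>\<integral> (g x - g y)\<close> over \<open>y < t < x\<close>, which is the tail integral of
  \<open>g - E g\<close> beyond \<open>t\<close>.  If this tail is \<open>c g' \<rho>\<close>, then
  \<open>g'\<close> cancels and the constant is \<open>c\<close>.  The choice \<open>g x = x\<close> suits the
  normal distribution and \<open>g x = x\<^sup>2\<close> the chi distribution.\<close>

lemma weighted_poincare:
  fixes \<rho> g g' h h' :: "real \<Rightarrow> real"
  assumes N_def: "N = density lborel (\<lambda>x. ennreal (\<rho> x))" and prob: "prob_space N"
    and [measurable]: "\<rho> \<in> borel_measurable borel" "g \<in> borel_measurable borel" "h' \<in> borel_measurable borel" "g' \<in> borel_measurable borel"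
    and rho: "\<And>x. \<rho> x \<ge> 0" "\<And>x. x \<notin> I \<Longrightarrow> \<rho> x = 0"
    and I: "\<And>x y. x \<in> I \<Longrightarrow> y \<in> I \<Longrightarrow> {y..x} \<subseteq> I"
    and g: "mono g" "\<And>t. t \<in> I \<Longrightarrow> (g has_real_derivative g' t) (at t)" "continuous_on I g'" "\<And>t. t \<in> I \<Longrightarrow> g' t > 0"
    and gi: "integrable N g"
    and tail: "\<And>t. t \<in> I \<Longrightarrow> (\<integral>x. indicator {t<..} x * (g x - (\<integral>z. g z \<partial>N)) \<partial>N) = c * g' t * \<rho> t"
    and h: "\<And>t. (h has_real_derivative h' t) (at t)" "continuous_on UNIV h'"
  shows "(\<integral>\<^sup>+x. \<integral>\<^sup>+y. ennreal ((h x - h y)\<^sup>2) \<partial>N \<partial>N) \<le> 2 * (\<integral>\<^sup>+t. ennreal (c * (h' t)\<^sup>2) \<partial>N)"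
proof -
  interpret N: prob_space N by fact
  interpret NN: pair_sigma_finite N N ..
  interpret NL: pair_sigma_finite lborel N ..
  have sN [measurable_cong, simp]: "sets N = sets borel" and spN [simp]: "space N = UNIV" by (simp_all add: N_def)
  have ch: "continuous_on UNIV h" using h(1) by (meson DERIV_isCont continuous_at_imp_continuous_on)
  then have [measurable]: "h \<in> borel_measurable borel" by (rule borel_measurable_continuous_onI)
  have AEI: "AE x in N. x \<in> I"
    unfolding N_def by (subst AE_density) (auto intro!: AE_I2, metis rho(2) less_irrefl)
  let ?q = "\<lambda>t. ennreal ((h' t)\<^sup>2 / g' t)"
  have cov: "(\<integral>\<^sup>+x. \<integral>\<^sup>+y. indicator {t<..} x * indicator {..<t} y * ennreal (g x - g y) \<partial>N \<partial>N) = ennreal (c * g' t * \<rho> t)"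
    if t: "t \<in> I" for t
  proof -
    define p :: real where "p = (\<integral>y. indicator {..<t} y \<partial>N)"
    define B where "B = (\<integral>y. indicator {..<t} y * g y \<partial>N)"
    define A where "A = (\<integral>y. indicator {t<..} y * g y \<partial>N)"
    have int: "integrable N (indicator {..<t} :: real \<Rightarrow> real)" "integrable N (indicator {t<..} :: real \<Rightarrow> real)"
      by (auto intro!: integrable_real_indicator simp: N.emeasure_eq_measure)
    have intg: "integrable N (\<lambda>y. indicator {..<t} y * g y)" "integrable N (\<lambda>y. indicator {t<..} y * g y)"
      by (auto intro!: integrable_real_mult_indicator gi simp: mult.commute[of _ "g _"])
    have AEt: "AE y in N. y \<noteq> t"
      unfolding N_def by (subst AE_density) (auto intro: AE_mp[OF AE_lborel_singleton[of t]])
    have sum1: "AE y in N. indicator {..<t} y + indicator {t<..} y = (1::real)"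
      using AEt by eventually_elim (auto simp: indicator_def)
    have pt: "(\<integral>y. indicator {t<..} y \<partial>N) = (1 - p :: real)"
    proof -
      have "(\<integral>y. indicator {..<t} y + indicator {t<..} y \<partial>N) = (\<integral>y. (1::real) \<partial>N)"
        using sum1 by (intro integral_cong_AE) auto
      then have "(\<integral>y. indicator {..<t} y \<partial>N) + (\<integral>y. indicator {t<..} y \<partial>N) = (1::real)"
        using N.prob_space by (subst (asm) Bochner_Integration.integral_add[OF int]) simp
      then show ?thesis unfolding p_def by linarith
    qed
    have AB: "A + B = (\<integral>z. g z \<partial>N)"
    proof -
      have "(\<integral>y. indicator {t<..} y * g y + indicator {..<t} y * g y \<partial>N) = (\<integral>y. g y \<partial>N)"
        using sum1 by (intro integral_cong_AE) (auto elim!: eventually_mono simp: ring_distribs[symmetric] add.commute)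
      then show ?thesis using intg by (simp add: A_def B_def)
    qed
    have inner: "(\<integral>\<^sup>+y. indicator {t<..} x * indicator {..<t} y * ennreal (g x - g y) \<partial>N) = ennreal (indicator {t<..} x * (g x * p - B))" for x
    proof (cases "x > t")
      case True
      have "(\<integral>\<^sup>+y. indicator {t<..} x * indicator {..<t} y * ennreal (g x - g y) \<partial>N)
          = (\<integral>\<^sup>+y. ennreal (g x * indicator {..<t} y - indicator {..<t} y * g y) \<partial>N)"
        using True by (intro nn_integral_cong) (auto simp: indicator_def)
      also have "\<dots> = ennreal (\<integral>y. g x * indicator {..<t} y - indicator {..<t} y * g y \<partial>N)"
      proof (rule nn_integral_eq_integral)
        show "integrable N (\<lambda>y. g x * indicator {..<t} y - indicator {..<t} y * g y)"
          by (intro Bochner_Integration.integrable_diff integrable_mult_right int intg)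
        show "AE y in N. 0 \<le> g x * indicator {..<t} y - indicator {..<t} y * g y"
        proof (rule AE_I2)
          fix y
          show "0 \<le> g x * indicator {..<t} y - indicator {..<t} y * g y"
            using monoD[OF g(1), of y x] True by (auto simp: indicator_def)
        qed
      qed
      also have "(\<integral>y. g x * indicator {..<t} y - indicator {..<t} y * g y \<partial>N) = g x * p - B"
        using int intg by (simp add: p_def B_def)
      finally show ?thesis using True by simp
    qed simp
    have eqA: "(\<integral>x. indicator {t<..} x * (g x * p - B) \<partial>N) = A * p - (1 - p) * B"
    proof -
      have "(\<integral>x. indicator {t<..} x * (g x * p - B) \<partial>N) = (\<integral>x. p * (indicator {t<..} x * g x) - B * indicator {t<..} x \<partial>N)"
        by (rule Bochner_Integration.integral_cong) (auto simp: algebra_simps)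
      also have "\<dots> = p * A - B * (1 - p)"
        unfolding pt[symmetric] A_def using int intg by (subst Bochner_Integration.integral_diff) auto
      finally show ?thesis by (simp add: mult.commute)
    qed
    have "(\<integral>\<^sup>+x. \<integral>\<^sup>+y. indicator {t<..} x * indicator {..<t} y * ennreal (g x - g y) \<partial>N \<partial>N)
        = (\<integral>\<^sup>+x. ennreal (indicator {t<..} x * (g x * p - B)) \<partial>N)" unfolding inner ..
    also have "\<dots> = ennreal (\<integral>x. indicator {t<..} x * (g x * p - B) \<partial>N)"
    proof (rule nn_integral_eq_integral)
      have "integrable N (\<lambda>x. p * (indicator {t<..} x * g x) - B * indicator {t<..} x)"
        by (intro Bochner_Integration.integrable_diff integrable_mult_right int intg)
      then show "integrable N (\<lambda>x. indicator {t<..} x * (g x * p - B))" by (simp add: algebra_simps)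
      show "AE x in N. 0 \<le> indicator {t<..} x * (g x * p - B)"
      proof (rule AE_I2)
        fix x
        show "0 \<le> indicator {t<..} x * (g x * p - B)"
        proof (cases "x > t")
          case True
          have "(\<integral>y. g x * indicator {..<t} y - indicator {..<t} y * g y \<partial>N) \<ge> 0"
            by (rule Bochner_Integration.integral_nonneg) (use monoD[OF g(1), of _ x] True in \<open>auto simp: indicator_def\<close>)
          then show ?thesis using int intg by (simp add: p_def B_def)
        qed simp
      qed
    qed
    also have "(\<integral>x. indicator {t<..} x * (g x * p - B) \<partial>N) = A - (1 - p) * (A + B)"
      unfolding eqA by (simp add: algebra_simps)
    also have "\<dots> = (\<integral>x. indicator {t<..} x * (g x - (\<integral>z. g z \<partial>N)) \<partial>N)"
    proof -
      have "(\<integral>x. indicator {t<..} x * (g x - (\<integral>z. g z \<partial>N)) \<partial>N) = (\<integral>x. indicator {t<..} x * g x - (\<integral>z. g z \<partial>N) * indicator {t<..} x \<partial>N)"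
        by (rule Bochner_Integration.integral_cong) (auto simp: algebra_simps)
      also have "\<dots> = A - (\<integral>z. g z \<partial>N) * (1 - p)"
        unfolding pt[symmetric] A_def using int intg by (subst Bochner_Integration.integral_diff) auto
      finally show ?thesis by (simp add: AB mult.commute)
    qed
    also have "\<dots> = c * g' t * \<rho> t" by (rule tail[OF t])
    finally show ?thesis .
  qed
  have "(\<integral>\<^sup>+x. \<integral>\<^sup>+y. ennreal ((h x - h y)\<^sup>2) \<partial>N \<partial>N)
      = (\<integral>\<^sup>+x. \<integral>\<^sup>+y. indicator {..<x} y * ennreal ((h x - h y)\<^sup>2) + indicator {x<..} y * ennreal ((h x - h y)\<^sup>2) \<partial>N \<partial>N)"
    by (intro nn_integral_cong) (auto simp: indicator_def not_less_iff_gr_or_eq)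
  also have "\<dots> = (\<integral>\<^sup>+x. \<integral>\<^sup>+y. indicator {..<x} y * ennreal ((h x - h y)\<^sup>2) \<partial>N \<partial>N) + (\<integral>\<^sup>+x. \<integral>\<^sup>+y. indicator {x<..} y * ennreal ((h x - h y)\<^sup>2) \<partial>N \<partial>N)"
    by (subst nn_integral_add[symmetric]) (auto intro!: nn_integral_cong nn_integral_add)
  also have "(\<integral>\<^sup>+x. \<integral>\<^sup>+y. indicator {x<..} y * ennreal ((h x - h y)\<^sup>2) \<partial>N \<partial>N) = (\<integral>\<^sup>+y. \<integral>\<^sup>+x. indicator {x<..} y * ennreal ((h x - h y)\<^sup>2) \<partial>N \<partial>N)"
    by (rule NN.Fubini') measurable
  also have "\<dots> = (\<integral>\<^sup>+x. \<integral>\<^sup>+y. indicator {..<x} y * ennreal ((h x - h y)\<^sup>2) \<partial>N \<partial>N)"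
    by (intro nn_integral_cong) (auto simp: indicator_def power2_commute)
  finally have sym: "(\<integral>\<^sup>+x. \<integral>\<^sup>+y. ennreal ((h x - h y)\<^sup>2) \<partial>N \<partial>N) = 2 * (\<integral>\<^sup>+x. \<integral>\<^sup>+y. indicator {..<x} y * ennreal ((h x - h y)\<^sup>2) \<partial>N \<partial>N)"
    by (simp add: mult_2)
  have ineq: "indicator {..<x} y * ennreal ((h x - h y)\<^sup>2)
     \<le> (\<integral>\<^sup>+t. indicator {t<..} x * indicator {..<t} y * ennreal (g x - g y) * ?q t \<partial>lborel)"
    if x: "x \<in> I" and y: "y \<in> I" for x y
  proof (cases "y < x")
    case True
    have sub: "{y..x} \<subseteq> I" by (rule I[OF x y])
    have "ennreal ((h x - h y)\<^sup>2) \<le> ennreal (g x - g y) * (\<integral>\<^sup>+t. indicator {y<..<x} t * ?q t \<partial>lborel)"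
      by (rule weighted_increment_bound[OF True])
        (use sub g h continuous_on_subset in \<open>auto intro: continuous_on_subset\<close>)
    also have "\<dots> = (\<integral>\<^sup>+t. ennreal (g x - g y) * (indicator {y<..<x} t * ?q t) \<partial>lborel)"
      by (rule nn_integral_cmult[symmetric]) measurable
    also have "\<dots> = (\<integral>\<^sup>+t. indicator {t<..} x * indicator {..<t} y * ennreal (g x - g y) * ?q t \<partial>lborel)"
      by (intro nn_integral_cong) (auto simp: indicator_def)
    finally show ?thesis using True by simp
  qed simp
  have "(\<integral>\<^sup>+x. \<integral>\<^sup>+y. indicator {..<x} y * ennreal ((h x - h y)\<^sup>2) \<partial>N \<partial>N)
     \<le> (\<integral>\<^sup>+x. \<integral>\<^sup>+y. \<integral>\<^sup>+t. indicator {t<..} x * indicator {..<t} y * ennreal (g x - g y) * ?q t \<partial>lborel \<partial>N \<partial>N)"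
  proof (rule nn_integral_mono_AE, use AEI in eventually_elim)
    fix x assume x: "x \<in> I"
    show "(\<integral>\<^sup>+y. indicator {..<x} y * ennreal ((h x - h y)\<^sup>2) \<partial>N)
     \<le> (\<integral>\<^sup>+y. \<integral>\<^sup>+t. indicator {t<..} x * indicator {..<t} y * ennreal (g x - g y) * ?q t \<partial>lborel \<partial>N)"
      by (rule nn_integral_mono_AE, use AEI in eventually_elim) (rule ineq[OF x])
  qed
  also have "\<dots> = (\<integral>\<^sup>+x. \<integral>\<^sup>+t. \<integral>\<^sup>+y. indicator {t<..} x * indicator {..<t} y * ennreal (g x - g y) * ?q t \<partial>N \<partial>lborel \<partial>N)"
    by (rule nn_integral_cong, rule NL.Fubini') measurable
  also have "\<dots> = (\<integral>\<^sup>+t. \<integral>\<^sup>+x. \<integral>\<^sup>+y. indicator {t<..} x * indicator {..<t} y * ennreal (g x - g y) * ?q t \<partial>N \<partial>N \<partial>lborel)"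
    by (rule NL.Fubini') measurable
  also have "\<dots> = (\<integral>\<^sup>+t. ennreal (\<rho> t) * ennreal (c * (h' t)\<^sup>2) \<partial>lborel)"
  proof (rule nn_integral_cong)
    fix t
    have pull: "(\<integral>\<^sup>+x. \<integral>\<^sup>+y. indicator {t<..} x * indicator {..<t} y * ennreal (g x - g y) * ?q t \<partial>N \<partial>N)
       = (\<integral>\<^sup>+x. \<integral>\<^sup>+y. indicator {t<..} x * indicator {..<t} y * ennreal (g x - g y) \<partial>N \<partial>N) * ?q t"
      by (subst nn_integral_multc[symmetric]; (intro nn_integral_cong nn_integral_multc)?; measurable?)
    show "(\<integral>\<^sup>+x. \<integral>\<^sup>+y. indicator {t<..} x * indicator {..<t} y * ennreal (g x - g y) * ?q t \<partial>N \<partial>N) = ennreal (\<rho> t) * ennreal (c * (h' t)\<^sup>2)"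
    proof (cases "t \<in> I")
      case True
      have "ennreal (c * g' t * \<rho> t) * ?q t = ennreal (c * g' t * \<rho> t * ((h' t)\<^sup>2 / g' t))"
        using g(4)[OF True] by (intro ennreal_mult''[symmetric]) auto
      also have "c * g' t * \<rho> t * ((h' t)\<^sup>2 / g' t) = \<rho> t * (c * (h' t)\<^sup>2)" using g(4)[OF True] by (simp add: field_simps)
      finally show ?thesis unfolding pull cov[OF True] using rho(1) by (simp add: ennreal_mult')
    next
      case False
      have "AE x in N. (\<integral>\<^sup>+y. indicator {t<..} x * indicator {..<t} y * ennreal (g x - g y) * ?q t \<partial>N) = 0"
        using AEI
      proof eventually_elim
        case (elim x)
        have "AE y in N. indicator {t<..} x * indicator {..<t} y * ennreal (g x - g y) * ?q t = 0"
          using AEI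
        proof eventually_elim
          case (elim y)
          have "t \<notin> {y..x}" using I[OF \<open>x \<in> I\<close> \<open>y \<in> I\<close>] False by blast
          then show ?case by (auto simp: indicator_def)
        qed
        then show ?case by (subst nn_integral_0_iff_AE) auto
      qed
      then have "(\<integral>\<^sup>+x. \<integral>\<^sup>+y. indicator {t<..} x * indicator {..<t} y * ennreal (g x - g y) * ?q t \<partial>N \<partial>N) = (\<integral>\<^sup>+x. 0 \<partial>N)"
        by (rule nn_integral_cong_AE)
      then show ?thesis using rho(2)[OF False] by simp
    qed
  qed
  also have "\<dots> = (\<integral>\<^sup>+t. ennreal (c * (h' t)\<^sup>2) \<partial>N)"
    unfolding N_def by (subst nn_integral_density) auto
  finally show ?thesis unfolding sym by (rule mult_left_mono) simp
qed

section \<open>The chi distribution\<close>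
definition chi_weight :: "real \<Rightarrow> real \<Rightarrow> real" where
  "chi_weight k x = x powr (k - 1) * exp (- x\<^sup>2 / 2)"

lemma chi_weight_nonneg [simp]: "0 \<le> chi_weight k x"
  by (simp add: chi_weight_def)

lemma borel_measurable_chi_weight [measurable]: "chi_weight k \<in> borel_measurable borel"
  unfolding chi_weight_def [abs_def] by measurable

lemma chi_weight_integrable:
  assumes k: "k > 0"
  shows "set_integrable lborel {0<..} (chi_weight k)"
  unfolding set_integrable_def real_scaleR_def
proof (rule Bochner_Integration.integrable_bound)
  have "integrable lborel (\<lambda>t. indicator {0..} t * t powr (k - 1) / exp t)"
    by (rule integrableI_nonneg) (auto simp: Gamma_conv_nn_integral_real[OF k, symmetric] intro!: AE_I2)
  then show "integrable lborel (\<lambda>t. exp (1 / 2) * (indicator {0..} t * t powr (k - 1) / exp t))"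
    by (rule integrable_mult_right)
  show "AE x in lborel. norm (indicator {0<..} x * chi_weight k x) \<le> norm (exp (1 / 2) * (indicator {0..} x * x powr (k - 1) / exp x))"
  proof (rule AE_I2)
    fix x :: real
    have "- x\<^sup>2 / 2 \<le> 1 / 2 - x" using zero_le_power2[of "x - 1"] by (simp add: power2_eq_square algebra_simps)
    then have "exp (- x\<^sup>2 / 2) \<le> exp (1 / 2 - x)" by simp
    then have "x powr (k - 1) * exp (- x\<^sup>2 / 2) \<le> x powr (k - 1) * exp (1 / 2 - x)"
      by (intro mult_left_mono) auto
    then show "norm (indicator {0<..} x * chi_weight k x) \<le> norm (exp (1 / 2) * (indicator {0..} x * x powr (k - 1) / exp x))"
      by (auto simp: indicator_def chi_weight_def exp_diff mult.commute)
  qed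
qed measurable

lemma chi_weight_integrable_bounded:
  fixes \<phi> :: "real \<Rightarrow> 'a::euclidean_space"
  assumes k: "k > 0" and [measurable]: "\<phi> \<in> borel_measurable borel"
    and b: "\<And>x. x > 0 \<Longrightarrow> norm (\<phi> x) \<le> C * (1 + x) ^ p"
  shows "set_integrable lborel {0<..} (\<lambda>x. chi_weight k x *\<^sub>R \<phi> x)"
  unfolding set_integrable_def
proof (rule Bochner_Integration.integrable_bound)
  show "integrable lborel (\<lambda>x. \<bar>C\<bar> * 2 ^ p * (indicator {0<..} x *\<^sub>R chi_weight k x + indicator {0<..} x *\<^sub>R chi_weight (k + real p) x))"
    using chi_weight_integrable[of k] chi_weight_integrable[of "k + real p"] k
    unfolding set_integrable_def by (intro integrable_mult_right Bochner_Integration.integrable_add) auto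
  show "AE x in lborel. norm (indicator {0<..} x *\<^sub>R chi_weight k x *\<^sub>R \<phi> x) \<le> norm (\<bar>C\<bar> * 2 ^ p * (indicator {0<..} x *\<^sub>R chi_weight k x + indicator {0<..} x *\<^sub>R chi_weight (k + real p) x))"
  proof (rule AE_I2)
    fix x :: real
    show "norm (indicator {0<..} x *\<^sub>R chi_weight k x *\<^sub>R \<phi> x) \<le> norm (\<bar>C\<bar> * 2 ^ p * (indicator {0<..} x *\<^sub>R chi_weight k x + indicator {0<..} x *\<^sub>R chi_weight (k + real p) x))"
    proof (cases "x > 0")
      case True
      have "(1 + x) ^ p \<le> (2 * max 1 x) ^ p" using True by (intro power_mono) auto
      also have "\<dots> = 2 ^ p * max 1 x ^ p" by (simp add: power_mult_distrib)
      also have "\<dots> \<le> 2 ^ p * (1 + x ^ p)"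
        using True by (intro mult_left_mono) (auto simp: max_def)
      finally have 1: "(1 + x) ^ p \<le> 2 ^ p * (1 + x ^ p)" .
      have w: "chi_weight (k + real p) x = chi_weight k x * x ^ p"
      proof -
        have "x powr (k + real p - 1) = x powr (k - 1) * x powr real p"
          unfolding powr_add[symmetric] by (rule arg_cong[where f = "\<lambda>q. x powr q"]) simp
        then show ?thesis using powr_realpow[OF True, of p] by (simp add: chi_weight_def)
      qed
      have "norm (\<phi> x) \<le> \<bar>C\<bar> * (1 + x) ^ p"
        by (rule order_trans[OF b[OF True] mult_right_mono]) (use True in auto)
      also have "\<dots> \<le> \<bar>C\<bar> * (2 ^ p * (1 + x ^ p))" using 1 by (intro mult_left_mono) auto
      finally have "chi_weight k x * norm (\<phi> x) \<le> chi_weight k x * (\<bar>C\<bar> * (2 ^ p * (1 + x ^ p)))"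
        by (intro mult_left_mono) auto
      then show ?thesis using True by (simp add: w algebra_simps abs_mult)
    qed simp
  qed
qed measurable

lemma chi_weight_vanishes_at_top:
  assumes k: "k > (0::real)"
  shows "((\<lambda>x. x powr k * exp (- x\<^sup>2 / 2) * (1 + x) ^ p) \<longlongrightarrow> 0) at_top"
  using k by real_asymp

text \<open>Integration of the derivative of \<open>- x\<^sup>k exp (- x\<^sup>2 / 2) \<phi>\<close>.\<close>

lemma chi_weight_by_parts:
  fixes \<phi> \<phi>' :: "real \<Rightarrow> 'a::euclidean_space"
  assumes k: "k > 0" and a: "a \<ge> 0"
    and der: "\<And>x. (\<phi> has_vector_derivative \<phi>' x) (at x)" and cont: "continuous_on UNIV \<phi>'"
    and b: "\<And>x. x > 0 \<Longrightarrow> norm (\<phi> x) \<le> C * (1 + x) ^ p"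
    and b': "\<And>x. x > 0 \<Longrightarrow> norm (\<phi>' x) \<le> C * (1 + x) ^ p"
  shows "(LBINT x:{a<..}. chi_weight k x *\<^sub>R ((x\<^sup>2 - k) *\<^sub>R \<phi> x - x *\<^sub>R \<phi>' x)) = (a powr k * exp (- a\<^sup>2 / 2)) *\<^sub>R \<phi> a"
proof -
  define F where "F x = - ((x powr k * exp (- x\<^sup>2 / 2)) *\<^sub>R \<phi> x)" for x
  define f where "f x = chi_weight k x *\<^sub>R ((x\<^sup>2 - k) *\<^sub>R \<phi> x - x *\<^sub>R \<phi>' x)" for x
  have contphi: "continuous_on UNIV \<phi>"
    by (rule continuous_at_imp_continuous_on) (intro ballI has_vector_derivative_continuous[OF der])
  have [measurable]: "\<phi> \<in> borel_measurable borel" "\<phi>' \<in> borel_measurable borel"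
    using contphi cont by (auto intro: borel_measurable_continuous_onI)
  have isc: "isCont \<phi> x" "isCont \<phi>' x" for x
    using contphi cont by (auto simp: continuous_on_eq_continuous_at)
  have C: "C \<ge> 0"
  proof (rule ccontr)
    assume "\<not> C \<ge> 0"
    then have "C * (1 + 1) ^ p < 0" by (intro mult_neg_pos) auto
    then show False using order_trans[OF norm_ge_zero b[of 1]] by simp
  qed
  have "(LBINT x=ereal a..\<infinity>. f x) = 0 - F a"
  proof (rule interval_integral_FTC_integrable)
    show "ereal a < \<infinity>" by simp
    show "(F has_vector_derivative f x) (at x)" if "ereal a < ereal x" for x
    proof -
      have x: "x > 0" using that a by simp
      have pk: "x powr k = x * x powr (k - 1)" using x by (simp add: powr_mult_base)
      have "((\<lambda>x. x powr k * exp (- x\<^sup>2 / 2)) has_real_derivative chi_weight k x * (k - x\<^sup>2)) (at x)"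
        using x by (auto intro!: derivative_eq_intros simp: chi_weight_def field_simps pk power2_eq_square)
      then have "((\<lambda>x. (x powr k * exp (- x\<^sup>2 / 2)) *\<^sub>R \<phi> x) has_vector_derivative
         (x powr k * exp (- x\<^sup>2 / 2)) *\<^sub>R \<phi>' x + (chi_weight k x * (k - x\<^sup>2)) *\<^sub>R \<phi> x) (at x)"
        by (rule has_vector_derivative_scaleR[OF _ der])
      then have "(F has_vector_derivative - ((x powr k * exp (- x\<^sup>2 / 2)) *\<^sub>R \<phi>' x + (chi_weight k x * (k - x\<^sup>2)) *\<^sub>R \<phi> x)) (at x)"
        unfolding F_def by (rule has_vector_derivative_minus)
      moreover have "- ((x powr k * exp (- x\<^sup>2 / 2)) *\<^sub>R \<phi>' x + (chi_weight k x * (k - x\<^sup>2)) *\<^sub>R \<phi> x) = f x"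
        by (simp add: f_def chi_weight_def pk algebra_simps)
      ultimately show ?thesis by simp
    qed
    show "isCont f x" if "ereal a < ereal x" for x
    proof -
      have x: "x > 0" using that a by simp
      show ?thesis unfolding f_def chi_weight_def by (intro continuous_intros isc) (use x in auto)
    qed
    show "set_integrable lborel (einterval (ereal a) \<infinity>) f"
    proof -
      have "norm ((x\<^sup>2 - k) *\<^sub>R \<phi> x - x *\<^sub>R \<phi>' x) \<le> (C * (2 + k)) * (1 + x) ^ (p + 2)" if x: "x > 0" for x
      proof -
        have "norm ((x\<^sup>2 - k) *\<^sub>R \<phi> x - x *\<^sub>R \<phi>' x) \<le> \<bar>x\<^sup>2 - k\<bar> * norm (\<phi> x) + \<bar>x\<bar> * norm (\<phi>' x)"
          by (rule order_trans[OF norm_triangle_ineq4]) simp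
        also have "\<dots> \<le> ((1 + k) * (1 + x)\<^sup>2) * (C * (1 + x) ^ p) + (1 + x)\<^sup>2 * (C * (1 + x) ^ p)"
        proof (intro add_mono mult_mono b b' x)
          have "\<bar>x\<^sup>2 - k\<bar> \<le> x\<^sup>2 + k" using k by (simp add: abs_le_iff)
          also have "\<dots> \<le> (1 + k) * (1 + x)\<^sup>2" using x k by (simp add: power2_eq_square algebra_simps)
          finally show "\<bar>x\<^sup>2 - k\<bar> \<le> (1 + k) * (1 + x)\<^sup>2" .
          show "\<bar>x\<bar> \<le> (1 + x)\<^sup>2" using x by (simp add: power2_eq_square algebra_simps)
        qed (use k x in auto)
        also have "\<dots> = (C * (2 + k)) * (1 + x) ^ (p + 2)"
        proof -
          have "((1 + k) * A) * (C * B) + A * (C * B) = (C * (2 + k)) * (B * A)" for A B :: real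
            by (simp add: algebra_simps)
          then show ?thesis by (simp only: power_add)
        qed
        finally show ?thesis .
      qed
      note bd = this
      have "set_integrable lborel {0<..} f" unfolding f_def
        by (rule chi_weight_integrable_bounded[OF k _ bd]) measurable
      then show ?thesis by (rule set_integrable_subset) (use a in \<open>auto simp: einterval_iff\<close>)
    qed
    have bnd: "norm (F x) \<le> C * (x powr k * exp (- x\<^sup>2 / 2) * (1 + x) ^ p)" if "x > 0" for x
      using mult_left_mono[OF b[OF that], of "x powr k * exp (- x\<^sup>2 / 2)"] by (simp add: F_def algebra_simps)
    show "((F \<circ> real_of_ereal) \<longlongrightarrow> F a) (at_right (ereal a))"
    proof -
      have "(F \<longlongrightarrow> F a) (at_right a)"
      proof (cases "a = 0")
        case True
        have "((\<lambda>x. C * (x powr k * exp (- x\<^sup>2 / 2) * (1 + x) ^ p)) \<longlongrightarrow> 0) (at_right 0)"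
          using k by real_asymp
        moreover have "\<forall>\<^sub>F x in at_right 0. norm (F x) \<le> C * (x powr k * exp (- x\<^sup>2 / 2) * (1 + x) ^ p)"
          by (rule eventually_at_rightI[of 0 1]) (rule bnd, simp_all)
        ultimately have "(F \<longlongrightarrow> 0) (at_right 0)" by (rule Lim_null_comparison[rotated])
        then show ?thesis using True by (simp add: F_def)
      next
        case False
        then have "isCont F a" unfolding F_def using a by (intro continuous_intros isc) auto
        then have "(F \<longlongrightarrow> F a) (at a)" by (simp add: isCont_def)
        then show ?thesis by (rule tendsto_within_subset) simp
      qed
      then show ?thesis unfolding ereal_tendsto_simps by (simp add: o_def)
    qed
    show "((F \<circ> real_of_ereal) \<longlongrightarrow> 0) (at_left \<infinity>)"
    proof -
      have "((\<lambda>x. C * (x powr k * exp (- x\<^sup>2 / 2) * (1 + x) ^ p)) \<longlongrightarrow> C * 0) at_top"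
        by (intro tendsto_mult tendsto_const chi_weight_vanishes_at_top k)
      then have "(F \<longlongrightarrow> 0) at_top"
      proof (rule Lim_null_comparison[rotated, OF tendsto_eq_rhs])
        show "\<forall>\<^sub>F x in at_top. norm (F x) \<le> C * (x powr k * exp (- x\<^sup>2 / 2) * (1 + x) ^ p)"
          using eventually_gt_at_top[of 0] by eventually_elim (rule bnd)
      qed simp
      then show ?thesis unfolding ereal_tendsto_simps by (simp add: o_def)
    qed
  qed
  then show ?thesis by (simp add: interval_integral_to_infinity_eq F_def f_def)
qed

definition chi_measure :: "real \<Rightarrow> real measure" where
  "chi_measure k = density lborel (\<lambda>x. ennreal (chi_density k x))"

lemma sets_chi_measure [simp, measurable_cong]: "sets (chi_measure k) = sets borel"
  and space_chi_measure [simp]: "space (chi_measure k) = UNIV"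
  by (simp_all add: chi_measure_def)

definition chi_norm :: "real \<Rightarrow> real" where
  "chi_norm k = 2 powr (k / 2 - 1) * Gamma (k / 2)"

lemma chi_norm_pos: "k > 0 \<Longrightarrow> chi_norm k > 0"
  by (simp add: chi_norm_def Gamma_real_pos)

lemma chi_density_weight: "chi_density k x = indicator {0<..} x * chi_weight k x / chi_norm k"
  by (simp add: chi_density_def chi_weight_def chi_norm_def)

lemma chi_density_nonneg: "k > 0 \<Longrightarrow> chi_density k x \<ge> 0"
  using chi_norm_pos[of k] by (simp add: chi_density_weight)

lemma borel_measurable_chi_density [measurable]: "chi_density k \<in> borel_measurable borel"
  unfolding chi_density_weight [abs_def] by measurable

lemma chi_measure_integrable_iff:
  fixes \<phi> :: "real \<Rightarrow> 'a::euclidean_space"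
  assumes k: "k > 0" and [measurable]: "\<phi> \<in> borel_measurable borel"
  shows "integrable (chi_measure k) \<phi> \<longleftrightarrow> set_integrable lborel {0<..} (\<lambda>x. chi_weight k x *\<^sub>R \<phi> x)"
proof -
  define \<theta> where "\<theta> x = indicator {0<..} x *\<^sub>R (chi_weight k x *\<^sub>R \<phi> x)" for x
  have "integrable (chi_measure k) \<phi> \<longleftrightarrow> integrable lborel (\<lambda>x. chi_density k x *\<^sub>R \<phi> x)"
    unfolding chi_measure_def by (rule integrable_density) (use chi_density_nonneg[OF k] in auto)
  also have "(\<lambda>x. chi_density k x *\<^sub>R \<phi> x) = (\<lambda>x. (1 / chi_norm k) *\<^sub>R \<theta> x)"
    by (rule ext) (simp add: \<theta>_def chi_density_weight divide_inverse ac_simps)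
  also have "integrable lborel (\<lambda>x. (1 / chi_norm k) *\<^sub>R \<theta> x) \<longleftrightarrow> integrable lborel \<theta>"
  proof
    assume "integrable lborel (\<lambda>x. (1 / chi_norm k) *\<^sub>R \<theta> x)"
    then have "integrable lborel (\<lambda>x. chi_norm k *\<^sub>R ((1 / chi_norm k) *\<^sub>R \<theta> x))" by (rule integrable_scaleR_right)
    then show "integrable lborel \<theta>" using chi_norm_pos[OF k] by simp
  qed (rule integrable_scaleR_right)
  finally show ?thesis unfolding set_integrable_def \<theta>_def .
qed

lemma chi_measure_integral:
  fixes \<phi> :: "real \<Rightarrow> 'a::euclidean_space"
  assumes k: "k > 0" and [measurable]: "\<phi> \<in> borel_measurable borel"
  shows "integral\<^sup>L (chi_measure k) \<phi> = (1 / chi_norm k) *\<^sub>R (LBINT x:{0<..}. chi_weight k x *\<^sub>R \<phi> x)"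
proof -
  define \<theta> where "\<theta> x = indicator {0<..} x *\<^sub>R (chi_weight k x *\<^sub>R \<phi> x)" for x
  have "integral\<^sup>L (chi_measure k) \<phi> = (\<integral>x. chi_density k x *\<^sub>R \<phi> x \<partial>lborel)"
    unfolding chi_measure_def by (rule integral_density) (use chi_density_nonneg[OF k] in auto)
  also have "(\<lambda>x. chi_density k x *\<^sub>R \<phi> x) = (\<lambda>x. (1 / chi_norm k) *\<^sub>R \<theta> x)"
    by (rule ext) (simp add: \<theta>_def chi_density_weight divide_inverse ac_simps)
  finally show ?thesis unfolding set_lebesgue_integral_def \<theta>_def[symmetric] by (simp only: integral_scaleR_right)
qed

lemma chi_measure_integrable:
  fixes \<phi> :: "real \<Rightarrow> 'a::euclidean_space"
  assumes "k > 0" "\<phi> \<in> borel_measurable borel" "\<And>x. x > 0 \<Longrightarrow> norm (\<phi> x) \<le> C * (1 + x) ^ p"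
  shows "integrable (chi_measure k) \<phi>"
  using assms by (subst chi_measure_integrable_iff) (auto intro: chi_weight_integrable_bounded)

text \<open>The Stein identity of the chi distribution.  It is stated for values in a Euclidean space so that
  it applies to complex exponentials.\<close>

lemma chi_measure_stein:
  fixes \<phi> \<phi>' :: "real \<Rightarrow> 'a::euclidean_space"
  assumes k: "k > 0"
    and der: "\<And>x. (\<phi> has_vector_derivative \<phi>' x) (at x)" and cont: "continuous_on UNIV \<phi>'"
    and b: "\<And>x. x > 0 \<Longrightarrow> norm (\<phi> x) \<le> C * (1 + x) ^ p"
    and b': "\<And>x. x > 0 \<Longrightarrow> norm (\<phi>' x) \<le> C * (1 + x) ^ p"
  shows "(\<integral>x. (x\<^sup>2 - k) *\<^sub>R \<phi> x - x *\<^sub>R \<phi>' x \<partial>chi_measure k) = 0"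
proof -
  have contphi: "continuous_on UNIV \<phi>"
    by (rule continuous_at_imp_continuous_on) (intro ballI has_vector_derivative_continuous[OF der])
  have [measurable]: "\<phi> \<in> borel_measurable borel" "\<phi>' \<in> borel_measurable borel"
    using contphi cont by (auto intro: borel_measurable_continuous_onI)
  show ?thesis
    by (subst chi_measure_integral[OF k], measurable)
      (subst chi_weight_by_parts[OF k order_refl der cont b b'], use k in auto)
qed

text \<open>The constant \<open>1 / 2\<close> is independent of \<open>k\<close>; this uniformity is what
  makes the variance bound independent of the row of the matrix.  It comes from \<open>x\<^sup>2\<close> as the
  weight: its tail integral is exactly \<open>t\<^sup>k exp (- t\<^sup>2 / 2)\<close> up to the
  normalization.\<close>

lemma chi_poincare:
  assumes k: "k > 0" and prob: "prob_space (chi_measure k)"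
    and h: "\<And>t. (h has_real_derivative h' t) (at t)" "continuous_on UNIV h'"
  shows "(\<integral>\<^sup>+x. \<integral>\<^sup>+y. ennreal ((h x - h y)\<^sup>2) \<partial>chi_measure k \<partial>chi_measure k) \<le> 2 * (\<integral>\<^sup>+t. ennreal (1 / 2 * (h' t)\<^sup>2) \<partial>chi_measure k)"
proof -
  interpret N: prob_space "chi_measure k" by fact
  have [measurable]: "h' \<in> borel_measurable borel" using h(2) by (rule borel_measurable_continuous_onI)
  \<comment> \<open>Truncated to be monotone on the whole line; the distribution lives on the positive half-line.\<close>
  let ?g = "\<lambda>x::real. (max 0 x)\<^sup>2"
  have g_eq: "AE x in chi_measure k. ?g x = x\<^sup>2"
    unfolding chi_measure_def by (subst AE_density) (auto intro!: AE_I2 simp: chi_density_def max_def)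
  have int2: "integrable (chi_measure k) (\<lambda>x. x\<^sup>2 :: real)"
    by (rule chi_measure_integrable[OF k, of _ 1 2]) (auto intro!: power_mono)
  have gi: "integrable (chi_measure k) ?g"
    by (rule Bochner_Integration.integrable_bound[OF int2]) (auto simp: max_def)
  have Eg: "(\<integral>x. ?g x \<partial>chi_measure k) = k"
  proof -
    have "(\<integral>x. (x\<^sup>2 - k) *\<^sub>R 1 - x *\<^sub>R 0 \<partial>chi_measure k) = (0::real)"
      by (rule chi_measure_stein[OF k, of _ _ 1 0]) auto
    then have "(\<integral>x. x\<^sup>2 \<partial>chi_measure k) = k" using int2 N.prob_space by simp
    moreover have "(\<integral>x. ?g x \<partial>chi_measure k) = (\<integral>x. x\<^sup>2 \<partial>chi_measure k)" using g_eq by (intro integral_cong_AE) auto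
    ultimately show ?thesis by simp
  qed
  show ?thesis
  proof (rule weighted_poincare[where g = ?g and g' = "\<lambda>t. 2 * t" and I = "{0<..}", OF chi_measure_def prob])
    show "(\<integral>x. indicator {t<..} x * (?g x - (\<integral>z. ?g z \<partial>chi_measure k)) \<partial>chi_measure k) = 1 / 2 * (2 * t) * chi_density k t"
      if t: "t \<in> {0<..}" for t :: real
    proof -
      have t0: "t > 0" using t by simp
      have "(\<integral>x. indicator {t<..} x * (?g x - k) \<partial>chi_measure k)
         = (1 / chi_norm k) * (LBINT x:{0<..}. chi_weight k x *\<^sub>R (indicator {t<..} x * (?g x - k)))"
        by (subst chi_measure_integral[OF k]) auto
      also have "(LBINT x:{0<..}. chi_weight k x *\<^sub>R (indicator {t<..} x * (?g x - k)))
         = (LBINT x:{t<..}. chi_weight k x *\<^sub>R ((x\<^sup>2 - k) *\<^sub>R 1 - x *\<^sub>R 0))"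
        unfolding set_lebesgue_integral_def
        by (rule Bochner_Integration.integral_cong) (use t0 in \<open>auto simp: indicator_def max_def\<close>)
      also have "\<dots> = (t powr k * exp (- t\<^sup>2 / 2)) *\<^sub>R (1::real)"
        by (rule chi_weight_by_parts[OF k, of _ _ _ 1 0]) (use t0 in auto)
      also have "(1 / chi_norm k) * ((t powr k * exp (- t\<^sup>2 / 2)) *\<^sub>R (1::real)) = 1 / 2 * (2 * t) * chi_density k t"
        using t0 by (simp add: chi_density_weight chi_weight_def powr_mult_base)
      finally show ?thesis unfolding Eg .
    qed
    show "mono ?g" by (intro monoI power_mono) auto
    show "(?g has_real_derivative 2 * t) (at t)" if "t \<in> {0<..}" for t :: real
    proof -
      have "((\<lambda>x. x\<^sup>2) has_real_derivative 2 * t) (at t)" by (auto intro!: derivative_eq_intros)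
      then show ?thesis
        by (rule has_field_derivative_transform_within_open[of _ _ _ "{0<..}"]) (use that in auto)
    qed
    show "{y..x} \<subseteq> {0<..}" if "x \<in> {0<..}" "y \<in> {0<..}" for x y :: real using that by auto
    show "chi_density k x = 0" if "x \<notin> {0<..}" for x using that by (simp add: chi_density_def)
  qed (use h gi chi_density_nonneg[OF k] in \<open>auto intro!: continuous_intros\<close>)
qed

section \<open>The Efron-Stein inequality\<close>
lemma (in prob_space) square_expectation_le:
  fixes f :: "'a \<Rightarrow> real"
  assumes [measurable]: "f \<in> borel_measurable M" and b: "\<And>x. \<bar>f x\<bar> \<le> B"
  shows "(expectation f)\<^sup>2 \<le> expectation (\<lambda>x. (f x)\<^sup>2)"
    and "integrable M f" and "integrable M (\<lambda>x. (f x)\<^sup>2)"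
proof -
  show i1: "integrable M f" by (rule integrable_const_bound[of _ B]) (use b in auto)
  show i2: "integrable M (\<lambda>x. (f x)\<^sup>2)"
  proof (rule integrable_const_bound[of _ "B\<^sup>2"])
    show "AE x in M. norm ((f x)\<^sup>2) \<le> B\<^sup>2"
      using power_mono[OF b abs_ge_zero, where n = 2] by simp
  qed simp
  show "(expectation f)\<^sup>2 \<le> expectation (\<lambda>x. (f x)\<^sup>2)"
    using variance_positive[of f] variance_eq[OF i1 i2] by simp
qed

text \<open>The expected squared difference of two independent copies is twice the variance.\<close>

lemma (in prob_space) nn_integral_square_differences:
  fixes f :: "'a \<Rightarrow> real"
  assumes [measurable]: "f \<in> borel_measurable M" and b: "\<And>x. \<bar>f x\<bar> \<le> B"
  shows "(\<integral>\<^sup>+s. \<integral>\<^sup>+t. ennreal ((f s - f t)\<^sup>2) \<partial>M \<partial>M) = ennreal (2 * (expectation (\<lambda>x. (f x)\<^sup>2) - (expectation f)\<^sup>2))"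
proof -
  note i = square_expectation_le(2,3)[OF assms]
  have inner: "(\<integral>\<^sup>+t. ennreal ((f s - f t)\<^sup>2) \<partial>M) = ennreal ((f s)\<^sup>2 - 2 * f s * expectation f + expectation (\<lambda>x. (f x)\<^sup>2))" for s
  proof -
    have "(\<integral>\<^sup>+t. ennreal ((f s - f t)\<^sup>2) \<partial>M) = (\<integral>\<^sup>+t. ennreal ((f s)\<^sup>2 - 2 * f s * f t + (f t)\<^sup>2) \<partial>M)"
      by (intro nn_integral_cong) (simp add: power2_eq_square algebra_simps)
    also have "\<dots> = ennreal (expectation (\<lambda>t. (f s)\<^sup>2 - 2 * f s * f t + (f t)\<^sup>2))"
    proof (rule nn_integral_eq_integral)
      show "AE t in M. 0 \<le> (f s)\<^sup>2 - 2 * f s * f t + (f t)\<^sup>2"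
        by (rule AE_I2) (use zero_le_power2[of "f s - f _"] in \<open>simp add: power2_eq_square algebra_simps\<close>)
    qed (intro Bochner_Integration.integrable_add Bochner_Integration.integrable_diff integrable_mult_right i integrable_const)
    also have "expectation (\<lambda>t. (f s)\<^sup>2 - 2 * f s * f t + (f t)\<^sup>2) = (f s)\<^sup>2 - 2 * f s * expectation f + expectation (\<lambda>x. (f x)\<^sup>2)"
      using i by (simp add: prob_space)
    finally show ?thesis .
  qed
  have "(\<integral>\<^sup>+s. \<integral>\<^sup>+t. ennreal ((f s - f t)\<^sup>2) \<partial>M \<partial>M) = (\<integral>\<^sup>+s. ennreal ((f s)\<^sup>2 - 2 * f s * expectation f + expectation (\<lambda>x. (f x)\<^sup>2)) \<partial>M)"
    unfolding inner ..
  also have "\<dots> = ennreal (expectation (\<lambda>s. (f s)\<^sup>2 - 2 * f s * expectation f + expectation (\<lambda>x. (f x)\<^sup>2)))"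
  proof (rule nn_integral_eq_integral)
    show "integrable M (\<lambda>s. (f s)\<^sup>2 - 2 * f s * expectation f + expectation (\<lambda>x. (f x)\<^sup>2))"
      using i by simp
    show "AE s in M. 0 \<le> (f s)\<^sup>2 - 2 * f s * expectation f + expectation (\<lambda>x. (f x)\<^sup>2)"
    proof (rule AE_I2)
      fix s
      have "(f s)\<^sup>2 - 2 * f s * expectation f + expectation (\<lambda>x. (f x)\<^sup>2) \<ge> (f s)\<^sup>2 - 2 * f s * expectation f + (expectation f)\<^sup>2"
        using square_expectation_le(1)[OF assms] by simp
      moreover have "(f s)\<^sup>2 - 2 * f s * expectation f + (expectation f)\<^sup>2 = (f s - expectation f)\<^sup>2"
        by (simp add: power2_eq_square algebra_simps)
      ultimately show "0 \<le> (f s)\<^sup>2 - 2 * f s * expectation f + expectation (\<lambda>x. (f x)\<^sup>2)"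
        by (metis order_trans zero_le_power2)
    qed
  qed
  also have "expectation (\<lambda>s. (f s)\<^sup>2 - 2 * f s * expectation f + expectation (\<lambda>x. (f x)\<^sup>2)) = 2 * (expectation (\<lambda>x. (f x)\<^sup>2) - (expectation f)\<^sup>2)"
    using i by (simp add: prob_space power2_eq_square)
  finally show ?thesis .
qed

text \<open>Twice the conditional variance of \<open>F\<close> in the coordinate \<open>i\<close> if
  \<open>F\<close> is square integrable there.  The form with two independent copies makes sense for every
  measurable \<open>F\<close>.\<close>

definition coord_energy :: "('i \<Rightarrow> 'b measure) \<Rightarrow> 'i \<Rightarrow> (('i \<Rightarrow> 'b) \<Rightarrow> real) \<Rightarrow> ('i \<Rightarrow> 'b) \<Rightarrow> ennreal" where
  "coord_energy N i F x = (\<integral>\<^sup>+s. \<integral>\<^sup>+t. ennreal ((F (x(i := s)) - F (x(i := t)))\<^sup>2) \<partial>N i \<partial>N i)"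

lemma measurable_PiM_upd:
  assumes "i \<in> I" "f \<in> measurable L (PiM I N)" "g \<in> measurable L (N i)"
  shows "(\<lambda>x. (f x)(i := g x)) \<in> measurable L (PiM I N)"
  by (rule measurable_fun_upd[OF _ assms(2,3)]) (use assms(1) in auto)

lemma measurable_PiM_upd_insert:
  assumes "f \<in> measurable L (PiM I N)" "g \<in> measurable L (N i)"
  shows "(\<lambda>x. (f x)(i := g x)) \<in> measurable L (PiM (insert i I) N)"
  by (rule measurable_fun_upd[OF _ assms]) auto

lemma measurable_coord_energy:
  assumes p: "prob_space (N i)" and i: "i \<in> I" and F: "F \<in> borel_measurable (PiM I N)"
  shows "coord_energy N i F \<in> borel_measurable (PiM I N)"
proof -
  interpret N: prob_space "N i" by fact
  note [measurable] = F measurable_PiM_upd[OF i]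
  show ?thesis unfolding coord_energy_def [abs_def] by measurable
qed

text \<open>Induction on the coordinates.  The variance splits into the mean conditional variance in the new
  coordinate and the variance of the conditional mean \<open>G\<close>; the energy of \<open>G\<close> in the
  old coordinates is at most the mean energy of \<open>F\<close> by the Jensen inequality.\<close>

theorem efron_stein_bounded:
  fixes N :: "'i \<Rightarrow> 'b measure" and F :: "('i \<Rightarrow> 'b) \<Rightarrow> real"
  assumes N: "\<And>i. prob_space (N i)" and I: "finite I"
    and F: "F \<in> borel_measurable (PiM I N)" and B: "\<And>x. \<bar>F x\<bar> \<le> B"
  shows "ennreal (2 * ((\<integral>x. (F x)\<^sup>2 \<partial>PiM I N) - (\<integral>x. F x \<partial>PiM I N)\<^sup>2)) \<le> (\<Sum>i\<in>I. \<integral>\<^sup>+x. coord_energy N i F x \<partial>PiM I N)"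
  using I F B
proof (induction I arbitrary: F rule: finite_induct)
  case empty
  interpret E: prob_space "PiM {} N" by (rule prob_space_PiM[OF N])
  have "(\<integral>x. f x \<partial>PiM {} N) = f (\<lambda>_. undefined)" for f :: "_ \<Rightarrow> real"
    by (simp add: PiM_empty lebesgue_integral_count_space_finite)
  then show ?case by simp
next
  case (insert j I)
  interpret product_sigma_finite N
    by (rule product_sigma_finite.intro) (rule prob_space_imp_sigma_finite[OF N])
  interpret PI: prob_space "PiM I N" by (rule prob_space_PiM[OF N])
  interpret PJ: prob_space "PiM (insert j I) N" by (rule prob_space_PiM[OF N])
  note Fm = \<open>F \<in> borel_measurable (PiM (insert j I) N)\<close>
  note [measurable] = Fm measurable_PiM_upd_insert
  note B = \<open>\<And>x. \<bar>F x\<bar> \<le> B\<close>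
  interpret Nj: prob_space "N j" by (rule N)
  define G where "G x = (\<integral>y. F (x(j := y)) \<partial>N j)" for x
  have Fj [measurable]: "(\<lambda>y. F (x(j := y))) \<in> borel_measurable (N j)" if "x \<in> space (PiM I N)" for x
    using measurable_compose[OF _ Fm, of "\<lambda>y. x(j := y)" "N j"] measurable_PiM_upd_insert[of "\<lambda>_. x" "N j" I N "\<lambda>y. y" j] that
    by simp
  have Gm [measurable]: "G \<in> borel_measurable (PiM I N)" unfolding G_def [abs_def] by measurable
  have B0: "B \<ge> 0" using B[of undefined] by linarith
  have GB: "\<bar>G x\<bar> \<le> B" for x
  proof (cases "integrable (N j) (\<lambda>y. F (x(j := y)))")
    case True
    have "\<bar>G x\<bar> \<le> (\<integral>y. \<bar>F (x(j := y))\<bar> \<partial>N j)" unfolding G_def by (rule integral_abs_bound)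
    also have "\<dots> \<le> (\<integral>y. B \<partial>N j)" using True B by (intro integral_mono) auto
    finally show ?thesis by (simp add: Nj.prob_space)
  qed (simp add: G_def not_integrable_integral_eq B0)
  note iF = PJ.square_expectation_le(2,3)[OF Fm B]
  note iG = PI.square_expectation_le(2,3)[OF Gm GB]
  have EF: "(\<integral>x. F x \<partial>PiM (insert j I) N) = (\<integral>x. G x \<partial>PiM I N)"
    unfolding G_def by (rule product_integral_insert[OF insert(1,2) iF(1)])
  define V where "V x = (\<integral>y. (F (x(j := y)))\<^sup>2 \<partial>N j) - (G x)\<^sup>2" for x
  have [measurable]: "(\<lambda>x. \<integral>y. (F (x(j := y)))\<^sup>2 \<partial>N j) \<in> borel_measurable (PiM I N)" by measurable
  have Vm [measurable]: "V \<in> borel_measurable (PiM I N)" unfolding V_def [abs_def] by measurable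
  have VE: "coord_energy N j F x = ennreal (2 * V x)" if "x \<in> space (PiM I N)" for x
    unfolding coord_energy_def V_def G_def by (rule Nj.nn_integral_square_differences[OF Fj[OF that] B])
  have V0: "V x \<ge> 0" if "x \<in> space (PiM I N)" for x
    using Nj.square_expectation_le(1)[OF Fj[OF that] B] by (simp add: V_def G_def)
  have EF2: "(\<integral>x. (F x)\<^sup>2 \<partial>PiM (insert j I) N) = (\<integral>x. \<integral>y. (F (x(j := y)))\<^sup>2 \<partial>N j \<partial>PiM I N)"
    by (rule product_integral_insert[OF insert(1,2) iF(2)])
  have iF2: "integrable (PiM I N) (\<lambda>x. \<integral>y. (F (x(j := y)))\<^sup>2 \<partial>N j)"
  proof (rule PI.integrable_const_bound[of _ "B\<^sup>2"])
    show "AE x in PiM I N. norm (\<integral>y. (F (x(j := y)))\<^sup>2 \<partial>N j) \<le> B\<^sup>2"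
    proof (rule AE_I2)
      fix x assume x: "x \<in> space (PiM I N)"
      have "(\<integral>y. (F (x(j := y)))\<^sup>2 \<partial>N j) \<le> (\<integral>y. B\<^sup>2 \<partial>N j)"
      proof (rule integral_mono)
        show "(F (x(j := y)))\<^sup>2 \<le> B\<^sup>2" for y using power_mono[OF B abs_ge_zero, where n = 2] by simp
      qed (use Nj.square_expectation_le(3)[OF Fj[OF x] B] in auto)
      then show "norm (\<integral>y. (F (x(j := y)))\<^sup>2 \<partial>N j) \<le> B\<^sup>2" by (simp add: Nj.prob_space)
    qed
  qed measurable
  have iV: "integrable (PiM I N) V" unfolding V_def using iF2 iG(2) by simp
  have E1: "(\<integral>x. (F x)\<^sup>2 \<partial>PiM (insert j I) N) = (\<integral>x. (G x)\<^sup>2 \<partial>PiM I N) + (\<integral>x. V x \<partial>PiM I N)"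
    unfolding EF2 V_def using iF2 iG(2) by simp
  have EV: "ennreal (2 * (\<integral>x. V x \<partial>PiM I N)) = (\<integral>\<^sup>+x. coord_energy N j F x \<partial>PiM (insert j I) N)"
  proof -
    have "(\<integral>\<^sup>+x. coord_energy N j F x \<partial>PiM (insert j I) N) = (\<integral>\<^sup>+x. \<integral>\<^sup>+y. coord_energy N j F (x(j := y)) \<partial>N j \<partial>PiM I N)"
      by (rule product_nn_integral_insert[OF insert(1,2)]) (rule measurable_coord_energy[OF N _ Fm], simp)
    also have "\<dots> = (\<integral>\<^sup>+x. coord_energy N j F x \<partial>PiM I N)"
      by (simp add: coord_energy_def Nj.emeasure_space_1)
    also have "\<dots> = (\<integral>\<^sup>+x. ennreal (2 * V x) \<partial>PiM I N)" by (intro nn_integral_cong VE)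
    also have "\<dots> = ennreal (\<integral>x. 2 * V x \<partial>PiM I N)"
      by (rule nn_integral_eq_integral) (use iV V0 in \<open>auto intro!: AE_I2\<close>)
    finally show ?thesis by simp
  qed
  have IH: "ennreal (2 * ((\<integral>x. (G x)\<^sup>2 \<partial>PiM I N) - (\<integral>x. G x \<partial>PiM I N)\<^sup>2)) \<le> (\<Sum>i\<in>I. \<integral>\<^sup>+x. coord_energy N i G x \<partial>PiM I N)"
    by (rule insert.IH[OF Gm GB])
  have EG: "(\<integral>\<^sup>+x. coord_energy N i G x \<partial>PiM I N) \<le> (\<integral>\<^sup>+x. coord_energy N i F x \<partial>PiM (insert j I) N)" if i: "i \<in> I" for i
  proof -
    interpret Ni: prob_space "N i" by (rule N)
    interpret NiNj: pair_sigma_finite "N i" "N j" ..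
    interpret NjNi: pair_sigma_finite "N j" "N i" ..
    have ij: "i \<noteq> j" using i insert(2) by auto
    note [measurable] = measurable_PiM_upd[OF i]
    have "coord_energy N i G x \<le> (\<integral>\<^sup>+y. coord_energy N i F (x(j := y)) \<partial>N j)" if x: "x \<in> space (PiM I N)" for x
    proof -
      have up: "x(i := s) \<in> space (PiM I N)" if "s \<in> space (N i)" for s
        using x that i by (auto simp: space_PiM PiE_iff extensional_def)
      have x_meas [measurable]: "(\<lambda>z. x) \<in> measurable L (PiM I N)" for L using x by simp
      have "coord_energy N i G x \<le> (\<integral>\<^sup>+s. \<integral>\<^sup>+t. \<integral>\<^sup>+y. ennreal ((F (x(i := s, j := y)) - F (x(i := t, j := y)))\<^sup>2) \<partial>N j \<partial>N i \<partial>N i)"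
        unfolding coord_energy_def
      proof (intro nn_integral_mono)
        fix s t assume st: "s \<in> space (N i)" "t \<in> space (N i)"
        note m = Fj[OF up[OF st(1)]] Fj[OF up[OF st(2)]]
        have bb: "\<bar>F (x(i := s, j := y)) - F (x(i := t, j := y))\<bar> \<le> 2 * B" for y
          using B[of "x(i := s, j := y)"] B[of "x(i := t, j := y)"] by linarith
        have "G (x(i := s)) - G (x(i := t)) = (\<integral>y. F (x(i := s, j := y)) - F (x(i := t, j := y)) \<partial>N j)"
          unfolding G_def
          using Nj.square_expectation_le(2)[OF m(1) B] Nj.square_expectation_le(2)[OF m(2) B] by simp
        then have "(G (x(i := s)) - G (x(i := t)))\<^sup>2 \<le> (\<integral>y. (F (x(i := s, j := y)) - F (x(i := t, j := y)))\<^sup>2 \<partial>N j)"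
          using Nj.square_expectation_le(1)[OF borel_measurable_diff[OF m] bb] by simp
        also have "ennreal \<dots> = (\<integral>\<^sup>+y. ennreal ((F (x(i := s, j := y)) - F (x(i := t, j := y)))\<^sup>2) \<partial>N j)"
          using Nj.square_expectation_le(3)[OF borel_measurable_diff[OF m] bb] by (intro nn_integral_eq_integral[symmetric]) auto
        finally show "ennreal ((G (x(i := s)) - G (x(i := t)))\<^sup>2) \<le> (\<integral>\<^sup>+y. ennreal ((F (x(i := s, j := y)) - F (x(i := t, j := y)))\<^sup>2) \<partial>N j)"
          by (simp add: ennreal_leI)
      qed
      also have "\<dots> = (\<integral>\<^sup>+s. \<integral>\<^sup>+y. \<integral>\<^sup>+t. ennreal ((F (x(i := s, j := y)) - F (x(i := t, j := y)))\<^sup>2) \<partial>N i \<partial>N j \<partial>N i)"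
      proof (rule nn_integral_cong)
        fix s assume s [measurable]: "s \<in> space (N i)"
        show "(\<integral>\<^sup>+t. \<integral>\<^sup>+y. ennreal ((F (x(i := s, j := y)) - F (x(i := t, j := y)))\<^sup>2) \<partial>N j \<partial>N i)
          = (\<integral>\<^sup>+y. \<integral>\<^sup>+t. ennreal ((F (x(i := s, j := y)) - F (x(i := t, j := y)))\<^sup>2) \<partial>N i \<partial>N j)"
          by (rule NjNi.Fubini') measurable
      qed
      also have "\<dots> = (\<integral>\<^sup>+y. \<integral>\<^sup>+s. \<integral>\<^sup>+t. ennreal ((F (x(i := s, j := y)) - F (x(i := t, j := y)))\<^sup>2) \<partial>N i \<partial>N i \<partial>N j)"
        by (rule NjNi.Fubini') measurable
      also have "\<dots> = (\<integral>\<^sup>+y. coord_energy N i F (x(j := y)) \<partial>N j)"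
        unfolding coord_energy_def by (simp add: fun_upd_twist[OF ij])
      finally show ?thesis .
    qed
    then have "(\<integral>\<^sup>+x. coord_energy N i G x \<partial>PiM I N) \<le> (\<integral>\<^sup>+x. \<integral>\<^sup>+y. coord_energy N i F (x(j := y)) \<partial>N j \<partial>PiM I N)"
      by (intro nn_integral_mono)
    also have "\<dots> = (\<integral>\<^sup>+x. coord_energy N i F x \<partial>PiM (insert j I) N)"
      by (rule product_nn_integral_insert[OF insert(1,2), symmetric]) (rule measurable_coord_energy[OF N _ Fm], use i in simp)
    finally show ?thesis .
  qed
  have split: "2 * ((\<integral>x. (F x)\<^sup>2 \<partial>PiM (insert j I) N) - (\<integral>x. F x \<partial>PiM (insert j I) N)\<^sup>2)
     = 2 * (\<integral>x. V x \<partial>PiM I N) + 2 * ((\<integral>x. (G x)\<^sup>2 \<partial>PiM I N) - (\<integral>x. G x \<partial>PiM I N)\<^sup>2)"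
    unfolding E1 EF by simp
  have "ennreal (2 * ((\<integral>x. (F x)\<^sup>2 \<partial>PiM (insert j I) N) - (\<integral>x. F x \<partial>PiM (insert j I) N)\<^sup>2))
     = ennreal (2 * (\<integral>x. V x \<partial>PiM I N)) + ennreal (2 * ((\<integral>x. (G x)\<^sup>2 \<partial>PiM I N) - (\<integral>x. G x \<partial>PiM I N)\<^sup>2))"
    unfolding split using PI.square_expectation_le(1)[OF Gm GB] V0
    by (intro ennreal_plus) (auto intro!: Bochner_Integration.integral_nonneg_AE AE_I2)
  also have "\<dots> \<le> (\<integral>\<^sup>+x. coord_energy N j F x \<partial>PiM (insert j I) N) + (\<Sum>i\<in>I. \<integral>\<^sup>+x. coord_energy N i F x \<partial>PiM (insert j I) N)"
    unfolding EV by (intro add_left_mono order_trans[OF IH] sum_mono EG)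
  finally show ?case using insert(1,2) by simp
qed

text \<open>Truncation is a contraction, so that it does not increase the energies.\<close>

theorem efron_stein:
  fixes N :: "'i \<Rightarrow> 'b measure" and F :: "('i \<Rightarrow> 'b) \<Rightarrow> real"
  assumes N: "\<And>i. prob_space (N i)" and I: "finite I"
    and F [measurable]: "F \<in> borel_measurable (PiM I N)" and F2: "integrable (PiM I N) (\<lambda>x. (F x)\<^sup>2)"
  shows "ennreal (2 * ((\<integral>x. (F x)\<^sup>2 \<partial>PiM I N) - (\<integral>x. F x \<partial>PiM I N)\<^sup>2)) \<le> (\<Sum>i\<in>I. \<integral>\<^sup>+x. coord_energy N i F x \<partial>PiM I N)"
proof -
  interpret P: prob_space "PiM I N" by (rule prob_space_PiM[OF N])
  define T where "T R x = max (- real R) (min (real R) (F x))" for R :: nat and x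
  have Tm [measurable]: "T R \<in> borel_measurable (PiM I N)" for R unfolding T_def [abs_def] by measurable
  have iF: "integrable (PiM I N) F" by (rule P.square_integrable_imp_integrable[OF F F2])
  have Tabs: "\<bar>T R x\<bar> \<le> \<bar>F x\<bar>" for R x unfolding T_def by auto
  have lim: "(\<lambda>R. T R x) \<longlonglongrightarrow> F x" for x
  proof (rule tendsto_eventually)
    show "\<forall>\<^sub>F R in sequentially. T R x = F x"
      using eventually_ge_at_top[of "nat \<lceil>\<bar>F x\<bar>\<rceil>"]
    proof eventually_elim
      case (elim R)
      then have "\<bar>F x\<bar> \<le> real R" by linarith
      then show ?case unfolding T_def by auto
    qed
  qed
  have l1: "(\<lambda>R. \<integral>x. T R x \<partial>PiM I N) \<longlonglongrightarrow> (\<integral>x. F x \<partial>PiM I N)"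
    by (rule integral_dominated_convergence[where w = "\<lambda>x. \<bar>F x\<bar>"]) (use iF lim Tabs in auto)
  have l2: "(\<lambda>R. \<integral>x. (T R x)\<^sup>2 \<partial>PiM I N) \<longlonglongrightarrow> (\<integral>x. (F x)\<^sup>2 \<partial>PiM I N)"
  proof (rule integral_dominated_convergence[where w = "\<lambda>x. (F x)\<^sup>2"])
    show "AE x in PiM I N. (\<lambda>R. (T R x)\<^sup>2) \<longlonglongrightarrow> (F x)\<^sup>2" by (intro AE_I2 tendsto_power lim)
    show "AE x in PiM I N. norm ((T R x)\<^sup>2) \<le> (F x)\<^sup>2" for R
      using power_mono[OF Tabs abs_ge_zero, where n = 2] by simp
  qed (use F2 in auto)
  have "(\<lambda>R. ennreal (2 * ((\<integral>x. (T R x)\<^sup>2 \<partial>PiM I N) - (\<integral>x. T R x \<partial>PiM I N)\<^sup>2)))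
    \<longlonglongrightarrow> ennreal (2 * ((\<integral>x. (F x)\<^sup>2 \<partial>PiM I N) - (\<integral>x. F x \<partial>PiM I N)\<^sup>2))"
    by (intro tendsto_ennrealI tendsto_intros l1 l2)
  then show ?thesis
  proof (rule LIMSEQ_le_const2, intro exI allI impI)
    fix R :: nat
    have "ennreal (2 * ((\<integral>x. (T R x)\<^sup>2 \<partial>PiM I N) - (\<integral>x. T R x \<partial>PiM I N)\<^sup>2)) \<le> (\<Sum>i\<in>I. \<integral>\<^sup>+x. coord_energy N i (T R) x \<partial>PiM I N)"
      by (rule efron_stein_bounded[OF N I Tm, of _ "real R"]) (auto simp: T_def)
    also have "\<dots> \<le> (\<Sum>i\<in>I. \<integral>\<^sup>+x. coord_energy N i F x \<partial>PiM I N)"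
    proof (intro sum_mono nn_integral_mono, unfold coord_energy_def, intro nn_integral_mono ennreal_leI)
      fix x y :: "'i \<Rightarrow> 'b"
      have "\<bar>T R x - T R y\<bar> \<le> \<bar>F x - F y\<bar>" for x y unfolding T_def by (auto simp: max_def min_def)
      then show "(T R (x(i := s)) - T R (x(i := t)))\<^sup>2 \<le> (F (x(i := s)) - F (x(i := t)))\<^sup>2" for i s t
        by (simp add: abs_le_square_iff)
    qed
    finally show "ennreal (2 * ((\<integral>x. (T R x)\<^sup>2 \<partial>PiM I N) - (\<integral>x. T R x \<partial>PiM I N)\<^sup>2)) \<le> (\<Sum>i\<in>I. \<integral>\<^sup>+x. coord_energy N i F x \<partial>PiM I N)" .
  qed
qed

text \<open>Replacing a coordinate by an independent copy does not change the distribution.\<close>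

lemma nn_integral_PiM_resample:
  assumes N: "\<And>i. prob_space (N i)" and I: "finite I" and i: "i \<in> I"
    and D: "D \<in> borel_measurable (PiM I N)"
  shows "(\<integral>\<^sup>+x. \<integral>\<^sup>+s. D (x(i := s)) \<partial>N i \<partial>PiM I N) = (\<integral>\<^sup>+x. D x \<partial>PiM I N)"
proof -
  interpret product_sigma_finite N
    by (rule product_sigma_finite.intro) (rule prob_space_imp_sigma_finite[OF N])
  interpret Ni: prob_space "N i" by (rule N)
  note [measurable] = D measurable_PiM_upd[OF i]
  define J where "J = I - {i}"
  have J: "finite J" "i \<notin> J" "insert i J = I" using I i by (auto simp: J_def)
  note ins = product_nn_integral_insert[OF J(1,2), unfolded J(3)]
  have "(\<integral>\<^sup>+x. \<integral>\<^sup>+s. D (x(i := s)) \<partial>N i \<partial>PiM I N) = (\<integral>\<^sup>+x. \<integral>\<^sup>+y. \<integral>\<^sup>+s. D (x(i := y, i := s)) \<partial>N i \<partial>N i \<partial>PiM J N)"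
    by (rule ins) measurable
  also have "\<dots> = (\<integral>\<^sup>+x. \<integral>\<^sup>+s. D (x(i := s)) \<partial>N i \<partial>PiM J N)"
    by (simp add: Ni.emeasure_space_1)
  also have "\<dots> = (\<integral>\<^sup>+x. D x \<partial>PiM I N)" by (rule ins[symmetric]) (rule D)
  finally show ?thesis .
qed

text \<open>One-dimensional Poincare inequalities tensorize: Efron-Stein applied to the joint law of
  independent variables.\<close>

theorem (in prob_space) poincare_independent:
  fixes X :: "'i \<Rightarrow> 'a \<Rightarrow> real" and F :: "('i \<Rightarrow> real) \<Rightarrow> real" and D :: "'i \<Rightarrow> ('i \<Rightarrow> real) \<Rightarrow> real"
  assumes I: "finite I" "I \<noteq> {}" and ind: "indep_vars (\<lambda>_. borel) X I"
    and F [measurable]: "F \<in> borel_measurable (PiM I (\<lambda>_. borel))"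
    and D: "\<And>i. i \<in> I \<Longrightarrow> D i \<in> borel_measurable (PiM I (\<lambda>_. borel))"
    and F2: "integrable M (\<lambda>\<omega>. (F (\<lambda>i\<in>I. X i \<omega>))\<^sup>2)"
    and coord: "\<And>i x. i \<in> I \<Longrightarrow> (\<integral>\<^sup>+s. \<integral>\<^sup>+t. ennreal ((F (x(i := s)) - F (x(i := t)))\<^sup>2) \<partial>distr M borel (X i) \<partial>distr M borel (X i))
        \<le> 2 * (\<integral>\<^sup>+s. ennreal (D i (x(i := s))) \<partial>distr M borel (X i))"
  shows "ennreal (variance (\<lambda>\<omega>. F (\<lambda>i\<in>I. X i \<omega>))) \<le> (\<Sum>i\<in>I. \<integral>\<^sup>+\<omega>. ennreal (D i (\<lambda>i\<in>I. X i \<omega>)) \<partial>M)"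
proof -
  have rv [measurable]: "random_variable borel (X i)" if "i \<in> I" for i
    using ind that by (auto simp: indep_vars_def)
  define N where "N i = (if i \<in> I then distr M borel (X i) else return borel 0)" for i
  have N: "prob_space (N i)" for i
    unfolding N_def by (auto intro!: prob_space_distr rv prob_space_return)
  have Xm [measurable]: "(\<lambda>\<omega>. \<lambda>i\<in>I. X i \<omega>) \<in> measurable M (PiM I (\<lambda>_. borel))"
    by (rule measurable_restrict) (rule rv)
  have PN: "distr M (PiM I (\<lambda>_. borel)) (\<lambda>\<omega>. \<lambda>i\<in>I. X i \<omega>) = PiM I N"
  proof -
    have "distr M (PiM I (\<lambda>_. borel)) (\<lambda>\<omega>. \<lambda>i\<in>I. X i \<omega>) = PiM I (\<lambda>i. distr M borel (X i))"
      using ind indep_vars_iff_distr_eq_PiM'[OF I(2), of X "\<lambda>_. borel"] rv by blast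
    also have "\<dots> = PiM I N" by (rule PiM_cong) (simp_all add: N_def)
    finally show ?thesis .
  qed
  have sN [measurable_cong]: "sets (PiM I N) = sets (PiM I (\<lambda>_. borel))"
    by (rule sets_PiM_cong) (simp_all add: N_def)
  have DN: "(\<lambda>x. ennreal (D i x)) \<in> borel_measurable (PiM I N)" if "i \<in> I" for i
    using D[OF that] by measurable
  have i2: "integrable (PiM I N) (\<lambda>x. (F x)\<^sup>2)" unfolding PN[symmetric]
    by (subst integrable_distr_eq) (use F2 in auto)
  have iF: "integrable M (\<lambda>\<omega>. F (\<lambda>i\<in>I. X i \<omega>))" by (rule square_integrable_imp_integrable[OF _ F2]) measurable
  define V where "V = variance (\<lambda>\<omega>. F (\<lambda>i\<in>I. X i \<omega>))"
  have V: "V = (\<integral>x. (F x)\<^sup>2 \<partial>PiM I N) - (\<integral>x. F x \<partial>PiM I N)\<^sup>2"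
    unfolding V_def PN[symmetric] variance_eq[OF iF F2] by (simp add: integral_distr)
  have "V \<ge> 0" unfolding V_def by (rule variance_positive)
  then have "2 * ennreal V = ennreal (2 * V)" by (simp add: ennreal_mult)
  also have "ennreal (2 * V) \<le> (\<Sum>i\<in>I. \<integral>\<^sup>+x. coord_energy N i F x \<partial>PiM I N)" unfolding V
    by (rule efron_stein[OF N I(1) _ i2]) measurable
  also have "\<dots> \<le> (\<Sum>i\<in>I. 2 * (\<integral>\<^sup>+x. ennreal (D i x) \<partial>PiM I N))"
  proof (rule sum_mono)
    fix i assume i: "i \<in> I"
    note [measurable] = DN[OF i] measurable_PiM_upd[OF i]
    interpret Ni: prob_space "N i" by (rule N)
    have "(\<integral>\<^sup>+x. coord_energy N i F x \<partial>PiM I N) \<le> (\<integral>\<^sup>+x. 2 * (\<integral>\<^sup>+s. ennreal (D i (x(i := s))) \<partial>N i) \<partial>PiM I N)"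
      unfolding coord_energy_def by (intro nn_integral_mono) (use coord[OF i] i in \<open>simp add: N_def\<close>)
    also have "\<dots> = 2 * (\<integral>\<^sup>+x. \<integral>\<^sup>+s. ennreal (D i (x(i := s))) \<partial>N i \<partial>PiM I N)"
      by (rule nn_integral_cmult) measurable
    also have "\<dots> = 2 * (\<integral>\<^sup>+x. ennreal (D i x) \<partial>PiM I N)"
      by (subst nn_integral_PiM_resample[OF N I(1) i DN[OF i]]) simp
    finally show "(\<integral>\<^sup>+x. coord_energy N i F x \<partial>PiM I N) \<le> 2 * (\<integral>\<^sup>+x. ennreal (D i x) \<partial>PiM I N)" .
  qed
  also have "\<dots> = 2 * (\<Sum>i\<in>I. \<integral>\<^sup>+\<omega>. ennreal (D i (\<lambda>i\<in>I. X i \<omega>)) \<partial>M)"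
    unfolding PN[symmetric] sum_distrib_left
    by (intro sum.cong refl) (use D in \<open>auto simp: nn_integral_distr\<close>)
  finally have "V \<le> (\<Sum>i\<in>I. \<integral>\<^sup>+\<omega>. ennreal (D i (\<lambda>i\<in>I. X i \<omega>)) \<partial>M)"
    by (subst (asm) ennreal_mult_le_mult_iff) auto
  then show ?thesis unfolding V_def .
qed

section \<open>Centred normal distributions\<close>
definition gauss_measure :: "real \<Rightarrow> real measure" where
  "gauss_measure \<sigma> = density lborel (\<lambda>x. ennreal (normal_density 0 \<sigma> x))"

lemma sets_gauss_measure [simp, measurable_cong]: "sets (gauss_measure \<sigma>) = sets borel"
  and space_gauss_measure [simp]: "space (gauss_measure \<sigma>) = UNIV"
  by (simp_all add: gauss_measure_def)

lemma prob_space_gauss_measure: "\<sigma> > 0 \<Longrightarrow> prob_space (gauss_measure \<sigma>)"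
  unfolding gauss_measure_def by (rule prob_space_normal_density)

lemma gauss_measure_integral:
  fixes f :: "real \<Rightarrow> real"
  assumes [measurable]: "f \<in> borel_measurable borel"
  shows "(\<integral>z. f z \<partial>gauss_measure \<sigma>) = (\<integral>z. normal_density 0 \<sigma> z * f z \<partial>lborel)"
  unfolding gauss_measure_def by (subst integral_density) auto

lemma gauss_measure_integrable:
  fixes f :: "real \<Rightarrow> real"
  assumes [measurable]: "f \<in> borel_measurable borel"
  shows "integrable (gauss_measure \<sigma>) f \<longleftrightarrow> integrable lborel (\<lambda>z. normal_density 0 \<sigma> z * f z)"
  unfolding gauss_measure_def by (subst integrable_density) auto

text \<open>The density is a primitive of \<open>- x / \<sigma>\<^sup>2\<close> times itself; this is the tail
  integral that the weighted Poincare inequality asks for.\<close>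

lemma normal_density_tail_moment:
  assumes s: "\<sigma> > 0"
  shows "(LBINT x:{t<..}. normal_density 0 \<sigma> x * x) = \<sigma>\<^sup>2 * normal_density 0 \<sigma> t"
proof -
  define c where "c = 1 / sqrt (2 * pi * \<sigma>\<^sup>2)"
  define d where "d = 1 / (2 * \<sigma>\<^sup>2)"
  have d: "d > 0" and sd: "\<sigma>\<^sup>2 * (2 * d) = 1" using s by (simp_all add: d_def)
  have nd: "normal_density 0 \<sigma> = (\<lambda>x. c * exp (- (d * x\<^sup>2)))"
    by (rule ext) (simp add: normal_density_def c_def d_def)
  let ?F = "\<lambda>x. - (\<sigma>\<^sup>2 * (c * exp (- (d * x\<^sup>2))))"
  have "(LBINT x=ereal t..\<infinity>. c * exp (- (d * x\<^sup>2)) * x) = 0 - ?F t"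
  proof (rule interval_integral_FTC_integrable)
    show "(?F has_vector_derivative c * exp (- (d * x\<^sup>2)) * x) (at x)" for x
    proof -
      have "((\<lambda>x. - (d * x\<^sup>2)) has_real_derivative - (d * (2 * x))) (at x)"
        by (auto intro!: derivative_eq_intros)
      then have "((\<lambda>x. exp (- (d * x\<^sup>2))) has_real_derivative exp (- (d * x\<^sup>2)) * (- (d * (2 * x)))) (at x)"
        by (rule DERIV_fun_exp)
      then have "(?F has_real_derivative - (\<sigma>\<^sup>2 * (c * (exp (- (d * x\<^sup>2)) * (- (d * (2 * x))))))) (at x)"
        by (intro DERIV_minus DERIV_cmult)
      moreover have "- (\<sigma>\<^sup>2 * (c * (e * (- (d * (2 * x)))))) = (\<sigma>\<^sup>2 * (2 * d)) * (c * e * x)" for e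
        by (simp only: mult_minus_right minus_minus ac_simps)
      ultimately show ?thesis
        unfolding has_real_derivative_iff_has_vector_derivative[symmetric] by (simp only: sd mult_1)
    qed
    show "isCont (\<lambda>x. c * exp (- (d * x\<^sup>2)) * x) x" for x by (intro continuous_intros)
    have "integrable lborel (\<lambda>x. c * exp (- (d * x\<^sup>2)) * x)"
      using integrable_normal_moment_nz_1[OF s, of 0] unfolding nd .
    then show "set_integrable lborel (einterval (ereal t) \<infinity>) (\<lambda>x. c * exp (- (d * x\<^sup>2)) * x)"
      unfolding set_integrable_def by (intro integrable_mult_indicator) auto
    have "isCont ?F t" by (intro continuous_intros)
    then have "(?F \<longlongrightarrow> ?F t) (at t)" by (simp add: isCont_def)
    then have "(?F \<longlongrightarrow> ?F t) (at_right t)" by (rule tendsto_within_subset) simp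
    then show "((?F \<circ> real_of_ereal) \<longlongrightarrow> ?F t) (at_right (ereal t))"
      unfolding ereal_tendsto_simps by (simp add: o_def)
    have "((\<lambda>x. exp (- (d * x\<^sup>2))) \<longlongrightarrow> 0) at_top" using d by real_asymp
    then have "(?F \<longlongrightarrow> - (\<sigma>\<^sup>2 * (c * 0))) at_top" by (intro tendsto_intros)
    then have "(?F \<longlongrightarrow> 0) at_top" by simp
    then show "((?F \<circ> real_of_ereal) \<longlongrightarrow> 0) (at_left \<infinity>)"
      unfolding ereal_tendsto_simps by (simp add: o_def)
  qed auto
  then show ?thesis by (simp add: interval_integral_to_infinity_eq nd)
qed

lemma gauss_poincare:
  assumes s: "\<sigma> > 0"
    and h: "\<And>t. (h has_real_derivative h' t) (at t)" "continuous_on UNIV h'"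
  shows "(\<integral>\<^sup>+x. \<integral>\<^sup>+y. ennreal ((h x - h y)\<^sup>2) \<partial>gauss_measure \<sigma> \<partial>gauss_measure \<sigma>) \<le> 2 * (\<integral>\<^sup>+t. ennreal (\<sigma>\<^sup>2 * (h' t)\<^sup>2) \<partial>gauss_measure \<sigma>)"
proof -
  note m = normal_moment_nz_1[OF s, of 0]
  have Eg: "(\<integral>z. z \<partial>gauss_measure \<sigma>) = 0"
    by (subst gauss_measure_integral) (simp_all add: has_bochner_integral_integral_eq[OF m])
  have gi: "integrable (gauss_measure \<sigma>) (\<lambda>x. x)"
    by (subst gauss_measure_integrable) (simp_all add: integrable_normal_moment_nz_1[OF s])
  have tail: "(\<integral>x. indicator {t<..} x * (x - (\<integral>z. z \<partial>gauss_measure \<sigma>)) \<partial>gauss_measure \<sigma>) = \<sigma>\<^sup>2 * 1 * normal_density 0 \<sigma> t" for t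
  proof -
    have "(\<integral>x. indicator {t<..} x * (x - 0) \<partial>gauss_measure \<sigma>) = (\<integral>x. normal_density 0 \<sigma> x * (indicator {t<..} x * (x - 0)) \<partial>lborel)"
      by (rule gauss_measure_integral) measurable
    also have "\<dots> = (LBINT x:{t<..}. normal_density 0 \<sigma> x * x)"
      unfolding set_lebesgue_integral_def by (rule Bochner_Integration.integral_cong) auto
    finally show ?thesis unfolding Eg normal_density_tail_moment[OF s] by simp
  qed
  have [measurable]: "h' \<in> borel_measurable borel" using h(2) by (rule borel_measurable_continuous_onI)
  show ?thesis
  proof (rule weighted_poincare[where g = "\<lambda>x. x" and g' = "\<lambda>t. 1" and I = UNIV and \<rho> = "normal_density 0 \<sigma>" and c = "\<sigma>\<^sup>2",
        OF gauss_measure_def prob_space_gauss_measure[OF s] _ _ _ _ _ _ _ _ _ _ _ gi tail h])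
    show "h' \<in> borel_measurable borel" by measurable
    show "mono (\<lambda>x::real. x)" by (rule monoI)
  qed auto
qed

section \<open>Random sequences whose moments decay like powers of \<open>1 / n\<close>\<close>
context prob_space begin

text \<open>The sequence is of order \<open>n\<^sup>-\<^sup>s\<^sup>/\<^sup>2\<close> in every
  \<open>L\<^sup>2\<^sup>k\<close>.  All even moments are required together so that the notion is closed under
  products; only large \<open>n\<close> counts, because a fixed entry exists only in large matrices.\<close>

definition moment_order :: "nat \<Rightarrow> (nat \<Rightarrow> 'a \<Rightarrow> real) \<Rightarrow> bool" where
  "moment_order s X \<longleftrightarrow> (\<forall>k. \<exists>C\<ge>0. \<forall>\<^sub>F n in sequentially. X n \<in> borel_measurable M \<and>
     (\<integral>\<^sup>+\<omega>. ennreal ((X n \<omega>) ^ (2 * k)) \<partial>M) \<le> ennreal (C / real n ^ (s * k)))"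

lemma moment_orderI:
  assumes "\<And>k. \<exists>C\<ge>0. \<forall>\<^sub>F n in sequentially. X n \<in> borel_measurable M \<and>
     (\<integral>\<^sup>+\<omega>. ennreal ((X n \<omega>) ^ (2 * k)) \<partial>M) \<le> ennreal (C / real n ^ (s * k))"
  shows "moment_order s X"
  using assms unfolding moment_order_def by blast

lemma moment_orderE:
  assumes "moment_order s X"
  obtains C where "C \<ge> 0" "\<forall>\<^sub>F n in sequentially. X n \<in> borel_measurable M \<and>
     (\<integral>\<^sup>+\<omega>. ennreal ((X n \<omega>) ^ (2 * k)) \<partial>M) \<le> ennreal (C / real n ^ (s * k))"
  using assms unfolding moment_order_def by blast

lemma moment_order_measurable: "moment_order s X \<Longrightarrow> \<forall>\<^sub>F n in sequentially. X n \<in> borel_measurable M"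
  by (erule moment_orderE[of s X 0]) (auto elim: eventually_mono)

lemma moment_order_dominated:
  assumes Y: "moment_order s Y"
    and le: "\<forall>\<^sub>F n in sequentially. X n \<in> borel_measurable M \<and> (AE \<omega> in M. \<bar>X n \<omega>\<bar> \<le> \<bar>Y n \<omega>\<bar>)"
  shows "moment_order s X"
proof (rule moment_orderI)
  fix k
  obtain C where C: "C \<ge> 0" "\<forall>\<^sub>F n in sequentially. Y n \<in> borel_measurable M \<and>
     (\<integral>\<^sup>+\<omega>. ennreal ((Y n \<omega>) ^ (2 * k)) \<partial>M) \<le> ennreal (C / real n ^ (s * k))"
    using Y by (rule moment_orderE)
  from C(2) le have "\<forall>\<^sub>F n in sequentially. X n \<in> borel_measurable M \<and>
     (\<integral>\<^sup>+\<omega>. ennreal ((X n \<omega>) ^ (2 * k)) \<partial>M) \<le> ennreal (C / real n ^ (s * k))"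
  proof eventually_elim
    case (elim n)
    have "(\<integral>\<^sup>+\<omega>. ennreal ((X n \<omega>) ^ (2 * k)) \<partial>M) \<le> (\<integral>\<^sup>+\<omega>. ennreal ((Y n \<omega>) ^ (2 * k)) \<partial>M)"
    proof (rule nn_integral_mono_AE)
      show "AE \<omega> in M. ennreal ((X n \<omega>) ^ (2 * k)) \<le> ennreal ((Y n \<omega>) ^ (2 * k))"
        using elim(2)[THEN conjunct2]
      proof eventually_elim
        case (elim \<omega>)
        then have "\<bar>X n \<omega>\<bar> ^ (2 * k) \<le> \<bar>Y n \<omega>\<bar> ^ (2 * k)" by (rule power_mono) simp
        then show ?case by (intro ennreal_leI) (simp add: power_even_abs)
      qed
    qed
    then show ?case using elim by (auto intro: order_trans)
  qed
  then show "\<exists>C\<ge>0. \<forall>\<^sub>F n in sequentially. X n \<in> borel_measurable M \<and>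
     (\<integral>\<^sup>+\<omega>. ennreal ((X n \<omega>) ^ (2 * k)) \<partial>M) \<le> ennreal (C / real n ^ (s * k))" using C(1) by blast
qed

lemma moment_order_cong_AE:
  assumes "moment_order s Y" "\<forall>\<^sub>F n in sequentially. X n \<in> borel_measurable M \<and> (AE \<omega> in M. X n \<omega> = Y n \<omega>)"
  shows "moment_order s X"
  using assms(1) by (rule moment_order_dominated) (use assms(2) in \<open>auto elim!: eventually_mono\<close>)

lemma moment_order_const:
  assumes b: "\<forall>\<^sub>F n in sequentially. (c n)\<^sup>2 \<le> B / real n ^ s" and B: "B \<ge> 0"
  shows "moment_order s (\<lambda>n \<omega>. c n)"
proof (rule moment_orderI)
  fix k
  have "\<forall>\<^sub>F n in sequentially. (\<lambda>\<omega>. c n) \<in> borel_measurable M \<and>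
     (\<integral>\<^sup>+\<omega>. ennreal ((c n) ^ (2 * k)) \<partial>M) \<le> ennreal (B ^ k / real n ^ (s * k))"
    using b
  proof eventually_elim
    case (elim n)
    have "((c n)\<^sup>2) ^ k \<le> (B / real n ^ s) ^ k" by (rule power_mono[OF elim]) simp
    then have "(c n) ^ (2 * k) \<le> B ^ k / real n ^ (s * k)" by (simp add: power_mult power_divide)
    then show ?case by (simp add: emeasure_space_1 ennreal_leI)
  qed
  then show "\<exists>C\<ge>0. \<forall>\<^sub>F n in sequentially. (\<lambda>\<omega>. c n) \<in> borel_measurable M \<and>
     (\<integral>\<^sup>+\<omega>. ennreal ((c n) ^ (2 * k)) \<partial>M) \<le> ennreal (C / real n ^ (s * k))"
    using B by (intro exI[of _ "B ^ k"]) auto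
qed

lemma moment_order_fixed: "moment_order 0 (\<lambda>n \<omega>. c)"
  by (rule moment_order_const[of _ "c\<^sup>2"]) auto

lemma moment_order_zero: "moment_order s (\<lambda>n \<omega>. 0)"
  by (rule moment_order_const[of _ 0]) auto

lemma moment_order_weaken:
  assumes X: "moment_order t X" and st: "s \<le> t"
  shows "moment_order s X"
proof (rule moment_orderI)
  fix k
  obtain C where C: "C \<ge> 0" "\<forall>\<^sub>F n in sequentially. X n \<in> borel_measurable M \<and>
     (\<integral>\<^sup>+\<omega>. ennreal ((X n \<omega>) ^ (2 * k)) \<partial>M) \<le> ennreal (C / real n ^ (t * k))"
    using X by (rule moment_orderE)
  from C(2) eventually_gt_at_top[of 0] have "\<forall>\<^sub>F n in sequentially. X n \<in> borel_measurable M \<and>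
     (\<integral>\<^sup>+\<omega>. ennreal ((X n \<omega>) ^ (2 * k)) \<partial>M) \<le> ennreal (C / real n ^ (s * k))"
  proof eventually_elim
    case (elim n)
    have "real n ^ (s * k) \<le> real n ^ (t * k)" using elim st by (intro power_increasing mult_le_mono1) auto
    then have "C / real n ^ (t * k) \<le> C / real n ^ (s * k)" using C(1) elim by (intro divide_left_mono) auto
    then show ?case using elim by (meson ennreal_leI order_trans)
  qed
  then show "\<exists>C\<ge>0. \<forall>\<^sub>F n in sequentially. X n \<in> borel_measurable M \<and>
     (\<integral>\<^sup>+\<omega>. ennreal ((X n \<omega>) ^ (2 * k)) \<partial>M) \<le> ennreal (C / real n ^ (s * k))" using C(1) by blast
qed

lemma moment_order_add:
  assumes X: "moment_order s X" and Y: "moment_order s Y"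
  shows "moment_order s (\<lambda>n \<omega>. X n \<omega> + Y n \<omega>)"
proof (rule moment_orderI)
  fix k
  obtain C where C: "C \<ge> 0" "\<forall>\<^sub>F n in sequentially. X n \<in> borel_measurable M \<and>
     (\<integral>\<^sup>+\<omega>. ennreal ((X n \<omega>) ^ (2 * k)) \<partial>M) \<le> ennreal (C / real n ^ (s * k))"
    using X by (rule moment_orderE)
  obtain D where D: "D \<ge> 0" "\<forall>\<^sub>F n in sequentially. Y n \<in> borel_measurable M \<and>
     (\<integral>\<^sup>+\<omega>. ennreal ((Y n \<omega>) ^ (2 * k)) \<partial>M) \<le> ennreal (D / real n ^ (s * k))"
    using Y by (rule moment_orderE)
  let ?E = "2 ^ (2 * k) * (C + D)"
  from C(2) D(2) have "\<forall>\<^sub>F n in sequentially. (\<lambda>\<omega>. X n \<omega> + Y n \<omega>) \<in> borel_measurable M \<and>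
     (\<integral>\<^sup>+\<omega>. ennreal ((X n \<omega> + Y n \<omega>) ^ (2 * k)) \<partial>M) \<le> ennreal (?E / real n ^ (s * k))"
  proof eventually_elim
    case (elim n)
    have [measurable]: "X n \<in> borel_measurable M" "Y n \<in> borel_measurable M" using elim by auto
    have pt: "(x + y) ^ (2 * k) \<le> 2 ^ (2 * k) * (x ^ (2 * k) + y ^ (2 * k))" for x y :: real
    proof -
      have "\<bar>x + y\<bar> \<le> 2 * max \<bar>x\<bar> \<bar>y\<bar>" by auto
      then have "\<bar>x + y\<bar> ^ (2 * k) \<le> (2 * max \<bar>x\<bar> \<bar>y\<bar>) ^ (2 * k)" by (rule power_mono) simp
      also have "\<dots> = 2 ^ (2 * k) * max \<bar>x\<bar> \<bar>y\<bar> ^ (2 * k)" by (simp add: power_mult_distrib)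
      also have "\<dots> \<le> 2 ^ (2 * k) * (\<bar>x\<bar> ^ (2 * k) + \<bar>y\<bar> ^ (2 * k))"
        by (intro mult_left_mono) (auto simp: max_def)
      finally show ?thesis by (simp add: power_even_abs)
    qed
    have "(\<integral>\<^sup>+\<omega>. ennreal ((X n \<omega> + Y n \<omega>) ^ (2 * k)) \<partial>M)
       \<le> (\<integral>\<^sup>+\<omega>. ennreal (2 ^ (2 * k)) * (ennreal ((X n \<omega>) ^ (2 * k)) + ennreal ((Y n \<omega>) ^ (2 * k))) \<partial>M)"
      by (intro nn_integral_mono) (simp add: ennreal_mult'[symmetric] ennreal_plus[symmetric] ennreal_leI pt del: ennreal_plus)
    also have "\<dots> = ennreal (2 ^ (2 * k)) * ((\<integral>\<^sup>+\<omega>. ennreal ((X n \<omega>) ^ (2 * k)) \<partial>M) + (\<integral>\<^sup>+\<omega>. ennreal ((Y n \<omega>) ^ (2 * k)) \<partial>M))"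
      by (subst nn_integral_cmult) (auto simp: nn_integral_add)
    also have "\<dots> \<le> ennreal (2 ^ (2 * k)) * (ennreal (C / real n ^ (s * k)) + ennreal (D / real n ^ (s * k)))"
      using elim by (intro mult_left_mono add_mono) auto
    also have "\<dots> = ennreal (?E / real n ^ (s * k))"
      using C(1) D(1) by (simp add: ennreal_mult'[symmetric] ennreal_plus[symmetric] add_divide_distrib distrib_left del: ennreal_plus)
    finally show ?case by simp
  qed
  then show "\<exists>C\<ge>0. \<forall>\<^sub>F n in sequentially. (\<lambda>\<omega>. X n \<omega> + Y n \<omega>) \<in> borel_measurable M \<and>
     (\<integral>\<^sup>+\<omega>. ennreal ((X n \<omega> + Y n \<omega>) ^ (2 * k)) \<partial>M) \<le> ennreal (C / real n ^ (s * k))"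
    using C(1) D(1) by (intro exI[of _ ?E]) auto
qed

text \<open>The weights \<open>n\<^sup>s\<^sup>k\<close> and \<open>n\<^sup>t\<^sup>k\<close> make the two
  terms of the arithmetic-geometric mean inequality of the same order.\<close>

lemma moment_order_mult:
  assumes X: "moment_order s X" and Y: "moment_order t Y"
  shows "moment_order (s + t) (\<lambda>n \<omega>. X n \<omega> * Y n \<omega>)"
proof (rule moment_orderI)
  fix k
  obtain C where C: "C \<ge> 0" "\<forall>\<^sub>F n in sequentially. X n \<in> borel_measurable M \<and>
     (\<integral>\<^sup>+\<omega>. ennreal ((X n \<omega>) ^ (2 * (2 * k))) \<partial>M) \<le> ennreal (C / real n ^ (s * (2 * k)))"
    using X by (rule moment_orderE)
  obtain D where D: "D \<ge> 0" "\<forall>\<^sub>F n in sequentially. Y n \<in> borel_measurable M \<and>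
     (\<integral>\<^sup>+\<omega>. ennreal ((Y n \<omega>) ^ (2 * (2 * k))) \<partial>M) \<le> ennreal (D / real n ^ (t * (2 * k)))"
    using Y by (rule moment_orderE)
  from C(2) D(2) eventually_gt_at_top[of 0]
  have "\<forall>\<^sub>F n in sequentially. (\<lambda>\<omega>. X n \<omega> * Y n \<omega>) \<in> borel_measurable M \<and>
     (\<integral>\<^sup>+\<omega>. ennreal ((X n \<omega> * Y n \<omega>) ^ (2 * k)) \<partial>M) \<le> ennreal ((C + D) / real n ^ ((s + t) * k))"
  proof eventually_elim
    case (elim n)
    have [measurable]: "X n \<in> borel_measurable M" "Y n \<in> borel_measurable M" using elim by auto
    define p q where "p = real n ^ (s * k)" and "q = real n ^ (t * k)"
    have pq: "p > 0" "q > 0" using elim by (auto simp: p_def q_def)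
    have pt: "(x * y) ^ (2 * k) \<le> p / q * x ^ (2 * (2 * k)) + q / p * y ^ (2 * (2 * k))" for x y :: real
    proof -
      define u v where "u = x ^ (2 * k)" and "v = y ^ (2 * k)"
      have uv: "u \<ge> 0" "v \<ge> 0" by (auto simp: u_def v_def)
      have "2 * ((p * u) * (q * v)) \<le> (p * u)\<^sup>2 + (q * v)\<^sup>2" using sum_squares_bound[of "p * u" "q * v"] by simp
      moreover have "(p * u) * (q * v) \<ge> 0" using pq uv by simp
      ultimately have "(p * u) * (q * v) \<le> (p * u)\<^sup>2 + (q * v)\<^sup>2" by linarith
      then have "u * v \<le> p / q * u\<^sup>2 + q / p * v\<^sup>2" using pq by (simp add: field_simps power2_eq_square)
      moreover have "u\<^sup>2 = x ^ (2 * (2 * k))" "v\<^sup>2 = y ^ (2 * (2 * k))" "u * v = (x * y) ^ (2 * k)"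
        by (simp_all add: u_def v_def power_mult[symmetric] power_mult_distrib mult.commute)
      ultimately show ?thesis by simp
    qed
    have "(\<integral>\<^sup>+\<omega>. ennreal ((X n \<omega> * Y n \<omega>) ^ (2 * k)) \<partial>M)
       \<le> (\<integral>\<^sup>+\<omega>. ennreal (p / q) * ennreal ((X n \<omega>) ^ (2 * (2 * k))) + ennreal (q / p) * ennreal ((Y n \<omega>) ^ (2 * (2 * k))) \<partial>M)"
    proof (rule nn_integral_mono)
      fix \<omega>
      have lin: "ennreal c * ennreal u + ennreal d * ennreal v = ennreal (c * u + d * v)"
        if "c \<ge> 0" "d \<ge> 0" "u \<ge> 0" "v \<ge> 0" for c d u v
        using that by (simp add: ennreal_mult)
      have "ennreal (p / q) * ennreal (x ^ (2 * (2 * k))) + ennreal (q / p) * ennreal (y ^ (2 * (2 * k)))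
        = ennreal (p / q * x ^ (2 * (2 * k)) + q / p * y ^ (2 * (2 * k)))" for x y
        by (rule lin) (use pq in \<open>auto simp: zero_le_even_power\<close>)
      then show "ennreal ((X n \<omega> * Y n \<omega>) ^ (2 * k)) \<le> ennreal (p / q) * ennreal ((X n \<omega>) ^ (2 * (2 * k))) + ennreal (q / p) * ennreal ((Y n \<omega>) ^ (2 * (2 * k)))"
        by (simp only:) (intro ennreal_leI pt)
    qed
    also have "\<dots> = ennreal (p / q) * (\<integral>\<^sup>+\<omega>. ennreal ((X n \<omega>) ^ (2 * (2 * k))) \<partial>M) + ennreal (q / p) * (\<integral>\<^sup>+\<omega>. ennreal ((Y n \<omega>) ^ (2 * (2 * k))) \<partial>M)"
      by (subst nn_integral_add) (auto simp: nn_integral_cmult)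
    also have "\<dots> \<le> ennreal (p / q) * ennreal (C / real n ^ (s * (2 * k))) + ennreal (q / p) * ennreal (D / real n ^ (t * (2 * k)))"
      using elim by (intro mult_left_mono add_mono) auto
    also have "\<dots> = ennreal (p / q * (C / real n ^ (s * (2 * k))) + q / p * (D / real n ^ (t * (2 * k))))"
      using C(1) D(1) pq by (simp add: ennreal_mult'[symmetric] ennreal_plus[symmetric] del: ennreal_plus)
    also have "p / q * (C / real n ^ (s * (2 * k))) + q / p * (D / real n ^ (t * (2 * k))) = (C + D) / real n ^ ((s + t) * k)"
    proof -
      have "real n ^ (s * (2 * k)) = p * p" "real n ^ (t * (2 * k)) = q * q" "real n ^ ((s + t) * k) = p * q"
        unfolding p_def q_def power_add[symmetric] by (rule arg_cong[where f = "\<lambda>j. real n ^ j"], simp add: algebra_simps)+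
      then show ?thesis using pq by (simp add: field_simps)
    qed
    finally show ?case by simp
  qed
  then show "\<exists>E\<ge>0. \<forall>\<^sub>F n in sequentially. (\<lambda>\<omega>. X n \<omega> * Y n \<omega>) \<in> borel_measurable M \<and>
     (\<integral>\<^sup>+\<omega>. ennreal ((X n \<omega> * Y n \<omega>) ^ (2 * k)) \<partial>M) \<le> ennreal (E / real n ^ ((s + t) * k))"
    using C(1) D(1) by (intro exI[of _ "C + D"]) auto
qed

lemma moment_order_cmult: "moment_order s X \<Longrightarrow> moment_order s (\<lambda>n \<omega>. c * X n \<omega>)"
  using moment_order_mult[OF moment_order_fixed[of c], of s X] by simp

lemma moment_order_diff: "moment_order s X \<Longrightarrow> moment_order s Y \<Longrightarrow> moment_order s (\<lambda>n \<omega>. X n \<omega> - Y n \<omega>)"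
  using moment_order_add[of s X "\<lambda>n \<omega>. (-1) * Y n \<omega>"] moment_order_cmult[of s Y "-1"] by simp

lemma moment_order_sum:
  assumes "\<And>i. i \<in> A \<Longrightarrow> moment_order s (X i)"
  shows "moment_order s (\<lambda>n \<omega>. \<Sum>i\<in>A. X i n \<omega>)"
  using assms by (induction A rule: infinite_finite_induct) (auto intro: moment_order_add moment_order_zero)

lemma moment_order_second_moment:
  assumes "moment_order s X"
  shows "\<exists>C\<ge>0. \<forall>\<^sub>F n in sequentially. X n \<in> borel_measurable M \<and> integrable M (X n) \<and>
     integrable M (\<lambda>\<omega>. (X n \<omega>)\<^sup>2) \<and> expectation (\<lambda>\<omega>. (X n \<omega>)\<^sup>2) \<le> C / real n ^ s"
proof -
  obtain C where C: "C \<ge> 0" "\<forall>\<^sub>F n in sequentially. X n \<in> borel_measurable M \<and>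
     (\<integral>\<^sup>+\<omega>. ennreal ((X n \<omega>) ^ (2 * 1)) \<partial>M) \<le> ennreal (C / real n ^ (s * 1))"
    using assms by (rule moment_orderE)
  from C(2) have "\<forall>\<^sub>F n in sequentially. X n \<in> borel_measurable M \<and> integrable M (X n) \<and>
     integrable M (\<lambda>\<omega>. (X n \<omega>)\<^sup>2) \<and> expectation (\<lambda>\<omega>. (X n \<omega>)\<^sup>2) \<le> C / real n ^ s"
  proof eventually_elim
    case (elim n)
    have [measurable]: "X n \<in> borel_measurable M" using elim by simp
    have le: "(\<integral>\<^sup>+\<omega>. ennreal ((X n \<omega>)\<^sup>2) \<partial>M) \<le> ennreal (C / real n ^ s)" using elim by simp
    have i2: "integrable M (\<lambda>\<omega>. (X n \<omega>)\<^sup>2)"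
      by (rule integrableI_nonneg) (use le in \<open>auto intro: order_le_less_trans\<close>)
    have "ennreal (expectation (\<lambda>\<omega>. (X n \<omega>)\<^sup>2)) \<le> ennreal (C / real n ^ s)"
      using le nn_integral_eq_integral[OF i2] by simp
    then have "expectation (\<lambda>\<omega>. (X n \<omega>)\<^sup>2) \<le> C / real n ^ s"
      using C(1) by (subst (asm) ennreal_le_iff) auto
    then show ?case using i2 square_integrable_imp_integrable[OF _ i2] by simp
  qed
  then show ?thesis using C(1) by blast
qed

text \<open>Fourth moments of order \<open>n\<^sup>-\<^sup>2\<close> are summable.\<close>

lemma moment_order_AE_tendsto:
  assumes "moment_order 1 X"
  shows "AE \<omega> in M. (\<lambda>n. X n \<omega>) \<longlonglongrightarrow> 0"
proof -
  obtain C where C: "C \<ge> 0" "\<forall>\<^sub>F n in sequentially. X n \<in> borel_measurable M \<and>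
     (\<integral>\<^sup>+\<omega>. ennreal ((X n \<omega>) ^ (2 * 2)) \<partial>M) \<le> ennreal (C / real n ^ (1 * 2))"
    using assms by (rule moment_orderE)
  then obtain m where m: "\<And>n. n \<ge> m \<Longrightarrow> X n \<in> borel_measurable M"
    "\<And>n. n \<ge> m \<Longrightarrow> (\<integral>\<^sup>+\<omega>. ennreal ((X n \<omega>) ^ 4) \<partial>M) \<le> ennreal (C / (real n)\<^sup>2)"
    unfolding eventually_sequentially by auto
  have [measurable]: "X (n + m) \<in> borel_measurable M" for n by (rule m) simp
  have s: "summable (\<lambda>n. C / (real (n + m))\<^sup>2)"
    using summable_mult[OF inverse_power_summable[of 2], of C] by (subst summable_iff_shift[of "\<lambda>n. C / (real n)\<^sup>2"]) (simp add: divide_inverse)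
  have "(\<integral>\<^sup>+\<omega>. (\<Sum>n. ennreal ((X (n + m) \<omega>) ^ 4)) \<partial>M) = (\<Sum>n. \<integral>\<^sup>+\<omega>. ennreal ((X (n + m) \<omega>) ^ 4) \<partial>M)"
    by (rule nn_integral_suminf) measurable
  also have "\<dots> \<le> (\<Sum>n. ennreal (C / (real (n + m))\<^sup>2))" by (intro suminf_le m summableI) auto
  also have "\<dots> = ennreal (\<Sum>n. C / (real (n + m))\<^sup>2)" using s C(1) by (intro suminf_ennreal2) auto
  also have "\<dots> < \<infinity>" by simp
  finally have "AE \<omega> in M. (\<Sum>n. ennreal ((X (n + m) \<omega>) ^ 4)) \<noteq> \<infinity>"
    by (intro nn_integral_noteq_infinite) auto
  then show ?thesis
  proof eventually_elim
    case (elim \<omega>)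
    have "summable (\<lambda>n. (X (n + m) \<omega>) ^ 4)"
      by (rule summable_suminf_not_top) (use elim in auto)
    then have "(\<lambda>n. (X (n + m) \<omega>) ^ 4) \<longlonglongrightarrow> 0" by (rule summable_LIMSEQ_zero)
    then have "(\<lambda>n. root 4 ((X (n + m) \<omega>) ^ 4)) \<longlonglongrightarrow> root 4 0" by (rule tendsto_real_root)
    then have "(\<lambda>n. \<bar>X (n + m) \<omega>\<bar>) \<longlonglongrightarrow> 0"
    proof -
      have "root 4 (x ^ 4) = \<bar>x\<bar>" for x using real_root_power_cancel[of 4 "\<bar>x\<bar>"] by (simp add: power_even_abs)
      then show ?thesis using \<open>(\<lambda>n. root 4 ((X (n + m) \<omega>) ^ 4)) \<longlonglongrightarrow> root 4 0\<close> by simp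
    qed
    then have "(\<lambda>n. X (n + m) \<omega>) \<longlonglongrightarrow> 0" by (rule tendsto_rabs_zero_cancel)
    then show ?case by (rule LIMSEQ_offset)
  qed
qed

end

section \<open>The centred square of a chi variable\<close>
lemma abs_square_minus_le:
  assumes "\<kappa> > 0" "x > (0::real)"
  shows "\<bar>x\<^sup>2 - \<kappa>\<bar> \<le> (1 + \<kappa>) * (1 + x)\<^sup>2"
proof -
  have "\<bar>x\<^sup>2 - \<kappa>\<bar> \<le> x\<^sup>2 + \<kappa>" using assms by (simp add: abs_le_iff)
  also have "\<dots> \<le> (1 + \<kappa>) * (1 + x)\<^sup>2" using assms by (simp add: power2_eq_square algebra_simps)
  finally show ?thesis .
qed

lemma chi_central_integrable:
  assumes k: "\<kappa> > 0"
  shows "integrable (chi_measure \<kappa>) (\<lambda>x. (x\<^sup>2 - \<kappa>) ^ j)"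
proof (rule chi_measure_integrable[OF k])
  fix x :: real assume x: "x > 0"
  have "\<bar>x\<^sup>2 - \<kappa>\<bar> ^ j \<le> ((1 + \<kappa>) * (1 + x)\<^sup>2) ^ j" by (rule power_mono[OF abs_square_minus_le[OF k x]]) simp
  then show "norm ((x\<^sup>2 - \<kappa>) ^ j) \<le> (1 + \<kappa>) ^ j * (1 + x) ^ (2 * j)"
    by (simp add: power_abs power_mult_distrib power_mult)
qed simp

text \<open>The Stein identity for \<open>\<phi> x = (x\<^sup>2 - \<kappa>)\<^sup>j\<close>.\<close>

lemma chi_central_recurrence:
  assumes k: "\<kappa> > 0"
  shows "(\<integral>x. (x\<^sup>2 - \<kappa>) ^ Suc j \<partial>chi_measure \<kappa>) = 2 * real j *
     ((\<integral>x. (x\<^sup>2 - \<kappa>) ^ j \<partial>chi_measure \<kappa>) + \<kappa> * (\<integral>x. (x\<^sup>2 - \<kappa>) ^ (j - 1) \<partial>chi_measure \<kappa>))"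
proof -
  note i = chi_central_integrable[OF k]
  have "(\<integral>x. (x\<^sup>2 - \<kappa>) *\<^sub>R (x\<^sup>2 - \<kappa>) ^ j - x *\<^sub>R (real j * (x\<^sup>2 - \<kappa>) ^ (j - 1) * (2 * x)) \<partial>chi_measure \<kappa>) = 0"
  proof (rule chi_measure_stein[OF k, where p = "2 * j + 1" and C = "(2 * real j + 1) * (1 + \<kappa>) ^ j"])
    show "((\<lambda>x. (x\<^sup>2 - \<kappa>) ^ j) has_vector_derivative real j * (x\<^sup>2 - \<kappa>) ^ (j - 1) * (2 * x)) (at x)" for x
      unfolding has_real_derivative_iff_has_vector_derivative[symmetric]
      by (auto intro!: derivative_eq_intros)
    show "continuous_on UNIV (\<lambda>x. real j * (x\<^sup>2 - \<kappa>) ^ (j - 1) * (2 * x))" by (intro continuous_intros)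
    fix x :: real assume x: "x > 0"
    have pw: "\<bar>x\<^sup>2 - \<kappa>\<bar> ^ i \<le> (1 + \<kappa>) ^ i * (1 + x) ^ (2 * i)" for i
      using power_mono[OF abs_square_minus_le[OF k x], of i] by (simp add: power_mult_distrib power_mult)
    have "norm ((x\<^sup>2 - \<kappa>) ^ j) \<le> (1 + \<kappa>) ^ j * (1 + x) ^ (2 * j)" using pw[of j] by (simp add: power_abs)
    also have "\<dots> \<le> ((2 * real j + 1) * (1 + \<kappa>) ^ j) * (1 + x) ^ (2 * j + 1)"
      using x k by (intro mult_mono power_increasing) (auto intro!: mult_le_cancel_right1[THEN iffD2])
    finally show "norm ((x\<^sup>2 - \<kappa>) ^ j) \<le> ((2 * real j + 1) * (1 + \<kappa>) ^ j) * (1 + x) ^ (2 * j + 1)" .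
    have "norm (real j * (x\<^sup>2 - \<kappa>) ^ (j - 1) * (2 * x)) = 2 * real j * (\<bar>x\<^sup>2 - \<kappa>\<bar> ^ (j - 1) * x)"
      using x by (simp add: abs_mult power_abs)
    also have "\<dots> \<le> 2 * real j * (((1 + \<kappa>) ^ (j - 1) * (1 + x) ^ (2 * (j - 1))) * (1 + x))"
      using x k by (intro mult_left_mono mult_mono pw) auto
    also have "\<dots> = (2 * real j * (1 + \<kappa>) ^ (j - 1)) * (1 + x) ^ (2 * (j - 1) + 1)" by simp
    also have "\<dots> \<le> ((2 * real j + 1) * (1 + \<kappa>) ^ j) * (1 + x) ^ (2 * j + 1)"
      using x k by (intro mult_mono power_increasing) auto
    finally show "norm (real j * (x\<^sup>2 - \<kappa>) ^ (j - 1) * (2 * x)) \<le> ((2 * real j + 1) * (1 + \<kappa>) ^ j) * (1 + x) ^ (2 * j + 1)" .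
  qed
  also have "(\<lambda>x. (x\<^sup>2 - \<kappa>) *\<^sub>R (x\<^sup>2 - \<kappa>) ^ j - x *\<^sub>R (real j * (x\<^sup>2 - \<kappa>) ^ (j - 1) * (2 * x)))
    = (\<lambda>x. (x\<^sup>2 - \<kappa>) ^ Suc j - 2 * real j * ((x\<^sup>2 - \<kappa>) ^ j + \<kappa> * (x\<^sup>2 - \<kappa>) ^ (j - 1)))"
  proof
    fix x
    show "(x\<^sup>2 - \<kappa>) *\<^sub>R (x\<^sup>2 - \<kappa>) ^ j - x *\<^sub>R (real j * (x\<^sup>2 - \<kappa>) ^ (j - 1) * (2 * x))
      = (x\<^sup>2 - \<kappa>) ^ Suc j - 2 * real j * ((x\<^sup>2 - \<kappa>) ^ j + \<kappa> * (x\<^sup>2 - \<kappa>) ^ (j - 1))"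
      by (cases j) (simp_all add: power2_eq_square algebra_simps)
  qed
  also have "(\<integral>x. (x\<^sup>2 - \<kappa>) ^ Suc j - 2 * real j * ((x\<^sup>2 - \<kappa>) ^ j + \<kappa> * (x\<^sup>2 - \<kappa>) ^ (j - 1)) \<partial>chi_measure \<kappa>)
    = (\<integral>x. (x\<^sup>2 - \<kappa>) ^ Suc j \<partial>chi_measure \<kappa>) - 2 * real j * ((\<integral>x. (x\<^sup>2 - \<kappa>) ^ j \<partial>chi_measure \<kappa>) + \<kappa> * (\<integral>x. (x\<^sup>2 - \<kappa>) ^ (j - 1) \<partial>chi_measure \<kappa>))"
  proof -
    have "(\<integral>x. X x - a * (Y x + \<kappa> * Z x) \<partial>N) = (\<integral>x. X x \<partial>N) - a * ((\<integral>x. Y x \<partial>N) + \<kappa> * (\<integral>x. Z x \<partial>N))"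
      if "integrable N X" "integrable N Y" "integrable N Z" for N :: "real measure" and X Y Z and a :: real
      using that by simp
    from this[OF i i i] show ?thesis .
  qed
  finally show ?thesis by linarith
qed

text \<open>The \<open>j\<close>-th central moment grows like \<open>\<kappa>\<^sup>j\<^sup>/\<^sup>2\<close>,
  with a constant for all degrees of freedom: in the recurrence, raising \<open>j\<close> by two costs one
  factor \<open>\<kappa>\<close>.\<close>

lemma chi_central_moment_bound:
  "\<exists>A\<ge>0. \<forall>\<kappa>>0. prob_space (chi_measure \<kappa>) \<longrightarrow> \<bar>\<integral>x. (x\<^sup>2 - \<kappa>) ^ j \<partial>chi_measure \<kappa>\<bar> \<le> A * sqrt (1 + \<kappa>) ^ j"
proof (induction j rule: less_induct)
  case (less j)
  show ?case
  proof (cases j)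
    case 0
    then show ?thesis by (intro exI[of _ 1]) (auto intro: prob_space.prob_le_1)
  next
    case (Suc i)
    have "i < j" "i - 1 < j" using Suc by auto
    obtain A where A: "A \<ge> 0" "\<And>\<kappa>. \<kappa> > 0 \<Longrightarrow> prob_space (chi_measure \<kappa>) \<Longrightarrow> \<bar>\<integral>x. (x\<^sup>2 - \<kappa>) ^ i \<partial>chi_measure \<kappa>\<bar> \<le> A * sqrt (1 + \<kappa>) ^ i"
      using less.IH[OF \<open>i < j\<close>] by blast
    obtain B where B: "B \<ge> 0" "\<And>\<kappa>. \<kappa> > 0 \<Longrightarrow> prob_space (chi_measure \<kappa>) \<Longrightarrow> \<bar>\<integral>x. (x\<^sup>2 - \<kappa>) ^ (i - 1) \<partial>chi_measure \<kappa>\<bar> \<le> B * sqrt (1 + \<kappa>) ^ (i - 1)"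
      using less.IH[OF \<open>i - 1 < j\<close>] by blast
    have "\<bar>\<integral>x. (x\<^sup>2 - \<kappa>) ^ j \<partial>chi_measure \<kappa>\<bar> \<le> 2 * real i * (A + B) * sqrt (1 + \<kappa>) ^ j"
      if k: "\<kappa> > 0" "prob_space (chi_measure \<kappa>)" for \<kappa>
    proof (cases "i = 0")
      case True
      then show ?thesis using chi_central_recurrence[OF k(1), of i] Suc by simp
    next
      case False
      define r where "r = sqrt (1 + \<kappa>)"
      have r: "r \<ge> 1" "\<kappa> \<le> r\<^sup>2" using k by (simp_all add: r_def)
      have "\<bar>\<integral>x. (x\<^sup>2 - \<kappa>) ^ j \<partial>chi_measure \<kappa>\<bar> = 2 * real i * \<bar>(\<integral>x. (x\<^sup>2 - \<kappa>) ^ i \<partial>chi_measure \<kappa>) + \<kappa> * (\<integral>x. (x\<^sup>2 - \<kappa>) ^ (i - 1) \<partial>chi_measure \<kappa>)\<bar>"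
        unfolding Suc chi_central_recurrence[OF k(1), of i] by (simp add: abs_mult)
      also have "\<dots> \<le> 2 * real i * (A * r ^ i + r\<^sup>2 * (B * r ^ (i - 1)))"
      proof (rule mult_left_mono, rule order_trans[OF abs_triangle_ineq], rule add_mono)
        show "\<bar>\<integral>x. (x\<^sup>2 - \<kappa>) ^ i \<partial>chi_measure \<kappa>\<bar> \<le> A * r ^ i" unfolding r_def by (rule A(2)[OF k])
        show "\<bar>\<kappa> * (\<integral>x. (x\<^sup>2 - \<kappa>) ^ (i - 1) \<partial>chi_measure \<kappa>)\<bar> \<le> r\<^sup>2 * (B * r ^ (i - 1))"
          unfolding abs_mult using k r B(2)[OF k] by (intro mult_mono) (auto simp: r_def)
      qed simp
      also have "\<dots> \<le> 2 * real i * (A * r ^ j + B * r ^ j)"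
      proof (intro mult_left_mono add_mono)
        show "r ^ i \<le> r ^ j" using r Suc by (intro power_increasing) auto
        have "r\<^sup>2 * r ^ (i - 1) = r ^ j" unfolding power_add[symmetric] using False Suc by simp
        then show "r\<^sup>2 * (B * r ^ (i - 1)) \<le> B * r ^ j" by (simp add: algebra_simps)
      qed (use A B in auto)
      finally show ?thesis by (simp add: r_def algebra_simps)
    qed
    then show ?thesis using A(1) B(1) by (intro exI[of _ "2 * real i * (A + B)"]) auto
  qed
qed

text \<open>An approximate form of the differential equation \<open>\<phi>' = - a t \<phi>\<close> that
  characterizes the normal distribution: \<open>exp (a t\<^sup>2 / 2) \<phi> t\<close> is nearly
  constant.\<close>

lemma gaussian_ode_perturbation:
  fixes \<phi> \<phi>' :: "real \<Rightarrow> complex"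
  assumes der: "\<And>t. (\<phi> has_vector_derivative \<phi>' t) (at t)" and 0: "\<phi> 0 = 1" and a: "a \<ge> 0" and e: "e \<ge> 0"
    and ode: "\<And>t. norm (\<phi>' t + complex_of_real (a * t) * \<phi> t) \<le> e * \<bar>t\<bar>"
  shows "norm (\<phi> t - complex_of_real (exp (- (a * t\<^sup>2 / 2)))) \<le> e * t\<^sup>2"
proof -
  define E where "E u = exp (a * u\<^sup>2 / 2)" for u
  define g where "g u = E u *\<^sub>R \<phi> u" for u
  have derE: "(E has_real_derivative E u * (a * u)) (at u)" for u
    unfolding E_def by (auto intro!: derivative_eq_intros)
  have dg: "(g has_vector_derivative E u *\<^sub>R (\<phi>' u + complex_of_real (a * u) * \<phi> u)) (at u)" for u
  proof -
    have "(g has_vector_derivative E u *\<^sub>R \<phi>' u + (E u * (a * u)) *\<^sub>R \<phi> u) (at u)"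
      unfolding g_def by (rule has_vector_derivative_scaleR[OF derE der])
    then show ?thesis by (simp add: scaleR_conv_of_real algebra_simps)
  qed
  have "norm (g t - g 0) \<le> (e * \<bar>t\<bar> * E t) * norm (t - 0)"
  proof (rule differentiable_bound[of "closed_segment 0 t"])
    show "(g has_derivative (\<lambda>h. h *\<^sub>R (E u *\<^sub>R (\<phi>' u + complex_of_real (a * u) * \<phi> u)))) (at u within closed_segment 0 t)" for u
      using dg[of u] unfolding has_vector_derivative_def by (rule has_derivative_at_withinI)
    fix u assume "u \<in> closed_segment 0 t"
    then have u: "\<bar>u\<bar> \<le> \<bar>t\<bar>" by (auto simp: closed_segment_eq_real_ivl split: if_splits)
    have "u\<^sup>2 \<le> t\<^sup>2" using u by (simp add: abs_le_square_iff)
    then have "E u \<le> E t" unfolding E_def using a by (simp add: mult_left_mono)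
    moreover have "norm (\<phi>' u + complex_of_real (a * u) * \<phi> u) \<le> e * \<bar>t\<bar>"
      using ode[of u] mult_left_mono[OF u e] by linarith
    ultimately have "E u * norm (\<phi>' u + complex_of_real (a * u) * \<phi> u) \<le> E t * (e * \<bar>t\<bar>)"
      by (intro mult_mono) (auto simp: E_def)
    note le = this
    show "onorm (\<lambda>h. h *\<^sub>R (E u *\<^sub>R (\<phi>' u + complex_of_real (a * u) * \<phi> u))) \<le> e * \<bar>t\<bar> * E t"
    proof (rule onorm_le)
      fix h :: real
      have "norm (h *\<^sub>R (E u *\<^sub>R (\<phi>' u + complex_of_real (a * u) * \<phi> u))) = \<bar>h\<bar> * (E u * norm (\<phi>' u + complex_of_real (a * u) * \<phi> u))"
        unfolding norm_scaleR by (simp add: E_def)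
      also have "\<dots> \<le> \<bar>h\<bar> * (E t * (e * \<bar>t\<bar>))" by (rule mult_left_mono[OF le]) simp
      finally show "norm (h *\<^sub>R (E u *\<^sub>R (\<phi>' u + complex_of_real (a * u) * \<phi> u))) \<le> e * \<bar>t\<bar> * E t * norm h"
        by (simp add: ac_simps)
    qed
  qed auto
  also have "\<dots> = E t * (e * t\<^sup>2)" by (simp add: power2_eq_square)
  finally have fin: "norm (g t - g 0) \<le> E t * (e * t\<^sup>2)" .
  have "norm (E t *\<^sub>R (\<phi> t - complex_of_real (exp (- (a * t\<^sup>2 / 2))))) \<le> E t * (e * t\<^sup>2)"
  proof -
    have "E t * exp (- (a * t\<^sup>2 / 2)) = 1" unfolding E_def exp_add[symmetric] by simp
    then have "E t *\<^sub>R complex_of_real (exp (- (a * t\<^sup>2 / 2))) = 1"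
      unfolding scaleR_conv_of_real of_real_mult[symmetric] by simp
    moreover have "g 0 = 1" by (simp add: g_def 0 E_def)
    ultimately have "E t *\<^sub>R (\<phi> t - complex_of_real (exp (- (a * t\<^sup>2 / 2)))) = g t - g 0"
      unfolding scaleR_diff_right g_def by simp
    then show ?thesis using fin by (simp only:)
  qed
  then have "E t * norm (\<phi> t - complex_of_real (exp (- (a * t\<^sup>2 / 2)))) \<le> E t * (e * t\<^sup>2)"
    unfolding norm_scaleR by (simp add: E_def)
  then show ?thesis by (rule mult_left_le_imp_le) (simp add: E_def)
qed

text \<open>Differentiation of a characteristic function under the integral sign; the difference quotients are
  dominated by \<open>\<bar>v\<bar>\<close>.\<close>

lemma (in prob_space) characteristic_integral_derivative:
  fixes v :: "'a \<Rightarrow> real"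
  assumes [measurable]: "v \<in> borel_measurable M" and i2: "integrable M (\<lambda>x. (v x)\<^sup>2)"
  shows "((\<lambda>t. \<integral>x. iexp (t * v x) \<partial>M) has_vector_derivative (\<integral>x. \<i> * complex_of_real (v x) * iexp (t * v x) \<partial>M)) (at t)"
proof -
  have i1: "integrable M v" by (rule square_integrable_imp_integrable[OF _ i2]) measurable
  have ie: "integrable M (\<lambda>x. iexp (t * v x))" for t
    by (rule integrable_const_bound[of _ 1]) auto
  have iv: "integrable M (\<lambda>x. \<i> * complex_of_real (v x) * iexp (t * v x))"
    by (rule Bochner_Integration.integrable_bound[OF i1]) (auto simp: norm_mult)
  let ?D = "\<integral>x. \<i> * complex_of_real (v x) * iexp (t * v x) \<partial>M"
  have bound: "norm ((\<integral>x. iexp ((t + h) * v x) \<partial>M) - (\<integral>x. iexp (t * v x) \<partial>M) - h *\<^sub>R ?D) \<le> h\<^sup>2 * (expectation (\<lambda>x. (v x)\<^sup>2) / 2)" for h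
  proof -
    have "(\<integral>x. iexp ((t + h) * v x) \<partial>M) - (\<integral>x. iexp (t * v x) \<partial>M) - h *\<^sub>R ?D
      = (\<integral>x. iexp ((t + h) * v x) - iexp (t * v x) - h *\<^sub>R (\<i> * complex_of_real (v x) * iexp (t * v x)) \<partial>M)"
    proof -
      have "(\<integral>x. A x \<partial>M) - (\<integral>x. B x \<partial>M) - h *\<^sub>R (\<integral>x. C x \<partial>M) = (\<integral>x. A x - B x - h *\<^sub>R C x \<partial>M)"
        if "integrable M A" "integrable M B" "integrable M C" for A B C :: "'a \<Rightarrow> complex"
        using that by simp
      from this[OF ie ie iv] show ?thesis .
    qed
    also have "norm (\<integral>x. iexp ((t + h) * v x) - iexp (t * v x) - h *\<^sub>R (\<i> * complex_of_real (v x) * iexp (t * v x)) \<partial>M) \<le> (\<integral>x. h\<^sup>2 * ((v x)\<^sup>2 / 2) \<partial>M)"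
    proof (rule order_trans[OF Bochner_Integration.integral_norm_bound], rule integral_mono)
      fix x
      have "iexp ((t + h) * v x) - iexp (t * v x) - h *\<^sub>R (\<i> * complex_of_real (v x) * iexp (t * v x))
         = iexp (t * v x) * (iexp (h * v x) - (1 + \<i> * complex_of_real (h * v x)))"
        by (simp add: algebra_simps exp_add scaleR_conv_of_real)
      then have "norm (iexp ((t + h) * v x) - iexp (t * v x) - h *\<^sub>R (\<i> * complex_of_real (v x) * iexp (t * v x)))
         = norm (iexp (h * v x) - (1 + \<i> * complex_of_real (h * v x)))"
        by (simp only: norm_mult norm_exp_i_times mult_1)
      also have "\<dots> \<le> (h * v x)\<^sup>2 / 2"
        using iexp_approx1[of "h * v x" 1] by (simp add: power2_eq_square abs_mult[symmetric])
      finally show "norm (iexp ((t + h) * v x) - iexp (t * v x) - h *\<^sub>R (\<i> * complex_of_real (v x) * iexp (t * v x))) \<le> h\<^sup>2 * ((v x)\<^sup>2 / 2)"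
        by (simp add: power_mult_distrib)
    next
      show "integrable M (\<lambda>x. norm (iexp ((t + h) * v x) - iexp (t * v x) - h *\<^sub>R (\<i> * complex_of_real (v x) * iexp (t * v x))))"
        by (intro integrable_norm Bochner_Integration.integrable_diff ie integrable_scaleR_right iv)
    qed (use i2 in simp)
    also have "\<dots> = h\<^sup>2 * (expectation (\<lambda>x. (v x)\<^sup>2) / 2)" using i2 by simp
    finally show ?thesis .
  qed
  show ?thesis unfolding has_vector_derivative_def has_derivative_at
  proof
    show "bounded_linear (\<lambda>h. h *\<^sub>R ?D)" by (rule bounded_linear_scaleR_left)
    show "(\<lambda>h. norm ((\<integral>x. iexp ((t + h) * v x) \<partial>M) - (\<integral>x. iexp (t * v x) \<partial>M) - h *\<^sub>R ?D) / norm h) \<midarrow>0\<rightarrow> 0"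
    proof (rule Lim_null_comparison)
      show "\<forall>\<^sub>F h in at 0. norm (norm ((\<integral>x. iexp ((t + h) * v x) \<partial>M) - (\<integral>x. iexp (t * v x) \<partial>M) - h *\<^sub>R ?D) / norm h) \<le> \<bar>h\<bar> * (expectation (\<lambda>x. (v x)\<^sup>2) / 2)"
        unfolding eventually_at_filter
      proof (intro always_eventually allI impI)
        fix h :: real assume h: "h \<noteq> 0"
        have "norm ((\<integral>x. iexp ((t + h) * v x) \<partial>M) - (\<integral>x. iexp (t * v x) \<partial>M) - h *\<^sub>R ?D) / \<bar>h\<bar> \<le> h\<^sup>2 * (expectation (\<lambda>x. (v x)\<^sup>2) / 2) / \<bar>h\<bar>"
          by (rule divide_right_mono[OF bound]) simp
        also have "h\<^sup>2 * (expectation (\<lambda>x. (v x)\<^sup>2) / 2) / \<bar>h\<bar> = \<bar>h\<bar> * (expectation (\<lambda>x. (v x)\<^sup>2) / 2)"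
          using h by (cases "h > 0") (simp_all add: power2_eq_square)
        finally show "norm (norm ((\<integral>x. iexp ((t + h) * v x) \<partial>M) - (\<integral>x. iexp (t * v x) \<partial>M) - h *\<^sub>R ?D) / norm h) \<le> \<bar>h\<bar> * (expectation (\<lambda>x. (v x)\<^sup>2) / 2)"
          by simp
      qed
      have "((\<lambda>h::real. \<bar>h\<bar> * (expectation (\<lambda>x. (v x)\<^sup>2) / 2)) \<longlongrightarrow> \<bar>0\<bar> * (expectation (\<lambda>x. (v x)\<^sup>2) / 2)) (at 0)"
        by (intro tendsto_intros)
      then show "((\<lambda>h::real. \<bar>h\<bar> * (expectation (\<lambda>x. (v x)\<^sup>2) / 2)) \<longlongrightarrow> 0) (at 0)" by simp
    qed
  qed
qed

text \<open>The Stein identity makes the characteristic function of \<open>(x\<^sup>2 - \<kappa>) / s\<close>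
  an approximate solution of the Gaussian differential equation with \<open>a = 2 \<kappa> / s\<^sup>2\<close>.
  This gives the central limit theorem for chi-square variables with an arbitrary real number of degrees of
  freedom, where a sum of independent squares is not available.\<close>

lemma chi_square_char_estimate:
  assumes k: "\<kappa> > 0" and prob: "prob_space (chi_measure \<kappa>)" and s: "s > 0"
  shows "norm ((\<integral>x. iexp (t * ((x\<^sup>2 - \<kappa>) / s)) \<partial>chi_measure \<kappa>) - complex_of_real (exp (- (2 * \<kappa> / s\<^sup>2 * t\<^sup>2 / 2))))
     \<le> (1 + 2 * \<kappa> / s\<^sup>2) / s * t\<^sup>2"
proof -
  interpret N: prob_space "chi_measure \<kappa>" by fact
  define v where "v x = (x\<^sup>2 - \<kappa>) / s" for x :: real
  have [measurable]: "v \<in> borel_measurable borel" unfolding v_def [abs_def] by measurable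
  have c2: "(\<integral>x. (x\<^sup>2 - \<kappa>)\<^sup>2 \<partial>chi_measure \<kappa>) = 2 * \<kappa>"
  proof -
    have c1: "(\<integral>x. (x\<^sup>2 - \<kappa>) \<partial>chi_measure \<kappa>) = 0" using chi_central_recurrence[OF k, of 0] by simp
    show ?thesis using chi_central_recurrence[OF k, of 1] c1 N.prob_space by (simp add: numeral_2_eq_2)
  qed
  have i2: "integrable (chi_measure \<kappa>) (\<lambda>x. (v x)\<^sup>2)"
    unfolding v_def power_divide using chi_central_integrable[OF k, of 2] by simp
  have E2: "(\<integral>x. (v x)\<^sup>2 \<partial>chi_measure \<kappa>) = 2 * \<kappa> / s\<^sup>2"
    unfolding v_def power_divide using c2 by simp
  have i1: "integrable (chi_measure \<kappa>) v" by (rule N.square_integrable_imp_integrable[OF _ i2]) measurable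
  have iabs: "(\<integral>x. \<bar>v x\<bar> \<partial>chi_measure \<kappa>) \<le> (1 + 2 * \<kappa> / s\<^sup>2) / 2"
  proof -
    have "(\<integral>x. \<bar>v x\<bar> \<partial>chi_measure \<kappa>) \<le> (\<integral>x. (1 + (v x)\<^sup>2) / 2 \<partial>chi_measure \<kappa>)"
    proof (rule integral_mono)
      show "\<bar>v x\<bar> \<le> (1 + (v x)\<^sup>2) / 2" for x using sum_squares_bound[of 1 "\<bar>v x\<bar>"] by simp
    qed (use i1 i2 in auto)
    also have "\<dots> = (1 + 2 * \<kappa> / s\<^sup>2) / 2" using i2 E2 N.prob_space by simp
    finally show ?thesis .
  qed
  define \<phi> where "\<phi> t = (\<integral>x. iexp (t * v x) \<partial>chi_measure \<kappa>)" for t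
  define J where "J t = (\<integral>x. complex_of_real (v x) * iexp (t * v x) \<partial>chi_measure \<kappa>)" for t
  have ie: "integrable (chi_measure \<kappa>) (\<lambda>x. iexp (t * v x))" for t
    by (rule N.integrable_const_bound[of _ 1]) auto
  have iv: "integrable (chi_measure \<kappa>) (\<lambda>x. complex_of_real (v x) * iexp (t * v x))" for t
    by (rule Bochner_Integration.integrable_bound[OF i1]) (auto simp: norm_mult)
  have der: "(\<phi> has_vector_derivative \<i> * J t) (at t)" for t
    using N.characteristic_integral_derivative[OF _ i2, of t] iv[of t] unfolding \<phi>_def [abs_def] J_def
    by (simp add: mult.assoc)
  have stein: "complex_of_real s * J t = 2 * \<i> * complex_of_real (t / s) * (complex_of_real s * J t + complex_of_real \<kappa> * \<phi> t)" for t
  proof -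
    have "(\<integral>x. (x\<^sup>2 - \<kappa>) *\<^sub>R iexp (t * v x) - x *\<^sub>R (\<i> * complex_of_real (t * (2 * x / s)) * iexp (t * v x)) \<partial>chi_measure \<kappa>) = 0"
    proof (rule chi_measure_stein[OF k, where p = 1 and C = "1 + 2 * \<bar>t\<bar> / s"])
      show "((\<lambda>x. iexp (t * v x)) has_vector_derivative \<i> * complex_of_real (t * (2 * x / s)) * iexp (t * v x)) (at x)" for x
      proof -
        have "((\<lambda>x. t * v x) has_real_derivative t * (2 * x / s)) (at x)"
          unfolding v_def using s by (auto intro!: derivative_eq_intros)
        then have "((\<lambda>x. \<i> * complex_of_real (t * v x)) has_vector_derivative \<i> * complex_of_real (t * (2 * x / s))) (at x)"
          by (intro has_vector_derivative_mult_right has_vector_derivative_of_real)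
        from field_vector_diff_chain_at[OF this DERIV_exp] show ?thesis by (simp add: o_def)
      qed
      show "continuous_on UNIV (\<lambda>x. \<i> * complex_of_real (t * (2 * x / s)) * iexp (t * v x))"
        unfolding v_def by (intro continuous_intros) (use s in auto)
      fix x :: real assume x: "x > 0"
      show "norm (iexp (t * v x)) \<le> (1 + 2 * \<bar>t\<bar> / s) * (1 + x) ^ 1"
        using x s by (simp add: mult_ge1_I)
      have "norm (\<i> * complex_of_real (t * (2 * x / s)) * iexp (t * v x)) = (2 * \<bar>t\<bar> / s) * x"
        unfolding norm_mult norm_of_real norm_exp_i_times using x s by (simp add: abs_mult)
      also have "\<dots> \<le> (1 + 2 * \<bar>t\<bar> / s) * (1 + x)" using x s by (intro mult_mono) auto
      finally show "norm (\<i> * complex_of_real (t * (2 * x / s)) * iexp (t * v x)) \<le> (1 + 2 * \<bar>t\<bar> / s) * (1 + x) ^ 1" by simp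
    qed
    also have "(\<lambda>x. (x\<^sup>2 - \<kappa>) *\<^sub>R iexp (t * v x) - x *\<^sub>R (\<i> * complex_of_real (t * (2 * x / s)) * iexp (t * v x)))
      = (\<lambda>x. complex_of_real s * (complex_of_real (v x) * iexp (t * v x)) - 2 * \<i> * complex_of_real (t / s) * (complex_of_real s * (complex_of_real (v x) * iexp (t * v x)) + complex_of_real \<kappa> * iexp (t * v x)))"
    proof
      fix x
      have 1: "x\<^sup>2 = s * v x + \<kappa>" using s by (simp add: v_def)
      have "x *\<^sub>R (\<i> * complex_of_real (t * (2 * x / s)) * iexp (t * v x)) = 2 * \<i> * complex_of_real (t / s) * (complex_of_real (x\<^sup>2) * iexp (t * v x))"
        by (simp add: scaleR_conv_of_real power2_eq_square)
      then show "(x\<^sup>2 - \<kappa>) *\<^sub>R iexp (t * v x) - x *\<^sub>R (\<i> * complex_of_real (t * (2 * x / s)) * iexp (t * v x))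
        = complex_of_real s * (complex_of_real (v x) * iexp (t * v x)) - 2 * \<i> * complex_of_real (t / s) * (complex_of_real s * (complex_of_real (v x) * iexp (t * v x)) + complex_of_real \<kappa> * iexp (t * v x))"
        unfolding 1 by (simp add: scaleR_conv_of_real algebra_simps)
    qed
    also have "(\<integral>x. complex_of_real s * (complex_of_real (v x) * iexp (t * v x)) - 2 * \<i> * complex_of_real (t / s) * (complex_of_real s * (complex_of_real (v x) * iexp (t * v x)) + complex_of_real \<kappa> * iexp (t * v x)) \<partial>chi_measure \<kappa>)
       = complex_of_real s * J t - 2 * \<i> * complex_of_real (t / s) * (complex_of_real s * J t + complex_of_real \<kappa> * \<phi> t)"
    proof -
      have "(\<integral>x. a * A x - b * (a * A x + c * B x) \<partial>N) = a * (\<integral>x. A x \<partial>N) - b * (a * (\<integral>x. A x \<partial>N) + c * (\<integral>x. B x \<partial>N))"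
        if "integrable N A" "integrable N B" for N :: "real measure" and A B and a b c :: complex
        using that by simp
      from this[OF iv ie] show ?thesis unfolding \<phi>_def J_def .
    qed
    finally show ?thesis by simp
  qed
  have "norm (\<phi> t - complex_of_real (exp (- (2 * \<kappa> / s\<^sup>2 * t\<^sup>2 / 2)))) \<le> (1 + 2 * \<kappa> / s\<^sup>2) / s * t\<^sup>2"
  proof (rule gaussian_ode_perturbation[OF der])
    show "\<phi> 0 = 1" by (simp add: \<phi>_def N.prob_space[unfolded space_chi_measure])
    show "0 \<le> 2 * \<kappa> / s\<^sup>2" "0 \<le> (1 + 2 * \<kappa> / s\<^sup>2) / s" using k s by auto
    fix t
    have J: "J t = 2 * \<i> * complex_of_real (t / s) * (J t + complex_of_real (\<kappa> / s) * \<phi> t)"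
    proof -
      have "complex_of_real s * J t = complex_of_real s * (2 * \<i> * complex_of_real (t / s) * (J t + complex_of_real (\<kappa> / s) * \<phi> t))"
        using s by (subst stein) (simp add: field_simps)
      then show ?thesis using s by (subst (asm) mult_cancel_left) simp
    qed
    have "\<i> * J t + complex_of_real (2 * \<kappa> / s\<^sup>2 * t) * \<phi> t = - (complex_of_real (2 * t / s) * J t)"
    proof -
      have "\<i> * J t = \<i> * (2 * \<i> * complex_of_real (t / s) * (J t + complex_of_real (\<kappa> / s) * \<phi> t))"
        by (subst J) (rule refl)
      also have "\<dots> = (\<i> * \<i>) * (complex_of_real (2 * t / s) * J t + complex_of_real (2 * t / s * (\<kappa> / s)) * \<phi> t)"
      proof -
        have c: "complex_of_real (2 * t / s) = 2 * complex_of_real (t / s)"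
          "complex_of_real (2 * t / s * (\<kappa> / s)) = 2 * complex_of_real (t / s) * complex_of_real (\<kappa> / s)" by simp_all
        have "i * (2 * i * T * (L + K * P)) = (i * i) * (2 * T * L + 2 * T * K * P)" for i T L K P :: complex
          by (simp add: algebra_simps)
        then show ?thesis unfolding c .
      qed
      also have "2 * t / s * (\<kappa> / s) = 2 * \<kappa> / s\<^sup>2 * t" by (simp add: power2_eq_square)
      finally have iJ: "\<i> * J t = (\<i> * \<i>) * (complex_of_real (2 * t / s) * J t + complex_of_real (2 * \<kappa> / s\<^sup>2 * t) * \<phi> t)" .
      have "(\<i> * \<i>) * (A + B) + B = - A" for A B :: complex by simp
      then show ?thesis by (simp only: iJ)
    qed
    then have "norm (\<i> * J t + complex_of_real (2 * \<kappa> / s\<^sup>2 * t) * \<phi> t) = 2 * \<bar>t\<bar> / s * norm (J t)"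
      using s by (simp add: norm_mult norm_divide abs_mult)
    also have "\<dots> \<le> 2 * \<bar>t\<bar> / s * ((1 + 2 * \<kappa> / s\<^sup>2) / 2)"
    proof (rule mult_left_mono)
      have "norm (J t) \<le> (\<integral>x. norm (complex_of_real (v x) * iexp (t * v x)) \<partial>chi_measure \<kappa>)"
        unfolding J_def by (rule Bochner_Integration.integral_norm_bound)
      also have "\<dots> = (\<integral>x. \<bar>v x\<bar> \<partial>chi_measure \<kappa>)"
        by (simp only: norm_mult norm_exp_i_times norm_of_real mult_1_right)
      also note iabs
      finally show "norm (J t) \<le> (1 + 2 * \<kappa> / s\<^sup>2) / 2" .
    qed (use s in simp)
    also have "\<dots> = (1 + 2 * \<kappa> / s\<^sup>2) / s * \<bar>t\<bar>"
    proof -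
      have "2 * b / s * (a / 2) = a / s * b" for a b :: real by simp
      then show ?thesis .
    qed
    finally show "norm (\<i> * J t + complex_of_real (2 * \<kappa> / s\<^sup>2 * t) * \<phi> t) \<le> (1 + 2 * \<kappa> / s\<^sup>2) / s * \<bar>t\<bar>" .
  qed
  then show ?thesis unfolding \<phi>_def v_def .
qed

section \<open>Chebyshev polynomials and the semicircle distribution\<close>
text \<open>The Chebyshev polynomials of the second kind at \<open>x / 2\<close>.\<close>

fun chebU :: "nat \<Rightarrow> real \<Rightarrow> real" where
  "chebU 0 x = 1"
| "chebU (Suc 0) x = x"
| "chebU (Suc (Suc m)) x = x * chebU (Suc m) x - chebU m x"

lemma continuous_on_chebU [continuous_intros]: "continuous_on S (chebU m)"
proof -
  have "continuous_on S (chebU m) \<and> continuous_on S (chebU (Suc m))"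
    by (induction m) (auto intro!: continuous_intros simp: fun_eq_iff[symmetric] simp del: chebU.simps simp: chebU.simps[abs_def])
  then show ?thesis ..
qed

lemma borel_measurable_chebU [measurable]: "chebU m \<in> borel_measurable borel"
  by (intro borel_measurable_continuous_onI continuous_on_chebU)

lemma mult_chebU_Suc: "x * chebU (Suc m) x = chebU (Suc (Suc m)) x + chebU m x" by simp

lemma chebU_cos: "chebU m (2 * cos t) * sin t = sin (real (Suc m) * t)"
proof (induction m rule: induct_nat_012)
  case 0
  show ?case by simp
next
  case 1
  have "chebU (Suc 0) (2 * cos t) * sin t = sin (2 * t)" unfolding sin_double by simp
  then show ?case by simp
next
  case (ge2 m)
  have "sin (real (Suc (Suc (Suc m))) * t) + sin (real (Suc m) * t) = 2 * cos t * sin (real (Suc (Suc m)) * t)"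
  proof -
    define u where "u = real (Suc (Suc m)) * t"
    have "real (Suc (Suc (Suc m))) * t = u + t" "real (Suc m) * t = u - t" by (simp_all add: u_def algebra_simps)
    then show ?thesis unfolding u_def[symmetric] by (simp add: sin_add sin_diff)
  qed
  moreover have "chebU (Suc (Suc m)) (2 * cos t) * sin t = 2 * cos t * (chebU (Suc m) (2 * cos t) * sin t) - chebU m (2 * cos t) * sin t"
    by (simp add: algebra_simps)
  ultimately show ?case using ge2 by simp
qed

lemma integral_cos_multiple:
  "((\<lambda>t. cos (real_of_int k * (pi - t))) has_integral (if k = 0 then pi else 0)) {0..pi}"
proof (cases "k = 0")
  case True
  then show ?thesis using has_integral_const_real[of "1::real" 0 pi] by simp
next
  case False
  have "((\<lambda>t. cos (real_of_int k * (pi - t))) has_integral (- sin (real_of_int k * (pi - pi)) / k) - (- sin (real_of_int k * (pi - 0)) / k)) {0..pi}"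
  proof (rule fundamental_theorem_of_calculus)
    show "((\<lambda>t. - sin (real_of_int k * (pi - t)) / k) has_vector_derivative cos (real_of_int k * (pi - t))) (at t within {0..pi})" for t
      unfolding has_real_derivative_iff_has_vector_derivative[symmetric]
      using False by (auto intro!: derivative_eq_intros)
  qed simp
  then show ?thesis using False sin_int_times_real[of k] by (simp add: sin_integer_2pi mult.commute)
qed

text \<open>With \<open>x = 2 cos u\<close> the integrand becomes \<open>sin ((m + 1) u) sin ((l + 1)
  u)\<close> up to a constant.  The substitution is carried out for \<open>x = - 2 cos t\<close>, \<open>t =
  \<pi> - u\<close>, which is increasing.\<close>

lemma chebU_semicircle_integral:
  "((\<lambda>x. sqrt (4 - x\<^sup>2) / (2 * pi) * (chebU m x * chebU l x)) has_integral (if m = l then 1 else 0)) {-2..2}"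
proof -
  define F where "F x = sqrt (4 - x\<^sup>2) / (2 * pi) * (chebU m x * chebU l x)" for x
  have cont: "continuous_on {-2..2} F"
    unfolding F_def by (intro continuous_intros) auto
  have sub: "((\<lambda>t. (2 * sin t) *\<^sub>R F (- 2 * cos t)) has_integral (integral {- 2 * cos 0..- 2 * cos pi} F)) {0..pi}"
  proof (rule has_integral_substitution[where c = "-2" and d = 2])
    show "(\<lambda>t. - 2 * cos t) ` {0..pi} \<subseteq> {- 2..2}"
    proof
      fix y assume "y \<in> (\<lambda>t. - 2 * cos t) ` {0..pi}"
      then obtain t where "y = - 2 * cos t" by blast
      then show "y \<in> {-2..2}" by (simp only: atLeastAtMost_iff) (use cos_le_one[of t] cos_ge_minus_one[of t] in linarith)
    qed
    show "((\<lambda>t. - 2 * cos t) has_real_derivative 2 * sin t) (at t within {0..pi})" for t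
      by (auto intro!: derivative_eq_intros)
  qed (use cont in auto)
  have eq: "(2 * sin t) *\<^sub>R F (- 2 * cos t) = 1 / pi * (cos (real_of_int (int m - int l) * (pi - t)) - cos (real_of_int (int m + int l + 2) * (pi - t)))"
    if t: "t \<in> {0..pi}" for t
  proof -
    define u where "u = pi - t"
    have su: "sin u = sin t" "2 * cos u = - 2 * cos t" by (simp_all add: u_def sin_diff cos_diff)
    have s0: "sin u \<ge> 0" unfolding su using t by (intro sin_ge_zero) auto
    have "4 - (- 2 * cos t)\<^sup>2 = (2 * sin u)\<^sup>2"
      unfolding su(1) by (simp add: power_mult_distrib sin_squared_eq)
    then have sq: "sqrt (4 - (- 2 * cos t)\<^sup>2) = 2 * sin u"
      by (intro real_sqrt_unique) (use s0 in simp_all)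
    have "(2 * sin t) *\<^sub>R F (- 2 * cos t) = 2 / pi * ((chebU m (2 * cos u) * sin u) * (chebU l (2 * cos u) * sin u))"
      unfolding F_def sq su(2) su(1)[symmetric] by (simp add: algebra_simps)
    also have "\<dots> = 2 / pi * (sin (real (Suc m) * u) * sin (real (Suc l) * u))" unfolding chebU_cos ..
    also have "sin (real (Suc m) * u) * sin (real (Suc l) * u) = (cos (real (Suc m) * u - real (Suc l) * u) - cos (real (Suc m) * u + real (Suc l) * u)) / 2"
      by (rule sin_times_sin)
    also have "real (Suc m) * u - real (Suc l) * u = real_of_int (int m - int l) * u" by (simp add: algebra_simps)
    also have "real (Suc m) * u + real (Suc l) * u = real_of_int (int m + int l + 2) * u" by (simp add: algebra_simps)
    finally have e: "(2 * sin t) *\<^sub>R F (- 2 * cos t) = 2 / pi * ((cos (real_of_int (int m - int l) * u) - cos (real_of_int (int m + int l + 2) * u)) / 2)" .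
    have "2 / pi * (X / 2) = 1 / pi * X" for X :: real by simp
    then show ?thesis unfolding u_def[symmetric] e .
  qed
  have "((\<lambda>t. 1 / pi * (cos (real_of_int (int m - int l) * (pi - t)) - cos (real_of_int (int m + int l + 2) * (pi - t)))) has_integral
     1 / pi * ((if int m - int l = 0 then pi else 0) - (if int m + int l + 2 = 0 then pi else 0))) {0..pi}"
    by (intro has_integral_mult_right has_integral_diff integral_cos_multiple)
  then have "((\<lambda>t. (2 * sin t) *\<^sub>R F (- 2 * cos t)) has_integral (if m = l then 1 else 0)) {0..pi}"
    by (subst has_integral_cong[OF eq]) (auto simp: if_distrib split: if_splits)
  with sub have "integral {-2..2} F = (if m = l then 1 else 0)" by (simp add: has_integral_unique)
  moreover have "F integrable_on {-2..2}" using cont by (rule integrable_continuous_real)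
  ultimately show ?thesis unfolding F_def[abs_def, symmetric] by (simp add: has_integral_iff)
qed

lemma sets_semicircle [simp, measurable_cong]: "sets semicircle = sets borel"
  and space_semicircle [simp]: "space semicircle = UNIV"
  by (simp_all add: semicircle_def)

lemma semicircle_density_nonneg: "0 \<le> indicator {-2..2} x * sqrt (4 - x\<^sup>2) / (2 * pi :: real)"
proof (cases "x \<in> {-2..2}")
  case True
  then have "x\<^sup>2 \<le> 2\<^sup>2" by (intro power2_le_iff_abs_le[THEN iffD2]) auto
  then show ?thesis by simp
qed simp

lemma semicircle_integral_eq:
  fixes f :: "real \<Rightarrow> real"
  assumes f: "continuous_on UNIV f"
  shows "integrable semicircle f" and "(\<integral>x. f x \<partial>semicircle) = integral {-2..2} (\<lambda>x. sqrt (4 - x\<^sup>2) / (2 * pi) * f x)"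
proof -
  have [measurable]: "f \<in> borel_measurable borel" using f by (rule borel_measurable_continuous_onI)
  have c: "continuous_on {-2..2} (\<lambda>x. sqrt (4 - x\<^sup>2) / (2 * pi) * f x)"
    by (intro continuous_intros continuous_on_subset[OF f]) auto
  have si: "set_integrable lborel {-2..2} (\<lambda>x. sqrt (4 - x\<^sup>2) / (2 * pi) * f x)"
    by (rule borel_integrable_atLeastAtMost'[OF c])
  have eq: "(\<lambda>x. (indicator {-2..2} x * sqrt (4 - x\<^sup>2) / (2 * pi)) *\<^sub>R f x) = (\<lambda>x. indicator {-2..2} x *\<^sub>R (sqrt (4 - x\<^sup>2) / (2 * pi) * f x))"
    by (auto simp: fun_eq_iff)
  show "integrable semicircle f"
  proof -
    have "integrable semicircle f \<longleftrightarrow> integrable lborel (\<lambda>x. (indicator {-2..2} x * sqrt (4 - x\<^sup>2) / (2 * pi)) *\<^sub>R f x)"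
      unfolding semicircle_def by (rule integrable_density) (use semicircle_density_nonneg in auto)
    then show ?thesis unfolding eq using si[unfolded set_integrable_def] by (simp only:)
  qed
  have "(\<integral>x. f x \<partial>semicircle) = (LBINT x:{-2..2}. sqrt (4 - x\<^sup>2) / (2 * pi) * f x)"
    unfolding semicircle_def set_lebesgue_integral_def eq[symmetric]
    by (rule integral_density) (use semicircle_density_nonneg in auto)
  then show "(\<integral>x. f x \<partial>semicircle) = integral {-2..2} (\<lambda>x. sqrt (4 - x\<^sup>2) / (2 * pi) * f x)"
    using set_borel_integral_eq_integral(2)[OF si] by simp
qed

lemma chebU_orthonormal: "(\<integral>x. chebU m x * chebU l x \<partial>semicircle) = (if m = l then 1 else 0)"
  by (subst semicircle_integral_eq(2)) (intro continuous_intros, rule integral_unique[OF chebU_semicircle_integral])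

lemma semicircle_chebU: "(\<integral>x. chebU m x \<partial>semicircle) = (if m = 0 then 1 else 0)"
  using chebU_orthonormal[of m 0] by simp

lemma AE_semicircle: "AE x in semicircle. \<bar>x\<bar> \<le> 2"
  unfolding semicircle_def by (subst AE_density) (auto intro!: AE_I2 simp: indicator_def)

text \<open>The normalization is the orthonormality relation for \<open>U\<^sub>0\<close>.\<close>

lemma prob_space_semicircle: "prob_space semicircle"
proof
  have "(\<integral>\<^sup>+x. ennreal (chebU 0 x) \<partial>semicircle) = ennreal (\<integral>x. chebU 0 x \<partial>semicircle)"
    by (rule nn_integral_eq_integral[OF semicircle_integral_eq(1)]) (auto intro!: continuous_intros)
  then show "emeasure semicircle (space semicircle) = 1" by (simp only: semicircle_chebU) simp
qed

lemma real_distribution_semicircle: "real_distribution semicircle"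
  using prob_space_semicircle by (simp add: real_distribution_def real_distribution_axioms_def)

text \<open>The bound \<open>d\<close> is part of the notion so that finitely many coefficients describe the
  polynomial.\<close>

definition cheb_span :: "nat \<Rightarrow> (real \<Rightarrow> real) \<Rightarrow> bool" where
  "cheb_span d f \<longleftrightarrow> (\<exists>\<alpha>. \<forall>x. f x = (\<Sum>m\<le>d. \<alpha> m * chebU m x))"

lemma cheb_span_add: "cheb_span d f \<Longrightarrow> cheb_span d g \<Longrightarrow> cheb_span d (\<lambda>x. f x + g x)"
  unfolding cheb_span_def
proof (elim exE)
  fix \<alpha> \<beta> assume "\<forall>x. f x = (\<Sum>m\<le>d. \<alpha> m * chebU m x)" "\<forall>x. g x = (\<Sum>m\<le>d. \<beta> m * chebU m x)"
  then show "\<exists>\<alpha>. \<forall>x. f x + g x = (\<Sum>m\<le>d. \<alpha> m * chebU m x)"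
    by (intro exI[of _ "\<lambda>m. \<alpha> m + \<beta> m"]) (simp add: ring_distribs sum.distrib)
qed

lemma cheb_span_cmult: "cheb_span d f \<Longrightarrow> cheb_span d (\<lambda>x. c * f x)"
  unfolding cheb_span_def
proof (elim exE)
  fix \<alpha> assume "\<forall>x. f x = (\<Sum>m\<le>d. \<alpha> m * chebU m x)"
  then show "\<exists>\<alpha>. \<forall>x. c * f x = (\<Sum>m\<le>d. \<alpha> m * chebU m x)"
    by (intro exI[of _ "\<lambda>m. c * \<alpha> m"]) (simp add: sum_distrib_left mult.assoc)
qed

lemma cheb_span_chebU: "m \<le> d \<Longrightarrow> cheb_span d (chebU m)"
  unfolding cheb_span_def
  by (intro exI[of _ "\<lambda>i. if i = m then 1 else 0"]) (auto simp: if_distrib[of "\<lambda>c. c * _"] cong: if_cong)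

lemma cheb_span_sum:
  assumes "\<And>i. i \<in> A \<Longrightarrow> cheb_span d (f i)" "finite A"
  shows "cheb_span d (\<lambda>x. \<Sum>i\<in>A. f i x)"
  using assms(2,1)
proof (induction A rule: finite_induct)
  case empty
  have "cheb_span d (\<lambda>x. 0 * chebU 0 x)" by (intro cheb_span_cmult cheb_span_chebU) simp
  then show ?case by simp
qed (simp add: cheb_span_add)

lemma cheb_span_times_x:
  assumes "cheb_span d f"
  shows "cheb_span (Suc d) (\<lambda>x. x * f x)"
proof -
  obtain \<alpha> where a: "\<And>x. f x = (\<Sum>m\<le>d. \<alpha> m * chebU m x)" using assms unfolding cheb_span_def by blast
  have x: "cheb_span (Suc d) (\<lambda>x. x * chebU m x)" if "m \<le> d" for m
  proof (cases m)
    case 0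
    have "cheb_span (Suc d) (chebU (Suc 0))" by (rule cheb_span_chebU) simp
    then show ?thesis using 0 by (simp add: cheb_span_def)
  next
    case (Suc i)
    have "cheb_span (Suc d) (\<lambda>x. chebU (Suc (Suc i)) x + chebU i x)"
      by (intro cheb_span_add cheb_span_chebU) (use Suc that in auto)
    then show ?thesis unfolding Suc mult_chebU_Suc .
  qed
  have "cheb_span (Suc d) (\<lambda>x. \<Sum>m\<in>{..d}. \<alpha> m * (x * chebU m x))"
    by (intro cheb_span_sum cheb_span_cmult x) auto
  then show ?thesis by (simp add: a sum_distrib_left mult.left_commute)
qed

lemma cheb_span_mono: "cheb_span d f \<Longrightarrow> d \<le> e \<Longrightarrow> cheb_span e f"
proof -
  assume "cheb_span d f" "d \<le> e"
  then obtain \<alpha> where "f = (\<lambda>x. \<Sum>m\<in>{..d}. \<alpha> m * chebU m x)" unfolding cheb_span_def by blast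
  moreover have "cheb_span e (\<lambda>x. \<Sum>m\<in>{..d}. \<alpha> m * chebU m x)"
    by (intro cheb_span_sum cheb_span_cmult cheb_span_chebU) (use \<open>d \<le> e\<close> in auto)
  ultimately show ?thesis by simp
qed

lemma psum_cheb_span: "cheb_span d (psum c d)"
proof -
  have pw: "cheb_span m (\<lambda>x. x ^ m)" for m
  proof (induction m)
    case 0
    show ?case using cheb_span_chebU[of 0 0] by (simp add: cheb_span_def)
  next
    case (Suc m)
    then show ?case using cheb_span_times_x by simp
  qed
  have "cheb_span d (\<lambda>x. \<Sum>m\<in>{..d}. c m * x ^ m)"
    by (intro cheb_span_sum cheb_span_cmult) (auto intro: cheb_span_mono[OF pw])
  then show ?thesis by (simp add: psum_def [abs_def])
qed

section \<open>From Chebyshev polynomials to continuous functions\<close>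
lemma spec_cmult: "spec n A (\<lambda>x. c * f x) = c * spec n A f"
  by (simp add: spec_def sum_distrib_left mult.left_commute)

lemma spec_add: "spec n A (\<lambda>x. f x + g x) = spec n A f + spec n A g"
  by (simp add: spec_def distrib_left sum.distrib)

lemma spec_sum: "spec n A (\<lambda>x. \<Sum>i\<in>I. f i x) = (\<Sum>i\<in>I. spec n A (f i))"
  unfolding spec_def sum_distrib_left by (rule sum.swap)

lemma spec_mono: "(\<And>x. f x \<le> g x) \<Longrightarrow> spec n A f \<le> spec n A g"
  unfolding spec_def by (intro sum_mono mult_left_mono) auto

lemma spec_abs: "\<bar>spec n A f\<bar> \<le> spec n A (\<lambda>x. \<bar>f x\<bar>)"
  unfolding spec_def by (rule order_trans[OF sum_abs]) (simp add: abs_mult)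

lemma spec_const:
  assumes "\<And>r c. A r c = A c r" "n > 0"
  shows "spec n A (\<lambda>_. c) = c"
  using eigensystem_weights[OF eigensystem_eig[of A n, OF assms(1)] assms(2)]
  by (simp add: spec_def sum_distrib_right[symmetric])

lemma psum_growth: "\<bar>x\<bar> \<ge> 1 \<Longrightarrow> \<bar>psum c d x\<bar> \<le> (\<Sum>m\<le>d. \<bar>c m\<bar>) * \<bar>x\<bar> ^ d"
proof -
  assume x: "\<bar>x\<bar> \<ge> 1"
  have "\<bar>psum c d x\<bar> \<le> (\<Sum>m\<le>d. \<bar>c m * x ^ m\<bar>)" unfolding psum_def by (rule sum_abs)
  also have "\<dots> \<le> (\<Sum>m\<le>d. \<bar>c m\<bar> * \<bar>x\<bar> ^ d)"
    using x by (intro sum_mono) (auto simp: abs_mult power_abs intro!: mult_left_mono power_increasing)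
  finally show ?thesis by (simp add: sum_distrib_right)
qed

text \<open>The polynomially bounded part outside \<open>[-3, 3]\<close> is dominated by a high even power,
  whose semicircle integral is small because \<open>2 < 3\<close>.  The constants \<open>K\<close> and
  \<open>D\<close> must not depend on \<open>r\<close>, which is chosen last.\<close>

lemma tail_domination:
  assumes g: "\<And>x. \<bar>x\<bar> \<le> 3 \<Longrightarrow> \<bar>g x\<bar> \<le> e" and e: "e \<ge> 0"
    and growth: "\<And>x. \<bar>g x\<bar> \<le> \<bar>psum c d x\<bar> + \<bar>psum c' d' x\<bar>"
  shows "\<exists>K\<ge>0. \<exists>D. \<forall>x r. \<bar>g x\<bar> \<le> e + K * (x ^ (2 * D) * (x / 3) ^ (2 * r))"
proof -
  define K where "K = (\<Sum>m\<le>d. \<bar>c m\<bar>) + (\<Sum>m\<le>d'. \<bar>c' m\<bar>)"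
  define D where "D = d + d'"
  have K: "K \<ge> 0" by (auto simp: K_def intro!: add_nonneg_nonneg sum_nonneg)
  have "\<bar>g x\<bar> \<le> e + K * (x ^ (2 * D) * (x / 3) ^ (2 * r))" for x r
  proof (cases "\<bar>x\<bar> \<le> 3")
    case True
    have "0 \<le> K * (x ^ (2 * D) * (x / 3) ^ (2 * r))" using K by (intro mult_nonneg_nonneg zero_le_even_power) auto
    then show ?thesis using g[OF True] by linarith
  next
    case False
    then have x: "\<bar>x\<bar> > 3" by simp
    have "\<bar>psum c d x\<bar> \<le> (\<Sum>m\<le>d. \<bar>c m\<bar>) * \<bar>x\<bar> ^ (2 * D)"
      by (rule order_trans[OF psum_growth]) (use x in \<open>auto simp: D_def intro!: mult_left_mono power_increasing sum_nonneg\<close>)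
    moreover have "\<bar>psum c' d' x\<bar> \<le> (\<Sum>m\<le>d'. \<bar>c' m\<bar>) * \<bar>x\<bar> ^ (2 * D)"
      by (rule order_trans[OF psum_growth]) (use x in \<open>auto simp: D_def intro!: mult_left_mono power_increasing sum_nonneg\<close>)
    ultimately have "\<bar>g x\<bar> \<le> K * \<bar>x\<bar> ^ (2 * D)" using growth[of x] by (simp add: K_def distrib_right)
    also have "\<dots> = K * (x ^ (2 * D) * 1)" by (simp add: power_even_abs)
    also have "\<dots> \<le> K * (x ^ (2 * D) * (x / 3) ^ (2 * r))"
    proof (intro mult_left_mono K)
      have "1 \<le> \<bar>x / 3\<bar> ^ (2 * r)" using x by (intro one_le_power) auto
      moreover have "\<bar>x / 3\<bar> ^ (2 * r) = (x / 3) ^ (2 * r)" by (rule power_even_abs) simp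
      ultimately show "1 \<le> (x / 3) ^ (2 * r)" by (simp only:)
    qed (simp add: zero_le_even_power)
    finally show ?thesis using e by linarith
  qed
  then show ?thesis using K by blast
qed

lemma polynomial_growth_psum: "polynomial_growth g \<longleftrightarrow> (\<exists>c d. \<forall>x. \<bar>g x\<bar> \<le> psum c d x)"
proof
  assume "polynomial_growth g"
  then obtain p where "\<And>x. \<bar>g x\<bar> \<le> poly p x" unfolding polynomial_growth_def by blast
  moreover have "poly p x = psum (coeff p) (degree p) x" for x by (simp add: psum_def poly_altdef)
  ultimately show "\<exists>c d. \<forall>x. \<bar>g x\<bar> \<le> psum c d x" by metis
next
  assume "\<exists>c d. \<forall>x. \<bar>g x\<bar> \<le> psum c d x"
  then obtain c d where cd: "\<And>x. \<bar>g x\<bar> \<le> psum c d x" by blast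
  have "poly (\<Sum>m\<le>d. monom (c m) m) x = psum c d x" for x by (simp add: psum_def poly_sum poly_monom)
  then show "polynomial_growth g" using cd unfolding polynomial_growth_def by metis
qed

lemma semicircle_even_power: "(\<integral>x. x ^ (2 * k) \<partial>semicircle) \<le> 4 ^ k"
proof -
  interpret sc: prob_space semicircle by (rule prob_space_semicircle)
  have "(\<integral>x. x ^ (2 * k) \<partial>semicircle) \<le> (\<integral>x. 4 ^ k \<partial>semicircle)"
  proof (rule integral_mono_AE)
    show "integrable semicircle (\<lambda>x. x ^ (2 * k))" by (rule semicircle_integral_eq) (intro continuous_intros)
    show "AE x in semicircle. x ^ (2 * k) \<le> 4 ^ k"
      using AE_semicircle
    proof eventually_elim
      case (elim x)
      then have "x\<^sup>2 \<le> 2\<^sup>2" by (intro power2_le_iff_abs_le[THEN iffD2]) auto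
      then show ?case unfolding power_mult by (intro power_mono) auto
    qed
  qed simp
  then show ?thesis using sc.prob_space by simp
qed

lemma semicircle_tail_power:
  "(\<integral>x. K * (x ^ (2 * D) * (x / 3) ^ (2 * r)) \<partial>semicircle) \<le> \<bar>K\<bar> * 4 ^ D * (4 / 9) ^ r"
proof -
  have eq: "K * (x ^ (2 * D) * (x / 3) ^ (2 * r)) = K / 9 ^ r * x ^ (2 * (D + r))" for x
    by (simp add: power_divide power_mult power_add power_mult_distrib)
  define I where "I = (\<integral>x. x ^ (2 * (D + r)) \<partial>semicircle)"
  have I: "0 \<le> I" "I \<le> 4 ^ (D + r)"
    unfolding I_def by (rule Bochner_Integration.integral_nonneg, simp add: zero_le_even_power, rule semicircle_even_power)
  have "(\<integral>x. K * (x ^ (2 * D) * (x / 3) ^ (2 * r)) \<partial>semicircle) = K / 9 ^ r * I"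
    unfolding eq I_def by (rule integral_mult_right_zero)
  also have "\<dots> \<le> \<bar>K\<bar> / 9 ^ r * 4 ^ (D + r)"
    by (intro mult_mono divide_right_mono I) auto
  also have "\<dots> = \<bar>K\<bar> * 4 ^ D * (4 / 9) ^ r" by (simp add: power_add power_divide)
  finally show ?thesis .
qed

lemma tail_power_psum:
  "\<exists>c d. \<forall>x. K * (x ^ (2 * D) * (x / 3) ^ (2 * r)) = psum c d x"
proof -
  have eq: "K * (x ^ (2 * D) * (x / 3) ^ (2 * r)) = K / 9 ^ r * x ^ (2 * (D + r))" for x :: real
    by (simp add: power_divide power_mult power_add power_mult_distrib)
  have "psum (\<lambda>m. if m = 2 * (D + r) then K / 9 ^ r else 0) (2 * (D + r)) x = K / 9 ^ r * x ^ (2 * (D + r))" for x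
    by (simp add: psum_def if_distrib[of "\<lambda>c. c * _"] cong: if_cong)
  then show ?thesis using eq by metis
qed

text \<open>Convergence on the \<open>chebU m\<close> gives convergence on every polynomial by linearity.  The
  abstract \<open>L\<close> stands for the spectral functional at a fixed outcome as well as for its
  expectation; linearity of the latter holds only once the integrals exist, that is, for large
  \<open>n\<close>.\<close>

lemma psum_limit:
  assumes lin: "\<And>\<alpha> d. \<forall>\<^sub>F n in sequentially. L (\<lambda>x. \<Sum>m\<le>d. \<alpha> m * chebU m x) n = (\<Sum>m\<le>d. \<alpha> m * L (chebU m) n)"
    and lim: "\<And>m. L (chebU m) \<longlonglongrightarrow> (if m = 0 then 1 else 0 :: real)"
  shows "L (psum c d) \<longlonglongrightarrow> (\<integral>x. psum c d x \<partial>semicircle)"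
proof -
  obtain \<alpha> where "\<forall>x. psum c d x = (\<Sum>m\<le>d. \<alpha> m * chebU m x)"
    using psum_cheb_span[of d c] unfolding cheb_span_def by blast
  then have a: "psum c d = (\<lambda>x. \<Sum>m\<le>d. \<alpha> m * chebU m x)" by auto
  have i: "integrable semicircle (chebU m)" for m by (rule semicircle_integral_eq) (intro continuous_intros)
  have "(\<integral>x. psum c d x \<partial>semicircle) = (\<Sum>m\<le>d. \<alpha> m * (if m = 0 then 1 else 0))"
    unfolding a using i by (simp add: semicircle_chebU)
  moreover have "(\<lambda>n. \<Sum>m\<le>d. \<alpha> m * L (chebU m) n) \<longlonglongrightarrow> (\<Sum>m\<le>d. \<alpha> m * (if m = 0 then 1 else 0))"
    by (intro tendsto_intros lim)
  then have "L (psum c d) \<longlonglongrightarrow> (\<Sum>m\<le>d. \<alpha> m * (if m = 0 then 1 else 0))"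
    unfolding a by (rule Lim_transform_eventually) (use lin[of \<alpha> d] in \<open>simp add: eq_commute\<close>)
  ultimately show ?thesis by (simp only:)
qed

text \<open>Approximation by a polynomial on \<open>[-3, 3]\<close>; the tail is controlled by the same
  statement for the dominating polynomial.\<close>

lemma spec_limit_of_chebU:
  assumes sym: "\<And>n r c. A n r c = A n c r"
    and lim: "\<And>m. (\<lambda>n. spec n (A n) (chebU m)) \<longlonglongrightarrow> (if m = 0 then 1 else 0)"
    and f: "continuous_on UNIV f" and growth: "\<And>x. \<bar>f x\<bar> \<le> psum c0 d0 x"
  shows "(\<lambda>n. spec n (A n) f) \<longlonglongrightarrow> (\<integral>x. f x \<partial>semicircle)"
proof (rule LIMSEQ_I)
  fix \<epsilon> :: real assume eps: "\<epsilon> > 0"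
  define e where "e = \<epsilon> / 8"
  have e: "e > 0" using eps by (simp add: e_def)
  interpret sc: prob_space semicircle by (rule prob_space_semicircle)
  have plim: "(\<lambda>n. spec n (A n) (psum c d)) \<longlonglongrightarrow> (\<integral>x. psum c d x \<partial>semicircle)" for c d
    by (rule psum_limit[of "\<lambda>f n. spec n (A n) f"]) (use lim in \<open>simp_all add: spec_sum spec_cmult\<close>)
  obtain c d where cd: "\<And>x. \<bar>x\<bar> \<le> 3 \<Longrightarrow> \<bar>f x - psum c d x\<bar> < e"
    using weierstrass_psum[OF f e, of 3] by blast
  have gr: "\<bar>f x - psum c d x\<bar> \<le> \<bar>psum c0 d0 x\<bar> + \<bar>psum c d x\<bar>" for x using growth[of x] by linarith
  obtain K D where K: "K \<ge> 0" "\<And>x r. \<bar>f x - psum c d x\<bar> \<le> e + K * (x ^ (2 * D) * (x / 3) ^ (2 * r))"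
    using tail_domination[of "\<lambda>x. f x - psum c d x" e, OF less_imp_le[OF cd] less_imp_le[OF e] gr] by blast
  have "(\<lambda>r. \<bar>K\<bar> * 4 ^ D * (4 / 9) ^ r) \<longlonglongrightarrow> \<bar>K\<bar> * 4 ^ D * 0"
    by (intro tendsto_intros LIMSEQ_power_zero) auto
  then have "\<forall>\<^sub>F r in sequentially. \<bar>K\<bar> * 4 ^ D * (4 / 9) ^ r < e" using e by (simp add: order_tendstoD)
  then obtain r where r: "\<bar>K\<bar> * 4 ^ D * (4 / 9) ^ r < e" unfolding eventually_sequentially by blast
  define T where "T x = K * (x ^ (2 * D) * (x / 3) ^ (2 * r))" for x :: real
  obtain c' d' where T: "T = psum c' d'" using tail_power_psum[of K D r] unfolding T_def by (auto simp: fun_eq_iff)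
  have T_int: "(\<integral>x. T x \<partial>semicircle) < e" unfolding T_def using semicircle_tail_power[of K D r] r by simp
  have dom: "\<bar>f x - psum c d x\<bar> \<le> e + T x" for x unfolding T_def by (rule K(2))
  have ic: "integrable semicircle f" "integrable semicircle (psum c d)" "integrable semicircle T"
    unfolding T by (rule semicircle_integral_eq, intro continuous_intros f)+
  have sc_diff: "\<bar>(\<integral>x. f x \<partial>semicircle) - (\<integral>x. psum c d x \<partial>semicircle)\<bar> \<le> 2 * e"
  proof -
    have "\<bar>(\<integral>x. f x \<partial>semicircle) - (\<integral>x. psum c d x \<partial>semicircle)\<bar> = \<bar>\<integral>x. f x - psum c d x \<partial>semicircle\<bar>"
      using ic by simp
    also have "\<dots> \<le> (\<integral>x. \<bar>f x - psum c d x\<bar> \<partial>semicircle)" by (rule integral_abs_bound)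
    also have "\<dots> \<le> (\<integral>x. e + T x \<partial>semicircle)" using ic dom by (intro integral_mono) auto
    also have "\<dots> \<le> 2 * e" using ic T_int sc.prob_space by simp
    finally show ?thesis .
  qed
  have "\<forall>\<^sub>F n in sequentially. \<bar>spec n (A n) (psum c d) - (\<integral>x. psum c d x \<partial>semicircle)\<bar> < e"
    using tendstoD[OF plim e] by (simp add: dist_real_def)
  moreover have "\<forall>\<^sub>F n in sequentially. spec n (A n) T < e"
    using order_tendstoD(2)[OF plim[of c' d', folded T] T_int] .
  ultimately have "\<forall>\<^sub>F n in sequentially. norm (spec n (A n) f - (\<integral>x. f x \<partial>semicircle)) < \<epsilon>"
    using eventually_gt_at_top[of 0]
  proof eventually_elim
    case (elim n)
    have "\<bar>spec n (A n) (\<lambda>x. f x - psum c d x)\<bar> \<le> spec n (A n) (\<lambda>x. e + T x)"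
      by (rule order_trans[OF spec_abs spec_mono[OF dom]])
    also have "\<dots> = e + spec n (A n) T" using elim by (simp add: spec_add spec_const[of "A n" n, OF sym])
    finally have "\<bar>spec n (A n) f - spec n (A n) (psum c d)\<bar> \<le> 2 * e" using elim by (simp add: spec_diff)
    then show ?case using elim sc_diff eps by (simp add: e_def abs_if split: if_splits)
  qed
  then show "\<exists>no. \<forall>n\<ge>no. norm (spec n (A n) f - (\<integral>x. f x \<partial>semicircle)) < \<epsilon>"
    unfolding eventually_sequentially .
qed

section \<open>Chebyshev polynomials of a Jacobi matrix\<close>
text \<open>The infinite Jacobi matrix.  Rows and columns count from zero and the entries from one, as in
  \<open>jacobi_mat\<close>.\<close>

definition tridiag :: "(nat \<Rightarrow> real) \<Rightarrow> (nat \<Rightarrow> real) \<Rightarrow> nat \<Rightarrow> nat \<Rightarrow> real" where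
  "tridiag a b r c = (if r = c then a (r + 1) else if c = r + 1 then b (r + 1) else if r = c + 1 then b (c + 1) else 0)"

lemma tridiag_sym: "tridiag a b r c = tridiag a b c r"
  by (auto simp: tridiag_def)

lemma jacobi_mat_tridiag: "r < n \<Longrightarrow> c < n \<Longrightarrow> jacobi_mat n a b $$ (r, c) = tridiag a b r c"
  by (simp add: jacobi_mat_def tridiag_def)

lemma jacobi_eigensystem:
  assumes e: "orthonormal_eigensystem n (jacobi_mat n a b) lam v"
  shows "eigensystem n (tridiag a b) (\<lambda>i. lam (Suc i)) (\<lambda>i r. v (Suc i) $ r)"
proof -
  have J: "jacobi_mat n a b \<in> carrier_mat n n" by (simp add: jacobi_mat_def)
  have ev: "eigenvector (jacobi_mat n a b) (v i) (lam i)" if "i \<in> {1..n}" for i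
    using e that by (simp add: orthonormal_eigensystem_def)
  have v: "v i \<in> carrier_vec n" if "i \<in> {1..n}" for i
    using ev[OF that] J by (auto simp: eigenvector_def)
  have 1: "(\<Sum>k<n. tridiag a b r k * v (Suc i) $ k) = lam (Suc i) * v (Suc i) $ r" if "i < n" "r < n" for i r
  proof -
    have i: "Suc i \<in> {1..n}" using that by simp
    have "(jacobi_mat n a b *\<^sub>v v (Suc i)) $ r = (lam (Suc i) \<cdot>\<^sub>v v (Suc i)) $ r"
      using ev[OF i] by (simp add: eigenvector_def)
    moreover have "(jacobi_mat n a b *\<^sub>v v (Suc i)) $ r = (\<Sum>k<n. tridiag a b r k * v (Suc i) $ k)"
      using v[OF i] J that by (simp add: scalar_prod_def atLeast0LessThan jacobi_mat_tridiag[symmetric])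
    moreover have "(lam (Suc i) \<cdot>\<^sub>v v (Suc i)) $ r = lam (Suc i) * v (Suc i) $ r"
      using v[OF i] that by simp
    ultimately show ?thesis by simp
  qed
  have 2: "(\<Sum>k<n. v (Suc i) $ k * v (Suc j) $ k) = (if i = j then 1 else 0)" if "i < n" "j < n" for i j
  proof -
    have "v (Suc i) \<bullet> v (Suc j) = (if Suc i = Suc j then 1 else 0)"
      using e that by (simp add: orthonormal_eigensystem_def)
    moreover have "v (Suc i) \<bullet> v (Suc j) = (\<Sum>k<n. v (Suc i) $ k * v (Suc j) $ k)"
      using v[of "Suc j"] that by (simp add: scalar_prod_def atLeast0LessThan)
    ultimately show ?thesis by simp
  qed
  have 3: "(\<Sum>i<n. v (Suc i) $ r * v (Suc i) $ c) = (if r = c then 1 else 0)" if "r < n" "c < n" for r c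
    by (rule orthonormal_rows_imp_columns[of n "\<lambda>i r. v (Suc i) $ r"]) (use 2 that in auto)
  show ?thesis unfolding eigensystem_def using 1 2 3 by simp
qed

lemma spectral_measure_spec:
  assumes e: "orthonormal_eigensystem n (jacobi_mat n a b) lam v" and n: "n > 0"
    and f: "continuous_on UNIV f"
  shows "(\<integral>x. f x \<partial>spectral_measure n lam v) = spec n (tridiag a b) f"
proof -
  have [measurable]: "f \<in> borel_measurable borel" using f by (rule borel_measurable_continuous_onI)
  have "(\<integral>x. f x \<partial>spectral_measure n lam v) = (\<Sum>i=1..n. \<bar>v i $ 0\<bar>\<^sup>2 * f (lam i))"
    by (rule integral_spectral_measure) measurable
  also have "\<dots> = (\<Sum>i<n. (v (Suc i) $ 0)\<^sup>2 * f (lam (Suc i)))"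
    by (rule sum.reindex_bij_witness[of _ Suc "\<lambda>i. i - 1"]) auto
  also have "\<dots> = spec n (tridiag a b) f"
    by (rule spec_eq_eigensystem[symmetric, OF jacobi_eigensystem[OF e] tridiag_sym n f])
  finally show ?thesis .
qed

text \<open>\<open>cheb_vec a b m\<close> is \<open>U\<^sub>m(J) e\<^sub>1\<close> for the infinite matrix.\<close>

definition jacobi_op :: "(nat \<Rightarrow> real) \<Rightarrow> (nat \<Rightarrow> real) \<Rightarrow> (nat \<Rightarrow> real) \<Rightarrow> nat \<Rightarrow> real" where
  "jacobi_op a b x r = a (r + 1) * x r + b (r + 1) * x (r + 1) + (if r = 0 then 0 else b r * x (r - 1))"

text \<open>The vector \<open>U\<^sub>m(J) e\<^sub>1\<close> for the infinite matrix \<open>J\<close>.\<close>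

fun cheb_vec :: "(nat \<Rightarrow> real) \<Rightarrow> (nat \<Rightarrow> real) \<Rightarrow> nat \<Rightarrow> nat \<Rightarrow> real" where
  "cheb_vec a b 0 r = (if r = 0 then 1 else 0)"
| "cheb_vec a b (Suc 0) r = jacobi_op a b (cheb_vec a b 0) r"
| "cheb_vec a b (Suc (Suc m)) r = jacobi_op a b (cheb_vec a b (Suc m)) r - cheb_vec a b m r"

lemma sum_tridiag:
  assumes "r + 1 < n"
  shows "(\<Sum>k<n. tridiag a b r k * x k) = jacobi_op a b x r"
proof -
  have "(\<Sum>k<n. tridiag a b r k * x k) = (\<Sum>k\<in>{r, r + 1} \<union> (if r = 0 then {} else {r - 1}). tridiag a b r k * x k)"
    by (rule sum.mono_neutral_right) (use assms in \<open>auto simp: tridiag_def split: if_splits\<close>)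
  also have "\<dots> = jacobi_op a b x r"
    by (cases r) (auto simp: tridiag_def jacobi_op_def)
  finally show ?thesis .
qed

lemma jacobi_op_cong:
  assumes "x r = y r" "x (r + 1) = y (r + 1)" "r \<noteq> 0 \<Longrightarrow> x (r - 1) = y (r - 1)"
  shows "jacobi_op a b x r = jacobi_op a b y r"
  using assms by (simp add: jacobi_op_def)

text \<open>Multiplication by the eigenvalue is the action of the matrix; away from the last row the finite
  matrix acts like the infinite one.\<close>

lemma eigensystem_jacobi_op:
  assumes e: "eigensystem n (tridiag a b) lam w" and r: "r + 1 < n"
  shows "(\<Sum>i<n. lam i * (p i * w i r)) = jacobi_op a b (\<lambda>k. \<Sum>i<n. p i * w i k) r"
proof -
  have "(\<Sum>i<n. lam i * (p i * w i r)) = (\<Sum>i<n. \<Sum>k<n. tridiag a b r k * (p i * w i k))"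
  proof (rule sum.cong[OF refl])
    fix i assume "i \<in> {..<n}"
    then have "lam i * w i r = (\<Sum>k<n. tridiag a b r k * w i k)" using eigensystem_eq[OF e, of i r] r by simp
    then have "p i * (lam i * w i r) = (\<Sum>k<n. tridiag a b r k * (p i * w i k))" by (simp add: sum_distrib_left mult.left_commute)
    then show "lam i * (p i * w i r) = (\<Sum>k<n. tridiag a b r k * (p i * w i k))" by (simp add: mult.left_commute)
  qed
  also have "\<dots> = (\<Sum>k<n. tridiag a b r k * (\<Sum>i<n. p i * w i k))" by (subst sum.swap) (simp add: sum_distrib_left)
  finally show ?thesis using sum_tridiag[OF r] by simp
qed

text \<open>The coordinate \<open>r\<close> of \<open>U\<^sub>m(J) e\<^sub>1\<close> depends only on the first
  \<open>m + r\<close> rows, so that the cut-off at \<open>n\<close> is not felt.\<close>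

lemma spec_cheb_vec:
  assumes e: "eigensystem n (tridiag a b) lam w"
  shows "m + r < n \<Longrightarrow> (\<Sum>i<n. chebU m (lam i) * w i 0 * w i r) = cheb_vec a b m r"
proof (induction m arbitrary: r rule: induct_nat_012)
  case 0
  then show ?case using eigensystem_cols[OF e, of 0 r] by auto
next
  case 1
  note step = eigensystem_jacobi_op[OF e]
  have "(\<Sum>i<n. chebU (Suc 0) (lam i) * w i 0 * w i r) = jacobi_op a b (\<lambda>k. \<Sum>i<n. w i 0 * w i k) r"
    using step[of r "\<lambda>i. w i 0"] 1 by (simp add: mult.assoc)
  also have "\<dots> = jacobi_op a b (cheb_vec a b 0) r"
    by (rule jacobi_op_cong) (use 1 eigensystem_cols[OF e, of 0] in auto)
  finally show ?case by simp
next
  case (ge2 m)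
  note step = eigensystem_jacobi_op[OF e]
  have "(\<Sum>i<n. chebU (Suc (Suc m)) (lam i) * w i 0 * w i r)
     = (\<Sum>i<n. lam i * ((chebU (Suc m) (lam i) * w i 0) * w i r)) - (\<Sum>i<n. chebU m (lam i) * w i 0 * w i r)"
    by (simp add: sum_subtractf[symmetric] algebra_simps)
  also have "(\<Sum>i<n. lam i * ((chebU (Suc m) (lam i) * w i 0) * w i r)) = jacobi_op a b (\<lambda>k. \<Sum>i<n. chebU (Suc m) (lam i) * w i 0 * w i k) r"
    using ge2.prems by (intro step) simp
  also have "\<dots> = jacobi_op a b (cheb_vec a b (Suc m)) r"
    by (rule jacobi_op_cong) (use ge2 in auto)
  also have "(\<Sum>i<n. chebU m (lam i) * w i 0 * w i r) = cheb_vec a b m r" using ge2 by simp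
  finally show ?case by simp
qed

lemma spec_chebU:
  assumes "m < n"
  shows "spec n (tridiag a b) (chebU m) = cheb_vec a b m 0"
  using spec_cheb_vec[OF eigensystem_eig[of "tridiag a b" n, OF tridiag_sym], of m 0] assms
  by (simp add: spec_def power2_eq_square ac_simps)

text \<open>The perturbation identity: \<open>J - J\<^sub>0\<close> enters between \<open>U\<^sub>l(J\<^sub>0)
  e\<^sub>1 = e\<^sub>l\<^sub>+\<^sub>1\<close> and \<open>U\<^sub>j(J) e\<^sub>1\<close> with \<open>j + l + 1
  = m\<close>.\<close>

lemma cheb_vec_perturbation:
  "cheb_vec a b m 0 = (if m = 0 then 1 else 0)
     + (\<Sum>j<m. jacobi_op a (\<lambda>i. b i - 1) (cheb_vec a b j) (m - Suc j))"
proof -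
  define u where "u j l = cheb_vec a b j l" for j l
  define prev where "prev j l = (if j = 0 then 0 else u (j - 1) l)" for j l
  define left where "left j l = (if l = 0 then 0 else u j (l - 1))" for j l
  have rec: "jacobi_op a b (u j) l = u (Suc j) l + prev j l" for j l
    by (cases j) (simp_all add: u_def[abs_def] prev_def)
  have pert: "jacobi_op a (\<lambda>i. b i - 1) (u j) l = u (Suc j) l + prev j l - u j (Suc l) - left j l" for j l
  proof -
    have "jacobi_op a (\<lambda>i. b i - 1) (u j) l = jacobi_op a b (u j) l - u j (Suc l) - left j l"
      by (simp add: jacobi_op_def left_def algebra_simps)
    then show ?thesis unfolding rec .
  qed
  have tele: "(\<Sum>j<m. u (Suc j) (m - Suc j) - u j (Suc (m - Suc j))) = u m 0 - u 0 m"
  proof -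
    have "(\<Sum>j<m. u (Suc j) (m - Suc j) - u j (Suc (m - Suc j))) = (\<Sum>j<m. u (Suc j) (m - Suc j) - u j (m - j))"
      by (rule sum.cong) (auto simp: Suc_diff_Suc)
    also have "\<dots> = u m (m - m) - u 0 (m - 0)" by (rule sum_lessThan_telescope[where f = "\<lambda>j. u j (m - j)"])
    finally show ?thesis by simp
  qed
  have low: "(\<Sum>j<m. prev j (m - Suc j)) = (\<Sum>j<m. left j (m - Suc j))"
  proof (cases m)
    case (Suc k)
    have "(\<Sum>j<Suc k. prev j (Suc k - Suc j)) = (\<Sum>j<k. u j (k - Suc j))"
      unfolding sum.lessThan_Suc_shift by (simp add: prev_def)
    moreover have "(\<Sum>j<Suc k. left j (Suc k - Suc j)) = (\<Sum>j<k. u j (k - Suc j))"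
      unfolding sum.lessThan_Suc by (auto simp: left_def intro!: sum.cong)
    ultimately show ?thesis using Suc by simp
  qed simp
  have "(\<Sum>j<m. jacobi_op a (\<lambda>i. b i - 1) (u j) (m - Suc j))
     = (\<Sum>j<m. u (Suc j) (m - Suc j) - u j (Suc (m - Suc j))) + ((\<Sum>j<m. prev j (m - Suc j)) - (\<Sum>j<m. left j (m - Suc j)))"
    unfolding pert sum.distrib[symmetric] sum_subtractf[symmetric] by (rule sum.cong) (auto simp: algebra_simps)
  also have "\<dots> = u m 0 - u 0 m" unfolding tele low by simp
  finally show ?thesis by (auto simp: u_def[abs_def])
qed

text \<open>Replacing \<open>U\<^sub>j(J) e\<^sub>1\<close> by \<open>e\<^sub>j\<^sub>+\<^sub>1\<close> in the
  perturbation identity leaves the sum of \<open>J - J\<^sub>0\<close> along the antidiagonal \<open>j + l + 1 =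
  m\<close>.  It meets the diagonal of the matrix if \<open>m\<close> is odd, and the two entries
  \<open>b\<^sub>i\<close> next to the diagonal if \<open>m\<close> is even: the linear part of
  \<open>U\<^sub>m\<close> consists of one entry.\<close>

lemma free_perturbation_sum:
  "(\<Sum>j<m. jacobi_op a d (\<lambda>r. if r = j then 1 else 0) (m - Suc j))
     = (if odd m then a ((m + 1) div 2) else if m = 0 then 0 else 2 * d (m div 2))"
proof -
  have summand: "jacobi_op a d (\<lambda>r. if r = j then 1 else 0) (m - Suc j)
     = (if 2 * j + 1 = m then a (j + 1) else 0) + (if 2 * j = m then d j else 0) + (if 2 * j + 2 = m then d (j + 1) else 0)"
    if "j < m" for j
  proof -
    define r where "r = m - Suc j"
    have "jacobi_op a d (\<lambda>r. if r = j then 1 else 0) r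
      = (if r = j then a (r + 1) else 0) + (if r + 1 = j then d (r + 1) else 0) + (if r \<noteq> 0 \<and> r - 1 = j then d r else 0)"
      by (simp add: jacobi_op_def)
    also have "(if r = j then a (r + 1) else 0) = (if 2 * j + 1 = m then a (j + 1) else 0)"
      by (rule if_cong) (use that in \<open>auto simp: r_def\<close>)
    also have "(if r + 1 = j then d (r + 1) else 0) = (if 2 * j = m then d j else 0)"
      by (rule if_cong) (use that in \<open>auto simp: r_def\<close>)
    also have "(if r \<noteq> 0 \<and> r - 1 = j then d r else 0) = (if 2 * j + 2 = m then d (j + 1) else 0)"
    proof (rule if_cong)
      show "(r \<noteq> 0 \<and> r - 1 = j) = (2 * j + 2 = m)" using that unfolding r_def by linarith
      show "d r = d (j + 1)" if "2 * j + 2 = m" using that unfolding r_def by (intro arg_cong[where f = d]) linarith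
    qed simp
    finally show ?thesis unfolding r_def .
  qed
  have "(\<Sum>j<m. jacobi_op a d (\<lambda>r. if r = j then 1 else 0) (m - Suc j))
     = (\<Sum>j<m. if 2 * j + 1 = m then a (j + 1) else 0) + (\<Sum>j<m. if 2 * j = m then d j else 0) + (\<Sum>j<m. if 2 * j + 2 = m then d (j + 1) else 0)"
    unfolding sum.distrib[symmetric] by (rule sum.cong) (use summand in auto)
  also have "\<dots> = (if odd m then a ((m + 1) div 2) else if m = 0 then 0 else 2 * d (m div 2))"
  proof (cases "odd m")
    case True
    then obtain k where k: "m = 2 * k + 1" by (elim oddE)
    have "(\<Sum>j<m. if 2 * j + 1 = m then a (j + 1) else 0) = (\<Sum>j<m. if j = k then a (j + 1) else 0)"
      by (rule sum.cong) (auto simp: k)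
    moreover have "(\<Sum>j<m. if 2 * j = m then d j else 0) = 0" "(\<Sum>j<m. if 2 * j + 2 = m then d (j + 1) else 0) = 0"
      using True by (auto intro!: sum.neutral)
    ultimately show ?thesis using True k by simp
  next
    case False
    then have "even m" by simp
    then obtain k where k: "m = 2 * k" by (elim evenE)
    have z: "(\<Sum>j<m. if 2 * j + 1 = m then a (j + 1) else 0) = 0" using False by (auto intro!: sum.neutral)
    show ?thesis
    proof (cases k)
      case (Suc i)
      have "(\<Sum>j<m. if 2 * j = m then d j else 0) = (\<Sum>j<m. if j = k then d j else 0)"
        by (rule sum.cong) (auto simp: k)
      also have "\<dots> = d k"
      proof -
        have "k < m" using k Suc by simp
        then show ?thesis by simp
      qed
      finally have s1: "(\<Sum>j<m. if 2 * j = m then d j else 0) = d k" .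
      have "(\<Sum>j<m. if 2 * j + 2 = m then d (j + 1) else 0) = (\<Sum>j<m. if j = i then d (j + 1) else 0)"
        by (rule sum.cong) (auto simp: k Suc)
      also have "\<dots> = d (i + 1)"
      proof -
        have "i < m" using k Suc by simp
        then show ?thesis by simp
      qed
      also have "i + 1 = k" using Suc by simp
      finally have s2: "(\<Sum>j<m. if 2 * j + 2 = m then d (j + 1) else 0) = d k" .
      have "m \<noteq> 0" using k Suc by simp
      have "m div 2 = k" unfolding k by simp
      then show ?thesis unfolding z s1 s2
        unfolding \<open>m div 2 = k\<close> if_not_P[OF False] if_not_P[OF \<open>m \<noteq> 0\<close>] mult_2 by (simp only: add_0_left)
    qed (use k in simp)
  qed
  finally show ?thesis .
qed

section \<open>The spectral functional of the Gaussian ensemble to first order\<close>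
lemma scaled_even_power:
  fixes x y :: real
  assumes "y > 0" shows "x ^ (2 * k) = 1 / y ^ k * (sqrt y * x) ^ (2 * k)"
  using assms by (simp add: power_mult_distrib power_mult)

locale beta_ensemble = prob_space M for M :: "'w measure" +
  fixes \<beta> :: real and a b :: "nat \<Rightarrow> nat \<Rightarrow> 'w \<Rightarrow> real"
  assumes beta_pos: "\<beta> > 0"
    and entries: "\<And>n. n \<ge> 1 \<Longrightarrow> gaussian_beta_entries M \<beta> n (a n) (b n)"
begin

definition dof :: "nat \<Rightarrow> nat \<Rightarrow> real" where "dof n i = real (n - i) * \<beta>"

lemma scale_pos: "n \<ge> 1 \<Longrightarrow> real n * \<beta> > 0"
  using beta_pos by simp

lemma dof_pos: "i < n \<Longrightarrow> dof n i > 0"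
  using beta_pos by (simp add: dof_def)

lemma entries_indep: "n \<ge> 1 \<Longrightarrow> indep_vars (\<lambda>_. borel) (case_sum (a n) (b n)) ({1..n} <+> {1..<n})"
  using entries by (simp add: gaussian_beta_entries_def)

lemma a_measurable [measurable]: "1 \<le> i \<Longrightarrow> i \<le> n \<Longrightarrow> a n i \<in> borel_measurable M"
proof -
  assume i: "1 \<le> i" "i \<le> n"
  have "indep_vars (\<lambda>_. borel) (case_sum (a n) (b n)) ({1..n} <+> {1..<n})"
    using i by (intro entries_indep) simp
  then have "\<forall>j\<in>{1..n} <+> {1..<n}. random_variable borel (case_sum (a n) (b n) j)"
    unfolding indep_vars_def by (rule conjunct1)
  then have "random_variable borel (case_sum (a n) (b n) (Inl i))"
    by (rule bspec) (use i in auto)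
  then show ?thesis by (simp only: sum.case)
qed

lemma b_measurable [measurable]: "1 \<le> i \<Longrightarrow> i < n \<Longrightarrow> b n i \<in> borel_measurable M"
proof -
  assume i: "1 \<le> i" "i < n"
  have "indep_vars (\<lambda>_. borel) (case_sum (a n) (b n)) ({1..n} <+> {1..<n})"
    using i by (intro entries_indep) simp
  then have "\<forall>j\<in>{1..n} <+> {1..<n}. random_variable borel (case_sum (a n) (b n) j)"
    unfolding indep_vars_def by (rule conjunct1)
  then have "random_variable borel (case_sum (a n) (b n) (Inr i))"
    by (rule bspec) (use i in auto)
  then show ?thesis by (simp only: sum.case)
qed

lemma distr_a:
  assumes i: "1 \<le> i" "i \<le> n"
  shows "distr M borel (\<lambda>\<omega>. sqrt (real n * \<beta>) * a n i \<omega>) = gauss_measure (sqrt 2)"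
proof -
  have "distributed M lborel (\<lambda>\<omega>. sqrt (real n * \<beta>) * a n i \<omega>) (\<lambda>x. ennreal (normal_density 0 (sqrt 2) x))"
    using entries[of n] i by (simp add: gaussian_beta_entries_def)
  then have "distr M lborel (\<lambda>\<omega>. sqrt (real n * \<beta>) * a n i \<omega>) = gauss_measure (sqrt 2)"
    unfolding gauss_measure_def by (rule distributed_distr_eq_density)
  moreover have "distr M lborel (\<lambda>\<omega>. sqrt (real n * \<beta>) * a n i \<omega>) = distr M borel (\<lambda>\<omega>. sqrt (real n * \<beta>) * a n i \<omega>)"
    by (rule distr_cong) simp_all
  ultimately show ?thesis by simp
qed

lemma distr_b:
  assumes i: "1 \<le> i" "i < n"
  shows "distr M borel (\<lambda>\<omega>. sqrt (real n * \<beta>) * b n i \<omega>) = chi_measure (dof n i)"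
proof -
  have "distributed M lborel (\<lambda>\<omega>. sqrt (real n * \<beta>) * b n i \<omega>) (\<lambda>x. ennreal (chi_density (real (n - i) * \<beta>) x))"
    using entries[of n] i by (simp add: gaussian_beta_entries_def)
  then have "distr M lborel (\<lambda>\<omega>. sqrt (real n * \<beta>) * b n i \<omega>) = chi_measure (dof n i)"
    unfolding chi_measure_def dof_def by (rule distributed_distr_eq_density)
  moreover have "distr M lborel (\<lambda>\<omega>. sqrt (real n * \<beta>) * b n i \<omega>) = distr M borel (\<lambda>\<omega>. sqrt (real n * \<beta>) * b n i \<omega>)"
    by (rule distr_cong) simp_all
  ultimately show ?thesis by simp
qed

lemma prob_space_chi:
  assumes "1 \<le> i" "i < n" shows "prob_space (chi_measure (dof n i))"
  unfolding distr_b[OF assms, symmetric] by (rule prob_space_distr) (use assms in measurable)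

text \<open>The centred square of the chi variable.  It replaces \<open>2 (b\<^sub>i - 1)\<close> as the
  linear part since its expectation is exactly zero and its characteristic function is accessible.\<close>

definition xi :: "nat \<Rightarrow> nat \<Rightarrow> 'w \<Rightarrow> real" where
  "xi n i \<omega> = ((sqrt (real n * \<beta>) * b n i \<omega>)\<^sup>2 - dof n i) / (real n * \<beta>)"

lemma xi_measurable [measurable]: "1 \<le> i \<Longrightarrow> i < n \<Longrightarrow> xi n i \<in> borel_measurable M"
  unfolding xi_def [abs_def] by measurable

lemma b_square:
  assumes "1 \<le> i" "i < n"
  shows "(b n i \<omega>)\<^sup>2 - 1 = xi n i \<omega> - real i / real n"
proof -
  have n: "real n > 0" using assms by simp
  have "(sqrt (real n * \<beta>) * b n i \<omega>)\<^sup>2 = (real n * \<beta>) * (b n i \<omega>)\<^sup>2"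
    using beta_pos by (simp add: power_mult_distrib)
  moreover have "dof n i = (real n * \<beta>) * (1 - real i / real n)"
    using assms n by (simp add: dof_def of_nat_diff field_simps)
  ultimately have "xi n i \<omega> = ((real n * \<beta>) * ((b n i \<omega>)\<^sup>2 - (1 - real i / real n))) / (real n * \<beta>)"
    by (simp add: xi_def right_diff_distrib)
  also have "\<dots> = (b n i \<omega>)\<^sup>2 - (1 - real i / real n)" using n beta_pos by simp
  finally show ?thesis by simp
qed

lemma eventually_index: "1 \<le> i \<Longrightarrow> \<forall>\<^sub>F n in sequentially. 1 \<le> i \<and> i < n"
  using eventually_gt_at_top[of i] by (auto elim: eventually_mono)

lemma a_order:
  assumes i: "1 \<le> i"
  shows "moment_order 1 (\<lambda>n. a n i)"
proof (rule moment_orderI)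
  fix k
  define G where "G = (\<integral>x. x ^ (2 * k) \<partial>gauss_measure (sqrt 2))"
  have iG: "integrable (gauss_measure (sqrt 2)) (\<lambda>x. x ^ (2 * k))"
    using integrable_normal_moment[of "sqrt 2" 0 "2 * k"] by (subst gauss_measure_integrable) auto
  have G0: "G \<ge> 0" unfolding G_def by (rule Bochner_Integration.integral_nonneg) (simp add: zero_le_even_power)
  have "\<forall>\<^sub>F n in sequentially. a n i \<in> borel_measurable M \<and> (\<integral>\<^sup>+\<omega>. ennreal ((a n i \<omega>) ^ (2 * k)) \<partial>M) \<le> ennreal (G / \<beta> ^ k / real n ^ (1 * k))"
    using eventually_index[OF i]
  proof eventually_elim
    case (elim n)
    then have m [measurable]: "a n i \<in> borel_measurable M" by simp
    have nb: "real n * \<beta> > 0" using elim by (intro scale_pos) simp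
    have eq: "(a n i \<omega>) ^ (2 * k) = 1 / (real n * \<beta>) ^ k * (sqrt (real n * \<beta>) * a n i \<omega>) ^ (2 * k)" for \<omega>
      by (rule scaled_even_power[OF nb])
    have "(\<integral>\<^sup>+\<omega>. ennreal ((a n i \<omega>) ^ (2 * k)) \<partial>M) = (\<integral>\<^sup>+\<omega>. ennreal (1 / (real n * \<beta>) ^ k) * ennreal ((sqrt (real n * \<beta>) * a n i \<omega>) ^ (2 * k)) \<partial>M)"
      unfolding eq using nb by (intro nn_integral_cong ennreal_mult') simp
    also have "\<dots> = ennreal (1 / (real n * \<beta>) ^ k) * (\<integral>\<^sup>+\<omega>. ennreal ((sqrt (real n * \<beta>) * a n i \<omega>) ^ (2 * k)) \<partial>M)"
      by (rule nn_integral_cmult) measurable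
    also have "(\<integral>\<^sup>+\<omega>. ennreal ((sqrt (real n * \<beta>) * a n i \<omega>) ^ (2 * k)) \<partial>M) = (\<integral>\<^sup>+x. ennreal (x ^ (2 * k)) \<partial>gauss_measure (sqrt 2))"
      unfolding distr_a[of i n, symmetric, OF elim[THEN conjunct1] less_imp_le[OF elim[THEN conjunct2]]] by (subst nn_integral_distr) auto
    also have "\<dots> = ennreal G" unfolding G_def by (rule nn_integral_eq_integral[OF iG]) (simp add: zero_le_even_power)
    also have "ennreal (1 / (real n * \<beta>) ^ k) * ennreal G = ennreal (G / \<beta> ^ k / real n ^ (1 * k))"
      using nb G0 by (simp add: ennreal_mult'[symmetric] power_mult_distrib mult.commute)
    finally show ?case using m by simp
  qed
  then show "\<exists>C\<ge>0. \<forall>\<^sub>F n in sequentially. a n i \<in> borel_measurable M \<and> (\<integral>\<^sup>+\<omega>. ennreal ((a n i \<omega>) ^ (2 * k)) \<partial>M) \<le> ennreal (C / real n ^ (1 * k))"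
    using G0 beta_pos by (intro exI[of _ "G / \<beta> ^ k"]) auto
qed

lemma xi_order:
  assumes i: "1 \<le> i"
  shows "moment_order 1 (\<lambda>n. xi n i)"
proof (rule moment_orderI)
  fix k
  obtain A where A: "A \<ge> 0" "\<And>\<kappa>. \<kappa> > 0 \<Longrightarrow> prob_space (chi_measure \<kappa>) \<Longrightarrow> \<bar>\<integral>x. (x\<^sup>2 - \<kappa>) ^ (2 * k) \<partial>chi_measure \<kappa>\<bar> \<le> A * sqrt (1 + \<kappa>) ^ (2 * k)"
    using chi_central_moment_bound[of "2 * k"] by blast
  define C where "C = A * ((1 + \<beta>) / \<beta>\<^sup>2) ^ k"
  have C0: "C \<ge> 0" using A(1) beta_pos by (simp add: C_def)
  have "\<forall>\<^sub>F n in sequentially. xi n i \<in> borel_measurable M \<and> (\<integral>\<^sup>+\<omega>. ennreal ((xi n i \<omega>) ^ (2 * k)) \<partial>M) \<le> ennreal (C / real n ^ (1 * k))"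
    using eventually_index[OF i]
  proof eventually_elim
    case (elim n)
    then have m [measurable]: "xi n i \<in> borel_measurable M" "b n i \<in> borel_measurable M" by auto
    have nb: "real n * \<beta> > 0" and n1: "real n \<ge> 1" using elim by (auto intro: scale_pos)
    define \<kappa> where "\<kappa> = dof n i"
    have kap: "\<kappa> > 0" "prob_space (chi_measure \<kappa>)" unfolding \<kappa>_def using elim by (auto intro: dof_pos prob_space_chi)
    have eq: "(xi n i \<omega>) ^ (2 * k) = 1 / (real n * \<beta>) ^ (2 * k) * ((sqrt (real n * \<beta>) * b n i \<omega>)\<^sup>2 - \<kappa>) ^ (2 * k)" for \<omega>
      unfolding xi_def \<kappa>_def power_divide by simp
    have "(\<integral>\<^sup>+\<omega>. ennreal ((xi n i \<omega>) ^ (2 * k)) \<partial>M) = (\<integral>\<^sup>+\<omega>. ennreal (1 / (real n * \<beta>) ^ (2 * k)) * ennreal (((sqrt (real n * \<beta>) * b n i \<omega>)\<^sup>2 - \<kappa>) ^ (2 * k)) \<partial>M)"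
      unfolding eq using nb by (intro nn_integral_cong ennreal_mult') simp
    also have "\<dots> = ennreal (1 / (real n * \<beta>) ^ (2 * k)) * (\<integral>\<^sup>+\<omega>. ennreal (((sqrt (real n * \<beta>) * b n i \<omega>)\<^sup>2 - \<kappa>) ^ (2 * k)) \<partial>M)"
      by (rule nn_integral_cmult) measurable
    also have "(\<integral>\<^sup>+\<omega>. ennreal (((sqrt (real n * \<beta>) * b n i \<omega>)\<^sup>2 - \<kappa>) ^ (2 * k)) \<partial>M) = (\<integral>\<^sup>+x. ennreal ((x\<^sup>2 - \<kappa>) ^ (2 * k)) \<partial>chi_measure \<kappa>)"
      unfolding \<kappa>_def distr_b[of i n, symmetric, OF elim[THEN conjunct1] elim[THEN conjunct2]] by (subst nn_integral_distr) auto
    also have "\<dots> = ennreal (\<integral>x. (x\<^sup>2 - \<kappa>) ^ (2 * k) \<partial>chi_measure \<kappa>)"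
      by (rule nn_integral_eq_integral[OF chi_central_integrable[OF kap(1)]]) (simp add: zero_le_even_power)
    also have "ennreal (1 / (real n * \<beta>) ^ (2 * k)) * \<dots> = ennreal (1 / (real n * \<beta>) ^ (2 * k) * (\<integral>x. (x\<^sup>2 - \<kappa>) ^ (2 * k) \<partial>chi_measure \<kappa>))"
      by (rule ennreal_mult'[symmetric]) simp
    also have "\<dots> \<le> ennreal (C / real n ^ (1 * k))"
    proof (rule ennreal_leI)
      have "(\<integral>x. (x\<^sup>2 - \<kappa>) ^ (2 * k) \<partial>chi_measure \<kappa>) \<le> A * sqrt (1 + \<kappa>) ^ (2 * k)" using A(2)[OF kap] by linarith
      also have "sqrt (1 + \<kappa>) ^ (2 * k) = (1 + \<kappa>) ^ k" using kap(1) by (simp add: power_mult)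
      also have "A * (1 + \<kappa>) ^ k \<le> A * (real n * (1 + \<beta>)) ^ k"
      proof (intro mult_left_mono power_mono)
        have "\<kappa> \<le> real n * \<beta>" unfolding \<kappa>_def dof_def using beta_pos by (intro mult_right_mono) auto
        then show "1 + \<kappa> \<le> real n * (1 + \<beta>)" using n1 by (simp add: algebra_simps)
      qed (use A kap in auto)
      finally have "1 / (real n * \<beta>) ^ (2 * k) * (\<integral>x. (x\<^sup>2 - \<kappa>) ^ (2 * k) \<partial>chi_measure \<kappa>) \<le> 1 / (real n * \<beta>) ^ (2 * k) * (A * (real n * (1 + \<beta>)) ^ k)"
        by (intro mult_left_mono) auto
      also have "\<dots> = C / real n ^ (1 * k)"
      proof -
        have "(real n * \<beta>) ^ (2 * k) = real n ^ k * (real n ^ k * (\<beta>\<^sup>2) ^ k)"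
          by (simp add: power_mult_distrib mult_2 power_add power2_eq_square)
        moreover have "(real n * (1 + \<beta>)) ^ k = real n ^ k * (1 + \<beta>) ^ k" by (rule power_mult_distrib)
        moreover have "real n ^ k > 0" "(\<beta>\<^sup>2) ^ k > 0" "n > 0" using n1 beta_pos by auto
        ultimately show ?thesis by (simp add: C_def power_divide divide_simps)
      qed
      finally show "1 / (real n * \<beta>) ^ (2 * k) * (\<integral>x. (x\<^sup>2 - \<kappa>) ^ (2 * k) \<partial>chi_measure \<kappa>) \<le> C / real n ^ (1 * k)" .
    qed
    finally show ?case using m by simp
  qed
  then show "\<exists>C\<ge>0. \<forall>\<^sub>F n in sequentially. xi n i \<in> borel_measurable M \<and> (\<integral>\<^sup>+\<omega>. ennreal ((xi n i \<omega>) ^ (2 * k)) \<partial>M) \<le> ennreal (C / real n ^ (1 * k))"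
    using C0 by blast
qed

lemma index_over_n_order: "moment_order 2 (\<lambda>n \<omega>. real i / real n)"
  by (rule moment_order_const[of _ "(real i)\<^sup>2"]) (auto simp: power_divide)

lemma AE_b_nonneg:
  assumes i: "1 \<le> i" "i < n"
  shows "AE \<omega> in M. b n i \<omega> \<ge> 0"
proof -
  have m [measurable]: "b n i \<in> borel_measurable M" using i by simp
  have "AE x in chi_measure (dof n i). x \<ge> 0"
    unfolding chi_measure_def by (subst AE_density) (auto intro!: AE_I2 simp: chi_density_def)
  then have "AE \<omega> in M. sqrt (real n * \<beta>) * b n i \<omega> \<ge> 0"
    unfolding distr_b[OF i, symmetric] by (rule AE_distrD[rotated]) measurable
  then show ?thesis using scale_pos[of n] i by (auto elim!: eventually_mono simp: zero_le_mult_iff)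
qed

text \<open>For \<open>b \<ge> 0\<close> the number \<open>\<bar>b - 1\<bar>\<close> is at most
  \<open>\<bar>b\<^sup>2 - 1\<bar>\<close>, and the square is known.\<close>

lemma b_order:
  assumes i: "1 \<le> i"
  shows "moment_order 1 (\<lambda>n \<omega>. b n i \<omega> - 1)"
proof (rule moment_order_dominated)
  show "moment_order 1 (\<lambda>n \<omega>. xi n i \<omega> - real i / real n)"
    by (intro moment_order_diff xi_order[OF i] moment_order_weaken[OF index_over_n_order]) simp
  show "\<forall>\<^sub>F n in sequentially. (\<lambda>\<omega>. b n i \<omega> - 1) \<in> borel_measurable M \<and> (AE \<omega> in M. \<bar>b n i \<omega> - 1\<bar> \<le> \<bar>xi n i \<omega> - real i / real n\<bar>)"
    using eventually_index[OF i]
  proof eventually_elim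
    case (elim n)
    then have [measurable]: "b n i \<in> borel_measurable M" by simp
    have "AE \<omega> in M. b n i \<omega> \<ge> 0" using elim by (intro AE_b_nonneg) auto
    then have "AE \<omega> in M. \<bar>b n i \<omega> - 1\<bar> \<le> \<bar>xi n i \<omega> - real i / real n\<bar>"
    proof eventually_elim
      case (elim \<omega>)
      have "\<bar>b n i \<omega> - 1\<bar> * 1 \<le> \<bar>b n i \<omega> - 1\<bar> * (b n i \<omega> + 1)" using elim by (intro mult_left_mono) auto
      also have "\<dots> = \<bar>(b n i \<omega> - 1) * (b n i \<omega> + 1)\<bar>" using elim by (simp add: abs_mult)
      also have "(b n i \<omega> - 1) * (b n i \<omega> + 1) = (b n i \<omega>)\<^sup>2 - 1" by (simp add: power2_eq_square algebra_simps)
      finally show ?case using b_square[of i n \<omega>] \<open>1 \<le> i \<and> i < n\<close> by simp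
    qed
    then show ?case by simp
  qed
qed

text \<open>The identity \<open>b\<^sup>2 - 1 = 2 (b - 1) + (b - 1)\<^sup>2\<close>.\<close>

lemma b_linearization:
  assumes i: "1 \<le> i"
  shows "moment_order 2 (\<lambda>n \<omega>. 2 * (b n i \<omega> - 1) - xi n i \<omega>)"
proof (rule moment_order_cong_AE)
  have "moment_order (1 + 1) (\<lambda>n \<omega>. (b n i \<omega> - 1) * (b n i \<omega> - 1))"
    by (intro moment_order_mult b_order i)
  then have "moment_order 2 (\<lambda>n \<omega>. (b n i \<omega> - 1) * (b n i \<omega> - 1))" by (simp add: numeral_2_eq_2)
  then show "moment_order 2 (\<lambda>n \<omega>. (0 - real i / real n) - (b n i \<omega> - 1) * (b n i \<omega> - 1))"
    by (intro moment_order_diff moment_order_zero index_over_n_order)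
  show "\<forall>\<^sub>F n in sequentially. (\<lambda>\<omega>. 2 * (b n i \<omega> - 1) - xi n i \<omega>) \<in> borel_measurable M \<and>
     (AE \<omega> in M. 2 * (b n i \<omega> - 1) - xi n i \<omega> = (0 - real i / real n) - (b n i \<omega> - 1) * (b n i \<omega> - 1))"
    using eventually_index[OF i]
  proof eventually_elim
    case (elim n)
    then have [measurable]: "b n i \<in> borel_measurable M" "xi n i \<in> borel_measurable M" by auto
    have "2 * (b n i \<omega> - 1) - xi n i \<omega> = (0 - real i / real n) - (b n i \<omega> - 1) * (b n i \<omega> - 1)" for \<omega>
      using b_square[of i n \<omega>] elim by (simp add: power2_eq_square algebra_simps)
    then show ?case by simp
  qed
qed

definition cv :: "nat \<Rightarrow> nat \<Rightarrow> nat \<Rightarrow> 'w \<Rightarrow> real" where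
  "cv m r n \<omega> = cheb_vec (\<lambda>i. a n i \<omega>) (\<lambda>i. b n i \<omega>) m r"

definition jac_op :: "(nat \<Rightarrow> nat \<Rightarrow> 'w \<Rightarrow> real) \<Rightarrow> nat \<Rightarrow> nat \<Rightarrow> 'w \<Rightarrow> real" where
  "jac_op X r n \<omega> = jacobi_op (\<lambda>i. a n i \<omega>) (\<lambda>i. b n i \<omega>) (\<lambda>k. X k n \<omega>) r"

lemma moment_order_of_shift:
  assumes "moment_order 1 (\<lambda>n \<omega>. X n \<omega> - c)"
  shows "moment_order 0 X"
proof -
  have "moment_order 0 (\<lambda>n \<omega>. (X n \<omega> - c) + c)"
    by (intro moment_order_add moment_order_fixed moment_order_weaken[OF assms]) simp
  then show ?thesis by simp
qed

lemma jac_op_order: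
  assumes X: "\<And>r. moment_order 1 (\<lambda>n \<omega>. X r n \<omega> - d r)"
  shows "moment_order 1 (\<lambda>n \<omega>. jac_op X r n \<omega> - (d (r + 1) + (if r = 0 then 0 else d (r - 1))))"
proof -
  note X0 = moment_order_of_shift[OF X]
  have 1: "moment_order 1 (\<lambda>n \<omega>. a n (r + 1) \<omega> * X r n \<omega>)"
    using moment_order_mult[OF a_order X0, of "r + 1" r] by simp
  have 2: "moment_order 1 (\<lambda>n \<omega>. b n i \<omega> * X k n \<omega> - d k)" if "1 \<le> i" for i k
  proof -
    have "moment_order (1 + 0) (\<lambda>n \<omega>. (b n i \<omega> - 1) * X k n \<omega>)"
      by (intro moment_order_mult b_order that X0)
    then have "moment_order 1 (\<lambda>n \<omega>. (b n i \<omega> - 1) * X k n \<omega> + (X k n \<omega> - d k))"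
      by (intro moment_order_add X) simp
    then show ?thesis by (simp add: algebra_simps)
  qed
  show ?thesis
  proof (cases "r = 0")
    case True
    have "moment_order 1 (\<lambda>n \<omega>. a n (r + 1) \<omega> * X r n \<omega> + (b n (r + 1) \<omega> * X (r + 1) n \<omega> - d (r + 1)))"
      by (intro moment_order_add 1 2) simp
    then show ?thesis using True by (simp add: jac_op_def jacobi_op_def algebra_simps)
  next
    case False
    have "moment_order 1 (\<lambda>n \<omega>. a n (r + 1) \<omega> * X r n \<omega> + (b n (r + 1) \<omega> * X (r + 1) n \<omega> - d (r + 1)) + (b n r \<omega> * X (r - 1) n \<omega> - d (r - 1)))"
      using False by (intro moment_order_add 1 2) auto
    then show ?thesis using False by (simp add: jac_op_def jacobi_op_def algebra_simps)
  qed
qed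

text \<open>The three-term recurrence with entries close to those of the free matrix, where
  \<open>U\<^sub>m(J\<^sub>0) e\<^sub>1 = e\<^sub>m\<^sub>+\<^sub>1\<close>.\<close>

lemma cv_order: "moment_order 1 (\<lambda>n \<omega>. cv m r n \<omega> - (if r = m then 1 else 0))"
proof (induction m arbitrary: r rule: induct_nat_012)
  case 0
  have "cv 0 r n \<omega> - (if r = 0 then 1 else 0) = 0" for n \<omega> by (simp add: cv_def)
  then show ?case by (simp only:) (rule moment_order_zero)
next
  case 1
  have c: "moment_order 1 (\<lambda>n \<omega>. cv 0 r n \<omega> - (if r = 0 then 1 else 0))" for r
  proof -
    have "cv 0 r n \<omega> - (if r = 0 then 1 else 0) = 0" for n \<omega> by (simp add: cv_def)
    then show ?thesis by (simp only:) (rule moment_order_zero)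
  qed
  have eq: "cv (Suc 0) r n \<omega> = jac_op (cv 0) r n \<omega>" for n \<omega> by (simp add: cv_def jac_op_def jacobi_op_def)
  have "(if r + 1 = 0 then 1 else 0) + (if r = 0 then 0 else if r - 1 = 0 then 1 else 0) = (if r = Suc 0 then 1 else 0 :: real)"
    by auto
  then show ?case using jac_op_order[of "cv 0", OF c, of r] unfolding eq by (simp only:)
next
  case (ge2 m)
  have eq: "cv (Suc (Suc m)) r n \<omega> = jac_op (cv (Suc m)) r n \<omega> - cv m r n \<omega>" for n \<omega> by (simp add: cv_def [abs_def] jac_op_def)
  have "moment_order 1 (\<lambda>n \<omega>. (jac_op (cv (Suc m)) r n \<omega> - ((if r + 1 = Suc m then 1 else 0) + (if r = 0 then 0 else if r - 1 = Suc m then 1 else 0)))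
     - (cv m r n \<omega> - (if r = m then 1 else 0)))"
    by (intro moment_order_diff jac_op_order[of "cv (Suc m)"] ge2)
  moreover have "(jac_op (cv (Suc m)) r n \<omega> - ((if r + 1 = Suc m then 1 else 0) + (if r = 0 then 0 else if r - 1 = Suc m then 1 else 0)))
     - (cv m r n \<omega> - (if r = m then 1 else 0)) = cv (Suc (Suc m)) r n \<omega> - (if r = Suc (Suc m) then 1 else 0)" for n \<omega>
    unfolding eq by auto
  ultimately show ?case by (simp only:)
qed

text \<open>The linear part of \<open>\<langle>\<mu>\<^sub>n, U\<^sub>m\<rangle>\<close>; its value zero for
  \<open>m = 0\<close> allows sums over all \<open>m \<le> d\<close>.\<close>

definition lin :: "nat \<Rightarrow> nat \<Rightarrow> 'w \<Rightarrow> real" where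
  "lin m n \<omega> = (if odd m then a n ((m + 1) div 2) \<omega> else if m = 0 then 0 else xi n (m div 2) \<omega>)"

text \<open>In the perturbation identity each summand is a product of a matrix entry of \<open>J -
  J\<^sub>0\<close> and a coordinate of \<open>U\<^sub>j(J) e\<^sub>1\<close>.  Replacing the latter by
  \<open>e\<^sub>j\<^sub>+\<^sub>1\<close> is an error of second order.\<close>

lemma cv_linearization: "moment_order 2 (\<lambda>n \<omega>. cv m 0 n \<omega> - (if m = 0 then 1 else 0) - lin m n \<omega>)"
proof -
  let ?q = "\<lambda>j r n \<omega>. cv j r n \<omega> - (if r = j then 1 else 0)"
  define R where "R j n \<omega> = jacobi_op (\<lambda>i. a n i \<omega>) (\<lambda>i. b n i \<omega> - 1) (\<lambda>r. ?q j r n \<omega>) (m - Suc j)" for j n \<omega>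
  define E where "E n \<omega> = (if odd m \<or> m = 0 then 0 else 2 * (b n (m div 2) \<omega> - 1) - xi n (m div 2) \<omega>)" for n \<omega>
  have R: "moment_order 2 (R j)" for j
  proof -
    define r where "r = m - Suc j"
    have p: "moment_order 2 (\<lambda>n \<omega>. X n \<omega> * ?q j k n \<omega>)" if "moment_order 1 X" for X k
      using moment_order_mult[OF that cv_order[of j k]] by (simp add: numeral_2_eq_2)
    have "moment_order 2 (\<lambda>n \<omega>. a n (r + 1) \<omega> * ?q j r n \<omega> + (b n (r + 1) \<omega> - 1) * ?q j (r + 1) n \<omega> + (if r = 0 then 0 else (b n r \<omega> - 1) * ?q j (r - 1) n \<omega>))"
    proof (cases "r = 0")
      case True
      have "moment_order 2 (\<lambda>n \<omega>. a n (r + 1) \<omega> * ?q j r n \<omega> + (b n (r + 1) \<omega> - 1) * ?q j (r + 1) n \<omega>)"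
        by (intro moment_order_add p a_order b_order) auto
      then show ?thesis using True by simp
    next
      case False
      have "moment_order 2 (\<lambda>n \<omega>. a n (r + 1) \<omega> * ?q j r n \<omega> + (b n (r + 1) \<omega> - 1) * ?q j (r + 1) n \<omega> + (b n r \<omega> - 1) * ?q j (r - 1) n \<omega>)"
        using False by (intro moment_order_add p a_order b_order) auto
      then show ?thesis using False by simp
    qed
    then show ?thesis unfolding R_def [abs_def] jacobi_op_def r_def .
  qed
  have E: "moment_order 2 E"
  proof (cases "odd m \<or> m = 0")
    case True
    then show ?thesis unfolding E_def [abs_def] by (simp add: moment_order_zero)
  next
    case False
    then have "1 \<le> m div 2" by (auto elim!: evenE)
    from b_linearization[OF this] show ?thesis unfolding E_def [abs_def] using False by simp
  qed
  have op_lin: "jacobi_op A B (cheb_vec A' B' j) k = jacobi_op A B (\<lambda>r. cheb_vec A' B' j r - (if r = j then 1 else 0)) k + jacobi_op A B (\<lambda>r. if r = j then 1 else 0) k" for A B A' B' j k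
    unfolding jacobi_op_def by (cases "k = 0") (auto simp: algebra_simps)
  have "cv m 0 n \<omega> - (if m = 0 then 1 else 0) - lin m n \<omega> = (\<Sum>j<m. R j n \<omega>) + E n \<omega>" for n \<omega>
  proof -
    have "cv m 0 n \<omega> - (if m = 0 then 1 else 0) = (\<Sum>j<m. jacobi_op (\<lambda>i. a n i \<omega>) (\<lambda>i. b n i \<omega> - 1) (cheb_vec (\<lambda>i. a n i \<omega>) (\<lambda>i. b n i \<omega>) j) (m - Suc j))"
      unfolding cv_def by (subst cheb_vec_perturbation) simp
    also have "\<dots> = (\<Sum>j<m. R j n \<omega>) + (\<Sum>j<m. jacobi_op (\<lambda>i. a n i \<omega>) (\<lambda>i. b n i \<omega> - 1) (\<lambda>r. if r = j then 1 else 0) (m - Suc j))"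
      unfolding op_lin sum.distrib R_def cv_def ..
    also have "(\<Sum>j<m. jacobi_op (\<lambda>i. a n i \<omega>) (\<lambda>i. b n i \<omega> - 1) (\<lambda>r. if r = j then 1 else 0) (m - Suc j)) = lin m n \<omega> + E n \<omega>"
      unfolding free_perturbation_sum by (simp add: lin_def E_def)
    finally show ?thesis by simp
  qed
  then show ?thesis by (simp only:) (intro moment_order_add moment_order_sum R E)
qed

definition jac :: "nat \<Rightarrow> 'w \<Rightarrow> nat \<Rightarrow> nat \<Rightarrow> real" where
  "jac n \<omega> = tridiag (\<lambda>i. a n i \<omega>) (\<lambda>i. b n i \<omega>)"

lemma jac_sym: "jac n \<omega> r c = jac n \<omega> c r"
  unfolding jac_def by (rule tridiag_sym)

lemma spec_jac_chebU: "m < n \<Longrightarrow> spec n (jac n \<omega>) (chebU m) = cv m 0 n \<omega>"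
  unfolding jac_def cv_def by (rule spec_chebU)

lemma moment_order_eventually_eq:
  assumes "moment_order s Y" "\<forall>\<^sub>F n in sequentially. \<forall>\<omega>. X n \<omega> = Y n \<omega>"
  shows "moment_order s X"
proof (rule moment_order_cong_AE[OF assms(1)])
  show "\<forall>\<^sub>F n in sequentially. X n \<in> borel_measurable M \<and> (AE \<omega> in M. X n \<omega> = Y n \<omega>)"
    using assms(2) moment_order_measurable[OF assms(1)]
  proof eventually_elim
    case (elim n)
    then have "X n = Y n" by auto
    then show ?case using elim by simp
  qed
qed

lemma spec_chebU_order: "moment_order 1 (\<lambda>n \<omega>. spec n (jac n \<omega>) (chebU m) - (if m = 0 then 1 else 0))"
proof (rule moment_order_eventually_eq)
  show "moment_order 1 (\<lambda>n \<omega>. cv m 0 n \<omega> - (if 0 = m then 1 else 0))" by (rule cv_order)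
  show "\<forall>\<^sub>F n in sequentially. \<forall>\<omega>. spec n (jac n \<omega>) (chebU m) - (if m = 0 then 1 else 0) = cv m 0 n \<omega> - (if 0 = m then 1 else 0)"
    using eventually_gt_at_top[of m] by eventually_elim (auto simp: spec_jac_chebU)
qed

lemma spec_chebU_linearization: "moment_order 2 (\<lambda>n \<omega>. spec n (jac n \<omega>) (chebU m) - (if m = 0 then 1 else 0) - lin m n \<omega>)"
proof (rule moment_order_eventually_eq[OF cv_linearization[of m]])
  show "\<forall>\<^sub>F n in sequentially. \<forall>\<omega>. spec n (jac n \<omega>) (chebU m) - (if m = 0 then 1 else 0) - lin m n \<omega> = cv m 0 n \<omega> - (if m = 0 then 1 else 0) - lin m n \<omega>"
    using eventually_gt_at_top[of m] by eventually_elim (auto simp: spec_jac_chebU)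
qed

lemma spec_psum_order: "moment_order 0 (\<lambda>n \<omega>. spec n (jac n \<omega>) (psum c d))"
proof -
  obtain \<alpha> where "\<forall>x. psum c d x = (\<Sum>m\<le>d. \<alpha> m * chebU m x)"
    using psum_cheb_span[of d c] unfolding cheb_span_def by blast
  then have al: "psum c d = (\<lambda>x. \<Sum>m\<le>d. \<alpha> m * chebU m x)" by auto
  have "moment_order 0 (\<lambda>n \<omega>. \<Sum>m\<le>d. \<alpha> m * spec n (jac n \<omega>) (chebU m))"
    by (intro moment_order_sum moment_order_cmult moment_order_of_shift[OF spec_chebU_order])
  then show ?thesis unfolding al spec_sum spec_cmult .
qed

lemma AE_spec_chebU: "AE \<omega> in M. \<forall>m. (\<lambda>n. spec n (jac n \<omega>) (chebU m)) \<longlonglongrightarrow> (if m = 0 then 1 else 0)"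
  unfolding AE_all_countable
proof
  fix m
  have "AE \<omega> in M. (\<lambda>n. spec n (jac n \<omega>) (chebU m) - (if m = 0 then 1 else 0)) \<longlonglongrightarrow> 0"
    by (rule moment_order_AE_tendsto[OF spec_chebU_order])
  then show "AE \<omega> in M. (\<lambda>n. spec n (jac n \<omega>) (chebU m)) \<longlonglongrightarrow> (if m = 0 then 1 else 0)"
    by eventually_elim (rule LIM_zero_cancel)
qed

lemma moment_order_expectation_tendsto:
  assumes X: "moment_order 1 X"
  shows "(\<lambda>n. expectation (X n)) \<longlonglongrightarrow> 0"
proof -
  obtain C where C: "C \<ge> 0" "\<forall>\<^sub>F n in sequentially. X n \<in> borel_measurable M \<and> integrable M (X n) \<and>
     integrable M (\<lambda>\<omega>. (X n \<omega>)\<^sup>2) \<and> expectation (\<lambda>\<omega>. (X n \<omega>)\<^sup>2) \<le> C / real n ^ 1"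
    using moment_order_second_moment[OF X] by blast
  have "(\<lambda>n. (expectation (X n))\<^sup>2) \<longlonglongrightarrow> 0"
  proof (rule Lim_null_comparison)
    show "\<forall>\<^sub>F n in sequentially. norm ((expectation (X n))\<^sup>2) \<le> C * (1 / real n)"
      using C(2)
    proof eventually_elim
      case (elim n)
      have "(expectation (X n))\<^sup>2 \<le> expectation (\<lambda>\<omega>. (X n \<omega>)\<^sup>2)"
        using variance_positive[of "X n"] variance_eq[of "X n"] elim by simp
      then show ?case using elim by simp
    qed
    have "(\<lambda>n. C * (1 / real n)) \<longlonglongrightarrow> C * 0" by (intro tendsto_mult tendsto_const lim_1_over_n)
    then show "(\<lambda>n. C * (1 / real n)) \<longlonglongrightarrow> 0" by simp
  qed
  then have "(\<lambda>n. sqrt ((expectation (X n))\<^sup>2)) \<longlonglongrightarrow> sqrt 0" by (rule tendsto_real_sqrt)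
  then have "(\<lambda>n. \<bar>expectation (X n)\<bar>) \<longlonglongrightarrow> 0" by simp
  then show ?thesis by (rule tendsto_rabs_zero_cancel)
qed

lemma moment_order_integrable: "moment_order s X \<Longrightarrow> \<forall>\<^sub>F n in sequentially. integrable M (X n)"
  using moment_order_second_moment[of s X] by (auto elim!: eventually_mono)

lemma expectation_spec_psum:
  "(\<lambda>n. expectation (\<lambda>\<omega>. spec n (jac n \<omega>) (psum c d))) \<longlonglongrightarrow> (\<integral>x. psum c d x \<partial>semicircle)"
proof (rule psum_limit[of "\<lambda>f n. expectation (\<lambda>\<omega>. spec n (jac n \<omega>) f)"])
  fix \<alpha> and d :: nat
  have "\<forall>\<^sub>F n in sequentially. \<forall>m\<in>{..d}. integrable M (\<lambda>\<omega>. spec n (jac n \<omega>) (chebU m))"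
    by (intro eventually_ball_finite) (auto intro!: moment_order_integrable moment_order_of_shift[OF spec_chebU_order])
  then show "\<forall>\<^sub>F n in sequentially. expectation (\<lambda>\<omega>. spec n (jac n \<omega>) (\<lambda>x. \<Sum>m\<le>d. \<alpha> m * chebU m x)) = (\<Sum>m\<le>d. \<alpha> m * expectation (\<lambda>\<omega>. spec n (jac n \<omega>) (chebU m)))"
  proof eventually_elim
    case (elim n)
    then show ?case unfolding spec_sum spec_cmult by (subst Bochner_Integration.integral_sum) auto
  qed
next
  fix m
  let ?X = "\<lambda>n \<omega>. spec n (jac n \<omega>) (chebU m)"
  have "(\<lambda>n. expectation (\<lambda>\<omega>. ?X n \<omega> - (if m = 0 then 1 else 0))) \<longlonglongrightarrow> 0"
    by (rule moment_order_expectation_tendsto[OF spec_chebU_order])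
  moreover have "\<forall>\<^sub>F n in sequentially. expectation (\<lambda>\<omega>. ?X n \<omega> - (if m = 0 then 1 else 0)) = expectation (?X n) - (if m = 0 then 1 else 0)"
    using moment_order_integrable[OF moment_order_of_shift[OF spec_chebU_order[of m]]]
    by eventually_elim (simp add: prob_space)
  ultimately have "(\<lambda>n. expectation (?X n) - (if m = 0 then 1 else 0)) \<longlonglongrightarrow> 0"
    by (rule Lim_transform_eventually)
  then show "(\<lambda>n. expectation (?X n)) \<longlonglongrightarrow> (if m = 0 then 1 else 0)" by (rule LIM_zero_cancel)
qed

end

section \<open>The variance of the spectral functional\<close>
lemma eigensystem_cong:
  assumes "\<And>r c. r < n \<Longrightarrow> c < n \<Longrightarrow> A r c = B r c"
  shows "eigensystem n A = eigensystem n B"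
proof (intro ext)
  fix lam and w :: "nat \<Rightarrow> nat \<Rightarrow> real"
  have "(\<Sum>k<n. A r k * w i k) = (\<Sum>k<n. B r k * w i k)" if "r < n" for i r
    using assms that by (intro sum.cong) auto
  then show "eigensystem n A lam w = eigensystem n B lam w" unfolding eigensystem_def by auto
qed

lemma spec_cong_matrix:
  assumes "\<And>r c. r < n \<Longrightarrow> c < n \<Longrightarrow> A r c = B r c"
  shows "spec n A f = spec n B f"
proof -
  have "eigensystem n A = eigensystem n B" by (rule eigensystem_cong[OF assms])
  then have "eig_vals n A = eig_vals n B" unfolding eig_vals_def by simp
  moreover from this have "eig_vecs n A = eig_vecs n B"
    unfolding eig_vecs_def using \<open>eigensystem n A = eigensystem n B\<close> by simp
  ultimately show ?thesis by (simp add: spec_def)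
qed

lemma mpow_measurable:
  assumes A: "\<And>r c. r < n \<Longrightarrow> c < n \<Longrightarrow> (\<lambda>x. A x r c) \<in> borel_measurable N" and r: "r < n"
  shows "c < n \<Longrightarrow> (\<lambda>x. mpow n (A x) m r c) \<in> borel_measurable N"
proof (induction m arbitrary: c)
  case (Suc m)
  then show ?case unfolding mpow.simps
    by (intro borel_measurable_sum borel_measurable_times A) auto
qed simp

text \<open>The functionals are pointwise limits of polynomials in the entries, which avoids choosing the
  eigenvectors measurably.\<close>

lemma spec_measurable:
  assumes A: "\<And>r c. r < n \<Longrightarrow> c < n \<Longrightarrow> (\<lambda>x. A x r c) \<in> borel_measurable N"
    and sym: "\<And>x r c. A x r c = A x c r" and n: "n > 0"
    and der: "\<And>x. (f has_real_derivative f' x) (at x)" and cont: "continuous_on UNIV f'"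
  shows "(\<lambda>x. spec n (A x) f) \<in> borel_measurable N"
    and "k < n \<Longrightarrow> l < n \<Longrightarrow> (\<lambda>x. spec_kern n (A x) f f' k l) \<in> borel_measurable N"
proof -
  obtain c d where "\<forall>R. \<forall>e>0. \<forall>\<^sub>F N in sequentially. \<forall>x. \<bar>x\<bar> \<le> R \<longrightarrow>
     \<bar>f' x - psum' (c N) (d N) x\<bar> \<le> e \<and> \<bar>f x - psum (c N) (d N) x\<bar> \<le> (e::real)"
    using C1_psum_sequence[OF der cont] by (elim exE)
  note cd = this[rule_format]
  show "(\<lambda>x. spec n (A x) f) \<in> borel_measurable N"
  proof (rule borel_measurable_LIMSEQ_real)
    show "(\<lambda>i. spec n (A x) (psum (c i) (d i))) \<longlonglongrightarrow> spec n (A x) f" for x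
      by (rule spec_limit_psum[OF sym n cd])
    show "(\<lambda>x. spec n (A x) (psum (c i) (d i))) \<in> borel_measurable N" for i
      unfolding spec_psum[of "A _", OF sym n]
      by (intro borel_measurable_sum borel_measurable_times mpow_measurable[OF A n n]) auto
  qed
  assume k: "k < n" and l: "l < n"
  show "(\<lambda>x. spec_kern n (A x) f f' k l) \<in> borel_measurable N"
  proof (rule borel_measurable_LIMSEQ_real)
    fix x
    show "(\<lambda>i. spec_kern n (A x) (psum (c i) (d i)) (psum' (c i) (d i)) k l) \<longlonglongrightarrow> spec_kern n (A x) f f' k l"
    proof (rule tendstoI)
      fix e :: real assume "e > 0"
      then have e: "e / 2 > 0" by simp
      show "\<forall>\<^sub>F i in sequentially. dist (spec_kern n (A x) (psum (c i) (d i)) (psum' (c i) (d i)) k l) (spec_kern n (A x) f f' k l) < e"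
        using cd[OF e, of "entry_sum n (A x)"]
      proof eventually_elim
        case (elim i)
        have dd: "((\<lambda>x. f x - psum (c i) (d i) x) has_real_derivative f' x - psum' (c i) (d i) x) (at x)" for x
          by (intro derivative_intros der psum_deriv)
        have "\<bar>spec_kern n (A x) f f' k l - spec_kern n (A x) (psum (c i) (d i)) (psum' (c i) (d i)) k l\<bar> \<le> e / 2"
          unfolding spec_kern_diff[symmetric] by (rule spec_kern_bound[OF sym k l order_refl dd]) (use elim in auto)
        then show ?case using e by (simp add: dist_real_def abs_minus_commute)
      qed
    qed
  next
    fix i
    show "(\<lambda>x. spec_kern n (A x) (psum (c i) (d i)) (psum' (c i) (d i)) k l) \<in> borel_measurable N"
      unfolding spec_kern_psum[of "A _", OF sym k l]
      by (intro borel_measurable_sum borel_measurable_times mpow_measurable[OF A n k] mpow_measurable[OF A l n]) auto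
  qed
qed

lemma tridiag_affine:
  "tridiag (\<lambda>i. a i + t * a' i) (\<lambda>i. b i + t * b' i) r c = tridiag a b r c + t * tridiag a' b' r c"
  by (simp add: tridiag_def)

text \<open>Summing along a diagonal of a square array meets every row at most once.\<close>

lemma sum_along_injection_le:
  fixes Q :: "nat \<Rightarrow> nat \<Rightarrow> real"
  assumes p: "inj_on p K" "p ` K \<subseteq> {..<n}" "q ` K \<subseteq> {..<n}" and Q: "\<And>r c. Q r c \<ge> 0"
  shows "(\<Sum>k\<in>K. Q (p k) (q k)) \<le> (\<Sum>r<n. \<Sum>c<n. Q r c)"
proof -
  have fin: "finite K" using p(1,2) by (metis finite_imageD finite_lessThan finite_subset)
  have "(\<Sum>k\<in>K. Q (p k) (q k)) \<le> (\<Sum>k\<in>K. \<Sum>c<n. Q (p k) c)"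
    by (intro sum_mono member_le_sum) (use p Q in auto)
  also have "\<dots> = (\<Sum>r\<in>p ` K. \<Sum>c<n. Q r c)" by (simp add: sum.reindex[OF p(1)])
  also have "\<dots> \<le> (\<Sum>r<n. \<Sum>c<n. Q r c)"
    by (intro sum_mono2 p(2) sum_nonneg Q) auto
  finally show ?thesis .
qed

text \<open>The derivative of the matrix with respect to one of its independent entries.\<close>

definition coord_dir :: "nat + nat \<Rightarrow> nat \<Rightarrow> nat \<Rightarrow> real" where
  "coord_dir i = tridiag (\<lambda>j. if i = Inl j then 1 else 0) (\<lambda>j. if i = Inr j then 1 else 0)"

lemma coord_dir_Inl:
  assumes "1 \<le> k" "k \<le> n"
  shows "(\<Sum>r<n. \<Sum>c<n. coord_dir (Inl k) r c * Q r c) = Q (k - 1) (k - 1)"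
proof -
  have "(\<Sum>r<n. \<Sum>c<n. coord_dir (Inl k) r c * Q r c) = (\<Sum>r<n. \<Sum>c<n. if c = r then (if r = k - 1 then Q r r else 0) else 0)"
    by (intro sum.cong refl) (use assms in \<open>auto simp: coord_dir_def tridiag_def\<close>)
  also have "\<dots> = Q (k - 1) (k - 1)" using assms by simp
  finally show ?thesis .
qed

lemma coord_dir_Inr_entry:
  "coord_dir (Inr (Suc j)) r c = (if c = Suc j \<and> r = j \<or> c = j \<and> r = Suc j then 1 else 0)"
proof -
  have i: "(Inr (Suc j) = (Inl x :: nat + nat)) = False" "(Inr (Suc j) = (Inr (y + 1) :: nat + nat)) = (y = j)" for x y
    by auto
  consider "r = c" | "c = r + 1" | "r = c + 1" | "r \<noteq> c" "c \<noteq> r + 1" "r \<noteq> c + 1" by blast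
  then show ?thesis
    unfolding coord_dir_def tridiag_def i by cases simp_all
qed

lemma coord_dir_Inr:
  assumes "1 \<le> k" "k < n"
  shows "(\<Sum>r<n. \<Sum>c<n. coord_dir (Inr k) r c * Q r c) = Q (k - 1) k + Q k (k - 1)"
proof -
  obtain j where k: "k = Suc j" using assms by (cases k) auto
  have j: "j < n" "Suc j < n" using assms k by auto
  have pt: "coord_dir (Inr k) r c * Q r c
      = (if c = Suc j then if r = j then Q r c else 0 else 0) + (if c = j then if r = Suc j then Q r c else 0 else 0)" for r c
    unfolding k coord_dir_Inr_entry by simp
  have "(\<Sum>r<n. \<Sum>c<n. coord_dir (Inr k) r c * Q r c)
      = (\<Sum>r<n. (if r = j then Q r (Suc j) else 0) + (if r = Suc j then Q r j else 0))"
    unfolding pt sum.distrib sum.delta[OF finite_lessThan] using j by simp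
  also have "\<dots> = Q j (Suc j) + Q (Suc j) j"
    unfolding sum.distrib sum.delta[OF finite_lessThan] using j by simp
  finally show ?thesis by (simp add: k)
qed

context beta_ensemble
begin

lemma jac_measurable: "r < n \<Longrightarrow> c < n \<Longrightarrow> (\<lambda>\<omega>. jac n \<omega> r c) \<in> borel_measurable M"
proof -
  assume rc: "r < n" "c < n"
  consider "r = c" | "c = r + 1" | "r = c + 1" | "r \<noteq> c" "c \<noteq> r + 1" "r \<noteq> c + 1" by blast
  then show ?thesis
    unfolding jac_def tridiag_def
    by cases (use rc in \<open>simp_all add: a_measurable b_measurable\<close>)
qed

lemma spec_jac_measurable:
  assumes "n > 0" "\<And>x. (f has_real_derivative f' x) (at x)" "continuous_on UNIV f'"
  shows "(\<lambda>\<omega>. spec n (jac n \<omega>) f) \<in> borel_measurable M"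
  by (rule spec_measurable(1)[OF jac_measurable jac_sym assms])

text \<open>The Poincare inequality for the independent scaled entries.  An entry \<open>b\<^sub>i\<close>
  occurs in two places, which doubles its derivative, and the smaller constant of the chi distribution
  compensates for that.\<close>

lemma variance_spec_kern:
  assumes n: "n \<ge> 1" and der: "\<And>x. (f has_real_derivative f' x) (at x)" and cont: "continuous_on UNIV f'"
    and i2: "integrable M (\<lambda>\<omega>. (spec n (jac n \<omega>) f)\<^sup>2)"
  shows "ennreal (variance (\<lambda>\<omega>. spec n (jac n \<omega>) f))
    \<le> (\<integral>\<^sup>+\<omega>. ennreal (4 / (real n * \<beta>) * (\<Sum>r<n. \<Sum>c<n. (spec_kern n (jac n \<omega>) f f' r c)\<^sup>2)) \<partial>M)"
proof -
  define I where "I = {1..n} <+> {1..<n}"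
  define X where "X i \<omega> = sqrt (real n * \<beta>) * case_sum (a n) (b n) i \<omega>" for i \<omega>
  define s where "s = 1 / sqrt (real n * \<beta>)"
  have nb: "real n * \<beta> > 0" using n by (rule scale_pos)
  have s2: "s\<^sup>2 = 1 / (real n * \<beta>)" using nb by (simp add: s_def power_divide)
  define A where "A x = tridiag (\<lambda>i. s * x (Inl i)) (\<lambda>i. s * x (Inr i))" for x :: "nat + nat \<Rightarrow> real"
  define F where "F x = spec n (A x) f" for x
  define H where "H i r c = s * coord_dir i r c" for i r c
  define G where "G i x = (\<Sum>r<n. \<Sum>c<n. H i r c * spec_kern n (A x) f f' r c)" for i x
  \<comment> \<open>The Poincare constants of the normal distribution of variance two and of the chi distribution.\<close>
  define w where "w i = case_sum (\<lambda>_. 2) (\<lambda>_. 1 / 2 :: real) i" for i :: "nat + nat"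
  define D where "D i x = w i * (G i x)\<^sup>2" for i x
  have Asym: "A x r c = A x c r" for x r c unfolding A_def by (rule tridiag_sym)
  have Hsym: "H i r c = H i c r" for i r c unfolding H_def coord_dir_def using tridiag_sym by metis
  have Am: "(\<lambda>x. A x r c) \<in> borel_measurable (PiM I (\<lambda>_. borel))" if "r < n" "c < n" for r c
  proof -
    have comp: "(\<lambda>x. s * x i) \<in> borel_measurable (PiM I (\<lambda>_. borel))" if "i \<in> I" for i
      using measurable_component_singleton[OF that] by (intro borel_measurable_times borel_measurable_const)
    consider "r = c" | "c = r + 1" | "r = c + 1" | "r \<noteq> c" "c \<noteq> r + 1" "r \<noteq> c + 1" by blast
    then show ?thesis
    proof cases
      case 1
      have "Inl (r + 1) \<in> I" using that by (auto simp: I_def)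
      from comp[OF this] show ?thesis unfolding A_def tridiag_def by (simp add: 1)
    next
      case 2
      have "Inr (r + 1) \<in> I" using that 2 by (auto simp: I_def)
      from comp[OF this] show ?thesis unfolding A_def tridiag_def by (simp add: 2)
    next
      case 3
      have "Inr (c + 1) \<in> I" using that 3 by (auto simp: I_def)
      from comp[OF this] show ?thesis unfolding A_def tridiag_def by (simp add: 3)
    next
      case 4
      then show ?thesis unfolding A_def tridiag_def by simp
    qed
  qed
  have Fm: "F \<in> borel_measurable (PiM I (\<lambda>_. borel))"
    unfolding F_def by (rule spec_measurable(1)[OF Am Asym _ der cont]) (use n in auto)
  have Km: "(\<lambda>x. spec_kern n (A x) f f' r c) \<in> borel_measurable (PiM I (\<lambda>_. borel))" if "r < n" "c < n" for r c
    by (rule spec_measurable(2)[OF Am Asym _ der cont that]) (use n in auto)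
  have Dm: "D i \<in> borel_measurable (PiM I (\<lambda>_. borel))" for i
    unfolding D_def G_def by (intro borel_measurable_times borel_measurable_power borel_measurable_sum Km borel_measurable_const) auto
  have Aeq: "A (\<lambda>i\<in>I. X i \<omega>) r c = jac n \<omega> r c" if "r < n" "c < n" for r c \<omega>
    using that nb by (auto simp: A_def jac_def tridiag_def I_def X_def s_def)
  have FX: "F (\<lambda>i\<in>I. X i \<omega>) = spec n (jac n \<omega>) f" for \<omega>
    unfolding F_def by (rule spec_cong_matrix) (rule Aeq)
  have upd: "A (x(i := t)) = (\<lambda>r c. A (x(i := 0)) r c + t * H i r c)" for x i t
  proof (intro ext)
    fix r c
    have 1: "s * (x(i := t)) j = s * (x(i := 0)) j + t * (s * (if i = j then 1 else 0))" for j by auto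
    have "A (x(i := t)) r c = A (x(i := 0)) r c + t * tridiag (\<lambda>j. s * (if i = Inl j then 1 else 0)) (\<lambda>j. s * (if i = Inr j then 1 else 0)) r c"
      unfolding A_def 1 tridiag_affine by (rule refl)
    also have "tridiag (\<lambda>j. s * (if i = Inl j then 1 else 0)) (\<lambda>j. s * (if i = Inr j then 1 else 0)) r c = H i r c"
      by (simp add: H_def coord_dir_def tridiag_def)
    finally show "A (x(i := t)) r c = A (x(i := 0)) r c + t * H i r c" .
  qed
  have dF: "((\<lambda>t. F (x(i := t))) has_real_derivative G i (x(i := t))) (at t)"
    and cG: "continuous_on UNIV (\<lambda>t. G i (x(i := t)))" for i x t
  proof -
    have n0: "n > 0" using n by simp
    define B where "B = A (x(i := 0))"
    have up: "A (x(i := u)) = (\<lambda>r c. B r c + u * H i r c)" for u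
      unfolding B_def by (rule upd)
    have Bsym: "B r c = B c r" for r c unfolding B_def by (rule Asym)
    note sd = spec_has_derivative[of B "H i" n f f', OF Bsym Hsym n0 der cont]
    show "((\<lambda>t. F (x(i := t))) has_real_derivative G i (x(i := t))) (at t)"
      unfolding F_def G_def up by (rule sd(1))
    show "continuous_on UNIV (\<lambda>t. G i (x(i := t)))"
      unfolding G_def up by (rule sd(2))
  qed
  have ind: "indep_vars (\<lambda>_. borel) X I"
    unfolding X_def [abs_def] I_def
    by (rule indep_vars_compose2[OF entries_indep[OF n]]) measurable
  have "ennreal (variance (\<lambda>\<omega>. F (\<lambda>i\<in>I. X i \<omega>))) \<le> (\<Sum>i\<in>I. \<integral>\<^sup>+\<omega>. ennreal (D i (\<lambda>i\<in>I. X i \<omega>)) \<partial>M)"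
  proof (rule poincare_independent[where I = I and X = X and F = F and D = D, OF _ _ ind Fm Dm])
    show "finite I" "I \<noteq> {}" using n by (auto simp: I_def)
    show "integrable M (\<lambda>\<omega>. (F (\<lambda>i\<in>I. X i \<omega>))\<^sup>2)" unfolding FX by (rule i2)
    fix i x assume i: "i \<in> I"
    show "(\<integral>\<^sup>+s. \<integral>\<^sup>+t. ennreal ((F (x(i := s)) - F (x(i := t)))\<^sup>2) \<partial>distr M borel (X i) \<partial>distr M borel (X i))
        \<le> 2 * (\<integral>\<^sup>+s. ennreal (D i (x(i := s))) \<partial>distr M borel (X i))"
    proof (cases i)
      case (Inl k)
      then have k: "1 \<le> k" "k \<le> n" using i by (auto simp: I_def)
      have d: "distr M borel (X i) = gauss_measure (sqrt 2)"
        unfolding X_def Inl sum.case by (rule distr_a[OF k])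
      have "D i y = (sqrt 2)\<^sup>2 * (G i y)\<^sup>2" for y by (simp add: D_def w_def Inl)
      then show ?thesis unfolding d using gauss_poincare[of "sqrt 2" "\<lambda>t. F (x(i := t))" "\<lambda>t. G i (x(i := t))", OF _ dF cG] by (simp only:) simp
    next
      case (Inr k)
      then have k: "1 \<le> k" "k < n" using i by (auto simp: I_def)
      have d: "distr M borel (X i) = chi_measure (dof n k)"
        unfolding X_def Inr sum.case by (rule distr_b[OF k])
      have "D i y = 1 / 2 * (G i y)\<^sup>2" for y by (simp add: D_def w_def Inr)
      then show ?thesis unfolding d
        using chi_poincare[of "dof n k" "\<lambda>t. F (x(i := t))" "\<lambda>t. G i (x(i := t))", OF dof_pos[OF k(2)] prob_space_chi[OF k] dF cG] by (simp only:)
    qed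
  qed
  also have "\<dots> = (\<integral>\<^sup>+\<omega>. (\<Sum>i\<in>I. ennreal (D i (\<lambda>i\<in>I. X i \<omega>))) \<partial>M)"
  proof (rule nn_integral_sum[symmetric])
    fix i
    have rv: "X i \<in> borel_measurable M" if "i \<in> I" for i using ind that by (auto simp: indep_vars_def)
    have "(\<lambda>\<omega>. \<lambda>i\<in>I. X i \<omega>) \<in> measurable M (PiM I (\<lambda>_. borel))" by (rule measurable_restrict) (rule rv)
    from measurable_compose[OF this Dm] show "(\<lambda>\<omega>. ennreal (D i (\<lambda>i\<in>I. X i \<omega>))) \<in> borel_measurable M" by measurable
  qed
  also have "\<dots> \<le> (\<integral>\<^sup>+\<omega>. ennreal (4 / (real n * \<beta>) * (\<Sum>r<n. \<Sum>c<n. (spec_kern n (jac n \<omega>) f f' r c)\<^sup>2)) \<partial>M)"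
  proof (rule nn_integral_mono)
    fix \<omega>
    define x where "x = (\<lambda>i\<in>I. X i \<omega>)"
    define Q where "Q r c = spec_kern n (A x) f f' r c" for r c
    define T where "T = (\<Sum>r<n. \<Sum>c<n. (Q r c)\<^sup>2)"
    have GQ: "G i x = s * (\<Sum>r<n. \<Sum>c<n. coord_dir i r c * Q r c)" for i
      unfolding G_def H_def Q_def by (simp add: sum_distrib_left mult.assoc)
    have T1: "(\<Sum>k=1..n. (Q (k - 1) (k - 1))\<^sup>2) \<le> T"
      unfolding T_def by (rule sum_along_injection_le) (auto simp: inj_on_def)
    have T2: "(\<Sum>k=1..<n. (Q (k - 1) k)\<^sup>2) \<le> T" "(\<Sum>k=1..<n. (Q k (k - 1))\<^sup>2) \<le> T"
      unfolding T_def by (rule sum_along_injection_le; auto simp: inj_on_def)+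
    have split: "(\<Sum>i\<in>I. D i x) = (\<Sum>k=1..n. D (Inl k) x) + (\<Sum>k=1..<n. D (Inr k) x)"
      unfolding I_def by (subst sum.Plus) auto
    have diag: "(\<Sum>k=1..n. D (Inl k) x) = 2 * s\<^sup>2 * (\<Sum>k=1..n. (Q (k - 1) (k - 1))\<^sup>2)"
      unfolding D_def GQ sum_distrib_left[of "2 * s\<^sup>2"]
      by (rule sum.cong) (auto simp: w_def coord_dir_Inl power_mult_distrib)
    have off: "(\<Sum>k=1..<n. D (Inr k) x) \<le> (\<Sum>k=1..<n. s\<^sup>2 * ((Q (k - 1) k)\<^sup>2 + (Q k (k - 1))\<^sup>2))"
    proof (rule sum_mono)
      fix k assume "k \<in> {1..<n}"
      then have "D (Inr k) x = s\<^sup>2 * (1 / 2 * (Q (k - 1) k + Q k (k - 1))\<^sup>2)"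
        unfolding D_def GQ by (simp add: w_def coord_dir_Inr power_mult_distrib)
      also have "\<dots> \<le> s\<^sup>2 * ((Q (k - 1) k)\<^sup>2 + (Q k (k - 1))\<^sup>2)"
      proof (rule mult_left_mono)
        show "1 / 2 * (u + v)\<^sup>2 \<le> u\<^sup>2 + v\<^sup>2" for u v :: real
          using zero_le_power2[of "u - v"] by (simp add: power2_eq_square algebra_simps)
      qed simp
      finally show "D (Inr k) x \<le> s\<^sup>2 * ((Q (k - 1) k)\<^sup>2 + (Q k (k - 1))\<^sup>2)" .
    qed
    have "2 * s\<^sup>2 * (\<Sum>k=1..n. (Q (k - 1) (k - 1))\<^sup>2) + (\<Sum>k=1..<n. s\<^sup>2 * ((Q (k - 1) k)\<^sup>2 + (Q k (k - 1))\<^sup>2))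
       = s\<^sup>2 * (2 * (\<Sum>k=1..n. (Q (k - 1) (k - 1))\<^sup>2) + ((\<Sum>k=1..<n. (Q (k - 1) k)\<^sup>2) + (\<Sum>k=1..<n. (Q k (k - 1))\<^sup>2)))"
      by (simp add: sum_distrib_left sum.distrib distrib_left mult_ac)
    also have "\<dots> \<le> s\<^sup>2 * (4 * T)" using T1 T2 by (intro mult_left_mono) auto
    finally have "(\<Sum>i\<in>I. D i x) \<le> s\<^sup>2 * (4 * T)" using off unfolding split diag by linarith
    then have "(\<Sum>i\<in>I. D i x) \<le> 4 / (real n * \<beta>) * T" by (simp add: s2)
    moreover have "T = (\<Sum>r<n. \<Sum>c<n. (spec_kern n (jac n \<omega>) f f' r c)\<^sup>2)"
    proof -
      have "eigensystem n (A x) = eigensystem n (jac n \<omega>)" unfolding x_def by (rule eigensystem_cong) (rule Aeq)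
      then have "eig_vals n (A x) = eig_vals n (jac n \<omega>)" unfolding eig_vals_def by simp
      moreover from this have "eig_vecs n (A x) = eig_vecs n (jac n \<omega>)"
        unfolding eig_vecs_def using \<open>eigensystem n (A x) = eigensystem n (jac n \<omega>)\<close> by simp
      ultimately show ?thesis unfolding T_def Q_def spec_kern_def by simp
    qed
    moreover have "(\<Sum>i\<in>I. ennreal (D i x)) = ennreal (\<Sum>i\<in>I. D i x)"
      by (rule sum_ennreal) (simp add: D_def w_def split: sum.split)
    ultimately show "(\<Sum>i\<in>I. ennreal (D i (\<lambda>i\<in>I. X i \<omega>))) \<le> ennreal (4 / (real n * \<beta>) * (\<Sum>r<n. \<Sum>c<n. (spec_kern n (jac n \<omega>) f f' r c)\<^sup>2))"
      unfolding x_def by (simp add: ennreal_leI)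
  qed
  finally show ?thesis unfolding FX .
qed

text \<open>On the interval between \<open>- max\<close> and \<open>max\<close> of
  \<open>\<bar>x\<bar>\<close> and \<open>\<bar>y\<bar>\<close> the bound for \<open>f'\<close>, being even and
  monotone in the modulus, is attained at an end point.\<close>

lemma ddiff_tail_bound:
  assumes der: "\<And>x. (f has_real_derivative f' x) (at x)"
    and b: "\<And>x. \<bar>f' x\<bar> \<le> e + K * (x ^ (2 * D) * (x / 3) ^ (2 * r))" and K: "K \<ge> 0" and e: "e \<ge> 0"
  shows "(ddiff f f' x y)\<^sup>2 \<le> 3 * e\<^sup>2 + 3 * K\<^sup>2 * (x ^ (2 * (2 * D)) * (x / 3) ^ (2 * (2 * r))) + 3 * K\<^sup>2 * (y ^ (2 * (2 * D)) * (y / 3) ^ (2 * (2 * r)))"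
proof -
  define T where "T u = K * (u ^ (2 * D) * (u / 3) ^ (2 * r))" for u :: real
  have T0: "T u \<ge> 0" for u unfolding T_def using K by (intro mult_nonneg_nonneg zero_le_even_power) auto
  have Tabs: "T u = K * (\<bar>u\<bar> ^ (2 * D) * \<bar>u / 3\<bar> ^ (2 * r))" for u unfolding T_def
  proof -
    have "\<bar>u\<bar> ^ (2 * D) = u ^ (2 * D)" "\<bar>u / 3\<bar> ^ (2 * r) = (u / 3) ^ (2 * r)" by (rule power_even_abs, simp)+
    then show "K * (u ^ (2 * D) * (u / 3) ^ (2 * r)) = K * (\<bar>u\<bar> ^ (2 * D) * \<bar>u / 3\<bar> ^ (2 * r))" by (simp only:)
  qed
  have Tmono: "T u \<le> T v" if "\<bar>u\<bar> \<le> \<bar>v\<bar>" for u v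
    unfolding Tabs using that K by (intro mult_left_mono mult_mono power_mono) auto
  define R where "R = max \<bar>x\<bar> \<bar>y\<bar>"
  have "\<bar>ddiff f f' x y\<bar> \<le> e + T x + T y"
  proof (rule ddiff_bound[OF der, of R])
    fix u assume "\<bar>u\<bar> \<le> R"
    then have "T u \<le> T x \<or> T u \<le> T y" unfolding R_def using Tmono[of u x] Tmono[of u y] by (auto simp: max_def split: if_splits)
    then show "\<bar>f' u\<bar> \<le> e + T x + T y" using b[of u, folded T_def] T0[of x] T0[of y] by linarith
  qed (auto simp: R_def)
  then have "\<bar>ddiff f f' x y\<bar>\<^sup>2 \<le> (e + T x + T y)\<^sup>2" by (rule power_mono) simp
  also have "\<dots> \<le> 3 * e\<^sup>2 + 3 * (T x)\<^sup>2 + 3 * (T y)\<^sup>2"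
  proof -
    have "(u + v + w)\<^sup>2 \<le> 3 * u\<^sup>2 + 3 * v\<^sup>2 + 3 * w\<^sup>2" for u v w :: real
      using zero_le_power2[of "u - v"] zero_le_power2[of "v - w"] zero_le_power2[of "u - w"]
      by (simp add: power2_eq_square algebra_simps)
    then show ?thesis .
  qed
  finally have le: "(ddiff f f' x y)\<^sup>2 \<le> 3 * e\<^sup>2 + 3 * (T x)\<^sup>2 + 3 * (T y)\<^sup>2" by simp
  have Tsq: "(T u)\<^sup>2 = K\<^sup>2 * (u ^ (2 * (2 * D)) * (u / 3) ^ (2 * (2 * r)))" for u
    unfolding T_def power_mult_distrib power_mult[symmetric] by (simp add: mult.commute mult.left_commute)
  show ?thesis using le unfolding Tsq by (simp only: mult.assoc)
qed

text \<open>The double integral of the squared divided differences is at most \<open>3 e\<^sup>2\<close> plus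
  tail terms in \<open>x\<close> and in \<open>y\<close> separately; the other variable integrates to
  one.\<close>

lemma variance_spec_tail:
  assumes n: "n \<ge> 1" and der: "\<And>x. (f has_real_derivative f' x) (at x)" and cont: "continuous_on UNIV f'"
    and i2: "integrable M (\<lambda>\<omega>. (spec n (jac n \<omega>) f)\<^sup>2)"
    and b: "\<And>x. \<bar>f' x\<bar> \<le> e + K * (x ^ (2 * D) * (x / 3) ^ (2 * r))" and K: "K \<ge> 0" and e: "e \<ge> 0"
    and iT: "integrable M (\<lambda>\<omega>. spec n (jac n \<omega>) (\<lambda>x. K\<^sup>2 * (x ^ (2 * (2 * D)) * (x / 3) ^ (2 * (2 * r)))))"
  shows "real n * \<beta> * variance (\<lambda>\<omega>. spec n (jac n \<omega>) f)
    \<le> 12 * e\<^sup>2 + 24 * expectation (\<lambda>\<omega>. spec n (jac n \<omega>) (\<lambda>x. K\<^sup>2 * (x ^ (2 * (2 * D)) * (x / 3) ^ (2 * (2 * r)))))"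
proof -
  define T where "T x = K\<^sup>2 * (x ^ (2 * (2 * D)) * (x / 3) ^ (2 * (2 * r)))" for x :: real
  note iT = iT[folded T_def]
  have n0: "n > 0" using n by simp
  have nb: "real n * \<beta> > 0" using n by (rule scale_pos)
  have T0: "T x \<ge> 0" for x unfolding T_def by (intro mult_nonneg_nonneg zero_le_even_power) auto
  have kern: "(\<Sum>k<n. \<Sum>c<n. (spec_kern n (jac n \<omega>) f f' k c)\<^sup>2) \<le> 3 * e\<^sup>2 + 6 * spec n (jac n \<omega>) T" for \<omega>
  proof -
    note eg = eigensystem_eig[of "jac n \<omega>" n, OF jac_sym]
    define lam w where "lam = eig_vals n (jac n \<omega>)" and "w = eig_vecs n (jac n \<omega>)"
    have W: "(\<Sum>i<n. (w i 0)\<^sup>2) = 1" unfolding w_def by (rule eigensystem_weights[OF eg n0])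
    have S: "spec n (jac n \<omega>) T = (\<Sum>i<n. (w i 0)\<^sup>2 * T (lam i))" by (simp add: spec_def lam_def w_def)
    have "(\<Sum>k<n. \<Sum>c<n. (spec_kern n (jac n \<omega>) f f' k c)\<^sup>2) = (\<Sum>i<n. \<Sum>j<n. (ddiff f f' (lam i) (lam j))\<^sup>2 * (w i 0)\<^sup>2 * (w j 0)\<^sup>2)"
      unfolding spec_kern_sum_squares[of "jac n \<omega>", OF jac_sym] lam_def w_def ..
    also have "\<dots> \<le> (\<Sum>i<n. \<Sum>j<n. (3 * e\<^sup>2 + 3 * T (lam i) + 3 * T (lam j)) * (w i 0)\<^sup>2 * (w j 0)\<^sup>2)"
      using ddiff_tail_bound[OF der b K e, unfolded mult.assoc[of 3] T_def[symmetric]]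
      by (intro sum_mono mult_right_mono) auto
    also have "\<dots> = (\<Sum>i<n. \<Sum>j<n. 3 * e\<^sup>2 * ((w i 0)\<^sup>2 * (w j 0)\<^sup>2) + 3 * (((w i 0)\<^sup>2 * T (lam i)) * (w j 0)\<^sup>2) + 3 * ((w i 0)\<^sup>2 * ((w j 0)\<^sup>2 * T (lam j))))"
      by (intro sum.cong refl) (simp add: algebra_simps)
    also have "\<dots> = 3 * e\<^sup>2 * ((\<Sum>i<n. (w i 0)\<^sup>2) * (\<Sum>j<n. (w j 0)\<^sup>2)) + 3 * ((\<Sum>i<n. (w i 0)\<^sup>2 * T (lam i)) * (\<Sum>j<n. (w j 0)\<^sup>2)) + 3 * ((\<Sum>i<n. (w i 0)\<^sup>2) * (\<Sum>j<n. (w j 0)\<^sup>2 * T (lam j)))"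
      unfolding sum_product unfolding sum.distrib sum_distrib_left by (rule refl)
    also have "\<dots> = 3 * e\<^sup>2 + 6 * spec n (jac n \<omega>) T" unfolding W S[symmetric] by simp
    finally show ?thesis .
  qed
  have S0: "spec n (jac n \<omega>) T \<ge> 0" for \<omega> unfolding spec_def using T0 by (intro sum_nonneg mult_nonneg_nonneg) auto
  have "ennreal (variance (\<lambda>\<omega>. spec n (jac n \<omega>) f))
    \<le> (\<integral>\<^sup>+\<omega>. ennreal (4 / (real n * \<beta>) * (\<Sum>r<n. \<Sum>c<n. (spec_kern n (jac n \<omega>) f f' r c)\<^sup>2)) \<partial>M)"
    by (rule variance_spec_kern[OF n der cont i2])
  also have "\<dots> \<le> (\<integral>\<^sup>+\<omega>. ennreal (4 / (real n * \<beta>) * (3 * e\<^sup>2 + 6 * spec n (jac n \<omega>) T)) \<partial>M)"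
    using nb by (intro nn_integral_mono ennreal_leI mult_left_mono kern) auto
  also have "\<dots> = ennreal (expectation (\<lambda>\<omega>. 4 / (real n * \<beta>) * (3 * e\<^sup>2 + 6 * spec n (jac n \<omega>) T)))"
    using nb S0 iT by (intro nn_integral_eq_integral) auto
  also have "expectation (\<lambda>\<omega>. 4 / (real n * \<beta>) * (3 * e\<^sup>2 + 6 * spec n (jac n \<omega>) T)) = 4 / (real n * \<beta>) * (3 * e\<^sup>2 + 6 * expectation (\<lambda>\<omega>. spec n (jac n \<omega>) T))"
    using iT by (simp add: prob_space)
  finally have "variance (\<lambda>\<omega>. spec n (jac n \<omega>) f) \<le> 4 / (real n * \<beta>) * (3 * e\<^sup>2 + 6 * expectation (\<lambda>\<omega>. spec n (jac n \<omega>) T))"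
    using nb S0 by (subst (asm) ennreal_le_iff) (auto intro!: mult_nonneg_nonneg add_nonneg_nonneg Bochner_Integration.integral_nonneg)
  then have "real n * \<beta> * variance (\<lambda>\<omega>. spec n (jac n \<omega>) f) \<le> real n * \<beta> * (4 / (real n * \<beta>) * (3 * e\<^sup>2 + 6 * expectation (\<lambda>\<omega>. spec n (jac n \<omega>) T)))"
    using nb by (intro mult_left_mono) auto
  also have "\<dots> = 12 * e\<^sup>2 + 24 * expectation (\<lambda>\<omega>. spec n (jac n \<omega>) T)" using nb beta_pos n by (simp add: field_simps)
  finally show ?thesis unfolding T_def .
qed

end

section \<open>Characteristic functions and the Gaussian limit of the linear part\<close>
lemma char_gauss_measure:
  assumes s: "\<sigma> > 0"
  shows "(\<integral>x. iexp (t * x) \<partial>gauss_measure \<sigma>) = complex_of_real (exp (- (\<sigma>\<^sup>2 * t\<^sup>2 / 2)))"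
proof -
  interpret N: prob_space std_normal_distribution by (rule prob_space_normal_density) simp
  have "distr std_normal_distribution lborel (\<lambda>x. x) = std_normal_distribution"
    by (rule distr_id2) simp
  then have "distributed std_normal_distribution lborel (\<lambda>x. x) (normal_density 0 1)"
    by (simp add: distributed_def)
  from N.normal_density_affine[OF this, of \<sigma> 0]
  have d: "distributed std_normal_distribution lborel (\<lambda>x. \<sigma> * x) (normal_density 0 \<sigma>)" using s by simp
  have "gauss_measure \<sigma> = distr std_normal_distribution lborel (\<lambda>x. \<sigma> * x)"
    unfolding gauss_measure_def using distributed_distr_eq_density[OF d] by simp
  then have "(\<integral>x. iexp (t * x) \<partial>gauss_measure \<sigma>) = (\<integral>x. iexp (t * (\<sigma> * x)) \<partial>std_normal_distribution)"
    by (simp add: integral_distr)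
  also have "\<dots> = char std_normal_distribution (t * \<sigma>)" by (simp add: char_def mult.assoc)
  also have "\<dots> = complex_of_real (exp (- ((t * \<sigma>)\<^sup>2) / 2))" by (simp add: char_std_normal_distribution)
  finally show ?thesis by (simp add: power_mult_distrib mult.commute)
qed

lemma real_distribution_normal_distribution:
  assumes "s2 \<ge> 0"
  shows "real_distribution (normal_distribution 0 s2)"
proof -
  have "prob_space (normal_distribution 0 s2)"
    unfolding normal_distribution_def using assms by (auto intro: prob_space_return prob_space_normal_density)
  then show ?thesis
    by (simp add: real_distribution_def real_distribution_axioms_def normal_distribution_def)
qed

lemma char_normal_distribution:
  assumes "s2 \<ge> 0"
  shows "char (normal_distribution 0 s2) t = complex_of_real (exp (- (s2 * t\<^sup>2 / 2)))"
proof (cases "s2 = 0")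
  case True
  have "(\<integral>x. iexp (t * x) \<partial>return borel (0::real)) = iexp (t * 0)" by (rule integral_return) auto
  then show ?thesis using True by (simp add: normal_distribution_def char_def)
next
  case False
  then have "sqrt s2 > 0" using assms by simp
  from char_gauss_measure[OF this, of t] show ?thesis
    using False assms by (simp add: normal_distribution_def char_def gauss_measure_def)
qed

lemma iexp_lipschitz: "norm (iexp u - iexp v) \<le> \<bar>u - v\<bar>"
proof -
  have "iexp u - iexp v = iexp v * (iexp (u - v) - 1)" by (simp add: right_diff_distrib exp_add[symmetric])
  then have "norm (iexp u - iexp v) = norm (iexp (u - v) - 1)" by (simp only: norm_mult norm_exp_i_times mult_1)
  also have "\<dots> \<le> \<bar>u - v\<bar>" using iexp_approx1[of "u - v" 0] by simp
  finally show ?thesis .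
qed

text \<open>Lipschitz continuity of the exponential and the Cauchy-Schwarz inequality.\<close>

lemma (in prob_space) characteristic_difference_le:
  assumes [measurable]: "X \<in> borel_measurable M" "Y \<in> borel_measurable M"
    and i2: "integrable M (\<lambda>\<omega>. (X \<omega> - Y \<omega>)\<^sup>2)" and le: "expectation (\<lambda>\<omega>. (X \<omega> - Y \<omega>)\<^sup>2) \<le> q\<^sup>2" and q: "q \<ge> 0"
  shows "norm ((\<integral>\<omega>. iexp (t * X \<omega>) \<partial>M) - (\<integral>\<omega>. iexp (t * Y \<omega>) \<partial>M)) \<le> \<bar>t\<bar> * q"
proof -
  have i1: "integrable M (\<lambda>\<omega>. X \<omega> - Y \<omega>)" by (rule square_integrable_imp_integrable[OF _ i2]) measurable
  then have ia: "integrable M (\<lambda>\<omega>. \<bar>X \<omega> - Y \<omega>\<bar>)" by simp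
  have "(expectation (\<lambda>\<omega>. \<bar>X \<omega> - Y \<omega>\<bar>))\<^sup>2 \<le> expectation (\<lambda>\<omega>. \<bar>X \<omega> - Y \<omega>\<bar>\<^sup>2)"
    using variance_positive[of "\<lambda>\<omega>. \<bar>X \<omega> - Y \<omega>\<bar>"] variance_eq[OF ia] i2 by simp
  also have "\<dots> \<le> q\<^sup>2" using le by simp
  finally have Eq: "expectation (\<lambda>\<omega>. \<bar>X \<omega> - Y \<omega>\<bar>) \<le> q" by (rule power2_le_imp_le) (rule q)
  have ie: "integrable M (\<lambda>\<omega>. iexp (t * V \<omega>))" if "V \<in> borel_measurable M" for V
    using that by (intro integrable_const_bound[of _ 1]) auto
  have "(\<integral>\<omega>. iexp (t * X \<omega>) \<partial>M) - (\<integral>\<omega>. iexp (t * Y \<omega>) \<partial>M) = (\<integral>\<omega>. iexp (t * X \<omega>) - iexp (t * Y \<omega>) \<partial>M)"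
    using ie[OF assms(1)] ie[OF assms(2)] by (rule Bochner_Integration.integral_diff[symmetric])
  also have "norm \<dots> \<le> (\<integral>\<omega>. \<bar>t\<bar> * \<bar>X \<omega> - Y \<omega>\<bar> \<partial>M)"
  proof (rule order_trans[OF Bochner_Integration.integral_norm_bound], rule integral_mono)
    show "norm (iexp (t * X \<omega>) - iexp (t * Y \<omega>)) \<le> \<bar>t\<bar> * \<bar>X \<omega> - Y \<omega>\<bar>" for \<omega>
      using iexp_lipschitz[of "t * X \<omega>" "t * Y \<omega>"] by (simp only: right_diff_distrib[symmetric] abs_mult)
    show "integrable M (\<lambda>\<omega>. norm (iexp (t * X \<omega>) - iexp (t * Y \<omega>)))"
      by (intro integrable_norm Bochner_Integration.integrable_diff ie) measurable
  qed (use ia in simp)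
  also have "\<dots> = \<bar>t\<bar> * expectation (\<lambda>\<omega>. \<bar>X \<omega> - Y \<omega>\<bar>)" by simp
  also have "\<dots> \<le> \<bar>t\<bar> * q" using Eq by (intro mult_left_mono) auto
  finally show ?thesis .
qed

text \<open>Independence only concerns the family of generated \<open>\<sigma>\<close>-algebras, so that it is
  inherited by every injectively indexed subfamily.\<close>

lemma (in prob_space) indep_vars_reindex_inj:
  assumes ind: "indep_vars (\<lambda>_. N) X I" and f: "inj_on f J" "f ` J \<subseteq> I"
  shows "indep_vars (\<lambda>_. N) (\<lambda>j. X (f j)) J"
proof -
  define F where "F i = sigma_sets (space M) {X i -` A \<inter> space M | A. A \<in> sets N}" for i
  have H: "indep_sets F I" and rv: "\<And>i. i \<in> I \<Longrightarrow> random_variable N (X i)"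
    using ind unfolding indep_vars_def F_def [abs_def] by auto
  have "indep_sets (\<lambda>j. F (f j)) J"
  proof (rule indep_setsI)
    show "F (f j) \<subseteq> events" if "j \<in> J" for j
      using H f(2) that unfolding indep_sets_def by blast
    fix A K assume K: "K \<noteq> {}" "K \<subseteq> J" "finite K" and A: "\<forall>j\<in>K. A j \<in> F (f j)"
    have injK: "inj_on f K" using f(1) K(2) by (rule inj_on_subset)
    define B where "B = A \<circ> the_inv_into K f"
    have B: "B (f j) = A j" if "j \<in> K" for j using that by (simp add: B_def the_inv_into_f_f[OF injK])
    have "prob (\<Inter>i\<in>f ` K. B i) = (\<Prod>i\<in>f ` K. prob (B i))"
      by (rule indep_setsD[OF H]) (use K f(2) A B in auto)
    also have "(\<Inter>i\<in>f ` K. B i) = (\<Inter>j\<in>K. A j)" using B by auto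
    also have "(\<Prod>i\<in>f ` K. prob (B i)) = (\<Prod>j\<in>K. prob (A j))"
      using B by (simp add: prod.reindex[OF injK])
    finally show "prob (\<Inter>j\<in>K. A j) = (\<Prod>j\<in>K. prob (A j))" .
  qed
  then show ?thesis unfolding indep_vars_def F_def [abs_def] using rv f(2) by auto
qed

lemma psum'_is_psum: "\<exists>c2 d2. psum' c d = psum c2 d2"
proof -
  have "real_polynomial_function (\<lambda>x. c i * (real i * x ^ (i - 1)))" for i
    by (intro real_polynomial_function.intros(4) real_polynomial_function.intros(2) real_polynomial_function_power
        real_polynomial_function.intros(1) bounded_linear_ident)
  then have "real_polynomial_function (psum' c d)"
    unfolding psum'_def [abs_def] by (intro real_polynomial_function_sum) auto
  then show ?thesis unfolding real_polynomial_function_iff_sum psum_def [abs_def] .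
qed

lemma exp_minus_lipschitz:
  assumes "x \<ge> 0" "y \<ge> (0::real)"
  shows "\<bar>exp (- x) - exp (- y)\<bar> \<le> \<bar>x - y\<bar>"
proof -
  have *: "exp (- v) - exp (- u) \<le> u - v" if uv: "0 \<le> v" "v \<le> u" for u v :: real
  proof -
    have "exp (- v) - exp (- u) = exp (- v) * (1 - exp (- (u - v)))" by (simp add: right_diff_distrib exp_add[symmetric])
    also have "\<dots> \<le> 1 * (u - v)"
    proof (rule mult_mono)
      show "1 - exp (- (u - v)) \<le> u - v" using exp_ge_add_one_self[of "- (u - v)"] by linarith
    qed (use uv in auto)
    finally show ?thesis by simp
  qed
  show ?thesis
  proof (cases "x \<le> y")
    case True
    then have "exp (- y) \<le> exp (- x)" by simp
    then show ?thesis using *[of x y] True assms by simp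
  next
    case False
    then have "exp (- x) \<le> exp (- y)" by simp
    then show ?thesis using *[of y x] False assms by simp
  qed
qed

lemma semicircle_variance_close:
  fixes f p :: "real \<Rightarrow> real"
  assumes f: "continuous_on UNIV f" and p: "continuous_on UNIV p"
    and B: "\<And>x. \<bar>x\<bar> \<le> 2 \<Longrightarrow> \<bar>f x\<bar> \<le> B" and close: "\<And>x. \<bar>x\<bar> \<le> 2 \<Longrightarrow> \<bar>f x - p x\<bar> \<le> 2 * e" and e: "0 \<le> e" "e \<le> 1"
  shows "\<bar>((\<integral>x. (p x)\<^sup>2 \<partial>semicircle) - (\<integral>x. p x \<partial>semicircle)\<^sup>2) - ((\<integral>x. (f x)\<^sup>2 \<partial>semicircle) - (\<integral>x. f x \<partial>semicircle)\<^sup>2)\<bar> \<le> 16 * (B + 1) * e"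
proof -
  interpret sc: prob_space semicircle by (rule prob_space_semicircle)
  have B0: "B \<ge> 0" using B[of 0] by simp
  have i: "integrable semicircle f" "integrable semicircle p" "integrable semicircle (\<lambda>x. (f x)\<^sup>2)" "integrable semicircle (\<lambda>x. (p x)\<^sup>2)"
    by (rule semicircle_integral_eq, intro continuous_intros f p)+
  have const: "\<bar>\<integral>x. u x \<partial>semicircle\<bar> \<le> c" if u: "integrable semicircle u" and c: "\<And>x. \<bar>x\<bar> \<le> 2 \<Longrightarrow> \<bar>u x\<bar> \<le> c" for u :: "real \<Rightarrow> real" and c
  proof -
    have "\<bar>\<integral>x. u x \<partial>semicircle\<bar> \<le> (\<integral>x. \<bar>u x\<bar> \<partial>semicircle)" by (rule integral_abs_bound)
    also have "\<dots> \<le> (\<integral>x. c \<partial>semicircle)"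
      by (rule integral_mono_AE) (use u AE_semicircle c in \<open>auto elim!: eventually_mono\<close>)
    also have "\<dots> = c" using sc.prob_space by simp
    finally show ?thesis .
  qed
  have sq: "\<bar>v\<^sup>2 - u\<^sup>2\<bar> \<le> 2 * e * (2 * (B + 1) * 2)" if "\<bar>u\<bar> \<le> B" "\<bar>u - v\<bar> \<le> 2 * e" for u v :: real
  proof -
    have "\<bar>v\<^sup>2 - u\<^sup>2\<bar> = \<bar>u - v\<bar> * \<bar>u + v\<bar>" by (simp add: power2_eq_square abs_mult[symmetric] algebra_simps abs_minus_commute)
    also have "\<dots> \<le> 2 * e * (2 * (B + 1) * 2)"
      using that e B0 by (intro mult_mono) (auto simp: abs_le_iff)
    finally show ?thesis .
  qed
  have 1: "\<bar>(\<integral>x. (p x)\<^sup>2 \<partial>semicircle) - (\<integral>x. (f x)\<^sup>2 \<partial>semicircle)\<bar> \<le> 2 * e * (2 * (B + 1) * 2)"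
  proof -
    have "(\<integral>x. (p x)\<^sup>2 \<partial>semicircle) - (\<integral>x. (f x)\<^sup>2 \<partial>semicircle) = (\<integral>x. (p x)\<^sup>2 - (f x)\<^sup>2 \<partial>semicircle)" using i by simp
    also have "\<bar>\<dots>\<bar> \<le> 2 * e * (2 * (B + 1) * 2)" by (rule const) (use i B close sq in auto)
    finally show ?thesis .
  qed
  have 2: "\<bar>(\<integral>x. p x \<partial>semicircle)\<^sup>2 - (\<integral>x. f x \<partial>semicircle)\<^sup>2\<bar> \<le> 2 * e * (2 * (B + 1) * 2)"
  proof (rule sq)
    show "\<bar>\<integral>x. f x \<partial>semicircle\<bar> \<le> B" by (rule const[OF i(1) B])
    have "(\<integral>x. f x \<partial>semicircle) - (\<integral>x. p x \<partial>semicircle) = (\<integral>x. f x - p x \<partial>semicircle)" using i by simp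
    also have "\<bar>\<dots>\<bar> \<le> 2 * e" by (rule const) (use i close in auto)
    finally show "\<bar>(\<integral>x. f x \<partial>semicircle) - (\<integral>x. p x \<partial>semicircle)\<bar> \<le> 2 * e" .
  qed
  have "2 * e * (2 * (B + 1) * 2) = 8 * (B + 1) * e" by simp
  then show ?thesis using 1 2 by linarith
qed

context beta_ensemble
begin

definition fluct :: "nat \<Rightarrow> real" where "fluct n = sqrt (real n * \<beta>) / sqrt 2"

lemma fluct_sq: "(fluct n)\<^sup>2 = real n * \<beta> / 2"
  using beta_pos by (simp add: fluct_def power_divide)

text \<open>The single entry that \<open>lin m\<close> depends on.\<close>

definition lin_index :: "nat \<Rightarrow> nat + nat" where
  "lin_index m = (if odd m then Inl ((m + 1) div 2) else Inr (m div 2))"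

lemma lin_measurable: "1 \<le> m \<Longrightarrow> m < n \<Longrightarrow> lin m n \<in> borel_measurable M"
  unfolding lin_def [abs_def] by (cases "odd m") (auto elim!: oddE evenE intro!: a_measurable xi_measurable)

lemma lin_half:
  fixes m n :: nat
  assumes "1 \<le> m" "m < n"
  shows "even m \<Longrightarrow> 1 \<le> m div 2 \<and> m div 2 < n"
    and "odd m \<Longrightarrow> 1 \<le> (m + 1) div 2 \<and> (m + 1) div 2 \<le> n"
proof -
  assume "even m"
  then obtain k where "m = 2 * k" by (elim evenE)
  then show "1 \<le> m div 2 \<and> m div 2 < n" using assms by simp
next
  assume "odd m"
  then obtain k where "m = 2 * k + 1" by (elim oddE)
  then show "1 \<le> (m + 1) div 2 \<and> (m + 1) div 2 \<le> n" using assms by simp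
qed

text \<open>Different \<open>m\<close> use different entries.\<close>

lemma lin_indep:
  assumes d: "d < n"
  shows "indep_vars (\<lambda>_. borel) (\<lambda>m \<omega>. c m * (fluct n * lin m n \<omega>)) {1..d}"
proof -
  define g where "g m y = c m * (fluct n * (if odd m then y else ((sqrt (real n * \<beta>) * y)\<^sup>2 - dof n (m div 2)) / (real n * \<beta>)))" for m y
  have n: "n \<ge> 1" using d by simp
  have "indep_vars (\<lambda>_. borel) (\<lambda>m. case_sum (a n) (b n) (lin_index m)) {1..d}"
  proof (rule indep_vars_reindex_inj[OF entries_indep[OF n]])
    show "inj_on lin_index {1..d}"
    proof (rule inj_onI)
      fix x y assume "lin_index x = lin_index y"
      then show "x = y" by (auto simp: lin_index_def split: if_splits elim!: oddE evenE)
    qed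
    show "lin_index ` {1..d} \<subseteq> {1..n} <+> {1..<n}"
    proof
      fix i assume "i \<in> lin_index ` {1..d}"
      then obtain m where m: "1 \<le> m" "m \<le> d" "i = lin_index m" by auto
      then show "i \<in> {1..n} <+> {1..<n}"
        using lin_half[of m n] d by (cases "odd m") (auto simp: lin_index_def)
    qed
  qed
  then have "indep_vars (\<lambda>_. borel) (\<lambda>m \<omega>. g m (case_sum (a n) (b n) (lin_index m) \<omega>)) {1..d}"
    by (rule indep_vars_compose2) (simp add: g_def)
  moreover have "g m (case_sum (a n) (b n) (lin_index m) \<omega>) = c m * (fluct n * lin m n \<omega>)" if "m \<in> {1..d}" for m \<omega>
    using that by (auto simp: g_def lin_index_def lin_def xi_def)
  ultimately show ?thesis by (subst indep_vars_cong[where Y = "\<lambda>m \<omega>. g m (case_sum (a n) (b n) (lin_index m) \<omega>)", OF refl _ refl]) auto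
qed

lemma lin_expectation:
  assumes m: "1 \<le> m" "m < n"
  shows "expectation (lin m n) = 0"
proof -
  have nb: "real n * \<beta> > 0" using m by (intro scale_pos) simp
  show ?thesis
  proof (cases "odd m")
    case True
    define i where "i = (m + 1) div 2"
    have i: "1 \<le> i" "i \<le> n" using lin_half(2)[OF m True] by (auto simp: i_def)
    note [measurable] = a_measurable[OF i]
    have "(\<integral>x. x \<partial>gauss_measure (sqrt 2)) = 0"
      using normal_moment_nz_1[of "sqrt 2" 0] by (subst gauss_measure_integral) (simp_all add: has_bochner_integral_integral_eq)
    then have "expectation (\<lambda>\<omega>. sqrt (real n * \<beta>) * a n i \<omega>) = 0"
      unfolding distr_a[OF i, symmetric] by (subst (asm) integral_distr) auto
    then have "expectation (a n i) = 0" using beta_pos m by simp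
    then show ?thesis using True by (simp add: lin_def [abs_def] i_def)
  next
    case False
    define i where "i = m div 2"
    have i: "1 \<le> i" "i < n" using lin_half(1)[OF m] False by (auto simp: i_def)
    note [measurable] = b_measurable[OF i]
    have "(\<integral>x. (x\<^sup>2 - dof n i) \<partial>chi_measure (dof n i)) = 0"
      using chi_central_recurrence[OF dof_pos[OF i(2)], of 0] by simp
    then have "(\<integral>x. (x\<^sup>2 - dof n i) \<partial>distr M borel (\<lambda>\<omega>. sqrt (real n * \<beta>) * b n i \<omega>)) = 0"
      unfolding distr_b[OF i] .
    then have "expectation (\<lambda>\<omega>. (sqrt (real n * \<beta>) * b n i \<omega>)\<^sup>2 - dof n i) = 0"
      by (subst (asm) integral_distr) auto
    then have "expectation (xi n i) = 0" unfolding xi_def [abs_def] by simp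
    then show ?thesis using False m by (simp add: lin_def [abs_def] i_def)
  qed
qed

text \<open>For odd \<open>m\<close> the scaled entry is exactly standard normal.  For even \<open>m\<close>
  the estimate for the chi-square variable applies with \<open>s = sqrt (2 n \<beta>)\<close>; the error is of
  order \<open>1 / s\<close>, and the variance \<open>1 - i / n\<close> tends to one.\<close>

lemma lin_char_tendsto:
  assumes m: "1 \<le> m"
  shows "(\<lambda>n. \<integral>\<omega>. iexp (t * (fluct n * lin m n \<omega>)) \<partial>M) \<longlonglongrightarrow> complex_of_real (exp (- (t\<^sup>2 / 2)))"
proof (cases "odd m")
  case True
  define i where "i = (m + 1) div 2"
  have "\<forall>\<^sub>F n in sequentially. (\<integral>\<omega>. iexp (t * (fluct n * lin m n \<omega>)) \<partial>M) = complex_of_real (exp (- (t\<^sup>2 / 2)))"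
    using eventually_gt_at_top[of m]
  proof eventually_elim
    case (elim n)
    have i: "1 \<le> i" "i \<le> n" using lin_half(2)[OF m elim True] by (auto simp: i_def)
    note [measurable] = a_measurable[OF i]
    have eq: "t * (fluct n * lin m n \<omega>) = t / sqrt 2 * (sqrt (real n * \<beta>) * a n i \<omega>)" for \<omega>
      using True by (simp add: lin_def i_def fluct_def)
    have "(\<integral>\<omega>. iexp (t * (fluct n * lin m n \<omega>)) \<partial>M) = (\<integral>x. iexp (t / sqrt 2 * x) \<partial>gauss_measure (sqrt 2))"
      unfolding eq distr_a[OF i, symmetric] by (rule integral_distr[symmetric]) measurable
    also have "\<dots> = complex_of_real (exp (- ((sqrt 2)\<^sup>2 * (t / sqrt 2)\<^sup>2 / 2)))" by (rule char_gauss_measure) simp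
    finally show ?case by (simp add: power_divide)
  qed
  then show ?thesis by (rule tendsto_eventually)
next
  case False
  define i where "i = m div 2"
  have i1: "1 \<le> i" using False m by (auto simp: i_def elim!: evenE)
  define \<gamma> where "\<gamma> n = 1 - real i / real n" for n
  define s where "s n = sqrt (2 * (real n * \<beta>))" for n
  have bound: "\<forall>\<^sub>F n in sequentially. norm ((\<integral>\<omega>. iexp (t * (fluct n * lin m n \<omega>)) \<partial>M) - complex_of_real (exp (- (\<gamma> n * t\<^sup>2 / 2)))) \<le> 2 * t\<^sup>2 / s n"
    using eventually_gt_at_top[of m]
  proof eventually_elim
    case (elim n)
    have i: "1 \<le> i" "i < n" using lin_half(1)[OF m elim] False by (auto simp: i_def)
    have nb: "real n * \<beta> > 0" using elim by (intro scale_pos) simp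
    have s: "s n > 0" "(s n)\<^sup>2 = 2 * (real n * \<beta>)" using nb by (simp_all add: s_def)
    note [measurable] = b_measurable[OF i]
    have fs: "fluct n / (real n * \<beta>) = 1 / s n"
    proof -
      define x where "x = real n * \<beta>"
      have x: "x > 0" using nb by (simp add: x_def)
      have "sqrt x / sqrt 2 / x = 1 / (sqrt 2 * sqrt x)"
        using x by (simp add: field_simps)
      then show ?thesis unfolding fluct_def s_def x_def real_sqrt_mult[of 2] .
    qed
    have eq: "t * (fluct n * lin m n \<omega>) = t * (((sqrt (real n * \<beta>) * b n i \<omega>)\<^sup>2 - dof n i) / s n)" for \<omega>
    proof -
      have "fluct n * lin m n \<omega> = (fluct n / (real n * \<beta>)) * ((sqrt (real n * \<beta>) * b n i \<omega>)\<^sup>2 - dof n i)"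
        using False m by (simp add: lin_def i_def xi_def)
      then show ?thesis unfolding fs by simp
    qed
    have kg: "2 * dof n i / (s n)\<^sup>2 = \<gamma> n"
      using i beta_pos unfolding s(2) by (simp add: dof_def \<gamma>_def of_nat_diff field_simps)
    have "(\<integral>\<omega>. iexp (t * (fluct n * lin m n \<omega>)) \<partial>M) = (\<integral>x. iexp (t * ((x\<^sup>2 - dof n i) / s n)) \<partial>chi_measure (dof n i))"
      unfolding eq unfolding distr_b[OF i, symmetric] by (rule integral_distr[symmetric]) measurable
    then have "norm ((\<integral>\<omega>. iexp (t * (fluct n * lin m n \<omega>)) \<partial>M) - complex_of_real (exp (- (\<gamma> n * t\<^sup>2 / 2)))) \<le> (1 + \<gamma> n) / s n * t\<^sup>2"
      using chi_square_char_estimate[OF dof_pos[OF i(2)] prob_space_chi[OF i] s(1), of t] unfolding kg by simp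
    also have "\<dots> \<le> 2 / s n * t\<^sup>2" using s(1) by (intro mult_right_mono divide_right_mono) (auto simp: \<gamma>_def)
    finally show ?case by simp
  qed
  have "filterlim (\<lambda>n. s n) at_top sequentially"
    unfolding s_def using beta_pos by real_asymp
  then have "(\<lambda>n. 2 * t\<^sup>2 / s n) \<longlonglongrightarrow> 0" by (intro real_tendsto_divide_at_top[OF tendsto_const])
  then have "(\<lambda>n. (\<integral>\<omega>. iexp (t * (fluct n * lin m n \<omega>)) \<partial>M) - complex_of_real (exp (- (\<gamma> n * t\<^sup>2 / 2)))) \<longlonglongrightarrow> 0"
    by (rule Lim_null_comparison[OF bound])
  moreover have "(\<lambda>n. complex_of_real (exp (- (\<gamma> n * t\<^sup>2 / 2)))) \<longlonglongrightarrow> complex_of_real (exp (- ((1 - 0) * t\<^sup>2 / 2)))"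
  proof -
    have "(\<lambda>n. real i * (1 / real n)) \<longlonglongrightarrow> real i * 0" by (intro tendsto_mult tendsto_const lim_1_over_n)
    then have "\<gamma> \<longlonglongrightarrow> 1 - 0" unfolding \<gamma>_def [abs_def] by (intro tendsto_diff tendsto_const) simp
    then show ?thesis by (intro tendsto_intros) auto
  qed
  ultimately have "(\<lambda>n. ((\<integral>\<omega>. iexp (t * (fluct n * lin m n \<omega>)) \<partial>M) - complex_of_real (exp (- (\<gamma> n * t\<^sup>2 / 2)))) + complex_of_real (exp (- (\<gamma> n * t\<^sup>2 / 2)))) \<longlonglongrightarrow> 0 + complex_of_real (exp (- ((1 - 0) * t\<^sup>2 / 2)))"
    by (rule tendsto_add)
  then show ?thesis by simp
qed

lemma lin_sum_char_tendsto:
  "(\<lambda>n. \<integral>\<omega>. iexp (t * (\<Sum>m=1..d. \<alpha> m * (fluct n * lin m n \<omega>))) \<partial>M)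
     \<longlonglongrightarrow> complex_of_real (exp (- ((\<Sum>m=1..d. (\<alpha> m)\<^sup>2) * t\<^sup>2 / 2)))"
proof -
  have "\<forall>\<^sub>F n in sequentially. (\<integral>\<omega>. iexp (t * (\<Sum>m=1..d. \<alpha> m * (fluct n * lin m n \<omega>))) \<partial>M)
      = (\<Prod>m=1..d. \<integral>\<omega>. iexp ((t * \<alpha> m) * (fluct n * lin m n \<omega>)) \<partial>M)"
    using eventually_gt_at_top[of d]
  proof eventually_elim
    case (elim n)
    have ml: "lin m n \<in> borel_measurable M" if "m \<in> {1..d}" for m using that elim by (intro lin_measurable) auto
    have c: "char (distr M borel X) t = (\<integral>\<omega>. iexp (t * X \<omega>) \<partial>M)" if [measurable]: "X \<in> borel_measurable M" for X
      unfolding char_def by (rule integral_distr) measurable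
    have "(\<integral>\<omega>. iexp (t * (\<Sum>m=1..d. \<alpha> m * (fluct n * lin m n \<omega>))) \<partial>M) = char (distr M borel (\<lambda>\<omega>. \<Sum>m=1..d. \<alpha> m * (fluct n * lin m n \<omega>))) t"
      by (rule c[symmetric]) (intro borel_measurable_sum borel_measurable_times borel_measurable_const ml)
    also have "\<dots> = (\<Prod>m=1..d. char (distr M borel (\<lambda>\<omega>. \<alpha> m * (fluct n * lin m n \<omega>))) t)"
      by (rule char_distr_sum[OF lin_indep[OF elim]])
    also have "\<dots> = (\<Prod>m=1..d. \<integral>\<omega>. iexp (t * (\<alpha> m * (fluct n * lin m n \<omega>))) \<partial>M)"
      by (intro prod.cong refl c borel_measurable_times borel_measurable_const ml)
    finally show ?case by (simp only: mult.assoc)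
  qed
  then have ev: "\<forall>\<^sub>F n in sequentially. (\<Prod>m=1..d. \<integral>\<omega>. iexp ((t * \<alpha> m) * (fluct n * lin m n \<omega>)) \<partial>M)
      = (\<integral>\<omega>. iexp (t * (\<Sum>m=1..d. \<alpha> m * (fluct n * lin m n \<omega>))) \<partial>M)"
    by eventually_elim (rule sym)
  have "(\<lambda>n. \<Prod>m=1..d. \<integral>\<omega>. iexp ((t * \<alpha> m) * (fluct n * lin m n \<omega>)) \<partial>M) \<longlonglongrightarrow> (\<Prod>m=1..d. complex_of_real (exp (- ((t * \<alpha> m)\<^sup>2 / 2))))"
    by (intro tendsto_prod lin_char_tendsto) auto
  also have "(\<Prod>m=1..d. complex_of_real (exp (- ((t * \<alpha> m)\<^sup>2 / 2)))) = complex_of_real (exp (\<Sum>m=1..d. - ((t * \<alpha> m)\<^sup>2 / 2)))"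
    unfolding of_real_prod[symmetric] exp_sum[OF finite_atLeastAtMost] ..
  also have "(\<Sum>m=1..d. - ((t * \<alpha> m)\<^sup>2 / 2)) = - ((\<Sum>m=1..d. (\<alpha> m)\<^sup>2) * t\<^sup>2 / 2)"
    unfolding sum_negf sum_distrib_right sum_divide_distrib by (simp add: power_mult_distrib mult.commute)
  finally show ?thesis by (rule Lim_transform_eventually[OF _ ev])
qed

end

section \<open>The limit theorems\<close>
lemma psum_even_bound: "\<bar>psum c d u\<bar> \<le> (\<Sum>m\<le>d. \<bar>c m\<bar>) * (1 + u ^ (2 * d))"
proof (cases "\<bar>u\<bar> \<ge> 1")
  case True
  have "\<bar>u\<bar> ^ d \<le> \<bar>u\<bar> ^ (2 * d)" using True by (intro power_increasing) auto
  also have "\<dots> = u ^ (2 * d)" by (simp add: power_mult)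
  finally have "(\<Sum>m\<le>d. \<bar>c m\<bar>) * \<bar>u\<bar> ^ d \<le> (\<Sum>m\<le>d. \<bar>c m\<bar>) * (1 + u ^ (2 * d))"
    by (intro mult_left_mono) (auto intro: sum_nonneg)
  then show ?thesis using psum_growth[OF True, of c d] by linarith
next
  case False
  have "\<bar>psum c d u\<bar> \<le> (\<Sum>m\<le>d. \<bar>c m * u ^ m\<bar>)" unfolding psum_def by (rule sum_abs)
  also have "\<dots> \<le> (\<Sum>m\<le>d. \<bar>c m\<bar> * 1)"
    unfolding abs_mult power_abs using False by (intro sum_mono mult_left_mono power_le_one) auto
  also have "\<dots> \<le> (\<Sum>m\<le>d. \<bar>c m\<bar>) * (1 + u ^ (2 * d))"
    unfolding sum_distrib_right by (intro sum_mono mult_left_mono) (auto simp: power_mult)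
  finally show ?thesis .
qed

lemma polynomial_growth_even:
  assumes "\<And>x. \<bar>g x\<bar> \<le> C + A * (1 + x ^ (2 * d)) * (1 + x\<^sup>2)"
  shows "polynomial_growth g"
  unfolding polynomial_growth_def
  by (rule exI[of _ "[:C:] + [:A:] * (1 + monom 1 (2 * d)) * (1 + monom 1 2)"]) (simp add: poly_monom assms flip: mult.assoc)

text \<open>A polynomial need not be monotone in the modulus of its argument; the bound \<open>A (1 +
  x\<^sup>2\<^sup>d)\<close> is, and it can be used along the whole segment from \<open>0\<close> to
  \<open>x\<close>.\<close>

lemma polynomial_growth_antiderivative:
  assumes der: "\<And>x. (f has_real_derivative f' x) (at x)" and growth: "polynomial_growth f'"
  shows "polynomial_growth f"
proof -
  obtain c d where cd: "\<And>x. \<bar>f' x\<bar> \<le> psum c d x" using growth unfolding polynomial_growth_psum by blast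
  define A where "A = (\<Sum>m\<le>d. \<bar>c m\<bar>)"
  have A: "A \<ge> 0" by (auto simp: A_def intro: sum_nonneg)
  show ?thesis
  proof (rule polynomial_growth_even)
    fix x
    have b: "\<bar>ddiff f f' x 0\<bar> \<le> A * (1 + x ^ (2 * d))"
    proof (rule ddiff_bound[OF der, of "\<bar>x\<bar>"])
      fix u assume u: "\<bar>u\<bar> \<le> \<bar>x\<bar>"
      have "\<bar>f' u\<bar> \<le> A * (1 + u ^ (2 * d))" using cd[of u] psum_even_bound[of c d u] unfolding A_def by linarith
      also have "\<dots> \<le> A * (1 + x ^ (2 * d))"
        using u A power_mono[of "\<bar>u\<bar>" "\<bar>x\<bar>" "2 * d"] by (intro mult_left_mono) (auto simp: power_mult)
      finally show "\<bar>f' u\<bar> \<le> A * (1 + x ^ (2 * d))" .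
    qed auto
    have "f x = f 0 + ddiff f f' x 0 * x" by (auto simp: ddiff_def)
    then have "\<bar>f x\<bar> \<le> \<bar>f 0\<bar> + \<bar>ddiff f f' x 0\<bar> * \<bar>x\<bar>" using abs_triangle_ineq[of "f 0" "ddiff f f' x 0 * x"] by (simp add: abs_mult)
    also have "\<bar>ddiff f f' x 0\<bar> * \<bar>x\<bar> \<le> A * (1 + x ^ (2 * d)) * (1 + x\<^sup>2)"
    proof (rule mult_mono[OF b])
      show "\<bar>x\<bar> \<le> 1 + x\<^sup>2" using zero_le_power2[of "\<bar>x\<bar> - 1"] by (simp add: power2_eq_square algebra_simps abs_mult_self_eq)
      show "0 \<le> A * (1 + x ^ (2 * d))" using b by linarith
    qed simp
    finally show "\<bar>f x\<bar> \<le> \<bar>f 0\<bar> + A * (1 + x ^ (2 * d)) * (1 + x\<^sup>2)" by simp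
  qed
qed

lemma (in prob_space) centered_sum_second_moment:
  fixes G R :: "'a \<Rightarrow> real"
  assumes i: "integrable M G" "integrable M R" "integrable M (\<lambda>\<omega>. (G \<omega>)\<^sup>2)" "integrable M (\<lambda>\<omega>. (R \<omega>)\<^sup>2)"
  shows "integrable M (\<lambda>\<omega>. ((G \<omega> - expectation G) + (R \<omega> - expectation R))\<^sup>2)"
    and "expectation (\<lambda>\<omega>. ((G \<omega> - expectation G) + (R \<omega> - expectation R))\<^sup>2) \<le> 2 * variance G + 2 * expectation (\<lambda>\<omega>. (R \<omega>)\<^sup>2)"
proof -
  have sq: "integrable M (\<lambda>\<omega>. (X \<omega> - c)\<^sup>2)" if "integrable M X" "integrable M (\<lambda>\<omega>. (X \<omega>)\<^sup>2)" for X :: "'a \<Rightarrow> real" and c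
    using that unfolding power2_diff by auto
  have iD: "integrable M (\<lambda>\<omega>. 2 * (G \<omega> - expectation G)\<^sup>2 + 2 * (R \<omega> - expectation R)\<^sup>2)"
    by (intro Bochner_Integration.integrable_add integrable_mult_right sq i)
  have [measurable]: "G \<in> borel_measurable M" "R \<in> borel_measurable M" using i by auto
  have le: "(u + v)\<^sup>2 \<le> 2 * u\<^sup>2 + 2 * v\<^sup>2" for u v :: real
    using zero_le_power2[of "u - v"] by (simp add: power2_eq_square algebra_simps)
  show i2: "integrable M (\<lambda>\<omega>. ((G \<omega> - expectation G) + (R \<omega> - expectation R))\<^sup>2)"
    by (rule Bochner_Integration.integrable_bound[OF iD]) (use le in \<open>auto intro!: AE_I2\<close>)
  have "expectation (\<lambda>\<omega>. ((G \<omega> - expectation G) + (R \<omega> - expectation R))\<^sup>2) \<le> expectation (\<lambda>\<omega>. 2 * (G \<omega> - expectation G)\<^sup>2 + 2 * (R \<omega> - expectation R)\<^sup>2)"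
    by (rule integral_mono[OF i2 iD le])
  also have "\<dots> = 2 * variance G + 2 * variance R"
    by (simp add: sq i)
  also have "variance R \<le> expectation (\<lambda>\<omega>. (R \<omega>)\<^sup>2)" unfolding variance_eq[OF i(2,4)] by simp
  finally show "expectation (\<lambda>\<omega>. ((G \<omega> - expectation G) + (R \<omega> - expectation R))\<^sup>2) \<le> 2 * variance G + 2 * expectation (\<lambda>\<omega>. (R \<omega>)\<^sup>2)"
    by simp
qed

text \<open>The coefficient of \<open>U\<^sub>0\<close> is the mean; by the Parseval identity the others make
  up the variance.\<close>

lemma semicircle_variance_cheb:
  "(\<integral>x. (\<Sum>m\<le>d. \<alpha> m * chebU m x)\<^sup>2 \<partial>semicircle) - (\<integral>x. (\<Sum>m\<le>d. \<alpha> m * chebU m x) \<partial>semicircle)\<^sup>2 = (\<Sum>m=1..d. (\<alpha> m)\<^sup>2)"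
proof -
  have i: "integrable semicircle (\<lambda>x. c * chebU m x)" "integrable semicircle (\<lambda>x. c * (chebU m x * chebU l x))" for c m l
    by (rule semicircle_integral_eq, intro continuous_intros)+
  have "(\<integral>x. (\<Sum>m\<le>d. \<alpha> m * chebU m x) \<partial>semicircle) = (\<Sum>m\<le>d. \<integral>x. \<alpha> m * chebU m x \<partial>semicircle)"
    by (rule Bochner_Integration.integral_sum) (rule i)
  also have "\<dots> = (\<Sum>m\<le>d. if m = 0 then \<alpha> m else 0)"
    by (intro sum.cong refl) (simp add: semicircle_chebU)
  also have "\<dots> = \<alpha> 0" by simp
  finally have E: "(\<integral>x. (\<Sum>m\<le>d. \<alpha> m * chebU m x) \<partial>semicircle) = \<alpha> 0" .
  have sq: "(\<Sum>m\<le>d. \<alpha> m * chebU m x)\<^sup>2 = (\<Sum>m\<le>d. \<Sum>l\<le>d. \<alpha> m * \<alpha> l * (chebU m x * chebU l x))" for x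
    unfolding power2_eq_square sum_product by (intro sum.cong refl) simp
  have "(\<integral>x. (\<Sum>m\<le>d. \<alpha> m * chebU m x)\<^sup>2 \<partial>semicircle) = (\<Sum>m\<le>d. \<integral>x. (\<Sum>l\<le>d. \<alpha> m * \<alpha> l * (chebU m x * chebU l x)) \<partial>semicircle)"
    unfolding sq by (rule Bochner_Integration.integral_sum) (intro Bochner_Integration.integrable_sum i)
  also have "\<dots> = (\<Sum>m\<le>d. \<Sum>l\<le>d. \<integral>x. \<alpha> m * \<alpha> l * (chebU m x * chebU l x) \<partial>semicircle)"
    by (intro sum.cong refl Bochner_Integration.integral_sum) (rule i)
  also have "\<dots> = (\<Sum>m\<le>d. \<Sum>l\<le>d. if l = m then \<alpha> m * \<alpha> l else 0)"
    by (intro sum.cong refl) (simp add: chebU_orthonormal)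
  also have "\<dots> = (\<Sum>m\<le>d. (\<alpha> m)\<^sup>2)" by (simp add: power2_eq_square)
  also have "\<dots> = (\<alpha> 0)\<^sup>2 + (\<Sum>m=1..d. (\<alpha> m)\<^sup>2)"
    unfolding atMost_atLeast0 by (subst sum.atLeast_Suc_atMost) auto
  finally show ?thesis unfolding E by simp
qed

text \<open>The total mass is the squared norm of the first unit vector in the eigenbasis.\<close>

lemma spectral_measure_distribution:
  assumes e: "orthonormal_eigensystem n (jacobi_mat n a b) lam v" and n: "n > 0"
  shows "real_distribution (spectral_measure n lam v)"
proof -
  have "(\<Sum>i=1..n. \<bar>v i $ 0\<bar>\<^sup>2 * 1) = (\<integral>x. 1 \<partial>spectral_measure n lam v)"
    by (rule integral_spectral_measure[symmetric]) simp
  also have "\<dots> = spec n (tridiag a b) (\<lambda>_. 1)"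
    by (rule spectral_measure_spec[OF e n]) simp
  also have "\<dots> = 1" by (rule spec_const[OF tridiag_sym n])
  finally have 1: "(\<Sum>i=1..n. \<bar>v i $ 0\<bar>\<^sup>2) = 1" by simp
  have "emeasure (spectral_measure n lam v) UNIV = (\<Sum>i=1..n. ennreal (\<bar>v i $ 0\<bar>\<^sup>2))"
    unfolding spectral_measure_def
    by (subst emeasure_distr) (auto simp: space_point_measure emeasure_point_measure_finite)
  also have "\<dots> = ennreal (\<Sum>i=1..n. \<bar>v i $ 0\<bar>\<^sup>2)" by (rule sum_ennreal) simp
  finally have "emeasure (spectral_measure n lam v) UNIV = 1" unfolding 1 by simp
  then have "prob_space (spectral_measure n lam v)"
    by (intro prob_spaceI) (simp add: spectral_measure_def)
  then show ?thesis
    by (simp add: real_distribution_def real_distribution_axioms_def spectral_measure_def)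
qed

text \<open>The matrix of size zero has no spectral measure of mass one, and sequences are shifted to avoid
  it.\<close>

lemma weak_conv_m_Suc: "weak_conv_m (\<lambda>n. \<nu> (Suc n)) \<rho> \<Longrightarrow> weak_conv_m \<nu> \<rho>"
  unfolding weak_conv_m_def weak_conv_def by (blast intro: LIMSEQ_imp_Suc)

context beta_ensemble
begin

lemma spec_order:
  assumes der: "\<And>x. (f has_real_derivative f' x) (at x)" and cont: "continuous_on UNIV f'" and growth: "polynomial_growth f'"
  shows "moment_order 0 (\<lambda>n \<omega>. spec n (jac n \<omega>) f)"
proof -
  obtain c d where cd: "\<And>x. \<bar>f x\<bar> \<le> psum c d x"
    using polynomial_growth_antiderivative[OF der growth] unfolding polynomial_growth_psum by blast
  show ?thesis
  proof (rule moment_order_dominated[OF spec_psum_order])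
    show "\<forall>\<^sub>F n in sequentially. (\<lambda>\<omega>. spec n (jac n \<omega>) f) \<in> borel_measurable M \<and>
        (AE \<omega> in M. \<bar>spec n (jac n \<omega>) f\<bar> \<le> \<bar>spec n (jac n \<omega>) (psum c d)\<bar>)"
      using eventually_gt_at_top[of 0]
    proof eventually_elim
      case (elim n)
      have "\<bar>spec n (jac n \<omega>) f\<bar> \<le> spec n (jac n \<omega>) (psum c d)" for \<omega>
        by (rule order_trans[OF spec_abs spec_mono]) (rule cd)
      then have "\<bar>spec n (jac n \<omega>) f\<bar> \<le> \<bar>spec n (jac n \<omega>) (psum c d)\<bar>" for \<omega>
        by (rule order_trans) (rule abs_ge_self)
      then show ?case using spec_jac_measurable[OF elim der cont] by auto
    qed
  qed
qed

lemma lin_order: "1 \<le> m \<Longrightarrow> moment_order 1 (\<lambda>n. lin m n)"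
proof (cases "odd m")
  case True
  then have "1 \<le> (m + 1) div 2" by presburger
  from a_order[OF this] show ?thesis using True by (simp add: lin_def [abs_def])
next
  case False
  assume "1 \<le> m"
  then have "1 \<le> m div 2" using False by presburger
  from xi_order[OF this] show ?thesis using False \<open>1 \<le> m\<close> by (simp add: lin_def [abs_def])
qed

text \<open>A function with small derivative on \<open>[-3, 3]\<close> has small fluctuations, uniformly for
  large \<open>n\<close>: the expected tail converges to its semicircle integral, which is below
  \<open>e\<^sup>2\<close> for \<open>r\<close> large.\<close>

lemma variance_spec_small:
  assumes der: "\<And>x. (g has_real_derivative g' x) (at x)" and cont: "continuous_on UNIV g'"
    and order: "moment_order 0 (\<lambda>n \<omega>. spec n (jac n \<omega>) g)"
    and small: "\<And>x. \<bar>x\<bar> \<le> 3 \<Longrightarrow> \<bar>g' x\<bar> \<le> e" and e: "e > 0"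
    and growth: "\<And>x. \<bar>g' x\<bar> \<le> \<bar>psum c d x\<bar> + \<bar>psum c' d' x\<bar>"
  shows "\<forall>\<^sub>F n in sequentially. real n * \<beta> * variance (\<lambda>\<omega>. spec n (jac n \<omega>) g) \<le> 36 * e\<^sup>2"
proof -
  have "\<exists>K\<ge>0. \<exists>D. \<forall>x r. \<bar>g' x\<bar> \<le> e + K * (x ^ (2 * D) * (x / 3) ^ (2 * r))"
    using e by (intro tail_domination[OF small _ growth]) auto
  then obtain K D where K: "K \<ge> 0" and KD: "\<And>x r. \<bar>g' x\<bar> \<le> e + K * (x ^ (2 * D) * (x / 3) ^ (2 * r))"
    by (elim exE conjE) metis
  \<comment> \<open>The added one keeps the divisor positive when the constant \<open>K\<close> is zero.\<close>
  define P where "P = \<bar>K\<^sup>2\<bar> * 4 ^ (2 * D) + (1 :: real)"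
  have P: "P > 0" by (auto simp: P_def intro!: add_nonneg_pos)
  obtain r where r: "(4 / 9 :: real) ^ r < e\<^sup>2 / P"
    using real_arch_pow_inv[of "e\<^sup>2 / P" "4 / 9"] e P by auto
  define T where "T x = K\<^sup>2 * (x ^ (2 * (2 * D)) * (x / 3) ^ (2 * (2 * r)))" for x :: real
  obtain cT dT where "\<forall>x. T x = psum cT dT x" unfolding T_def using tail_power_psum by blast
  then have T: "T = psum cT dT" by auto
  have "(\<integral>x. T x \<partial>semicircle) \<le> \<bar>K\<^sup>2\<bar> * 4 ^ (2 * D) * (4 / 9) ^ (2 * r)"
    unfolding T_def by (rule semicircle_tail_power)
  also have "\<dots> \<le> P * (4 / 9) ^ r"
    by (intro mult_mono power_decreasing) (auto simp: P_def)
  also have "\<dots> < P * (e\<^sup>2 / P)" using r P by (intro mult_strict_left_mono)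
  also have "\<dots> = e\<^sup>2" using P by simp
  finally have Tsmall: "(\<integral>x. T x \<partial>semicircle) < e\<^sup>2" .
  have "(\<lambda>n. expectation (\<lambda>\<omega>. spec n (jac n \<omega>) T)) \<longlonglongrightarrow> (\<integral>x. T x \<partial>semicircle)"
    unfolding T by (rule expectation_spec_psum)
  then have E: "\<forall>\<^sub>F n in sequentially. expectation (\<lambda>\<omega>. spec n (jac n \<omega>) T) < e\<^sup>2"
    using Tsmall by (rule order_tendstoD)
  have iT: "\<forall>\<^sub>F n in sequentially. integrable M (\<lambda>\<omega>. spec n (jac n \<omega>) T)"
    unfolding T by (rule moment_order_integrable[OF spec_psum_order])
  have "\<forall>\<^sub>F n in sequentially. integrable M (\<lambda>\<omega>. (spec n (jac n \<omega>) g)\<^sup>2)"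
    using moment_order_second_moment[OF order] by (auto elim!: eventually_mono)
  then show ?thesis using E iT eventually_ge_at_top[of 1]
  proof eventually_elim
    case (elim n)
    have "real n * \<beta> * variance (\<lambda>\<omega>. spec n (jac n \<omega>) g)
      \<le> 12 * e\<^sup>2 + 24 * expectation (\<lambda>\<omega>. spec n (jac n \<omega>) T)"
      unfolding T_def by (rule variance_spec_tail[OF elim(4) der cont elim(1) KD K less_imp_le[OF e] elim(3)[unfolded T_def]])
    then show ?case using elim(2) by linarith
  qed
qed

definition fluctuation :: "(real \<Rightarrow> real) \<Rightarrow> nat \<Rightarrow> 'w \<Rightarrow> real" where
  "fluctuation f n \<omega> = fluct n * (spec n (jac n \<omega>) f - expectation (\<lambda>\<omega>. spec n (jac n \<omega>) f))"

text \<open>The polynomial approximates \<open>f\<close> in \<open>C\<^sup>1\<close> on \<open>[-3,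
  3]\<close>.  The difference between the fluctuation of \<open>f\<close> and the linear part of the polynomial
  consists of the fluctuation of \<open>f - p\<close>, controlled by the Poincare inequality, and the
  second-order remainder of \<open>p\<close>, whose contribution tends to zero.\<close>

lemma fluctuation_approximation:
  assumes der: "\<And>x. (f has_real_derivative f' x) (at x)" and cont: "continuous_on UNIV f'"
    and growth: "polynomial_growth f'" and e: "e > 0"
  shows "\<exists>\<alpha> d. (\<forall>x. \<bar>x\<bar> \<le> 2 \<longrightarrow> \<bar>f x - (\<Sum>m\<le>d. \<alpha> m * chebU m x)\<bar> \<le> 2 * e) \<and>
    (\<forall>\<^sub>F n in sequentially. fluctuation f n \<in> borel_measurable M \<and>
       (\<lambda>\<omega>. \<Sum>m=1..d. \<alpha> m * (fluct n * lin m n \<omega>)) \<in> borel_measurable M \<and>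
       integrable M (\<lambda>\<omega>. (fluctuation f n \<omega> - (\<Sum>m=1..d. \<alpha> m * (fluct n * lin m n \<omega>)))\<^sup>2) \<and>
       expectation (\<lambda>\<omega>. (fluctuation f n \<omega> - (\<Sum>m=1..d. \<alpha> m * (fluct n * lin m n \<omega>)))\<^sup>2) \<le> (7 * e)\<^sup>2)"
proof -
  obtain c d where cd: "\<And>x. \<bar>x\<bar> \<le> 3 \<Longrightarrow> \<bar>f' x - psum' c d x\<bar> < e \<and> \<bar>f x - psum c d x\<bar> \<le> e * \<bar>x\<bar>"
    using weierstrass_C1_psum[OF der cont e, of 3] by blast
  obtain \<alpha> where "\<forall>x. psum c d x = (\<Sum>m\<le>d. \<alpha> m * chebU m x)"
    using psum_cheb_span[of d c] unfolding cheb_span_def by blast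
  then have al: "psum c d = (\<lambda>x. \<Sum>m\<le>d. \<alpha> m * chebU m x)" by auto
  define g where "g x = f x - psum c d x" for x
  define g' where "g' x = f' x - psum' c d x" for x
  have derg: "(g has_real_derivative g' x) (at x)" for x
    unfolding g_def [abs_def] g'_def by (intro derivative_intros der psum_deriv)
  have contg: "continuous_on UNIV g'" unfolding g'_def [abs_def] by (intro continuous_intros cont)
  have gspec: "spec n A g = spec n A f - spec n A (psum c d)" for n A
    unfolding g_def [abs_def] by (rule spec_diff)
  have orderg: "moment_order 0 (\<lambda>n \<omega>. spec n (jac n \<omega>) g)"
    unfolding gspec by (intro moment_order_diff spec_order[OF der cont growth] spec_psum_order)
  obtain c0 d0 where c0: "\<And>x. \<bar>f' x\<bar> \<le> psum c0 d0 x" using growth unfolding polynomial_growth_psum by blast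
  obtain c2 d2 where c2: "psum' c d = psum c2 d2" using psum'_is_psum by blast
  have growthg: "\<bar>g' x\<bar> \<le> \<bar>psum c0 d0 x\<bar> + \<bar>psum c2 d2 x\<bar>" for x
    using c0[of x] unfolding g'_def c2 by linarith
  have smallg: "\<bar>g' x\<bar> \<le> e" if "\<bar>x\<bar> \<le> 3" for x using cd[OF that] unfolding g'_def by linarith
  have V: "\<forall>\<^sub>F n in sequentially. real n * \<beta> * variance (\<lambda>\<omega>. spec n (jac n \<omega>) g) \<le> 36 * e\<^sup>2"
    by (rule variance_spec_small[OF derg contg orderg smallg e growthg])
  define R where "R n \<omega> = (\<Sum>m\<le>d. \<alpha> m * (spec n (jac n \<omega>) (chebU m) - (if m = 0 then 1 else 0) - lin m n \<omega>))" for n \<omega>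
  have R: "moment_order 2 R"
    unfolding R_def [abs_def] by (intro moment_order_sum moment_order_cmult spec_chebU_linearization)
  obtain CR where CR: "CR \<ge> 0" "\<forall>\<^sub>F n in sequentially. R n \<in> borel_measurable M \<and> integrable M (R n) \<and>
     integrable M (\<lambda>\<omega>. (R n \<omega>)\<^sup>2) \<and> expectation (\<lambda>\<omega>. (R n \<omega>)\<^sup>2) \<le> CR / real n ^ 2"
    using moment_order_second_moment[OF R] by blast
  have G: "\<forall>\<^sub>F n in sequentially. integrable M (\<lambda>\<omega>. spec n (jac n \<omega>) g) \<and> integrable M (\<lambda>\<omega>. (spec n (jac n \<omega>) g)\<^sup>2)"
    using moment_order_second_moment[OF orderg] by (auto elim!: eventually_mono)
  have L: "\<forall>\<^sub>F n in sequentially. \<forall>m\<in>{1..d}. integrable M (lin m n)"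
    by (intro eventually_ball_finite) (auto intro!: moment_order_integrable lin_order)
  \<comment> \<open>From here on the remainder contributes at most \<open>e\<^sup>2\<close>.\<close>
  have big: "\<forall>\<^sub>F n in sequentially. \<beta> * CR / e\<^sup>2 \<le> real n"
    using eventually_ge_at_top[of "nat \<lceil>\<beta> * CR / e\<^sup>2\<rceil>"] by (auto elim!: eventually_mono)
  have "\<forall>\<^sub>F n in sequentially. fluctuation f n \<in> borel_measurable M \<and>
       (\<lambda>\<omega>. \<Sum>m=1..d. \<alpha> m * (fluct n * lin m n \<omega>)) \<in> borel_measurable M \<and>
       integrable M (\<lambda>\<omega>. (fluctuation f n \<omega> - (\<Sum>m=1..d. \<alpha> m * (fluct n * lin m n \<omega>)))\<^sup>2) \<and>
       expectation (\<lambda>\<omega>. (fluctuation f n \<omega> - (\<Sum>m=1..d. \<alpha> m * (fluct n * lin m n \<omega>)))\<^sup>2) \<le> (7 * e)\<^sup>2"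
    using V CR(2) G L big eventually_gt_at_top[of d]
  proof eventually_elim
    case (elim n)
    have n0: "n > 0" using elim(6) by simp
    have nb: "real n * \<beta> > 0" using n0 by (intro scale_pos) simp
    let ?G = "\<lambda>\<omega>. spec n (jac n \<omega>) g"
    let ?L = "\<lambda>\<omega>. \<Sum>m=1..d. \<alpha> m * lin m n \<omega>"
    have lin0: "lin 0 n \<omega> = 0" for \<omega> by (simp add: lin_def)
    have iL: "integrable M ?L"
      by (intro Bochner_Integration.integrable_sum integrable_mult_right) (use elim(4) in auto)
    have EL: "expectation ?L = 0"
    proof -
      have "expectation ?L = (\<Sum>m=1..d. expectation (\<lambda>\<omega>. \<alpha> m * lin m n \<omega>))"
        by (rule Bochner_Integration.integral_sum) (use elim(4) in auto)
      also have "\<dots> = (\<Sum>m=1..d. 0)"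
        by (intro sum.cong refl) (use elim(6) lin_expectation[of _ n] in auto)
      finally show ?thesis by simp
    qed
    have spl: "(\<Sum>m\<le>d. h m) = h 0 + (\<Sum>m=1..d. h m)" for h :: "nat \<Rightarrow> real"
      unfolding atMost_atLeast0 by (subst sum.atLeast_Suc_atMost) auto
    have dec: "spec n (jac n \<omega>) f = ?G \<omega> + (\<alpha> 0 + (?L \<omega> + R n \<omega>))" for \<omega>
    proof -
      have "R n \<omega> = (\<Sum>m\<le>d. \<alpha> m * spec n (jac n \<omega>) (chebU m)) - (\<Sum>m\<le>d. \<alpha> m * (if m = 0 then 1 else 0)) - (\<Sum>m\<le>d. \<alpha> m * lin m n \<omega>)"
        unfolding R_def right_diff_distrib sum_subtractf ..
      also have "(\<Sum>m\<le>d. \<alpha> m * (if m = 0 then 1 else 0)) = \<alpha> 0" unfolding spl by simp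
      also have "(\<Sum>m\<le>d. \<alpha> m * lin m n \<omega>) = ?L \<omega>" unfolding spl lin0 by simp
      also have "(\<Sum>m\<le>d. \<alpha> m * spec n (jac n \<omega>) (chebU m)) = spec n (jac n \<omega>) (psum c d)"
        unfolding al spec_sum spec_cmult ..
      finally show ?thesis using gspec[of n "jac n \<omega>"] by linarith
    qed
    have Ef: "expectation (\<lambda>\<omega>. spec n (jac n \<omega>) f) = expectation ?G + (\<alpha> 0 + (0 + expectation (R n)))"
    proof -
      have "expectation (\<lambda>\<omega>. X \<omega> + (q + (Y \<omega> + W \<omega>))) = expectation X + (q + (expectation Y + expectation W))"
        if "integrable M X" "integrable M Y" "integrable M W" for X Y W :: "'w \<Rightarrow> real" and q
        using that by (simp add: prob_space)
      from this[of ?G ?L "R n" "\<alpha> 0"] show ?thesis unfolding dec EL using elim(2,3) iL by blast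
    qed
    have eq: "fluctuation f n \<omega> - (\<Sum>m=1..d. \<alpha> m * (fluct n * lin m n \<omega>)) = fluct n * ((?G \<omega> - expectation ?G) + (R n \<omega> - expectation (R n)))" for \<omega>
    proof -
      have "(\<Sum>m=1..d. \<alpha> m * (fluct n * lin m n \<omega>)) = fluct n * ?L \<omega>"
        unfolding sum_distrib_left by (intro sum.cong refl) simp
      then show ?thesis unfolding fluctuation_def Ef unfolding dec by (simp add: algebra_simps)
    qed
    have iG: "integrable M ?G" "integrable M (R n)" "integrable M (\<lambda>\<omega>. (?G \<omega>)\<^sup>2)" "integrable M (\<lambda>\<omega>. (R n \<omega>)\<^sup>2)"
      using elim(2,3) by auto
    note cs = centered_sum_second_moment[OF iG]
    have Rsmall: "real n * \<beta> * expectation (\<lambda>\<omega>. (R n \<omega>)\<^sup>2) \<le> e\<^sup>2"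
    proof -
      have "real n * \<beta> * expectation (\<lambda>\<omega>. (R n \<omega>)\<^sup>2) \<le> real n * \<beta> * (CR / real n ^ 2)"
        using elim(2) nb by (intro mult_left_mono) auto
      also have "\<dots> = \<beta> * CR / real n" using n0 by (simp add: power2_eq_square)
      also have "\<dots> \<le> e\<^sup>2" using elim(5) n0 e by (simp add: field_simps)
      finally show ?thesis .
    qed
    have "expectation (\<lambda>\<omega>. (fluctuation f n \<omega> - (\<Sum>m=1..d. \<alpha> m * (fluct n * lin m n \<omega>)))\<^sup>2)
        = (fluct n)\<^sup>2 * expectation (\<lambda>\<omega>. ((?G \<omega> - expectation ?G) + (R n \<omega> - expectation (R n)))\<^sup>2)"
      unfolding eq power_mult_distrib by (rule integral_mult_right_zero)
    also have "\<dots> \<le> (fluct n)\<^sup>2 * (2 * variance ?G + 2 * expectation (\<lambda>\<omega>. (R n \<omega>)\<^sup>2))"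
      by (intro mult_left_mono cs(2)) simp
    also have "\<dots> = real n * \<beta> * variance ?G + real n * \<beta> * expectation (\<lambda>\<omega>. (R n \<omega>)\<^sup>2)"
      unfolding fluct_sq by (simp add: distrib_left)
    also have "\<dots> \<le> 36 * e\<^sup>2 + e\<^sup>2" using elim(1) Rsmall by linarith
    also have "\<dots> \<le> (7 * e)\<^sup>2" by (simp add: power_mult_distrib)
    finally have le: "expectation (\<lambda>\<omega>. (fluctuation f n \<omega> - (\<Sum>m=1..d. \<alpha> m * (fluct n * lin m n \<omega>)))\<^sup>2) \<le> (7 * e)\<^sup>2" .
    have "integrable M (\<lambda>\<omega>. (fluctuation f n \<omega> - (\<Sum>m=1..d. \<alpha> m * (fluct n * lin m n \<omega>)))\<^sup>2)"
      unfolding eq power_mult_distrib using cs(1) by (rule integrable_mult_right)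
    moreover have "fluctuation f n \<in> borel_measurable M"
      unfolding fluctuation_def [abs_def]
      by (intro borel_measurable_times borel_measurable_diff borel_measurable_const spec_jac_measurable[OF n0 der cont])
    moreover have "(\<lambda>\<omega>. \<Sum>m=1..d. \<alpha> m * (fluct n * lin m n \<omega>)) \<in> borel_measurable M"
      using elim(6) by (intro borel_measurable_sum borel_measurable_times borel_measurable_const lin_measurable) auto
    ultimately show ?case using le by blast
  qed
  moreover have "\<bar>f x - (\<Sum>m\<le>d. \<alpha> m * chebU m x)\<bar> \<le> 2 * e" if "\<bar>x\<bar> \<le> 2" for x
  proof -
    have "\<bar>f x - psum c d x\<bar> \<le> e * \<bar>x\<bar>" using cd[of x] that by simp
    also have "\<dots> \<le> e * 2" using that e by (intro mult_left_mono) auto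
    finally show ?thesis unfolding al by simp
  qed
  ultimately show ?thesis by blast
qed

text \<open>Three errors: from \<open>f\<close> to the linear part of the polynomial, from the linear part to
  its normal limit, and from the variance of the polynomial to that of \<open>f\<close>.\<close>

theorem fluctuation_char_tendsto:
  assumes der: "\<And>x. (f has_real_derivative f' x) (at x)" and cont: "continuous_on UNIV f'"
    and growth: "polynomial_growth f'"
  defines "v \<equiv> (\<integral>x. (f x)\<^sup>2 \<partial>semicircle) - (\<integral>x. f x \<partial>semicircle)\<^sup>2"
  shows "(\<lambda>n. \<integral>\<omega>. iexp (t * fluctuation f n \<omega>) \<partial>M) \<longlonglongrightarrow> complex_of_real (exp (- (v * t\<^sup>2 / 2)))"
proof (rule LIMSEQ_I)
  fix \<eta> :: real assume eta: "\<eta> > 0"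
  interpret sc: prob_space semicircle by (rule prob_space_semicircle)
  have contf: "continuous_on UNIV f" using der by (intro continuous_at_imp_continuous_on) (auto intro: DERIV_isCont)
  have v0: "v \<ge> 0"
  proof -
    have i: "integrable semicircle f" "integrable semicircle (\<lambda>x. (f x)\<^sup>2)"
      by (rule semicircle_integral_eq, intro continuous_intros contf)+
    show ?thesis unfolding v_def using sc.variance_positive[of f] sc.variance_eq[OF i] by simp
  qed
  have "bounded (f ` {-2..2})"
    by (intro compact_imp_bounded compact_continuous_image continuous_on_subset[OF contf]) auto
  then obtain B where Bf: "\<forall>y\<in>f ` {-2..2}. norm y \<le> B" unfolding bounded_iff by (elim exE)
  have B: "\<bar>f x\<bar> \<le> B" if "\<bar>x\<bar> \<le> 2" for x using Bf that by (auto simp: abs_le_iff)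
  have B0: "B \<ge> 0" using B[of 0] by simp
  \<comment> \<open>The errors of the first and the third kind add up to \<open>A e\<close>.\<close>
  define A where "A = 7 * \<bar>t\<bar> + 8 * (B + 1) * t\<^sup>2"
  have A: "A \<ge> 0" using B0 by (auto simp: A_def)
  define e where "e = min 1 (\<eta> / (2 * (A + 1)))"
  have e: "e > 0" "e \<le> 1" using eta A by (auto simp: e_def)
  have Ae: "A * e < \<eta> / 2"
  proof -
    have "A * e \<le> A * (\<eta> / (2 * (A + 1)))" using A by (intro mult_left_mono) (auto simp: e_def)
    also have "\<dots> < \<eta> / 2" using A eta by (simp add: field_simps)
    finally show ?thesis .
  qed
  obtain \<alpha> d where ad: "(\<forall>x. \<bar>x\<bar> \<le> 2 \<longrightarrow> \<bar>f x - (\<Sum>m\<le>d. \<alpha> m * chebU m x)\<bar> \<le> 2 * e) \<and>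
    (\<forall>\<^sub>F n in sequentially. fluctuation f n \<in> borel_measurable M \<and>
       (\<lambda>\<omega>. \<Sum>m=1..d. \<alpha> m * (fluct n * lin m n \<omega>)) \<in> borel_measurable M \<and>
       integrable M (\<lambda>\<omega>. (fluctuation f n \<omega> - (\<Sum>m=1..d. \<alpha> m * (fluct n * lin m n \<omega>)))\<^sup>2) \<and>
       expectation (\<lambda>\<omega>. (fluctuation f n \<omega> - (\<Sum>m=1..d. \<alpha> m * (fluct n * lin m n \<omega>)))\<^sup>2) \<le> (7 * e)\<^sup>2)"
    using fluctuation_approximation[OF der cont growth e(1)] by (elim exE)
  note close = ad[THEN conjunct1, rule_format] and appr = ad[THEN conjunct2]
  define w where "w = (\<Sum>m=1..d. (\<alpha> m)\<^sup>2)"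
  have w0: "w \<ge> 0" unfolding w_def by (intro sum_nonneg) simp
  have wv: "\<bar>w - v\<bar> \<le> 16 * (B + 1) * e"
    unfolding v_def w_def semicircle_variance_cheb[of \<alpha> d, symmetric]
    by (rule semicircle_variance_close[OF contf _ B close less_imp_le[OF e(1)] e(2)]) (intro continuous_intros)
  have exps: "\<bar>exp (- (w * t\<^sup>2 / 2)) - exp (- (v * t\<^sup>2 / 2))\<bar> \<le> 8 * (B + 1) * t\<^sup>2 * e"
  proof -
    have "\<bar>exp (- (w * t\<^sup>2 / 2)) - exp (- (v * t\<^sup>2 / 2))\<bar> \<le> \<bar>w * t\<^sup>2 / 2 - v * t\<^sup>2 / 2\<bar>"
      using w0 v0 by (intro exp_minus_lipschitz) auto
    also have "\<dots> = \<bar>w - v\<bar> * (t\<^sup>2 / 2)"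
    proof -
      have eq: "w * t\<^sup>2 / 2 - v * t\<^sup>2 / 2 = (w - v) * (t\<^sup>2 / 2)" by (simp add: algebra_simps diff_divide_distrib)
      show ?thesis unfolding eq abs_mult by simp
    qed
    also have "\<dots> \<le> 16 * (B + 1) * e * (t\<^sup>2 / 2)" by (intro mult_right_mono wv) simp
    also have "\<dots> = 8 * (B + 1) * t\<^sup>2 * e" by simp
    finally show ?thesis .
  qed
  have "\<forall>\<^sub>F n in sequentially. norm ((\<integral>\<omega>. iexp (t * (\<Sum>m=1..d. \<alpha> m * (fluct n * lin m n \<omega>))) \<partial>M) - complex_of_real (exp (- (w * t\<^sup>2 / 2)))) < \<eta> / 2"
    using tendstoD[OF lin_sum_char_tendsto[of t \<alpha> d], of "\<eta> / 2"] eta by (simp add: w_def dist_norm)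
  then have "\<forall>\<^sub>F n in sequentially. norm ((\<integral>\<omega>. iexp (t * fluctuation f n \<omega>) \<partial>M) - complex_of_real (exp (- (v * t\<^sup>2 / 2)))) < \<eta>"
    using appr
  proof eventually_elim
    case (elim n)
    let ?Z = "\<integral>\<omega>. iexp (t * fluctuation f n \<omega>) \<partial>M"
    let ?L = "\<integral>\<omega>. iexp (t * (\<Sum>m=1..d. \<alpha> m * (fluct n * lin m n \<omega>))) \<partial>M"
    have 1: "norm (?Z - ?L) \<le> \<bar>t\<bar> * (7 * e)"
      by (rule characteristic_difference_le) (use elim(2) e in auto)
    have 2: "norm (complex_of_real (exp (- (w * t\<^sup>2 / 2))) - complex_of_real (exp (- (v * t\<^sup>2 / 2)))) \<le> 8 * (B + 1) * t\<^sup>2 * e"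
      using exps by (simp only: of_real_diff[symmetric] norm_of_real)
    have tri: "norm (z - c) \<le> norm (z - l) + (norm (l - b) + norm (b - c))" for z l b c :: complex
      using norm_triangle_ineq[of "z - l" "(l - b) + (b - c)"] norm_triangle_ineq[of "l - b" "b - c"] by simp
    note tri[of ?Z "complex_of_real (exp (- (v * t\<^sup>2 / 2)))" ?L "complex_of_real (exp (- (w * t\<^sup>2 / 2)))"]
    moreover have "\<bar>t\<bar> * (7 * e) + 8 * (B + 1) * t\<^sup>2 * e = A * e" by (simp add: A_def algebra_simps)
    ultimately show ?case using 1 2 elim(1) Ae by linarith
  qed
  then show "\<exists>n0. \<forall>n\<ge>n0. norm ((\<integral>\<omega>. iexp (t * fluctuation f n \<omega>) \<partial>M) - complex_of_real (exp (- (v * t\<^sup>2 / 2)))) < \<eta>"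
    unfolding eventually_sequentially .
qed

theorem fluctuation_weak_conv:
  assumes der: "\<And>x. (f has_real_derivative f' x) (at x)" and cont: "continuous_on UNIV f'"
    and growth: "polynomial_growth f'"
  shows "weak_conv_m (\<lambda>n. distr M borel (fluctuation f (Suc n)))
     (normal_distribution 0 ((\<integral>x. (f x)\<^sup>2 \<partial>semicircle) - (\<integral>x. f x \<partial>semicircle)\<^sup>2))"
proof -
  interpret sc: prob_space semicircle by (rule prob_space_semicircle)
  have contf: "continuous_on UNIV f" using der by (intro continuous_at_imp_continuous_on) (auto intro: DERIV_isCont)
  have v0: "(\<integral>x. (f x)\<^sup>2 \<partial>semicircle) - (\<integral>x. f x \<partial>semicircle)\<^sup>2 \<ge> 0"
  proof -
    have i: "integrable semicircle f" "integrable semicircle (\<lambda>x. (f x)\<^sup>2)"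
      by (rule semicircle_integral_eq, intro continuous_intros contf)+
    show ?thesis using sc.variance_positive[of f] sc.variance_eq[OF i] by simp
  qed
  have m [measurable]: "fluctuation f (Suc n) \<in> borel_measurable M" for n
    unfolding fluctuation_def [abs_def]
    by (intro borel_measurable_times borel_measurable_diff borel_measurable_const spec_jac_measurable[OF _ der cont]) simp
  show ?thesis
  proof (rule levy_continuity)
    show "real_distribution (distr M borel (fluctuation f (Suc n)))" for n
      using prob_space_distr[OF m] by (simp add: real_distribution_def real_distribution_axioms_def)
    show "real_distribution (normal_distribution 0 ((\<integral>x. (f x)\<^sup>2 \<partial>semicircle) - (\<integral>x. f x \<partial>semicircle)\<^sup>2))"
      by (rule real_distribution_normal_distribution[OF v0])
    fix t
    have "char (distr M borel (fluctuation f (Suc n))) t = (\<integral>\<omega>. iexp (t * fluctuation f (Suc n) \<omega>) \<partial>M)" for n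
      unfolding char_def by (rule integral_distr) measurable
    then show "(\<lambda>n. char (distr M borel (fluctuation f (Suc n))) t)
        \<longlonglongrightarrow> char (normal_distribution 0 ((\<integral>x. (f x)\<^sup>2 \<partial>semicircle) - (\<integral>x. f x \<partial>semicircle)\<^sup>2)) t"
      using LIMSEQ_Suc[OF fluctuation_char_tendsto[OF der cont growth, of t]]
      by (simp only: char_normal_distribution[OF v0])
  qed
qed

text \<open>One exceptional set serves all functions, because countably many polynomials
  \<open>U\<^sub>m\<close> determine the limit.  This yields weak convergence of the measures for almost every
  outcome.\<close>

theorem AE_spec_tendsto:
  "AE \<omega> in M. \<forall>f C. continuous_on UNIV f \<longrightarrow> (\<forall>x. \<bar>f x\<bar> \<le> C) \<longrightarrow>
     (\<lambda>n. spec n (jac n \<omega>) f) \<longlonglongrightarrow> (\<integral>x. f x \<partial>semicircle)"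
  using AE_spec_chebU
proof eventually_elim
  case (elim \<omega>)
  show ?case
  proof (intro allI impI)
    fix f :: "real \<Rightarrow> real" and C assume f: "continuous_on UNIV f" "\<forall>x. \<bar>f x\<bar> \<le> C"
    have "\<bar>f x\<bar> \<le> psum (\<lambda>_. C) 0 x" for x using f(2) by (simp add: psum_def)
    from spec_limit_of_chebU[of "\<lambda>n. jac n \<omega>", OF jac_sym elim[rule_format] f(1) this]
    show "(\<lambda>n. spec n (jac n \<omega>) f) \<longlonglongrightarrow> (\<integral>x. f x \<partial>semicircle)" .
  qed
qed

end

theorem theorem1p1:
  fixes M :: "'w measure" and \<beta> :: real
    and a b :: "nat \<Rightarrow> nat \<Rightarrow> 'w \<Rightarrow> real"
    and lam :: "nat \<Rightarrow> 'w \<Rightarrow> nat \<Rightarrow> real"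
    and v :: "nat \<Rightarrow> 'w \<Rightarrow> nat \<Rightarrow> real vec"
    and \<mu> :: "nat \<Rightarrow> 'w \<Rightarrow> real measure"
  assumes "prob_space M" and "\<beta> > 0"
    and "\<And>n. n \<ge> 1 \<Longrightarrow> gaussian_beta_entries M \<beta> n (a n) (b n)"
    and "\<And>n \<omega>. n \<ge> 1 \<Longrightarrow> \<omega> \<in> space M \<Longrightarrow>
           orthonormal_eigensystem n (jacobi_mat n (\<lambda>i. a n i \<omega>) (\<lambda>i. b n i \<omega>)) (lam n \<omega>) (v n \<omega>)"
    and "\<And>n \<omega>. \<mu> n \<omega> = spectral_measure n (lam n \<omega>) (v n \<omega>)"
  shows "(AE \<omega> in M. weak_conv_m (\<lambda>n. \<mu> n \<omega>) semicircle) \<and>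
    (\<forall>f :: real \<Rightarrow> real. continuous_on UNIV f \<and> bounded (range f) \<longrightarrow>
       (AE \<omega> in M. (\<lambda>n. \<integral>x. f x \<partial>\<mu> n \<omega>) \<longlonglongrightarrow> (\<integral>x. f x \<partial>semicircle))) \<and>
    (\<forall>f :: real \<Rightarrow> real. f differentiable_on UNIV \<and> continuous_on UNIV (deriv f) \<and>
         polynomial_growth (deriv f) \<longrightarrow>
       weak_conv_m
         (\<lambda>n. distr M borel (\<lambda>\<omega>. sqrt (real n * \<beta>) / sqrt 2 *
            ((\<integral>x. f x \<partial>\<mu> n \<omega>) - (\<integral>\<omega>'. (\<integral>x. f x \<partial>\<mu> n \<omega>') \<partial>M))))
         (normal_distribution 0
            ((\<integral>x. (f x)\<^sup>2 \<partial>semicircle) - (\<integral>x. f x \<partial>semicircle)\<^sup>2)))"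
proof -
  interpret beta_ensemble M \<beta> a b
    using assms(1-3) by (intro beta_ensemble.intro) (simp_all add: beta_ensemble_axioms_def)
  note eig = assms(4)
  have int: "(\<integral>x. f x \<partial>\<mu> n \<omega>) = spec n (jac n \<omega>) f" if "n \<ge> 1" "\<omega> \<in> space M" "continuous_on UNIV f" for n \<omega> f
    unfolding assms(5) jac_def by (rule spectral_measure_spec[OF eig[OF that(1,2)]]) (use that in auto)
  have shifted: "(\<lambda>n. \<integral>x. f x \<partial>\<mu> (Suc n) \<omega>) \<longlonglongrightarrow> (\<integral>x. f x \<partial>semicircle)"
    if w: "\<omega> \<in> space M" and f: "continuous_on UNIV f" and lim: "(\<lambda>n. spec n (jac n \<omega>) f) \<longlonglongrightarrow> (\<integral>x. f x \<partial>semicircle)" for \<omega> f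
  proof -
    have "(\<integral>x. f x \<partial>\<mu> (Suc n) \<omega>) = spec (Suc n) (jac (Suc n) \<omega>) f" for n
      by (rule int[OF _ w f]) simp
    then show ?thesis using LIMSEQ_Suc[OF lim] by (simp only:)
  qed
  have part1: "AE \<omega> in M. weak_conv_m (\<lambda>n. \<mu> n \<omega>) semicircle"
    using AE_spec_tendsto AE_space
  proof eventually_elim
    case (elim \<omega>)
    have "weak_conv_m (\<lambda>n. \<mu> (Suc n) \<omega>) semicircle"
    proof (rule integral_bdd_continuous_conv_imp_weak_conv)
      show "real_distribution (\<mu> (Suc n) \<omega>)" for n
        unfolding assms(5) by (rule spectral_measure_distribution[OF eig]) (use elim(2) in auto)
      show "real_distribution semicircle" by (rule real_distribution_semicircle)
      fix f :: "real \<Rightarrow> real" assume f: "\<And>x. isCont f x" "\<And>x. \<bar>f x\<bar> \<le> 1"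
      have c: "continuous_on UNIV f" using f(1) by (simp add: continuous_at_imp_continuous_on)
      show "(\<lambda>n. \<integral>x. f x \<partial>\<mu> (Suc n) \<omega>) \<longlonglongrightarrow> (\<integral>x. f x \<partial>semicircle)"
        using elim(1) f(2) c by (intro shifted[OF elim(2) c]) blast
    qed
    then show ?case by (rule weak_conv_m_Suc)
  qed
  have part2: "AE \<omega> in M. (\<lambda>n. \<integral>x. f x \<partial>\<mu> n \<omega>) \<longlonglongrightarrow> (\<integral>x. f x \<partial>semicircle)"
    if f: "continuous_on UNIV f" "bounded (range f)" for f :: "real \<Rightarrow> real"
  proof -
    obtain C where "\<forall>y\<in>range f. norm y \<le> C" using f(2) unfolding bounded_iff by (elim exE)
    then have C: "\<forall>x. \<bar>f x\<bar> \<le> C" by simp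
    show ?thesis
      using AE_spec_tendsto AE_space
    proof eventually_elim
      case (elim \<omega>)
      have "(\<lambda>n. spec n (jac n \<omega>) f) \<longlonglongrightarrow> (\<integral>x. f x \<partial>semicircle)"
        using elim(1)[rule_format, OF f(1), of C] C by simp
      from shifted[OF elim(2) f(1) this] show ?case by (rule LIMSEQ_imp_Suc)
    qed
  qed
  have part3: "weak_conv_m
         (\<lambda>n. distr M borel (\<lambda>\<omega>. sqrt (real n * \<beta>) / sqrt 2 *
            ((\<integral>x. f x \<partial>\<mu> n \<omega>) - (\<integral>\<omega>'. (\<integral>x. f x \<partial>\<mu> n \<omega>') \<partial>M))))
         (normal_distribution 0
            ((\<integral>x. (f x)\<^sup>2 \<partial>semicircle) - (\<integral>x. f x \<partial>semicircle)\<^sup>2))"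
    if f: "f differentiable_on UNIV" "continuous_on UNIV (deriv f)" "polynomial_growth (deriv f)" for f :: "real \<Rightarrow> real"
  proof (rule weak_conv_m_Suc)
    have der: "(f has_real_derivative deriv f x) (at x)" for x
      using f(1) by (simp add: differentiable_on_def DERIV_deriv_iff_real_differentiable)
    have c: "continuous_on UNIV f" using f(1) by (rule differentiable_imp_continuous_on)
    have "distr M borel (\<lambda>\<omega>. sqrt (real (Suc n) * \<beta>) / sqrt 2 *
            ((\<integral>x. f x \<partial>\<mu> (Suc n) \<omega>) - (\<integral>\<omega>'. (\<integral>x. f x \<partial>\<mu> (Suc n) \<omega>') \<partial>M))) = distr M borel (fluctuation f (Suc n))" for n
    proof (rule distr_cong[OF refl refl])
      have i: "(\<integral>x. f x \<partial>\<mu> (Suc n) \<omega>) = spec (Suc n) (jac (Suc n) \<omega>) f" if "\<omega> \<in> space M" for \<omega>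
        by (rule int[OF _ that c]) simp
      have E: "(\<integral>\<omega>'. (\<integral>x. f x \<partial>\<mu> (Suc n) \<omega>') \<partial>M) = expectation (\<lambda>\<omega>. spec (Suc n) (jac (Suc n) \<omega>) f)"
        by (rule Bochner_Integration.integral_cong[OF refl i])
      fix \<omega> assume "\<omega> \<in> space M"
      from i[OF this] show "sqrt (real (Suc n) * \<beta>) / sqrt 2 *
            ((\<integral>x. f x \<partial>\<mu> (Suc n) \<omega>) - (\<integral>\<omega>'. (\<integral>x. f x \<partial>\<mu> (Suc n) \<omega>') \<partial>M)) = fluctuation f (Suc n) \<omega>"
        unfolding E by (simp only: fluctuation_def fluct_def)
    qed
    then show "weak_conv_m
         (\<lambda>n. distr M borel (\<lambda>\<omega>. sqrt (real (Suc n) * \<beta>) / sqrt 2 *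
            ((\<integral>x. f x \<partial>\<mu> (Suc n) \<omega>) - (\<integral>\<omega>'. (\<integral>x. f x \<partial>\<mu> (Suc n) \<omega>') \<partial>M))))
         (normal_distribution 0
            ((\<integral>x. (f x)\<^sup>2 \<partial>semicircle) - (\<integral>x. f x \<partial>semicircle)\<^sup>2))"
      using fluctuation_weak_conv[OF der f(2,3)] by (simp only:)
  qed
  show ?thesis using part1 part2 part3 by blast
qed

end
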